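(* Let $X$ be a quasi-diffusion process corresponding to $L$. Let $R\in(0,\infty]$ and let $u$ be a nonnegative harmonic function (relative to $X$) in $B_{2R}$. Then for any $x,y\in B_R$ we have $u(x)\le Nu(y)$, where $N=N(d,\delta,\|b\|)$.
   Context: Fix the dimension $d$, $\delta\in(0,1)$ and a number denoted $\|b\|\in(0,\infty)$. $\mathbb S_\delta$ is the set of symmetric $d\times d$ matrices with eigenvalues in $[\delta,\delta^{-1}]$. $a:\mathbb R^d\to\mathbb S_\delta$ and $b:\mathbb R^d\to\mathbb R^d$ are Borel with $\|b\|_{L_d(\mathbb R^d)}\le\|b\|$ (the right side is the fixed number). $L=(1/2)a^{ij}(x)D_{ij}+b^i(x)D_i$, where $D_i=\partial/\partial x^i$, $D_{ij}=D_iD_j$, with summation over repeated indices. A quasi-diffusion process corresponding to $L$ is a continuous time-homogeneous Markov process $X=(x_t,\infty,\mathcal M_t,P_x)$ in $\mathbb R^d$ with infinite lifetime (in Dynkin's sense; $P_x$ is the law for the starting point $x$, $E_x$ the expectation) such that for any $x\in\mathbb R^d$, $t\ge0$, $E_x\int_0^t|b(x_s)|\,ds<\infty$ and, for any twice continuously differentiable compactly supported $u$, $u(x)=E_xu(x_t)-E_x\int_0^tLu(x_s)\,ds$. $N=N(\dots)$ means that $N$ depends only on the listed parameters, i.e. is the same for all Borel $a:\mathbb R^d\to\mathbb S_\delta$, all Borel $b:\mathbb R^d\to\mathbb R^d$ with $\|b\|_{L_d(\mathbb R^d)}$ not exceeding the fixed number $\|b\|$, all quasi-diffusion processes $X$ corresponding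 to the operator $L$ with these coefficients, all $R\in(0,\infty]$ and all nonnegative harmonic functions $u$ (relative to $X$) in $B_{2R}$. $B_R(y)=\{x:|x-y|<R\}$, $B_R=B_R(0)$, $B_\infty=\mathbb R^d$. A bounded Borel function $u$ on a set $D\subset\mathbb R^d$ is harmonic (relative to $X$) if for any $y$ and $R\in(0,\infty)$ with $\bar B_R(y)\subset D$ and any $x\in B_R(y)$, $u(x)=E_xu(x_{\tau_R(y)})$, where $\tau_R(y)$ is the first exit time of $x_t$ from $B_R(y)$. *)

theory Defs
  imports "HOL-Probability.Probability"
begin

section \<open>Coefficients and the operator\<close>

definition ellipticity_class :: "real \<Rightarrow> (real^'n^'n) set" where
  "ellipticity_class \<delta> =
    {A. transpose A = A \<and> (\<forall>c v. v \<noteq> 0 \<and> A *v v = c *\<^sub>R v \<longrightarrow> c \<in> {\<delta>..1 / \<delta>})}"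

text \<open>The \<open>L\<^sub>d\<close>-norm on \<open>\<real>\<^sup>d\<close>, with \<open>d = CARD('n)\<close>, is at most \<open>K\<close>; integrability makes
  the norm finite (the Bochner integral of a non-integrable function would be 0).\<close>

definition Ld_norm_le :: "(real^'n \<Rightarrow> real^'n) \<Rightarrow> real \<Rightarrow> bool" where
  "Ld_norm_le b K \<longleftrightarrow>
    integrable lborel (\<lambda>x. norm (b x) ^ CARD('n)) \<and>
    root CARD('n) (LINT x|lborel. norm (b x) ^ CARD('n)) \<le> K"

definition pderivative :: "'n \<Rightarrow> (real^'n \<Rightarrow> real) \<Rightarrow> real^'n \<Rightarrow> real" where
  "pderivative i u x = deriv (\<lambda>h. u (x + h *\<^sub>R axis i 1)) 0"

text \<open>Twice continuously differentiable with compact support. Continuity of \<open>u\<close> and of its first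
  partial derivatives is implied by their differentiability.\<close>

definition C2_compact_support :: "(real^'n \<Rightarrow> real) \<Rightarrow> bool" where
  "C2_compact_support u \<longleftrightarrow>
    u differentiable_on UNIV \<and>
    (\<forall>i. pderivative i u differentiable_on UNIV) \<and>
    (\<forall>i j. continuous_on UNIV (pderivative i (pderivative j u))) \<and>
    compact (closure {x. u x \<noteq> 0})"

definition diffusion_operator ::
    "(real^'n \<Rightarrow> real^'n^'n) \<Rightarrow> (real^'n \<Rightarrow> real^'n) \<Rightarrow> (real^'n \<Rightarrow> real) \<Rightarrow> real^'n \<Rightarrow> real" where
  "diffusion_operator a b u x =
    1/2 * (\<Sum>i\<in>UNIV. \<Sum>j\<in>UNIV. a x $ i $ j * pderivative i (pderivative j u) x) +
    (\<Sum>i\<in>UNIV. b x $ i * pderivative i u x)"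

section \<open>Markov processes\<close>

text \<open>
  A continuous time-homogeneous Markov process with infinite lifetime, following E. B. Dynkin,
  Markov Processes, Chapter 3. The time index is a real number, and only indices \<open>t \<ge> 0\<close> matter.
  The sample space is the common space of all \<open>P x\<close>; the sets of \<open>P x\<close> are the common
  \<open>\<sigma>\<close>-algebra on which all these measures are defined. Of the \<open>F t\<close> only the \<open>\<sigma>\<close>-algebra
  is used. The last but one condition is part of Dynkin's definition (it provides the shift
  operators).
\<close>

locale continuous_markov_process =
  fixes X :: "real \<Rightarrow> 'w \<Rightarrow> 'e::euclidean_space"
    and F :: "real \<Rightarrow> 'w measure"
    and P :: "'e \<Rightarrow> 'w measure"
  assumes prob_space_P: "prob_space (P x)"
    and sets_P: "sets (P x) = sets (P y)"
    and subalgebra_F: "0 \<le> t \<Longrightarrow> subalgebra (P x) (F t)"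
    and F_mono: "0 \<le> s \<Longrightarrow> s \<le> t \<Longrightarrow> sets (F s) \<subseteq> sets (F t)"
    and adapted: "0 \<le> t \<Longrightarrow> X t \<in> F t \<rightarrow>\<^sub>M borel"
    and transition_measurable: "0 \<le> t \<Longrightarrow> G \<in> sets borel \<Longrightarrow>
      (\<lambda>x. measure (P x) {\<omega> \<in> space (P x). X t \<omega> \<in> G}) \<in> borel_measurable borel"
    and start: "measure (P x) {\<omega> \<in> space (P x). X 0 \<omega> = x} = 1"
    and markov: "0 \<le> s \<Longrightarrow> 0 \<le> t \<Longrightarrow> G \<in> sets borel \<Longrightarrow>
      AE \<omega> in P x. real_cond_exp (P x) (F t) (indicator {\<omega>' \<in> space (P x). X (t + s) \<omega>' \<in> G}) \<omega>
        = measure (P (X t \<omega>)) {\<omega>' \<in> space (P (X t \<omega>)). X s \<omega>' \<in> G}"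
    and shift: "0 \<le> t \<Longrightarrow> \<omega> \<in> space (P x) \<Longrightarrow>
      \<exists>\<omega>'\<in>space (P x). \<forall>s\<ge>0. X s \<omega>' = X (t + s) \<omega>"
    and continuous_paths: "\<omega> \<in> space (P x) \<Longrightarrow> continuous_on {0..} (\<lambda>t. X t \<omega>)"

locale quasi_diffusion = continuous_markov_process X F P
  for X :: "real \<Rightarrow> 'w \<Rightarrow> real^'n" and F :: "real \<Rightarrow> 'w measure" and P :: "real^'n \<Rightarrow> 'w measure" +
  fixes a :: "real^'n \<Rightarrow> real^'n^'n" and b :: "real^'n \<Rightarrow> real^'n"
  assumes drift_integrable: "0 \<le> t \<Longrightarrow>
      (\<integral>\<^sup>+\<omega>. (\<integral>\<^sup>+s\<in>{0..t}. ennreal (norm (b (X s \<omega>))) \<partial>lborel) \<partial>P x) < \<infinity>"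
    and generator: "C2_compact_support u \<Longrightarrow> 0 \<le> t \<Longrightarrow>
      u x = (LINT \<omega>|P x. u (X t \<omega>))
          - (LINT \<omega>|P x. (LINT s:{0..t}|lborel. diffusion_operator a b u (X s \<omega>)))"

section \<open>Harmonic functions\<close>

text \<open>The infimum is \<open>\<infinity>\<close> on a path that never leaves the ball.\<close>

definition exit_time :: "(real \<Rightarrow> 'w \<Rightarrow> 'e::metric_space) \<Rightarrow> 'e \<Rightarrow> real \<Rightarrow> 'w \<Rightarrow> ereal" where
  "exit_time X y r \<omega> = Inf {ereal t |t. 0 \<le> t \<and> X t \<omega> \<notin> ball y r}"

definition exit_point :: "(real \<Rightarrow> 'w \<Rightarrow> 'e::metric_space) \<Rightarrow> 'e \<Rightarrow> real \<Rightarrow> 'w \<Rightarrow> 'e" where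
  "exit_point X y r \<omega> = X (real_of_ereal (exit_time X y r \<omega>)) \<omega>"

text \<open>
  The function \<open>u\<close> is a total function whose values outside \<open>D\<close> are irrelevant: a continuous path
  that starts in the ball leaves it through the sphere, which lies in \<open>D\<close>, so on the event of
  finite exit time the exit point is in \<open>D\<close> almost surely. A path that never leaves the
  ball contributes 0 to the expectation.
\<close>

definition harmonic_on ::
    "(real \<Rightarrow> 'w \<Rightarrow> 'e::euclidean_space) \<Rightarrow> ('e \<Rightarrow> 'w measure) \<Rightarrow> 'e set \<Rightarrow> ('e \<Rightarrow> real) \<Rightarrow> bool" where
  "harmonic_on X P D u \<longleftrightarrow>
    bounded (u ` D) \<and> u \<in> borel_measurable (restrict_space borel D) \<and>
    (\<forall>y r x. 0 < r \<and> cball y r \<subseteq> D \<and> x \<in> ball y r \<longrightarrow>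
      u x = (LINT \<omega>:{\<omega> \<in> space (P x). exit_time X y r \<omega> < \<infinity> \<and> exit_point X y r \<omega> \<in> D}|P x.
               u (exit_point X y r \<omega>)))"

definition centered_ball :: "ereal \<Rightarrow> 'e::real_normed_vector set" where
  "centered_ball R = {x. ereal (norm x) < R}"

section \<open>The Harnack inequality with a given constant\<close>

text \<open>
  \<open>N\<close> is a Harnack constant for all processes in \<open>\<real>\<^sup>d\<close>, \<open>d = CARD('n)\<close>, whose sample space is a
  set of elements of type \<open>'w\<close>; \<open>K\<close> is the bound for the norm of the drift.
\<close>

definition harnack_constant ::
    "'w itself \<Rightarrow> 'n::finite itself \<Rightarrow> real \<Rightarrow> real \<Rightarrow> real \<Rightarrow> bool" where
  "harnack_constant _ _ \<delta> K N \<longleftrightarrow>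
    (\<forall>(a :: real^'n \<Rightarrow> real^'n^'n) (b :: real^'n \<Rightarrow> real^'n)
      (X :: real \<Rightarrow> 'w \<Rightarrow> real^'n) F P (R :: ereal) u.
      a \<in> borel_measurable borel \<and> range a \<subseteq> ellipticity_class \<delta> \<and>
      b \<in> borel_measurable borel \<and> Ld_norm_le b K \<and>
      quasi_diffusion X F P a b \<and>
      0 < R \<and>
      harmonic_on X P (centered_ball (2 * R)) u \<and> (\<forall>x\<in>centered_ball (2 * R). 0 \<le> u x) \<longrightarrow>
      (\<forall>x\<in>centered_ball R. \<forall>y\<in>centered_ball R. u x \<le> N * u y))"

text \<open>
  The Harnack constant must not depend on the sample space, but HOL has no quantification
  over the type \<open>'w\<close> below \<open>\<exists>N\<close>. The theorem therefore asserts that a Harnack constant \<open>N\<close>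
  exists for sample spaces in the fixed type \<^typ>\<open>real \<Rightarrow> real^'n\<close> (large enough for path space),
  and that each such \<open>N\<close> is a Harnack constant for sample spaces in an arbitrary type \<open>'w\<close>.
  Together: one \<open>N\<close> serves all sample spaces of all types.
\<close>

end

theory Submission
  imports Defs "HOL-Library.Nat_Bijection"
begin

text \<open>
 Since the total drift is bounded, the shell between \<open>B\<^sub>R\<close> and \<open>B\<^bsub>2R\<^esub>\<close> contains, among boundedly many
 concentric subshells, one in which the \<open>L\<^sub>d\<close>-norm of the drift is as small as we please. On small
 balls in that subshell the Krylov--Safonov theory for small drift applies: an
 Aleksandrov--Bakelman--Pucci estimate for expected occupation times (proved by applying Dynkin's
 formula to a smoothed convex function, which is constructed by semidiscrete optimal transport)
 shows that the process visits every subset of almost full measure, whence a growth lemma for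
 nonnegative harmonic functions, and a covering argument on dyadic cubes turns it into a local
 Harnack inequality. For \<open>d >= 2\<close> a chain of balls along a sphere in the subshell makes the values on
 the sphere comparable; as \<open>u\<close> inside is an average of its values on the sphere, no estimate is
 needed in the interior, where the drift may be large. For \<open>d = 1\<close> a scale function bounds from below
 the probability of leaving an interval through either endpoint.

 A constant for path space is a constant for every sample space because a quasi-diffusion can be
 pushed forward along the map that sends a sample point to its trajectory.
\<close>

section \<open>Linear algebra and calculus\<close>

text \<open>The \<open>L_d\<close> norm of the drift is invariant under scaling, so shrinking a ball
  makes its drift small only at a scale that depends on \<open>b\<close> and not on \<open>K\<close>
  alone. Such a scale serves for qualitative facts, namely almost sure exit from balls; quantitative
  steps need drift below the fixed threshold \<open>drift_tol\<close>, which the shell provides.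
  There the drift is treated as a perturbation: the occupation estimate is applied to
  \<open>|b|\<close> itself and the result absorbed. The analytic input is Dynkin's formula for
  compactly supported C2 functions alone. Hence every test function is explicit (truncated powers
  and mollifications), and Borel functions are reached from step functions through open sets, since
  the occupation measure could be singular a priori. Harmonicity is a mean value at exits, with
  paths that never leave contributing 0; almost sure exit is therefore needed before constants may
  be added to \<open>u\<close>, as the growth property demands. In dimension one the sphere consists
  of two points, which no chain joins.\<close>

lemma linear_coeff_zero_of_quadratic_nonneg:
 fixes p q :: real
 assumes "!!t. 0 <= 2 * t * p + t^2 * q"
 shows "p = 0"
proof (rule ccontr)
 assume p: "p ~= 0"
 define M where "M = abs q + 1"
 have M: "M > 0" "q <= M" "M ~= 0" by (auto simp: M_def)
 have "0 <= 2 * (- p / M) * p + (- p / M)^2 * q" using assms .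
 also have "... <= 2 * (- p / M) * p + (- p / M)^2 * M" using M by (intro add_left_mono mult_left_mono) auto
 also have "... = - (p^2 / M)" using M by (simp add: field_simps power2_eq_square)
 also have "... < 0" using p M by simp
 finally show False by simp
qed

text \<open>Maximize the Rayleigh quotient on the unit sphere of \<open>V\<close>. At a maximizer
  \<open>v\<close> the form \<open>g\<close> is nonnegative on \<open>V\<close> and vanishes at
  \<open>v\<close>; its first variation in the direction \<open>w = c v - f v\<close> is a multiple
  of \<open>|w|^2\<close>, which must therefore be zero.\<close>

lemma self_adjoint_eigenvector:
 fixes f :: "'a::euclidean_space => 'a"
 assumes lin: "linear f" and sa: "!!x y. f x \<bullet> y = x \<bullet> f y"
  and V: "subspace V" "!!x. x \<in> V ==> f x \<in> V" and ne: "V ~= {0}"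
 obtains v c where "v \<in> V" "norm v = 1" "f v = c *\<^sub>R v"
proof -
 obtain x0 where x0: "x0 \<in> V" "x0 ~= 0" using ne V(1) subspace_0 by fastforce
 have "compact (V Int sphere 0 1)" by (intro closed_Int_compact closed_subspace V) simp
 moreover have "sgn x0 \<in> V Int sphere 0 1" using x0 V by (simp add: sgn_div_norm subspace_scale)
 moreover have "continuous_on (V Int sphere 0 1) (%x. f x \<bullet> x)"
  by (intro continuous_intros linear_continuous_on linear_conv_bounded_linear[THEN iffD1] lin)
 ultimately obtain v where v: "v \<in> V Int sphere 0 1"
  and max: "!!y. y \<in> V Int sphere 0 1 ==> f y \<bullet> y <= f v \<bullet> v"
  using continuous_attains_sup[of "V Int sphere 0 1" "%x. f x \<bullet> x"] by blast
 define c where "c = f v \<bullet> v"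
 define g where "g w = c * (w \<bullet> w) - f w \<bullet> w" for w
 have vv: "v \<bullet> v = 1" using v by (simp add: norm_eq_1)
 have g0: "g w >= 0" if "w \<in> V" for w
 proof (cases "w = 0")
  case False
  have "sgn w \<in> V Int sphere 0 1" using that False V by (simp add: sgn_div_norm subspace_scale)
  from max[OF this] have "(f w \<bullet> w) / (norm w)^2 <= c"
   by (simp add: c_def sgn_div_norm linear_cmul[OF lin] power2_eq_square field_simps)
  thus ?thesis using False by (simp add: g_def field_simps dot_square_norm)
 qed (simp add: g_def)
 define w where "w = c *\<^sub>R v - f v"
 have wV: "w \<in> V" unfolding w_def using v V by (auto intro!: subspace_diff subspace_scale)
 have "0 <= 2 * t * (w \<bullet> w) + t^2 * g w" for t
 proof -
  have "0 <= g (v + t *\<^sub>R w)" using v wV V by (intro g0 subspace_add subspace_scale) auto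
  also have "f v \<bullet> v = c" by (simp add: c_def)
  hence "g (v + t *\<^sub>R w) = 2 * t * (c * (v \<bullet> w) - f v \<bullet> w) + t^2 * g w" using vv sa[of w v]
   by (simp add: g_def linear_add[OF lin] linear_cmul[OF lin] inner_add algebra_simps power2_eq_square inner_commute)
  also have "c * (v \<bullet> w) - f v \<bullet> w = w \<bullet> w"
   by (simp add: w_def inner_diff_left inner_diff_right inner_commute algebra_simps)
  finally show ?thesis .
 qed
 hence "w \<bullet> w = 0" by (rule linear_coeff_zero_of_quadratic_nonneg)
 hence "f v = c *\<^sub>R v" by (simp add: w_def)
 thus ?thesis using that[of v c] v by simp
qed

text \<open>Split off an eigenvector; by self-adjointness its orthogonal complement in
  \<open>V\<close> is again invariant.\<close>

lemma self_adjoint_orthonormal_eigenbasis_subspace: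
 fixes f :: "'a::euclidean_space => 'a"
 assumes lin: "linear f" and sa: "!!x y. f x \<bullet> y = x \<bullet> f y"
  and "subspace V" "!!x. x \<in> V ==> f x \<in> V"
 shows "EX B<=V. finite B & pairwise orthogonal B & (ALL v:B. norm v = 1 & (EX c. f v = c *\<^sub>R v)) & V <= span B"
 using assms(3,4)
proof (induction "dim V" arbitrary: V rule: less_induct)
 case less
 show ?case
 proof (cases "V = {0}")
  case True
  thus ?thesis by (intro exI[of _ "{}"]) auto
 next
  case False
  obtain v c where v: "v \<in> V" "norm v = 1" "f v = c *\<^sub>R v"
   using self_adjoint_eigenvector[OF lin sa less.prems False] by metis
  define W where "W = {y \<in> V. orthogonal v y}"
  have W: "subspace W" unfolding W_def using less.prems(1) subspace_orthogonal_to_vector[of v]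
   by (auto simp: subspace_def)
  have fW: "f x \<in> W" if "x \<in> W" for x
   using that less.prems(2) sa[of v x] v by (auto simp: W_def orthogonal_def)
  have "v ~= 0" using v by auto
  hence "v ~: W" by (auto simp: W_def orthogonal_def)
  hence "W \<subset> V" using v by (auto simp: W_def)
  hence "dim W < dim V" using W less.prems(1) by (metis dim_psubset span_eq_iff)
  from less.hyps[OF this W fW] obtain B where B: "B <= W" "finite B" "pairwise orthogonal B"
   "ALL v:B. norm v = 1 & (EX c. f v = c *\<^sub>R v)" "W <= span B" by auto
  show ?thesis
  proof (intro exI[of _ "insert v B"] conjI)
   show "insert v B <= V" using v B \<open>W \<subset> V\<close> by auto
   show "pairwise orthogonal (insert v B)" using B v by (intro pairwise_orthogonal_insert) (auto simp: W_def)
   show "V <= span (insert v B)"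
   proof
    fix x assume x: "x \<in> V"
    have vv: "v \<bullet> v = 1" using v by (simp add: norm_eq_1)
    have "x - (v \<bullet> x) *\<^sub>R v \<in> W" unfolding W_def orthogonal_def using x v vv less.prems(1)
     by (auto simp: inner_diff_right intro!: subspace_diff subspace_scale)
    hence "x - (v \<bullet> x) *\<^sub>R v \<in> span B" using B by blast
    thus "x \<in> span (insert v B)" using span_breakdown_eq by blast
   qed
  qed (use B v in auto)
 qed
qed

text \<open>The class is defined through eigenvalues, while the estimates need coordinates: this is
  the spectral decomposition of \<open>A\<close> together with the resolution of the identity by the
  same vectors.\<close>

lemma ellipticity_class_spectral:
 assumes "A \<in> ellipticity_class ell"
 obtains B and c :: "real^'n => real" where "finite B" "!!v. v \<in> B ==> norm v = 1"
  "!!v. v \<in> B ==> c v \<in> {ell..1 / ell}"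
  "!!i j. A $ i $ j = (\<Sum>v\<in>B. c v * (v $ i * v $ j))"
  "!!i j. (\<Sum>v\<in>B. v $ i * v $ j) = (if i = j then 1 else 0)"
proof -
 have sym: "transpose A = A" and ev: "!!c v. v ~= 0 ==> A *v v = c *\<^sub>R v ==> c \<in> {ell..1/ell}"
  using assms by (auto simp: ellipticity_class_def)
 have "(A *v x) \<bullet> y = x \<bullet> (A *v y)" for x y
  by (metis dot_lmul_matrix sym matrix_vector_mul_linear transpose_matrix_vector)
 from self_adjoint_orthonormal_eigenbasis_subspace[OF matrix_vector_mul_linear this, of UNIV]
 obtain B where B: "finite B" "pairwise orthogonal B" "ALL v:B. norm v = 1 & (EX c. A *v v = c *\<^sub>R v)"
  "UNIV <= span B" by auto
 from B(3) obtain c where c: "!!v. v \<in> B ==> A *v v = c v *\<^sub>R v" by metis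
 have n1: "norm v = 1" if "v \<in> B" for v using B that by auto
 have "x = (\<Sum>v\<in>B. (v \<bullet> x) *\<^sub>R v)" for x
 proof -
  have "x \<in> span B" using B by auto
  then obtain u where u: "x = (\<Sum>v\<in>B. u v *\<^sub>R v)" using B(1) by (auto simp: span_finite)
  have "w \<bullet> x = u w" if "w \<in> B" for w
  proof -
   have "w \<bullet> x = (\<Sum>v\<in>B. u v * (w \<bullet> v))" unfolding u by (simp add: inner_sum_right)
   also have "... = (\<Sum>v\<in>B. if v = w then u v else 0)"
    using B(2) that n1 by (intro sum.cong) (auto simp: pairwise_def orthogonal_def norm_eq_1)
   finally show ?thesis using that B(1) by simp
  qed
  thus ?thesis by (subst (1) u) (auto intro!: sum.cong)
 qed
 from this[of "axis j 1" for j] have ax: "axis j 1 = (\<Sum>v\<in>B. (v $ j) *\<^sub>R v)" for j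
  by (simp add: inner_axis)
 show ?thesis
 proof (rule that[of B c])
  fix i j
  show "(\<Sum>v\<in>B. v $ i * v $ j) = (if i = j then 1 else 0)" using arg_cong[OF ax[of j], of "%x. x $ i"]
   by (simp add: axis_def mult.commute split: if_splits)
  have "A $ i $ j = (A *v axis j 1) $ i" by (simp add: matrix_vector_mult_basis column_def)
  also have "... = (\<Sum>v\<in>B. (v $ j) *\<^sub>R (A *v v)) $ i"
   by (subst ax) (simp add: linear_sum[OF matrix_vector_mul_linear] linear_cmul[OF matrix_vector_mul_linear])
  also have "... = (\<Sum>v\<in>B. c v * (v $ i * v $ j))" by (auto simp: c mult_ac intro!: sum.cong)
  finally show "A $ i $ j = (\<Sum>v\<in>B. c v * (v $ i * v $ j))" .
 next
  fix v assume "v \<in> B"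
  thus "c v \<in> {ell..1 / ell}" using ev[of v "c v"] c n1[of v] by force
 qed (use B n1 in auto)
qed

section \<open>Derivatives as gradients, truncated powers, smoothing kernels\<close>

lemma pderivative_eq_gradient:
 assumes "(u has_derivative (%h. h \<bullet> G)) (at x)"
 shows "pderivative i u x = G $ i"
proof -
 have "((%h. u (x + h *\<^sub>R axis i 1)) has_derivative (%h. (h *\<^sub>R axis i 1) \<bullet> G)) (at 0)"
  by (rule has_derivative_compose[where f="%h. x + h *\<^sub>R axis i 1" and g=u])
   (auto intro!: derivative_eq_intros assms)
 hence "((%h. u (x + h *\<^sub>R axis i 1)) has_field_derivative G $ i) (at 0)"
  by (simp add: has_field_derivative_def inner_axis' mult.commute[of _ "G $ i"] mult_commute_abs)
 thus ?thesis unfolding pderivative_def by (rule DERIV_imp_deriv)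
qed

text \<open>\<open>H i\<close> is the gradient of the i-th partial derivative. Test functions are
  built with Frechet derivatives, for which integrals can be differentiated; this lemma returns to
  the coordinatewise derivatives of the definitions.\<close>

lemma C2_compact_support_gradientI:
 assumes u: "!!x. (u has_derivative (%h. h \<bullet> G x)) (at x)"
  and G: "!!i x. ((%x. G x $ i) has_derivative (%h. h \<bullet> H i x)) (at x)"
  and H: "!!i. continuous_on UNIV (H i)"
  and supp: "{x. u x ~= 0} <= cball z r"
 shows "C2_compact_support u"
  and "pderivative i u = (%x. G x $ i)"
  and "pderivative j (pderivative i u) = (%x. H i x $ j)"
proof -
 have 1: "pderivative i u = (%x. G x $ i)" for i using pderivative_eq_gradient[OF u] by blast
 have 2: "pderivative j (pderivative i u) = (%x. H i x $ j)" for i j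
  unfolding 1 using pderivative_eq_gradient[OF G] by blast
 show "C2_compact_support u" unfolding C2_compact_support_def 2 unfolding 1
 proof (intro conjI allI)
  show "u differentiable_on UNIV" "(%x. G x $ i) differentiable_on UNIV" for i
   using u G by (auto simp: differentiable_on_def differentiable_def)
  show "continuous_on UNIV (%x. H j x $ i)" for i j by (intro continuous_intros H)
  show "compact (closure {x. u x ~= 0})" using supp by (meson bounded_cball bounded_subset compact_closure)
 qed
 show "pderivative i u = (%x. G x $ i)" "pderivative j (pderivative i u) = (%x. H i x $ j)" using 1 2 by auto
qed

lemma diffusion_operator_gradient:
 assumes "!!x. (u has_derivative (%h. h \<bullet> G x)) (at x)"
  and "!!i x. ((%x. G x $ i) has_derivative (%h. h \<bullet> H i x)) (at x)"
 shows "diffusion_operator a b u x = 1/2 * (\<Sum>i\<in>UNIV. \<Sum>j\<in>UNIV. a x $ i $ j * H j x $ i) + b x \<bullet> G x"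
proof -
 have 1: "pderivative i u = (%x. G x $ i)" for i using pderivative_eq_gradient[OF assms(1)] by blast
 have 2: "pderivative j (pderivative i u) = (%x. H i x $ j)" for i j
  unfolding 1 using pderivative_eq_gradient[OF assms(2)] by blast
 show ?thesis unfolding diffusion_operator_def 2 unfolding 1 by (simp add: inner_vec_def)
qed

text \<open>The truncated power is C2 from \<open>m = 3\<close> on, has compact support for
  \<open>m > 0\<close>, and its derivatives are built from truncated powers of lower exponent. It
  serves as smoothing kernel with \<open>m = 3\<close> and as barrier with a large exponent.\<close>

definition bump :: "'a::real_inner => real => nat => 'a => real" where
 "bump z c m x = (max 0 (c - (x - z) \<bullet> (x - z))) ^ m"

lemma bump_nonneg: "0 <= bump z c m x" by (simp add: bump_def)

lemma bump_le: "0 <= c ==> bump z c m x <= c ^ m" unfolding bump_def by (intro power_mono) auto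

lemma bump_eq_0: "m > 0 ==> c <= (x - z) \<bullet> (x - z) ==> bump z c m x = 0" by (simp add: bump_def)

lemma bump_eq: "(x - z) \<bullet> (x - z) <= c ==> bump z c m x = (c - (x - z) \<bullet> (x - z)) ^ m"
 by (simp add: bump_def)

lemma bump_outside: "m > 0 ==> 0 <= r ==> x ~: ball z r ==> bump z (r^2) m x = 0"
 by (rule bump_eq_0) (auto simp: dist_norm norm_minus_commute dot_square_norm intro!: power_mono)

lemma continuous_on_bump [continuous_intros]:
 assumes "continuous_on S f" "continuous_on S g"
 shows "continuous_on S (%x. bump (f x) c m (g x))" unfolding bump_def by (intro continuous_intros assms)

lemma max0_power_has_derivative:
 assumes "2 <= m"
 shows "((%s::real. (max 0 s) ^ m) has_real_derivative real m * (max 0 s) ^ (m - 1)) (at s)"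
proof -
 consider "s > 0" | "s < 0" | "s = 0" by linarith
 thus ?thesis
 proof cases
  case 1
  have "((%s::real. s ^ m) has_real_derivative real m * s ^ (m - 1)) (at s)" by (auto intro!: derivative_eq_intros)
  hence "((%s::real. (max 0 s) ^ m) has_real_derivative real m * s ^ (m - 1)) (at s)"
   by (rule DERIV_cong_ev[OF refl _ refl, THEN iffD1, rotated])
    (rule eventually_mono[OF eventually_nhds_in_open[of "{0<..}"]], use 1 in auto)
  thus ?thesis using 1 by simp
 next
  case 2
  have "((%s::real. 0) has_real_derivative 0) (at s)" by simp
  hence "((%s::real. (max 0 s) ^ m) has_real_derivative 0) (at s)"
   by (rule DERIV_cong_ev[OF refl _ refl, THEN iffD1, rotated])
    (rule eventually_mono[OF eventually_nhds_in_open[of "{..<0}"]], use 2 assms in auto)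
  thus ?thesis using 2 assms by (simp add: power_0_left)
 next
  case 3
  have "((%h. (max 0 h) ^ m / h) \<longlongrightarrow> 0) (at (0::real))"
  proof (rule Lim_null_comparison)
   show "\<forall>\<^sub>F h in at 0. norm ((max 0 h) ^ m / h) <= abs h ^ (m - 1)"
   proof (rule eventually_mono[OF eventually_neq_at_within[of 0]])
    fix h :: real assume h: "h ~= 0"
    have "abs ((max 0 h) ^ m) <= abs h ^ m" unfolding power_abs by (intro power_mono) auto
    also have "abs h ^ m = abs h ^ (m - 1) * abs h" using assms by (cases m) auto
    finally show "norm ((max 0 h) ^ m / h) <= abs h ^ (m - 1)" using h by (simp add: divide_le_eq abs_mult)
   qed
   show "((%h. abs h ^ (m - 1)) \<longlongrightarrow> 0) (at (0::real))"
    by (rule tendsto_eq_rhs, (rule tendsto_intros)+) (use assms in auto)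
  qed
  thus ?thesis using 3 assms by (simp add: DERIV_def power_0_left)
 qed
qed

lemma bump_has_derivative:
 assumes "2 <= m"
 shows "(bump z c m has_derivative (%h. h \<bullet> ((- 2 * real m * bump z c (m - 1) x) *\<^sub>R (x - z)))) (at x)"
proof -
 let ?g = "%x. c - (x - z) \<bullet> (x - z)"
 have "(?g has_derivative (%h. - 2 * ((x - z) \<bullet> h))) (at x)"
  by (auto intro!: derivative_eq_intros simp: inner_commute)
 from has_derivative_compose[OF this, of "%s. (max 0 s) ^ m",
   OF max0_power_has_derivative[OF assms, unfolded has_field_derivative_def]]
 show ?thesis unfolding bump_def [abs_def] by (rule has_derivative_eq_rhs) (auto simp: inner_commute)
qed

definition bump_hess :: "real^'n => real => nat => 'n => real^'n => real^'n" where
 "bump_hess z c m i x = (4 * real m * real (m - 1) * bump z c (m - 2) x * (x - z) $ i) *\<^sub>R (x - z)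
  - (2 * real m * bump z c (m - 1) x) *\<^sub>R axis i 1"

lemma bump_gradient_has_derivative:
 assumes "3 <= m"
 shows "((%x. ((- 2 * real m * bump z c (m - 1) x) *\<^sub>R (x - z)) $ i) has_derivative
  (%h. h \<bullet> bump_hess z c m i x)) (at x)"
proof -
 have "((%x. (x - z) $ i) has_derivative (%h. h $ i)) (at x)"
  by (auto intro!: derivative_eq_intros bounded_linear_imp_has_derivative bounded_linear_vec_nth)
 moreover have "(bump z c (m - 1) has_derivative (%h. h \<bullet> ((- 2 * real (m - 1) * bump z c (m - 1 - 1) x) *\<^sub>R (x - z)))) (at x)"
  by (rule bump_has_derivative) (use assms in auto)
 ultimately have "((%x. (- 2 * real m * bump z c (m - 1) x) * (x - z) $ i) has_derivative
   (%h. (- 2 * real m * bump z c (m - 1) x) * h $ i +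
    (- 2 * real m * (h \<bullet> ((- 2 * real (m - 1) * bump z c (m - 1 - 1) x) *\<^sub>R (x - z)))) * (x - z) $ i)) (at x)"
  by (intro has_derivative_mult has_derivative_mult_right)
 thus ?thesis by (rule has_derivative_eq_rhs[OF back_subst[of "%f. (f has_derivative _) _"]])
   (auto simp: bump_hess_def inner_diff_right inner_axis algebra_simps numeral_2_eq_2)
qed

lemma continuous_on_bump_hess [continuous_intros]:
 assumes "continuous_on S f" "continuous_on S g"
 shows "continuous_on S (%x. bump_hess (f x) c m i (g x))" unfolding bump_hess_def by (intro continuous_intros assms)

lemma bump_C2_compact_support:
 assumes "3 <= m" "0 <= r"
 shows "C2_compact_support (bump z (r^2) m :: real^'n => real)"
proof (rule C2_compact_support_gradientI)
 show "(bump z (r^2) m has_derivative (%h. h \<bullet> ((- 2 * real m * bump z (r^2) (m - 1) x) *\<^sub>R (x - z)))) (at x)" for x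
  by (rule bump_has_derivative) (use assms in auto)
 show "((%x. ((- 2 * real m * bump z (r^2) (m - 1) x) *\<^sub>R (x - z)) $ i) has_derivative
  (%h. h \<bullet> bump_hess z (r^2) m i x)) (at x)" for i x by (rule bump_gradient_has_derivative[OF assms(1)])
 show "continuous_on UNIV (bump_hess z (r^2) m i)" for i by (intro continuous_intros)
 show "{x. bump z (r^2) m x ~= 0} <= cball z r" using bump_outside[of m r] assms ball_subset_cball by fastforce
qed

text \<open>All derivatives fall on the kernel, so continuity of \<open>f\<close> suffices. This is
  what makes the smoothing of a merely convex function twice differentiable.\<close>

lemma integral_kernel_has_derivative:
 fixes k :: "'a::euclidean_space => 'a => real"
 assumes k: "!!x y. ((%x. k x y) has_derivative (%h. h \<bullet> D x y)) (at x)"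
  and kc: "!!x. continuous_on UNIV (k x)"
  and D: "continuous_on UNIV (%(x, y). D x y)"
  and f: "continuous_on UNIV f"
 shows "((%x. integral (cbox l u) (%y. f y * k x y)) has_derivative
     (%h. h \<bullet> integral (cbox l u) (%y. f y *\<^sub>R D x y))) (at x)"
proof -
 have D': "continuous_on S (%y. D x y)" for x S
 proof -
  have "continuous_on S (%y. (%(x, y). D x y) (x, y))"
   by (rule continuous_on_compose2[OF D]) (auto intro!: continuous_intros)
  thus ?thesis by simp
 qed
 have f': "continuous_on S f" for S using f continuous_on_subset by blast
 have int: "(%y. f y *\<^sub>R D x y) integrable_on cbox l u" by (intro integrable_continuous continuous_intros D' f')
 have int2: "(%y. blinfun_inner_left (f y *\<^sub>R D x y)) integrable_on cbox l u"
  by (intro integrable_continuous continuous_intros D' f')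
 have "((%x. integral (cbox l u) (%y. f y * k x y)) has_derivative
     integral (cbox l u) (%y. blinfun_inner_left (f y *\<^sub>R D x y))) (at x within UNIV)"
 proof (rule leibniz_rule[where fx="%x y. blinfun_inner_left (f y *\<^sub>R D x y)"])
  show "((%x. f y * k x y) has_derivative blinfun_inner_left (f y *\<^sub>R D x y)) (at x within UNIV)" for x y
   by (rule has_derivative_eq_rhs[OF has_derivative_mult_right[OF k]]) auto
  show "(%y. f y * k x y) integrable_on cbox l u" for x
   by (intro integrable_continuous continuous_intros f' continuous_on_subset[OF kc]) auto
  have "continuous_on (UNIV \<times> cbox l u) (%p. blinfun_inner_left (f (snd p) *\<^sub>R D (fst p) (snd p)))"
   using D by (intro continuous_intros continuous_on_compose2[OF f])
    (auto simp: case_prod_beta' intro: continuous_on_subset)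
  thus "continuous_on (UNIV \<times> cbox l u) (%(x, y). blinfun_inner_left (f y *\<^sub>R D x y))"
   by (simp add: case_prod_beta')
 qed auto
 thus ?thesis
 proof (rule has_derivative_eq_rhs)
  show "blinfun_apply (integral (cbox l u) (%y. blinfun_inner_left (f y *\<^sub>R D x y))) =
   (%h. h \<bullet> integral (cbox l u) (%y. f y *\<^sub>R D x y))"
  proof
   fix h
   have "blinfun_apply (integral (cbox l u) (%y. blinfun_inner_left (f y *\<^sub>R D x y))) h
    = integral (cbox l u) (%y. blinfun_apply (blinfun_inner_left (f y *\<^sub>R D x y)) h)"
    by (rule blinfun_apply_integral[OF int2])
   also have "... = h \<bullet> integral (cbox l u) (%y. f y *\<^sub>R D x y)"
    using integral_linear[OF int bounded_linear_inner_right[of h]] by (simp add: o_def)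
   finally show "blinfun_apply (integral (cbox l u) (%y. blinfun_inner_left (f y *\<^sub>R D x y))) h
     = h \<bullet> integral (cbox l u) (%y. f y *\<^sub>R D x y)" .
  qed
 qed
qed

section \<open>Convex functions with prescribed kinks\<close>

text \<open>A function on the space of slopes: the set where the \<open>i\<close>-th term attains
  the maximum is the cell of slopes assigned to the point \<open>y i\<close>, and the weights
  \<open>h\<close> shift the cell boundaries.\<close>

definition max_affine :: "'i set => ('i => 'a::real_inner) => ('i => real) => 'a => real" where
 "max_affine I y h p = Max ((%i. p \<bullet> y i - h i) ` I)"

lemma max_affine_ge: "finite I ==> i \<in> I ==> p \<bullet> y i - h i <= max_affine I y h p"
 by (simp add: max_affine_def)

lemma max_affine_le_iff:
 "finite I ==> I ~= {} ==> max_affine I y h p <= c \<longleftrightarrow> (ALL i:I. p \<bullet> y i - h i <= c)"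
 by (simp add: max_affine_def)

lemma continuous_on_max_affine:
 assumes "finite I" "I ~= {}"
 shows "continuous_on S (max_affine I y h)" using assms
proof (induction rule: finite_ne_induct)
 case (singleton i)
 thus ?case by (auto simp: max_affine_def intro!: continuous_intros)
next
 case (insert i I)
 have "max_affine (insert i I) y h = (%p. max (p \<bullet> y i - h i) (max_affine I y h p))"
  using insert.hyps by (simp add: max_affine_def fun_eq_iff)
 thus ?case using insert by (auto intro!: continuous_intros)
qed

text \<open>At a near-minimizer of the convex dual functional of semidiscrete optimal transport, lowering a
single weight by \<open>t\<close> cannot gain much, so that the enlarged cell of each point carries at least half
of its mass. A mere near-minimizer suffices, which avoids measure-zero ties and compactness.\<close>

lemma semidiscrete_transport:
 fixes y :: "'i => 'a::euclidean_space" and m :: "'i => real"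
 assumes I: "finite I" "I ~= {}" and m: "!!i. i \<in> I ==> 0 < m i"
  and S: "compact S" "measure lborel S = (\<Sum>i\<in>I. m i)" and t: "0 < t"
 obtains h where "!!i. i \<in> I ==> m i / 2 <= measure lborel {p \<in> S. max_affine I y h p <= p \<bullet> y i - h i + t}"
proof -
 let ?g = "max_affine I y"
 \<comment> \<open>The dual functional. Formally, its derivative in \<open>h i\<close> is
   \<open>m i\<close> minus the volume of the \<open>i\<close>-th cell in \<open>S\<close>.\<close>
 define F where "F h = (LINT p|lborel. indicator S p *\<^sub>R ?g h p) + (\<Sum>i\<in>I. m i * h i)" for h
 have Sm[measurable]: "S \<in> sets lborel" using S(1) by (simp add: compact_imp_closed)
 have Sfin: "emeasure lborel S < \<infinity>" using S(1) emeasure_bounded_finite compact_imp_bounded by blast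
 have int: "integrable lborel (%p. indicator S p *\<^sub>R ?g h p)" for h
  by (rule borel_integrable_compact[OF S(1) continuous_on_max_affine[OF I]])
 obtain M where M: "!!p i. p \<in> S ==> i \<in> I ==> \<bar>p \<bullet> y i\<bar> <= M"
 proof -
  obtain b where b: "!!p. p \<in> S ==> norm p <= b" using compact_imp_bounded[OF S(1)] by (auto simp: bounded_iff)
  show ?thesis
  proof (rule that[of "abs b * Max ((%i. norm (y i)) ` I)"])
   fix p i assume p: "p \<in> S" "i \<in> I"
   have "abs (p \<bullet> y i) <= norm p * norm (y i)" by (rule Cauchy_Schwarz_ineq2)
   also have "... <= abs b * Max ((%i. norm (y i)) ` I)" using p I b[OF p(1)] by (intro mult_mono) auto
   finally show "abs (p \<bullet> y i) <= abs b * Max ((%i. norm (y i)) ` I)" .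
  qed
 qed
 \<comment> \<open>Balance of the masses makes \<open>F\<close> invariant under adding a constant to
   all weights, so the smallest weight \<open>h i0\<close> cancels.\<close>
 have bdd: "- M * measure lborel S <= F h" for h
 proof -
  obtain i0 where i0: "i0 \<in> I" "!!i. i \<in> I ==> h i0 <= h i"
   using I by (metis (mono_tags, lifting) arg_min_if_finite(1) arg_min_least)
  have "(- M - h i0) * measure lborel S = (LINT p|lborel. indicator S p *\<^sub>R (- M - h i0))" using Sfin by simp
  also have "... <= (LINT p|lborel. indicator S p *\<^sub>R ?g h p)"
  proof (rule integral_mono[OF _ int])
   show "integrable lborel (%p. indicator S p *\<^sub>R (- M - h i0))"
    by (rule borel_integrable_compact[OF S(1) continuous_on_const])
   fix p
   show "indicator S p *\<^sub>R (- M - h i0) <= indicator S p *\<^sub>R ?g h p"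
    using M[of p i0] i0(1) max_affine_ge[OF I(1) i0(1), of p y h] by (auto simp: indicator_def)
  qed
  also have "... = F h - (\<Sum>i\<in>I. m i * h i)" by (simp add: F_def)
  also have "(\<Sum>i\<in>I. m i * h i) >= (\<Sum>i\<in>I. m i * h i0)"
   using i0 m by (intro sum_mono mult_left_mono) (auto simp: less_imp_le)
  hence "F h - (\<Sum>i\<in>I. m i * h i) <= F h - h i0 * measure lborel S"
   unfolding S(2) sum_distrib_left by (simp add: mult.commute)
  finally show ?thesis by (simp add: algebra_simps)
 qed
 define q where "q = Min (m ` I)"
 have q: "0 < q" "!!i. i \<in> I ==> q <= m i" using I m by (auto simp: q_def)
 have bb: "bdd_below (range F)" using bdd by (auto intro!: bdd_belowI)
 \<comment> \<open>The slack is \<open>t\<close> times half of the smallest mass; it is the half of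
   the mass that the conclusion gives away.\<close>
 obtain h where h: "F h < Inf (range F) + t * q / 2"
  using cInf_lessD[of "range F" "Inf (range F) + t * q / 2"] q t by auto
 show ?thesis
 proof (rule that[of h])
  fix i assume i: "i \<in> I"
  define U where "U = {p \<in> S. ?g h p <= p \<bullet> y i - h i + t}"
  have "closed U" unfolding U_def Collect_conj_eq Collect_mem_eq
   by (intro closed_Int closed_Collect_le continuous_intros continuous_on_max_affine I compact_imp_closed S)
  hence Um[measurable]: "U \<in> sets lborel" by simp
  have Ufin: "emeasure lborel U < \<infinity>"
   using emeasure_bounded_finite[of U] bounded_subset[OF compact_imp_bounded[OF S(1)], of U] by (auto simp: U_def)
  define h' where "h' = h(i := h i - t)"
  \<comment> \<open>Lowering one weight by \<open>t\<close> raises the maximum by at most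
    \<open>t\<close>, and only on \<open>U\<close>.\<close>
  have le: "?g h' p <= ?g h p + indicator U p * t" if "p \<in> S" for p
  proof (subst max_affine_le_iff[OF I], safe)
   fix j assume j: "j \<in> I"
   show "p \<bullet> y j - h' j <= ?g h p + indicator U p * t" using max_affine_ge[OF I(1) j, of p y h] t that
    by (auto simp: h'_def U_def indicator_def)
  qed
  have "Inf (range F) <= F h'" using bb by (intro cInf_lower) auto
  also have "F h' <= F h + t * measure lborel U - t * m i"
  proof -
   have "(LINT p|lborel. indicator S p *\<^sub>R ?g h' p) <= (LINT p|lborel. indicator S p *\<^sub>R ?g h p + indicator U p *\<^sub>R t)"
   proof (rule integral_mono[OF int Bochner_Integration.integrable_add[OF int]])
    show "integrable lborel (%p. indicator U p *\<^sub>R t)"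
     using Ufin Um by (intro integrable_scaleR_left integrable_real_indicator) auto
    show "indicator S p *\<^sub>R ?g h' p <= indicator S p *\<^sub>R ?g h p + indicator U p *\<^sub>R t" for p
     using le[of p] by (auto simp: indicator_def U_def)
   qed
   also have "... = (LINT p|lborel. indicator S p *\<^sub>R ?g h p) + t * measure lborel U"
    by (subst Bochner_Integration.integral_add[OF int])
     (use Ufin Um in \<open>auto intro!: integrable_real_indicator integrable_mult_left simp: mult.commute\<close>)
   finally have 1: "(LINT p|lborel. indicator S p *\<^sub>R ?g h' p) <= ..." .
   have "(\<Sum>j\<in>I. m j * h' j) = (\<Sum>j\<in>I. m j * h j - (if j = i then t * m i else 0))"
    by (intro sum.cong) (auto simp: h'_def algebra_simps)
   also have "... = (\<Sum>j\<in>I. m j * h j) - t * m i" using i I by (simp add: sum_subtractf)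
   finally show ?thesis using 1 by (simp add: F_def)
  qed
  finally have "t * m i - t * q / 2 <= t * measure lborel U" using h by simp
  hence "t * (m i - q / 2) <= t * measure lborel U" by (simp add: algebra_simps)
  thus "m i / 2 <= measure lborel {p \<in> S. ?g h p <= p \<bullet> y i - h i + t}"
   using t q(2)[OF i] unfolding U_def[symmetric] by simp
 qed
qed

text \<open>\<open>f\<close> is the Legendre transform over a ball \<open>S\<close> of slopes, whose
  radius is fixed by balance of volumes: mass \<open>4 w (r i)^d\<close> for each point, with
  \<open>w\<close> the volume of the unit ball. The near-cell of \<open>y i\<close> has at least
  half of this, twice the volume of a ball of radius \<open>r i\<close>, so it cannot lie within
  distance \<open>r i\<close> of one of its slopes. All its slopes are subgradients at
  \<open>y i\<close> up to the error \<open>t\<close>.\<close>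

lemma convex_function_with_kinks:
 fixes y :: "'i => 'a::euclidean_space" and r :: "'i => real"
 assumes I: "finite I" "I ~= {}" and r: "!!i. i \<in> I ==> 0 < r i" and t: "0 < t"
 obtains f s where "0 < s" "s ^ DIM('a) = 4 * (\<Sum>i\<in>I. r i ^ DIM('a))"
  "!!x. EX p. norm p <= s & (ALL z. f x + p \<bullet> (z - x) <= f z)"
  "!!i. i \<in> I ==> EX p q. r i <= norm (p - q) &
    (ALL x. f (y i) + p \<bullet> (x - y i) - t <= f x) & (ALL x. f (y i) + q \<bullet> (x - y i) - t <= f x)"
proof -
 let ?d = "DIM('a)"
 define w where "w = unit_ball_vol (real ?d)"
 have w: "w > 0" by (simp add: w_def)
 have vol: "measure lborel (cball (c::'a) j) = w * j ^ ?d" if "j >= 0" for c j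
  using content_cball[OF that, of c] by (simp add: w_def)
 define s where "s = root ?d (4 * (\<Sum>i\<in>I. r i ^ ?d))"
 have pos: "(\<Sum>i\<in>I. r i ^ ?d) > 0" using I r by (intro sum_pos) auto
 have s: "s > 0" "s ^ ?d = 4 * (\<Sum>i\<in>I. r i ^ ?d)" using pos by (auto simp: s_def)
 define S where "S = cball (0::'a) s"
 have S: "compact S" "S ~= {}" using s by (auto simp: S_def)
 have mS: "measure lborel S = (\<Sum>i\<in>I. 4 * w * r i ^ ?d)"
  unfolding S_def using s by (simp add: vol sum_distrib_left mult_ac)
 have "0 < 4 * w * r i ^ ?d" if "i \<in> I" for i using r[OF that] w by simp
 from semidiscrete_transport[OF I this S(1) mS t, of y] obtain h where
  h: "!!i. i \<in> I ==> 4 * w * r i ^ ?d / 2 <= measure lborel {p \<in> S. max_affine I y h p <= p \<bullet> y i - h i + t}"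
  by blast
 define g where "g = max_affine I y h"
 define f where "f x = Sup ((%p. p \<bullet> x - g p) ` S)" for x
 have cont: "continuous_on S (%p. p \<bullet> x - g p)" for x unfolding g_def
  by (intro continuous_intros continuous_on_max_affine I)
 have bdd: "bdd_above ((%p. p \<bullet> x - g p) ` S)" for x
  by (intro bounded_imp_bdd_above compact_imp_bounded compact_continuous_image cont S)
 have \<phi>_ge: "p \<bullet> x - g p <= f x" if "p \<in> S" for p x
  unfolding f_def using bdd that by (auto intro!: cSup_upper)
 have supp: "EX p. norm p <= s & (ALL z. f x + p \<bullet> (z - x) <= f z)" for x
 proof -
  obtain p where p: "p \<in> S" "ALL q:S. q \<bullet> x - g q <= p \<bullet> x - g p"
   using continuous_attains_sup[OF S cont] by blast
  have "f x = p \<bullet> x - g p" unfolding f_def using p by (intro cSup_eq_maximum) auto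
  thus ?thesis using p(1) \<phi>_ge[OF p(1)] by (intro exI[of _ p]) (auto simp: S_def inner_diff_right)
 qed
 show ?thesis
 proof (rule that[OF s supp])
  fix i assume i: "i \<in> I"
  define U where "U = {p \<in> S. g p <= p \<bullet> y i - h i + t}"
  have "f (y i) <= h i" unfolding f_def g_def using S max_affine_ge[OF I(1) i, of _ y h]
   by (intro cSup_least) (auto simp: algebra_simps)
  hence U: "f (y i) + p \<bullet> (x - y i) - t <= f x" if "p \<in> U" for p x
   using \<phi>_ge[of p x] that by (auto simp: U_def inner_diff_right)
  have "EX p:U. EX q:U. r i <= norm (p - q)"
  proof (rule ccontr)
   assume *: "~ ?thesis"
   have mU: "2 * w * r i ^ ?d <= measure lborel U" using h[OF i] by (simp add: U_def g_def)
   moreover have "0 < w * r i ^ ?d" using w r[OF i] by simp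
   ultimately have "U ~= {}" by (cases "U = {}") auto
   then obtain p where p: "p \<in> U" by blast
   have "U <= cball p (r i)" using * p by (force simp: dist_norm)
   moreover have "closed U" unfolding U_def g_def Collect_conj_eq Collect_mem_eq
    by (intro closed_Int closed_Collect_le continuous_intros continuous_on_max_affine I compact_imp_closed S)
   ultimately have "measure lborel U <= measure lborel (cball p (r i))"
    by (intro measure_mono_fmeasurable) (auto intro!: borel_closed fmeasurableI emeasure_bounded_finite bounded_cball)
   also have "... = w * r i ^ ?d" using r[OF i] by (simp add: vol)
   finally show False using mU \<open>0 < w * r i ^ ?d\<close> by simp
  qed
  thus "EX p q. r i <= norm (p - q) &
    (ALL x. f (y i) + p \<bullet> (x - y i) - t <= f x) & (ALL x. f (y i) + q \<bullet> (x - y i) - t <= f x)"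
   using U by blast
 qed
qed

section \<open>Smoothing and the Aleksandrov--Bakelman--Pucci test function\<close>

lemma lborel_integral_affine:
 fixes f :: "'a::euclidean_space => real"
 assumes [measurable]: "f \<in> borel_measurable borel" and "c ~= 0"
 shows "(LINT x|lborel. f x) = abs c ^ DIM('a) * (LINT x|lborel. f (t + c *\<^sub>R x))"
proof -
 have "(LINT x|lborel. f x) = (LINT x|density (distr lborel borel (%x. t + c *\<^sub>R x)) (%_. ennreal (abs c^DIM('a))). f x)"
  using lborel_affine[OF assms(2), of t] by (simp add: ennreal_power)
 also have "... = abs c ^ DIM('a) * (LINT x|lborel. f (t + c *\<^sub>R x))"
  by (subst integral_density) (auto simp: integral_distr)
 finally show ?thesis .
qed

lemma integrable_continuous_support:
 fixes f :: "'a::euclidean_space => real"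
 assumes "continuous_on UNIV f" "!!x. x ~: cball z r ==> f x = 0"
 shows "integrable lborel f"
proof -
 have "integrable lborel (%x. indicator (cball z r) x *\<^sub>R f x)"
  by (intro borel_integrable_compact continuous_on_subset[OF assms(1)]) auto
 moreover have "(%x. indicator (cball z r) x *\<^sub>R f x) = f"
  using assms(2) by (auto simp: fun_eq_iff indicator_def)
 ultimately show ?thesis by simp
qed

lemma bump_support_cball:
 assumes "0 < m" "0 <= e" "v ~: cball 0 e"
 shows "bump 0 (e^2) m v = 0" using bump_outside[of m e v 0] assms ball_subset_cball by blast

text \<open>Links two forms of the smoothing: over a fixed box, where differentiation under the
  integral applies, and over the whole space, where changes of variable are free.\<close>

lemma integral_convolution_eq:
 fixes f k :: "real^'n => real"
 assumes f: "continuous_on UNIV f" and k: "continuous_on UNIV k" "!!v. v ~: cball 0 e ==> k v = 0"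
  and box: "cball x e <= cbox l u"
 shows "integral (cbox l u) (%y. f y * k (y - x)) = (LINT v|lborel. f (x + v) * k v)"
proof -
 have c: "continuous_on UNIV (%y. f y * k (y - x))"
  by (intro continuous_intros f continuous_on_compose2[OF k(1)]) auto
 have 0: "f y * k (y - x) = 0" if "y ~: cbox l u" for y
  using k(2)[of "y - x"] that box by (force simp: dist_norm norm_minus_commute)
 have "set_integrable lborel (cbox l u) (%y. f y * k (y - x))"
  unfolding set_integrable_def by (intro borel_integrable_compact continuous_on_subset[OF c]) auto
 hence "integral (cbox l u) (%y. f y * k (y - x)) = (LINT y:cbox l u|lborel. f y * k (y - x))"
  by (rule set_borel_integral_eq_integral(2)[symmetric])
 also have "... = (LINT y|lborel. f y * k (y - x))"
  unfolding set_lebesgue_integral_def using 0 by (intro Bochner_Integration.integral_cong) (auto simp: indicator_def)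
 also have "... = (LINT v|lborel. f (x + v) * k v)" by (subst lborel_integral_affine[where c=1 and t=x])
   (auto intro!: borel_measurable_continuous_onI c)
 finally show ?thesis .
qed

lemma bump_odd_moment:
 "(LINT v|lborel. (p \<bullet> v) * bump 0 c m (v::'a::euclidean_space)) = 0"
proof -
 have "continuous_on UNIV (%v. (p \<bullet> v) * bump 0 c m v)" by (intro continuous_intros)
 hence "(LINT v|lborel. (p \<bullet> v) * bump 0 c m v) = - (LINT v|lborel. (p \<bullet> v) * bump 0 c m v)"
  by (subst lborel_integral_affine[where c="-1" and t=0])
   (auto simp: bump_def borel_measurable_continuous_onI)
 thus ?thesis by simp
qed

text \<open>The kernel is left unnormalized; its mass is only estimated, in the test function below.
  With \<open>c = e^2\<close> the fixed box gives compact support, and at points whose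
  \<open>e\<close>-ball lies in the box the result is a true convolution.\<close>

definition moll :: "real^'n => real^'n => real => (real^'n => real) => real^'n => real" where
 "moll l u c f x = integral (cbox l u) (%y. f y * bump y c 3 x)"

definition moll_grad :: "real^'n => real^'n => real => (real^'n => real) => real^'n => real^'n" where
 "moll_grad l u c f x = integral (cbox l u) (%y. f y *\<^sub>R ((- 6 * bump y c 2 x) *\<^sub>R (x - y)))"

definition moll_hess :: "real^'n => real^'n => real => (real^'n => real) => 'n => real^'n => real^'n" where
 "moll_hess l u c f i x = integral (cbox l u) (%y. f y *\<^sub>R bump_hess y c 3 i x)"

context
 fixes f :: "real^'n => real"
 assumes f: "continuous_on UNIV f"
begin

lemma cont_on_\<phi>: "continuous_on S f" using f continuous_on_subset by blast

lemma moll_has_derivative: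
 "(moll l u c f has_derivative (%h. h \<bullet> moll_grad l u c f x)) (at x)"
 unfolding moll_def [abs_def] moll_grad_def
proof (rule integral_kernel_has_derivative)
 show "((%x. bump y c 3 x) has_derivative (%h. h \<bullet> ((- 6 * bump y c 2 x) *\<^sub>R (x - y)))) (at x)" for x y :: "real^'n"
  using bump_has_derivative[of 3 y c x] by simp
qed (auto intro!: continuous_intros f simp: case_prod_beta')

lemma moll_grad_nth: "moll_grad l u c f x $ i = integral (cbox l u) (%y. f y * ((- 6 * bump y c 2 x) *\<^sub>R (x - y)) $ i)"
proof -
 have "(%y. f y *\<^sub>R ((- 6 * bump y c 2 x) *\<^sub>R (x - y))) integrable_on cbox l u"
  by (intro integrable_continuous continuous_intros cont_on_\<phi>)
 from integral_linear[OF this bounded_linear_vec_nth[of i]]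
 show ?thesis unfolding moll_grad_def by (simp add: o_def mult.assoc)
qed

lemma moll_grad_has_derivative:
 "((%x. moll_grad l u c f x $ i) has_derivative (%h. h \<bullet> moll_hess l u c f i x)) (at x)"
 unfolding moll_grad_nth moll_hess_def
proof (rule integral_kernel_has_derivative)
 show "((%x. ((- 6 * bump y c 2 x) *\<^sub>R (x - y)) $ i) has_derivative (%h. h \<bullet> bump_hess y c 3 i x)) (at x)" for x y :: "real^'n"
  using bump_gradient_has_derivative[of 3 y c i x] by simp
qed (auto intro!: continuous_intros f simp: case_prod_beta')

lemma moll_hess_nth: "moll_hess l u c f i x $ j = integral (cbox l u) (%y. f y * bump_hess y c 3 i x $ j)"
proof -
 have "(%y. f y *\<^sub>R bump_hess y c 3 i x) integrable_on cbox l u"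
  by (intro integrable_continuous continuous_intros cont_on_\<phi>)
 from integral_linear[OF this bounded_linear_vec_nth[of j]]
 show ?thesis unfolding moll_hess_def by (simp add: o_def)
qed

lemma continuous_on_moll_hess: "continuous_on S (moll_hess l u c f i)"
proof -
 have "continuous_on UNIV (moll_hess l u c f i)" unfolding moll_hess_def [abs_def]
  by (rule integral_continuous_on_param)
   (auto simp: case_prod_beta' intro!: continuous_intros continuous_on_compose2[OF f])
 thus ?thesis using continuous_on_subset by blast
qed

lemma moll_C2_compact_support:
 assumes "0 <= e"
 shows "C2_compact_support (moll l u (e^2) f)"
proof -
 obtain r where r: "cbox l u <= cball 0 r"
  using bounded_subset_ballD[OF bounded_cbox, of l u 0] ball_subset_cball by blast
 show ?thesis
 proof (rule C2_compact_support_gradientI[OF moll_has_derivative moll_grad_has_derivative continuous_on_moll_hess])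
  show "{x. moll l u (e^2) f x ~= 0} <= cball 0 (r + e)"
  proof safe
   fix x assume *: "moll l u (e^2) f x ~= 0"
   show "x \<in> cball 0 (r + e)"
   proof (rule ccontr)
    assume x: "x ~: cball 0 (r + e)"
    have "bump y (e^2) 3 x = 0" if "y \<in> cbox l u" for y
    proof (rule bump_outside)
     have "norm x <= norm y + norm (x - y)" by (metis norm_triangle_sub add.commute)
     thus "x ~: ball y e" using x that r by (auto simp: dist_norm norm_minus_commute)
    qed (use assms in auto)
    hence "moll l u (e^2) f x = integral (cbox l u) (%y. 0)"
     unfolding moll_def by (intro Henstock_Kurzweil_Integration.integral_cong) auto
    thus False using * by simp
   qed
  qed
 qed
qed

lemma moll_eq:
 assumes "0 <= e" "cball x e <= cbox l u"
 shows "moll l u (e^2) f x = (LINT v|lborel. f (x + v) * bump 0 (e^2) 3 v)"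
proof -
 have "moll l u (e^2) f x = integral (cbox l u) (%y. f y * bump 0 (e^2) 3 (y - x))"
  unfolding moll_def by (intro Henstock_Kurzweil_Integration.integral_cong)
   (simp add: bump_def inner_diff_left inner_diff_right algebra_simps inner_commute)
 also have "... = (LINT v|lborel. f (x + v) * bump 0 (e^2) 3 v)" by (rule integral_convolution_eq[OF f _ _ assms(2)])
   (auto intro!: continuous_intros bump_support_cball assms simp del: mem_cball)
 finally show ?thesis .
qed

text \<open>The factor multiplying \<open>f\<close> is the Laplacian of the truncated cube
  \<open>bump 0 (e^2) 3\<close>.\<close>

lemma moll_laplace_eq:
 assumes "0 <= e" "cball x e <= cbox l u"
 shows "(\<Sum>i\<in>UNIV. moll_hess l u (e^2) f i x $ i) =
  (LINT v|lborel. f (x + v) * (24 * bump 0 (e^2) 1 v * (v \<bullet> v) - 6 * CARD('n) * bump 0 (e^2) 2 v))"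
proof -
 let ?k = "%v::real^'n. 24 * bump 0 (e^2) 1 v * (v \<bullet> v) - 6 * CARD('n) * bump 0 (e^2) 2 v"
 have b: "bump y (e^2) m x = bump 0 (e^2) m (y - x)" for y m
  by (simp add: bump_def inner_diff_left inner_diff_right algebra_simps inner_commute)
 have "(\<Sum>i\<in>UNIV. moll_hess l u (e^2) f i x $ i) = integral (cbox l u) (%y. \<Sum>i\<in>UNIV. f y * bump_hess y (e^2) 3 i x $ i)"
  unfolding moll_hess_nth
  by (intro Henstock_Kurzweil_Integration.integral_sum[symmetric] integrable_continuous continuous_intros cont_on_\<phi>) simp
 also have "... = integral (cbox l u) (%y. f y * ?k (y - x))"
 proof (intro Henstock_Kurzweil_Integration.integral_cong)
  fix y
  have "(\<Sum>i\<in>UNIV. bump_hess y (e^2) 3 i x $ i) = (\<Sum>i\<in>UNIV. 24 * bump 0 (e^2) 1 (y - x) * ((y - x) $ i * (y - x) $ i)) - (\<Sum>i\<in>(UNIV::'n set). 6 * bump 0 (e^2) 2 (y - x))"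
   unfolding sum_subtractf[symmetric] by (intro sum.cong) (auto simp: bump_hess_def b axis_def algebra_simps)
  also have "... = ?k (y - x)" by (simp add: inner_vec_def sum_distrib_left)
  finally show "(\<Sum>i\<in>UNIV. f y * bump_hess y (e^2) 3 i x $ i) = f y * ?k (y - x)"
   by (simp add: sum_distrib_left[symmetric])
 qed
 also have "... = (LINT v|lborel. f (x + v) * ?k v)" by (rule integral_convolution_eq[OF f _ _ assms(2)])
   (auto intro!: continuous_intros simp: bump_support_cball assms simp del: mem_cball)
 finally show ?thesis .
qed

end

text \<open>The kernel is even, so its first moments vanish and affine functions are reproduced up
  to the mass of the kernel. A supporting plane can thus be subtracted before smoothing without
  changing second derivatives.\<close>

lemma moll_affine:
 fixes p :: "real^'n"
 assumes "0 <= e" and W: "open W" "!!x. x \<in> W ==> cball x e <= cbox l u" and x: "x \<in> W"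
 shows "moll_grad l u (e^2) (%y. A + p \<bullet> y) x = (LINT v|lborel. bump 0 (e^2) 3 (v::real^'n)) *\<^sub>R p"
  and "moll_hess l u (e^2) (%y. A + p \<bullet> y) i x = 0"
proof -
 let ?f = "%y. A + p \<bullet> y" and ?Z = "LINT v|lborel. bump 0 (e^2) 3 (v::real^'n)"
 have c: "continuous_on UNIV ?f" by (intro continuous_intros)
 have m: "moll l u (e^2) ?f x = ?Z * ?f x" if "x \<in> W" for x
 proof -
  have i: "integrable lborel (bump 0 (e^2) 3 :: real^'n => real)"
   "integrable lborel (%v. (p \<bullet> v) * bump 0 (e^2) 3 v)"
   by (rule integrable_continuous_support[of _ 0 e], (intro continuous_intros; fail),
     simp add: bump_support_cball assms(1) del: mem_cball)+
  have "moll l u (e^2) ?f x = (LINT v|lborel. ?f x * bump 0 (e^2) 3 v + (p \<bullet> v) * bump 0 (e^2) 3 v)"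
   unfolding moll_eq[OF c assms(1) W(2)[OF that]] by (simp add: inner_add_right algebra_simps)
  also have "... = ?Z * ?f x" using i by (simp add: bump_odd_moment)
  finally show ?thesis .
 qed
 have g: "moll_grad l u (e^2) ?f x = ?Z *\<^sub>R p" if "x \<in> W" for x
 proof -
  have "((%x. ?Z * ?f x) has_derivative (%h. h \<bullet> (?Z *\<^sub>R p))) (at x)"
   by (auto intro!: derivative_eq_intros simp: inner_commute)
  hence "(moll l u (e^2) ?f has_derivative (%h. h \<bullet> (?Z *\<^sub>R p))) (at x)"
   by (rule has_derivative_transform_within_open[OF _ W(1) that]) (simp add: m)
  from fun_cong[OF has_derivative_unique[OF this moll_has_derivative[OF c]]]
  show ?thesis by (metis vector_eq_ldot)
 qed
 show "moll_grad l u (e^2) ?f x = ?Z *\<^sub>R p" using g x .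
 have "((%x. moll_grad l u (e^2) ?f x $ i) has_derivative (%h. h \<bullet> 0)) (at x)"
  by (rule has_derivative_transform_within_open[OF _ W(1) x, of "%x. (?Z *\<^sub>R p) $ i"]) (auto simp: g)
 from fun_cong[OF has_derivative_unique[OF this moll_grad_has_derivative[OF c]]]
 show "moll_hess l u (e^2) ?f i x = 0" by (metis vector_eq_ldot)
qed

text \<open>With \<open>Z = (e^2 - |v|^2)^3\<close> the right-hand side is the integral of \<open>c\<close> against the Laplacian of \<open>Z\<close>, and
\<open>W = 6 (e^2 - |v|^2)^2\<close> satisfies \<open>DZ = - W v\<close>. The inequality is the derivative at \<open>t = 1\<close> of the integral
of \<open>c\<close> against the rescaled weight \<open>W (v / t)\<close>, estimated by \<open>c (t v) <= t c v\<close>; no derivative of \<open>c\<close> occurs.\<close>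

lemma radially_convex_laplace_bump:
 fixes c :: "real^'n => real"
 assumes c: "continuous_on UNIV c" and rad: "!!t v. 0 <= t ==> t <= 1 ==> c (t *\<^sub>R v) <= t * c v"
  and e: "0 <= e"
 shows "(LINT v|lborel. c v * (6 * bump 0 (e^2) 2 v)) <=
  (LINT v|lborel. c v * (24 * bump 0 (e^2) 1 v * (v \<bullet> v) - 6 * CARD('n) * bump 0 (e^2) 2 v))"
proof -
 let ?d = "CARD('n)"
 define b where "b k v = bump 0 (e^2) k (v::real^'n)" for k v
 have bc: "continuous_on S (b k)" for k S unfolding b_def by (intro continuous_intros)
 have b0: "b k v = 0" if "0 < k" "v ~: cball 0 e" for k v
  using bump_support_cball[OF that(1) e that(2)] by (simp add: b_def)
 have \<gamma>': "continuous_on S c" for S using c continuous_on_subset by blast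
 obtain l u where box: "cball (0::real^'n) e <= cbox l u"
  using bounded_subset_cbox_symmetric[OF bounded_cball, of 0 e] by metis
 have LI: "integral (cbox l u) (%v. c v * k v) = (LINT v|lborel. c v * k v)"
  if "continuous_on UNIV k" "!!v. v ~: cball 0 e ==> k v = 0" for k
  using integral_convolution_eq[where x=0 and e=e and l=l and u=u, OF c that] box by simp
 \<comment> \<open>\<open>m\<close> stands for \<open>1 / t\<close>. Of the factor
   \<open>m ^ (?d + 1)\<close>, all powers but one are the Jacobian, and the remaining one matches
   the bound \<open>c (v / m) <= c v / m\<close>.\<close>
 define K where "K m = integral (cbox l u) (%v. c v * (m ^ (?d + 1) * b 2 (m *\<^sub>R v)))" for m :: real
 have "K m <= K 1" if "1 <= m" for m
 proof -
  have 0: "b 2 (m *\<^sub>R v) = 0" if v: "v ~: cball 0 e" for v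
  proof (rule b0)
   have "norm v <= norm (m *\<^sub>R v)" using \<open>1 <= m\<close> by (simp add: mult_le_cancel_right1)
   thus "m *\<^sub>R v ~: cball 0 e" using v by auto
  qed simp
  have c1: "continuous_on UNIV (%v. c v * (m ^ (?d + 1) * b 2 (m *\<^sub>R v)))"
   by (intro continuous_intros c continuous_on_compose2[OF bc[of UNIV]]) auto
  have "K m = (LINT v|lborel. c v * (m ^ (?d + 1) * b 2 (m *\<^sub>R v)))"
   unfolding K_def by (rule LI) (auto intro!: continuous_intros continuous_on_compose2[OF bc[of UNIV]] simp: 0 simp del: mem_cball)
  also have "... = abs (1 / m) ^ DIM(real^'n) * (LINT v|lborel. c ((1 / m) *\<^sub>R v) * (m ^ (?d + 1) * b 2 (m *\<^sub>R ((1 / m) *\<^sub>R v))))"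
   using that lborel_integral_affine[OF borel_measurable_continuous_onI[OF c1], of "1 / m" 0] by simp
  also have "... = (LINT v|lborel. m * c ((1 / m) *\<^sub>R v) * b 2 v)"
   using that unfolding integral_mult_right_zero[symmetric]
   by (intro Bochner_Integration.integral_cong) (auto simp: field_simps)
  also have "... <= (LINT v|lborel. c v * b 2 v)"
  proof (rule integral_mono)
   show "integrable lborel (%v. m * c ((1 / m) *\<^sub>R v) * b 2 v)" "integrable lborel (%v. c v * b 2 v)"
    by (rule integrable_continuous_support[of _ 0 e],
      (intro continuous_intros bc c continuous_on_compose2[OF c]; simp; fail), simp add: b0 del: mem_cball)+
   fix v
   have "m * c ((1 / m) *\<^sub>R v) <= m * (1 / m * c v)" using that by (intro mult_left_mono rad) auto
   thus "m * c ((1 / m) *\<^sub>R v) * b 2 v <= c v * b 2 v"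
    using that by (intro mult_right_mono) (auto simp: b_def bump_nonneg)
  qed
  also have "... = K 1" unfolding K_def by (subst LI) (auto intro!: bc simp: b0 simp del: mem_cball)
  finally show ?thesis .
 qed note K1 = this
 have "(K has_field_derivative integral (cbox l u) (%v. c v * (real (?d + 1) * 1 ^ ?d * b 2 (1 *\<^sub>R v) - 1 ^ (?d + 1) * (4 * 1 * (v \<bullet> v) * b 1 (1 *\<^sub>R v))))) (at 1 within UNIV)"
  unfolding K_def [abs_def]
 proof (rule leibniz_rule_field_derivative)
  fix m :: real and v :: "real^'n"
  have "((%m. e^2 - m^2 * (v \<bullet> v)) has_real_derivative - 2 * m * (v \<bullet> v)) (at m)"
   by (auto intro!: derivative_eq_intros)
  from DERIV_chain2[OF max0_power_has_derivative[of 2] this]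
  have "((%m. b 2 (m *\<^sub>R v)) has_real_derivative - (4 * m * (v \<bullet> v) * b 1 (m *\<^sub>R v))) (at m)"
   by (simp add: b_def bump_def power2_eq_square mult_ac)
  note [derivative_intros] = this
  have "m * m ^ (?d - Suc 0) = m ^ ?d" by (metis One_nat_def mult.commute power_minus_mult zero_less_card_finite)
  then    show "((%m. c v * (m ^ (?d + 1) * b 2 (m *\<^sub>R v))) has_field_derivative
   c v * (real (?d + 1) * m ^ ?d * b 2 (m *\<^sub>R v) - m ^ (?d + 1) * (4 * m * (v \<bullet> v) * b 1 (m *\<^sub>R v)))) (at m within UNIV)"
   by (auto intro!: derivative_eq_intros simp: algebra_simps)
 next
  show "(%v. c v * (m ^ (?d + 1) * b 2 (m *\<^sub>R v))) integrable_on cbox l u" for m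
   by (intro integrable_continuous continuous_intros \<gamma>' continuous_on_compose2[OF bc[of UNIV]]) auto
  show "continuous_on (UNIV \<times> cbox l u) (%(m, v). c v * (real (?d + 1) * m ^ ?d * b 2 (m *\<^sub>R v) - m ^ (?d + 1) * (4 * m * (v \<bullet> v) * b 1 (m *\<^sub>R v))))"
   unfolding case_prod_beta'
   by (intro continuous_intros continuous_on_compose2[OF c] continuous_on_compose2[OF bc[of UNIV]]) auto
 qed auto
 hence K': "(K has_real_derivative integral (cbox l u) (%v. c v * (real (?d + 1) * b 2 v - 4 * (v \<bullet> v) * b 1 v))) (at 1)" by simp
 \<comment> \<open>To the right of 1 the function \<open>K\<close> does not exceed its value at 1,
   so its derivative there cannot be positive.\<close>
 have "integral (cbox l u) (%v. c v * (real (?d + 1) * b 2 v - 4 * (v \<bullet> v) * b 1 v)) <= 0"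
 proof (rule ccontr)
  assume "~ ?thesis"
  then obtain d where d: "d > 0" "ALL h>0. h < d --> K 1 < K (1 + h)" using DERIV_pos_inc_right[OF K'] by force
  thus False using d(2)[THEN spec, of "d / 2"] K1[of "1 + d / 2"] d(1) by linarith
 qed
 also have "integral (cbox l u) (%v. c v * (real (?d + 1) * b 2 v - 4 * (v \<bullet> v) * b 1 v))
  = (LINT v|lborel. c v * (real (?d + 1) * b 2 v - 4 * (v \<bullet> v) * b 1 v))"
  by (rule LI) (auto intro!: continuous_intros bc simp: b0 simp del: mem_cball)
 finally have *: "(LINT v|lborel. c v * (real (?d + 1) * b 2 v - 4 * (v \<bullet> v) * b 1 v)) <= 0" .
 have int: "integrable lborel (%v. c v * k v)" if "continuous_on UNIV k" "!!v. v ~: cball 0 e ==> k v = 0" for k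
  by (rule integrable_continuous_support[of _ 0 e]) (use that in \<open>auto intro!: continuous_intros c that(1) simp del: mem_cball\<close>)
 have "(LINT v|lborel. c v * (6 * b 2 v)) - (LINT v|lborel. c v * (24 * b 1 v * (v \<bullet> v) - 6 * CARD('n) * b 2 v))
  = (LINT v|lborel. c v * (6 * b 2 v) - c v * (24 * b 1 v * (v \<bullet> v) - 6 * CARD('n) * b 2 v))"
  by (intro Bochner_Integration.integral_diff[symmetric] int continuous_intros bc) (auto simp: b0 simp del: mem_cball)
 also have "... = 6 * (LINT v|lborel. c v * (real (?d + 1) * b 2 v - 4 * (v \<bullet> v) * b 1 v))"
  unfolding integral_mult_right_zero[symmetric]
  by (intro Bochner_Integration.integral_cong) (auto simp: algebra_simps)
 finally show ?thesis using * by (simp add: b_def)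
qed

section \<open>Convexity, Hessians and elliptic traces\<close>

lemma convex_on_directional_tangent:
 fixes u :: "'a::real_inner => real"
 assumes u: "!!x. (u has_derivative (%h. h \<bullet> G x)) (at x)"
  and W: "open W" "convex_on W u" and x: "x \<in> W" "y \<in> W"
 shows "(y - x) \<bullet> G x <= u y - u x"
proof -
 define f where "f t = u (x + t *\<^sub>R (y - x))" for t
 have W': "convex W" using W(2) by (simp add: convex_on_def)
 define A where "A = {t. x + t *\<^sub>R (y - x) \<in> W}"
 have A: "convex A" unfolding A_def
 proof (rule convexI, safe)
  fix s t p q :: real assume *: "x + s *\<^sub>R (y - x) \<in> W" "x + t *\<^sub>R (y - x) \<in> W" "0 <= p" "0 <= q" "p + q = 1"
  have "p *\<^sub>R (x + s *\<^sub>R (y - x)) + q *\<^sub>R (x + t *\<^sub>R (y - x)) = (p + q) *\<^sub>R x + (p *\<^sub>R s + q *\<^sub>R t) *\<^sub>R (y - x)"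
   by (simp add: algebra_simps)
  thus "x + (p *\<^sub>R s + q *\<^sub>R t) *\<^sub>R (y - x) \<in> W" using convexD[OF W' *] * by simp
 qed
 have fc: "convex_on A f"
 proof (rule convex_onI[OF _ A])
  fix r s t :: real assume *: "0 < r" "r < 1" "s \<in> A" "t \<in> A"
  have "x + ((1 - r) *\<^sub>R s + r *\<^sub>R t) *\<^sub>R (y - x) = (1 - r) *\<^sub>R (x + s *\<^sub>R (y - x)) + r *\<^sub>R (x + t *\<^sub>R (y - x))"
   by (simp add: algebra_simps)
  thus "f ((1 - r) *\<^sub>R s + r *\<^sub>R t) <= (1 - r) * f s + r * f t"
   unfolding f_def using convex_onD[OF W(2), of r "x + s *\<^sub>R (y - x)" "x + t *\<^sub>R (y - x)"] * by (simp add: A_def)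
 qed
 have oA: "open A"
  unfolding A_def by (rule continuous_open_preimage[of UNIV, simplified vimage_def, simplified]) (auto intro!: continuous_intros W)
 have "(f has_derivative (%h. (h *\<^sub>R (y - x)) \<bullet> G x)) (at 0)" unfolding f_def
  by (rule has_derivative_compose[where g=u and f="%t. x + t *\<^sub>R (y - x)"])
   (auto intro!: derivative_eq_intros u)
 hence "(f has_real_derivative (y - x) \<bullet> G x) (at 0)"
  by (simp add: has_field_derivative_def mult.commute[of _ "(y - x) \<bullet> G x"] mult_commute_abs)
 hence "(f has_real_derivative (y - x) \<bullet> G x) (at 0 within A)" by (rule has_field_derivative_at_within)
 from convex_on_imp_above_tangent[OF fc _ _ _ this, of 1] oA A x
 show ?thesis by (auto simp: f_def A_def convex_connected interior_open)
qed

text \<open>Convexity enters only through the tangent inequality, used at both endpoints of a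
  segment; it makes the slope in the direction \<open>v\<close> monotone along the line.\<close>

lemma convex_on_hessian_nonneg:
 fixes u :: "real^'n => real"
 assumes u: "!!x. (u has_derivative (%h. h \<bullet> G x)) (at x)"
  and G: "!!i x. ((%x. G x $ i) has_derivative (%h. h \<bullet> H i x)) (at x)"
  and W: "open W" "convex_on W u" and x: "x \<in> W"
 shows "0 <= (\<Sum>i\<in>UNIV. \<Sum>j\<in>UNIV. v $ i * v $ j * H j x $ i)"
proof -
 define g where "g t = v \<bullet> G (x + t *\<^sub>R v)" for t
 have "((%t. G (x + t *\<^sub>R v) $ j) has_derivative (%h. (h *\<^sub>R v) \<bullet> H j x)) (at 0)" for j
  by (rule has_derivative_compose[where g="%y. G y $ j" and f="%t. x + t *\<^sub>R v"])
   (auto intro!: derivative_eq_intros G)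
 hence "(g has_derivative (%h. \<Sum>j\<in>UNIV. v $ j * ((h *\<^sub>R v) \<bullet> H j x))) (at 0)"
  unfolding g_def inner_vec_def[of v] inner_real_def by (intro has_derivative_sum has_derivative_mult_right)
 moreover have "(%h. \<Sum>j\<in>UNIV. v $ j * ((h *\<^sub>R v) \<bullet> H j x)) = (*) (\<Sum>j\<in>UNIV. v $ j * (v \<bullet> H j x))"
  by (auto simp: sum_distrib_left sum_distrib_right mult_ac)
 ultimately have g': "(g has_real_derivative (\<Sum>j\<in>UNIV. v $ j * (v \<bullet> H j x))) (at 0)"
  by (simp add: has_field_derivative_def)
 have "open ((%t. x + t *\<^sub>R v) -` W)" by (rule continuous_open_vimage[OF W(1)]) (auto intro!: continuous_intros)
 moreover have "0 \<in> (%t. x + t *\<^sub>R v) -` W" using x by simp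
 ultimately obtain T where \<tau>0: "T > 0" "ALL t. dist t 0 < T --> t \<in> (%t. x + t *\<^sub>R v) -` W"
  unfolding open_dist by blast
 hence T: "T > 0" "!!t. abs t < T ==> x + t *\<^sub>R v \<in> W" by simp_all
 have mono: "g 0 <= g t" if "0 < t" "t < T" for t
 proof -
  have "x + t *\<^sub>R v \<in> W" using T(2)[of t] that by simp
  from convex_on_directional_tangent[OF u W x this] convex_on_directional_tangent[OF u W this x]
  have "t * g 0 <= t * g t" by (simp add: g_def)
  thus ?thesis using that by simp
 qed
 have "(\<Sum>j\<in>UNIV. v $ j * (v \<bullet> H j x)) >= 0"
 proof (rule ccontr)
  assume "~ ?thesis"
  then obtain d where d: "d > 0" "ALL h>0. h < d --> g (0 + h) < g 0" using DERIV_neg_dec_right[OF g'] by force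
  have "g (0 + min d T / 2) < g 0" using d T(1) by (intro d(2)[rule_format]) auto
  thus False using mono[of "min d T / 2"] d(1) T(1) by (simp add: min_def split: if_splits)
 qed
 thus ?thesis by (subst sum.swap) (simp add: inner_vec_def sum_distrib_left mult_ac)
qed

text \<open>In an eigenbasis of \<open>A\<close> the right-hand side is a sum of nonnegative values
  of the quadratic form of \<open>H\<close>, weighted by eigenvalues at least \<open>ell\<close>;
  the trace of \<open>H\<close> is the same sum with weights 1.\<close>

lemma elliptic_trace_lower_bound:
 fixes H :: "'n => real^'n"
 assumes A: "A \<in> ellipticity_class ell" and H: "!!v::real^'n. 0 <= (\<Sum>i\<in>UNIV. \<Sum>j\<in>UNIV. v $ i * v $ j * H j $ i)"
 shows "ell * (\<Sum>i\<in>UNIV. H i $ i) <= (\<Sum>i\<in>UNIV. \<Sum>j\<in>UNIV. A $ i $ j * H j $ i)"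
proof -
 obtain B and c :: "real^'n => real" where B: "finite B" "!!v. v \<in> B ==> norm v = 1" "!!v. v \<in> B ==> c v \<in> {ell..1 / ell}"
  "!!i j. A $ i $ j = (\<Sum>v\<in>B. c v * (v $ i * v $ j))"
  "!!i j. (\<Sum>v\<in>B. v $ i * v $ j) = (if i = j then 1 else 0)"
  by (rule ellipticity_class_spectral[OF A]) (rule that, (assumption | blast)+)
 have sw: "(\<Sum>i\<in>UNIV. \<Sum>j\<in>UNIV. (\<Sum>v\<in>B. k v * (v $ i * v $ j)) * H j $ i)
  = (\<Sum>v\<in>B. k v * (\<Sum>i\<in>UNIV. \<Sum>j\<in>UNIV. v $ i * v $ j * H j $ i))" for k :: "real^'n => real"
 proof -
  have "(\<Sum>i\<in>UNIV. \<Sum>j\<in>UNIV. (\<Sum>v\<in>B. k v * (v $ i * v $ j)) * H j $ i)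
   = (\<Sum>i\<in>UNIV. \<Sum>v\<in>B. \<Sum>j\<in>UNIV. k v * (v $ i * v $ j) * H j $ i)"
   unfolding sum_distrib_right by (intro sum.cong[OF refl] sum.swap)
  also have "... = (\<Sum>v\<in>B. \<Sum>i\<in>UNIV. \<Sum>j\<in>UNIV. k v * (v $ i * v $ j) * H j $ i)" by (rule sum.swap)
  finally show ?thesis by (simp add: sum_distrib_left mult_ac)
 qed
 have "(\<Sum>i\<in>UNIV. H i $ i) = (\<Sum>i\<in>UNIV. \<Sum>j\<in>UNIV. (if i = j then 1 else 0) * H j $ i)"
  by (intro sum.cong[OF refl]) (simp add: if_distrib[of "%x. x * _"] cong: if_cong)
 also have "... = (\<Sum>v\<in>B. 1 * (\<Sum>i\<in>UNIV. \<Sum>j\<in>UNIV. v $ i * v $ j * H j $ i))"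
  unfolding sw[symmetric] by (simp add: B(5))
 finally have "ell * (\<Sum>i\<in>UNIV. H i $ i) = (\<Sum>v\<in>B. ell * (\<Sum>i\<in>UNIV. \<Sum>j\<in>UNIV. v $ i * v $ j * H j $ i))"
  by (simp add: sum_distrib_left)
 also have "... <= (\<Sum>v\<in>B. c v * (\<Sum>i\<in>UNIV. \<Sum>j\<in>UNIV. v $ i * v $ j * H j $ i))"
  using B(3) by (intro sum_mono mult_right_mono H) auto
 also have "... = (\<Sum>i\<in>UNIV. \<Sum>j\<in>UNIV. A $ i $ j * H j $ i)" unfolding B(4) sw by simp
 finally show ?thesis .
qed

text \<open>The factor 4 comes from the volume of slopes in
  \<open>convex_function_with_kinks\<close>; the base of the outer power is the ratio between a
  kink, normalized by the size of the kernel, and the value \<open>F i * h\<close> that it has to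
  produce.\<close>

definition abp_const :: "nat => real" where
 "abp_const d = 4 * (512 * sqrt d * 8 ^ d) ^ d"

text \<open>The function \<open>U\<close> replaces the solution of a Monge--Ampere equation: its gradient is bounded by the
\<open>L\<^sub>d\<close>-norm of the step function with value \<open>F i\<close> on a cell of side \<open>h\<close> around \<open>y i\<close>, while its elliptic
trace dominates that step function.\<close>

theorem ABP_test_function:
 fixes y :: "'i => real^'n" and F :: "'i => real"
 assumes I: "finite I" "I ~= {}" and F: "!!i. i \<in> I ==> 0 < F i" and h: "0 < h" and \<rho>: "0 <= \<rho>"
 obtains U s where "C2_compact_support U" "0 <= s"
  "s ^ CARD('n) = abp_const CARD('n) * (\<Sum>i\<in>I. (F i * h) ^ CARD('n))"
  "!!x x'. x \<in> cball z \<rho> ==> x' \<in> cball z \<rho> ==> \<bar>U x - U x'\<bar> <= s * norm (x - x')"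
  "!!a b x ell. x \<in> cball z \<rho> ==> 0 < ell ==> a x \<in> ellipticity_class ell ==>
   - norm (b x) * s <= diffusion_operator a b U x"
  "!!a b x ell i. x \<in> cball z \<rho> ==> 0 < ell ==> a x \<in> ellipticity_class ell ==> i \<in> I ==>
   norm (x - y i) <= sqrt CARD('n) * h ==>
   ell * F i - norm (b x) * s <= diffusion_operator a b U x"
proof -
 let ?d = "CARD('n)"
 have d: "?d > 0" by simp
 define l where "l = unit_ball_vol (real ?d)"
 \<comment> \<open>The smoothing radius is 16 times the distance \<open>sqrt d * h\<close> allowed
   between a point of the cell and \<open>y i\<close>, so that the kink at \<open>y i\<close> is
   seen from the whole cell.\<close>
 define e where "e = 16 * sqrt ?d * h"
 define N where "N = l * e ^ (?d + 6)"
 define L where "L = 512 * sqrt ?d * 8 ^ ?d"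
 define r where "r i = L * (F i * h) / N" for i
 have l: "l > 0" by (simp add: l_def)
 have e: "e > 0" using h d by (simp add: e_def)
 have N: "N > 0" using l e by (simp add: N_def)
 have L: "L > 0" using d by (simp add: L_def)
 have r: "r i > 0" if "i \<in> I" for i using F[OF that] h N L by (simp add: r_def)
 \<comment> \<open>Small enough that the transport error stays below a fixed fraction of every
   kink.\<close>
 define t where "t = Min (r ` I) * (e / 32)"
 have t: "t > 0" using I r e by (simp add: t_def)
 have tr: "t <= r i * (e / 32)" if "i \<in> I" for i unfolding t_def using I that e by (intro mult_right_mono) auto
 obtain g n where n: "0 < n" "n ^ ?d = 4 * (\<Sum>i\<in>I. r i ^ ?d)"
  and supp: "!!x. EX p. norm p <= n & (ALL z. g x + p \<bullet> (z - x) <= g z)"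
  and kink: "!!i. i \<in> I ==> EX p q. r i <= norm (p - q) &
    (ALL x. g (y i) + p \<bullet> (x - y i) - t <= g x) & (ALL x. g (y i) + q \<bullet> (x - y i) - t <= g x)"
  by (rule convex_function_with_kinks[where y=y and r=r, OF I r t]) (assumption, rule that, assumption, simp only: DIM_cart DIM_real mult_1_right, assumption+)
 have \<phi>_diff: "g x - g x' <= n * norm (x - x')" for x x'
 proof -
  obtain p where p: "norm p <= n" "g x + p \<bullet> (x' - x) <= g x'" using supp[of x] by blast
  have "- (p \<bullet> (x' - x)) <= norm p * norm (x - x')"
   using Cauchy_Schwarz_ineq2[of p "x' - x"] by (simp add: norm_minus_commute)
  also have "... <= n * norm (x - x')" using p(1) by (intro mult_right_mono) auto
  finally show ?thesis using p(2) by simp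
 qed
 have \<phi>_lip: "abs (g x - g x') <= n * norm (x - x')" for x x'
  using \<phi>_diff[of x x'] \<phi>_diff[of x' x] by (simp add: norm_minus_commute abs_le_iff)
 have "n-lipschitz_on UNIV g" using \<phi>_lip n by (intro lipschitz_onI) (auto simp: dist_norm)
 hence \<phi>c: "continuous_on UNIV g" by (rule lipschitz_on_continuous_on)
 have \<phi>c': "continuous_on S (%v. g (x + v))" for S x
  by (rule continuous_on_compose2[OF \<phi>c]) (auto intro!: continuous_intros)
 have \<phi>_convex: "g ((1 - w) *\<^sub>R x + w *\<^sub>R x') <= (1 - w) * g x + w * g x'" if "0 <= w" "w <= 1" for x x' w
 proof -
  let ?m = "(1 - w) *\<^sub>R x + w *\<^sub>R x'"
  obtain p where p: "!!z. g ?m + p \<bullet> (z - ?m) <= g z" using supp[of ?m] by blast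
  have "(1 - w) * (g ?m + p \<bullet> (x - ?m)) + w * (g ?m + p \<bullet> (x' - ?m)) <= (1 - w) * g x + w * g x'"
   using that by (intro add_mono mult_left_mono p) auto
  also have "(1 - w) * (g ?m + p \<bullet> (x - ?m)) + w * (g ?m + p \<bullet> (x' - ?m)) = g ?m + p \<bullet> ((1 - w) *\<^sub>R (x - ?m) + w *\<^sub>R (x' - ?m))"
   by (simp add: inner_add_right algebra_simps)
  also have "(1 - w) *\<^sub>R (x - ?m) + w *\<^sub>R (x' - ?m) = 0" by (simp add: algebra_simps)
  finally show ?thesis by simp
 qed
 \<comment> \<open>The box contains the \<open>e\<close>-neighbourhood of the open set
   \<open>W\<close> introduced next, and \<open>W\<close> contains the given closed ball; on
   \<open>W\<close> the smoothing is a convolution.\<close>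
 obtain c0 where box: "cball z (\<rho> + 1 + e) <= cbox (- c0) c0"
  using bounded_subset_cbox_symmetric[OF bounded_cball] by metis
 define W where "W = ball z (\<rho> + 1)"
 have W: "open W" "convex W" by (auto simp: W_def)
 have Wbox: "cball x e <= cbox (- c0) c0" if "x \<in> W" for x
 proof -
  have "cball x e <= cball z (\<rho> + 1 + e)" using that by (auto simp: W_def cball_subset_cball_iff dist_commute)
  thus ?thesis using box by blast
 qed
 have CW: "cball z \<rho> <= W" by (auto simp: W_def)
 define U where "U = moll (- c0) c0 (e^2) g"
 define G where "G = moll_grad (- c0) c0 (e^2) g"
 define H where "H = moll_hess (- c0) c0 (e^2) g"
 have UG: "(U has_derivative (%h. h \<bullet> G x)) (at x)" for x
  unfolding U_def G_def by (rule moll_has_derivative[OF \<phi>c])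
 have GH: "((%x. G x $ i) has_derivative (%h. h \<bullet> H i x)) (at x)" for i x
  unfolding G_def H_def by (rule moll_grad_has_derivative[OF \<phi>c])
 let ?b = "%k v::real^'n. bump 0 (e^2) k v"
 have b0: "?b k v = 0" if "0 < k" "v ~: cball 0 e" for k v using bump_support_cball[OF that(1) _ that(2)] e by simp
 have bint: "integrable lborel (%v. f v * ?b k v)" if "0 < k" "continuous_on UNIV f" for k f
  by (rule integrable_continuous_support[of _ 0 e]) (use that b0 in \<open>auto intro!: continuous_intros simp del: mem_cball\<close>)
 have Ueq: "U x = (LINT v|lborel. g (x + v) * ?b 3 v)" if "x \<in> W" for x
  unfolding U_def using moll_eq[OF \<phi>c _ Wbox[OF that]] e by simp
 have vol: "measure lborel (cball c T) = l * T ^ ?d" "measure lborel (ball c T) = l * T ^ ?d" if "0 <= T" for c :: "real^'n" and T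
  using content_cball[OF that, of c] content_ball[OF that, of c] by (simp_all add: l_def)
 define Z where "Z = (LINT v|lborel. ?b 3 v)"
 have Z: "0 <= Z" "Z <= N"
 proof -
  show "0 <= Z" unfolding Z_def by (intro integral_nonneg_AE) (auto simp: bump_nonneg)
  have "Z <= (LINT v|lborel. indicator (cball (0::real^'n) e) v *\<^sub>R (e^2) ^ 3)" unfolding Z_def
  proof (rule integral_mono)
   show "integrable lborel (?b 3)" using bint[of 3 "%_. 1"] by simp
   show "integrable lborel (%v. indicator (cball (0::real^'n) e) v *\<^sub>R (e^2) ^ 3)"
    by (rule borel_integrable_compact) auto
   show "?b 3 v <= indicator (cball 0 e) v *\<^sub>R (e^2) ^ 3" for v
    using bump_le[of "e^2" 0 3 v] b0[of 3 v] by (cases "v \<in> cball 0 e") (auto simp del: mem_cball)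
  qed
  also have "... = N" using e vol(1)[of e 0] by (simp add: N_def power_add)
  finally show "Z <= N" .
 qed
 define s where "s = n * N"
 have s: "0 <= s" using n N by (simp add: s_def)
 have sd: "s ^ ?d = abp_const ?d * (\<Sum>i\<in>I. (F i * h) ^ ?d)"
 proof -
  have "s ^ ?d = 4 * (\<Sum>i\<in>I. (r i * N) ^ ?d)"
   by (simp add: s_def power_mult_distrib n sum_distrib_left sum_distrib_right mult_ac)
  also have "(\<Sum>i\<in>I. (r i * N) ^ ?d) = (\<Sum>i\<in>I. L ^ ?d * (F i * h) ^ ?d)"
   using N by (intro sum.cong) (auto simp: r_def power_mult_distrib)
  also have "... = L ^ ?d * (\<Sum>i\<in>I. (F i * h) ^ ?d)" by (simp only: sum_distrib_left)
  finally show ?thesis by (simp add: abp_const_def L_def)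
 qed
 have Ulip: "abs (U x - U x') <= s * norm (x - x')" if x: "x \<in> W" "x' \<in> W" for x x'
 proof -
  have "U x - U x' = (LINT v|lborel. g (x + v) * ?b 3 v - g (x' + v) * ?b 3 v)" unfolding Ueq[OF x(1)] Ueq[OF x(2)]
   by (intro Bochner_Integration.integral_diff[symmetric] bint \<phi>c') auto
  also have "abs (...) <= (LINT v|lborel. n * norm (x - x') * ?b 3 v)"
  proof (rule integral_abs_bound[THEN order_trans], rule integral_mono)
   show "integrable lborel (%v. abs (g (x + v) * ?b 3 v - g (x' + v) * ?b 3 v))"
    by (intro integrable_abs Bochner_Integration.integrable_diff bint \<phi>c') auto
   show "integrable lborel (%v. n * norm (x - x') * ?b 3 v)" by (intro bint) auto
   fix v
   have "abs (g (x + v) * ?b 3 v - g (x' + v) * ?b 3 v) = abs (g (x + v) - g (x' + v)) * ?b 3 v"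
    by (simp add: left_diff_distrib[symmetric] abs_mult bump_nonneg)
   also have "... <= n * norm (x - x') * ?b 3 v"
    using \<phi>_lip[of "x + v" "x' + v"] by (intro mult_right_mono) (auto simp: bump_nonneg)
   finally show "abs (g (x + v) * ?b 3 v - g (x' + v) * ?b 3 v) <= n * norm (x - x') * ?b 3 v" .
  qed
  also have "... = n * norm (x - x') * Z" by (simp add: Z_def)
  also have "... <= n * norm (x - x') * N" using Z n by (intro mult_left_mono) auto
  finally show ?thesis by (simp add: s_def mult_ac)
 qed
 have Ucvx: "convex_on W U"
 proof (rule convex_onI[OF _ W(2)])
  fix w x x' assume w: "0 < w" "w < (1::real)" and x: "x \<in> W" "x' \<in> W"
  have m: "(1 - w) *\<^sub>R x + w *\<^sub>R x' \<in> W" using convexD_alt[OF W(2) x, of w] w by simp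
  have "U ((1 - w) *\<^sub>R x + w *\<^sub>R x') <= (LINT v|lborel. (1 - w) * (g (x + v) * ?b 3 v) + w * (g (x' + v) * ?b 3 v))"
   unfolding Ueq[OF m]
  proof (rule integral_mono)
   show "integrable lborel (%v. g ((1 - w) *\<^sub>R x + w *\<^sub>R x' + v) * ?b 3 v)" by (intro bint \<phi>c') auto
   show "integrable lborel (%v. (1 - w) * (g (x + v) * ?b 3 v) + w * (g (x' + v) * ?b 3 v))"
    by (intro Bochner_Integration.integrable_add integrable_mult_right bint \<phi>c') auto
   fix v
   have "(1 - w) *\<^sub>R x + w *\<^sub>R x' + v = (1 - w) *\<^sub>R (x + v) + w *\<^sub>R (x' + v)" by (simp add: algebra_simps)
   hence "g ((1 - w) *\<^sub>R x + w *\<^sub>R x' + v) * ?b 3 v <= ((1 - w) * g (x + v) + w * g (x' + v)) * ?b 3 v"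
    using w by (intro mult_right_mono) (auto intro!: \<phi>_convex simp: bump_nonneg)
   thus "g ((1 - w) *\<^sub>R x + w *\<^sub>R x' + v) * ?b 3 v <= (1 - w) * (g (x + v) * ?b 3 v) + w * (g (x' + v) * ?b 3 v)"
    by (simp add: algebra_simps)
  qed
  also have "... = (1 - w) * U x + w * U x'" unfolding Ueq[OF x(1)] Ueq[OF x(2)]
   by (subst Bochner_Integration.integral_add) (auto intro!: integrable_mult_right bint \<phi>c')
  finally show "U ((1 - w) *\<^sub>R x + w *\<^sub>R x') <= (1 - w) * U x + w * U x'" .
 qed
 have Gnorm: "norm (G x) <= s" if x: "x \<in> W" for x
 proof (cases "G x = 0")
  case False
  obtain T where T: "T > 0" "ball x T <= W" using W(1) x open_contains_ball by blast
  define u where "u = T / (2 * norm (G x))"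
  have u: "u > 0" using False T by (simp add: u_def)
  have x': "x + u *\<^sub>R G x \<in> W" using T False by (intro subsetD[OF T(2)]) (simp add: dist_norm u_def)
  have "u * (norm (G x))^2 = (x + u *\<^sub>R G x - x) \<bullet> G x" by (simp add: dot_square_norm)
  also have "... <= U (x + u *\<^sub>R G x) - U x" by (rule convex_on_directional_tangent[OF UG W(1) Ucvx x x'])
  also have "... <= s * (u * norm (G x))" using Ulip[OF x' x] u by simp
  finally have "u * norm (G x) * norm (G x) <= u * norm (G x) * s" by (simp add: power2_eq_square mult_ac)
  thus ?thesis using u False by (simp add: mult_le_cancel_left_pos)
 qed (use s in simp)
 let ?k = "%v::real^'n. 24 * ?b 1 v * (v \<bullet> v) - 6 * ?d * ?b 2 v"
 have kint: "integrable lborel (%v. f v * ?k v)" if "continuous_on UNIV f" for f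
  by (rule integrable_continuous_support[of _ 0 e]) (use that b0 in \<open>auto intro!: continuous_intros simp del: mem_cball\<close>)
 \<comment> \<open>Subtract the supporting plane, whose smoothing has zero Laplacian; the remainder
   is radially convex about \<open>x\<close> and vanishes there.\<close>
 have lap: "(LINT v|lborel. (g (x + v) - g x - p \<bullet> v) * (6 * ?b 2 v)) <= (\<Sum>i\<in>UNIV. H i x $ i)"
  if x: "x \<in> W" and p: "!!z. g x + p \<bullet> (z - x) <= g z" for x p
 proof -
  let ?A = "%y. (g x - p \<bullet> x) + p \<bullet> y"
  let ?B = "%v. g (x + v) - g x - p \<bullet> v"
  have e0: "0 <= e" using e by simp
  have Ac: "continuous_on UNIV ?A" by (intro continuous_intros)
  have "(LINT v|lborel. ?A (x + v) * ?k v) = (\<Sum>i\<in>UNIV. moll_hess (- c0) c0 (e^2) ?A i x $ i)"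
   by (rule moll_laplace_eq[OF Ac e0 Wbox[OF x], symmetric])
  also have "... = 0" using moll_affine(2)[OF e0 W(1) Wbox x] by simp
  finally have A0: "(LINT v|lborel. ?A (x + v) * ?k v) = 0" .
  have "(LINT v|lborel. ?B v * (6 * ?b 2 v)) <= (LINT v|lborel. ?B v * ?k v)"
  proof (rule radially_convex_laplace_bump[OF _ _ e0])
   show "continuous_on UNIV ?B" by (intro continuous_intros \<phi>c')
   fix t :: real and v assume t: "0 <= t" "t <= 1"
   have "(1 - t) *\<^sub>R x + t *\<^sub>R (x + v) = x + t *\<^sub>R v" by (simp add: algebra_simps)
   thus "?B (t *\<^sub>R v) <= t * ?B v" using \<phi>_convex[OF t, of x "x + v"] by (simp add: algebra_simps)
  qed
  also have "(LINT v|lborel. ?B v * ?k v) = (LINT v|lborel. g (x + v) * ?k v - ?A (x + v) * ?k v)"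
   by (intro Bochner_Integration.integral_cong) (auto simp: inner_add_right algebra_simps)
  also have "... = (LINT v|lborel. g (x + v) * ?k v) - (LINT v|lborel. ?A (x + v) * ?k v)"
   by (intro Bochner_Integration.integral_diff kint \<phi>c' continuous_intros)
  also have "... = (\<Sum>i\<in>UNIV. H i x $ i)" unfolding A0 H_def moll_laplace_eq[OF \<phi>c e0 Wbox[OF x]] by simp
  finally show ?thesis .
 qed
 have wint: "integrable lborel (%v. (g (x + v) - g x - p \<bullet> v) * (6 * ?b 2 v))" for x p
  by (rule integrable_continuous_support[of _ 0 e]) (use b0 in \<open>auto intro!: continuous_intros \<phi>c' simp del: mem_cball\<close>)
 have lap0: "0 <= (\<Sum>i\<in>UNIV. H i x $ i)" if x: "x \<in> W" for x
 proof -
  obtain p where p: "!!z. g x + p \<bullet> (z - x) <= g z" using supp[of x] by blast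
  have "0 <= g (x + v) - g x - p \<bullet> v" for v using p[of "x + v"] by simp
  hence "0 <= (LINT v|lborel. (g (x + v) - g x - p \<bullet> v) * (6 * ?b 2 v))"
   by (intro integral_nonneg_AE AE_I2 mult_nonneg_nonneg) (simp_all add: bump_nonneg)
  thus ?thesis using lap[OF x p] by simp
 qed
 have lapF: "2 * F i <= (\<Sum>i\<in>UNIV. H i x $ i)" if x: "x \<in> W" and i: "i \<in> I" and xi: "norm (x - y i) <= sqrt ?d * h" for x i
 proof -
  obtain p0 where p0: "!!z. g x + p0 \<bullet> (z - x) <= g z" using supp[of x] by blast
  obtain p q where pq: "r i <= norm (p - q)" "!!x. g (y i) + p \<bullet> (x - y i) - t <= g x"
   "!!x. g (y i) + q \<bullet> (x - y i) - t <= g x" using kink[OF i] by blast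
  have "norm (p - q) <= norm (p - p0) + norm (q - p0)" by (metis norm_triangle_sub dist_norm dist_triangle2)
  \<comment> \<open>One of the two slopes at the kink is at least half a kink away from the
    subgradient at \<open>x\<close>.\<close>
  hence "r i / 2 <= norm (p - p0) \<or> r i / 2 <= norm (q - p0)" using pq(1) by linarith
  then obtain p' where p': "r i / 2 <= norm (p' - p0)" "!!x. g (y i) + p' \<bullet> (x - y i) - t <= g x"
   using pq by blast
  define v where "v = p' - p0"
  have v: "r i / 2 <= norm v" "norm v > 0" using p'(1) r[OF i] by (auto simp: v_def)
  let ?B = "%w. g (x + w) - g x - p0 \<bullet> w"
  \<comment> \<open>On the ball of radius \<open>e / 8\<close> about \<open>c\<close> the excess
    over the supporting plane is at least \<open>(3/8 - 1/8 - 1/16) e |v| - t\<close>: the losses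
    are the radius of that ball and the distance from \<open>x\<close> to \<open>y i\<close>. Since
    \<open>|v| >= r i / 2\<close> and \<open>t <= r i * e / 32\<close>, at least
    \<open>r i * e / 16\<close> remains.\<close>
  define c where "c = (3 / 8 * e) *\<^sub>R sgn v"
  have nc: "norm c = 3 / 8 * e" using e v by (simp add: c_def norm_sgn)
  have vc: "v \<bullet> c = norm v * (3 / 8 * e)"
   using v by (simp add: c_def sgn_div_norm dot_square_norm power2_eq_square)
  have B: "r i * (e / 16) <= ?B w" if w: "w \<in> ball c (e / 8)" for w
  proof -
   have "g (y i) + p' \<bullet> (x + w - y i) - t <= g (x + w)" by (rule p'(2))
   moreover have "g x + p0 \<bullet> (y i - x) <= g (y i)" by (rule p0)
   moreover have "v \<bullet> (x + w - y i) = p' \<bullet> (x + w - y i) - p0 \<bullet> w + p0 \<bullet> (y i - x)"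
    by (simp add: v_def inner_diff_left inner_diff_right inner_add_right)
   ultimately have 1: "v \<bullet> (x + w - y i) - t <= ?B w" by linarith
   have "abs (v \<bullet> (w - c)) <= norm v * (e / 8)"
    using w by (intro order_trans[OF Cauchy_Schwarz_ineq2] mult_left_mono) (auto simp: dist_norm norm_minus_commute)
   moreover have "abs (v \<bullet> (x - y i)) <= norm v * (e / 16)"
    using xi by (intro order_trans[OF Cauchy_Schwarz_ineq2] mult_left_mono) (auto simp: e_def)
   moreover have "v \<bullet> (x + w - y i) = v \<bullet> (w - c) + v \<bullet> (x - y i) + v \<bullet> c"
    by (simp add: inner_diff_right inner_add_right)
   moreover have "norm v * (3 / 16 * e) = norm v * (3 / 8 * e) - norm v * (e / 8) - norm v * (e / 16)"
    by (simp add: algebra_simps)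
   ultimately have "norm v * (3 / 16 * e) <= v \<bullet> (x + w - y i)" using vc by linarith
   moreover have "r i / 2 * (3 / 16 * e) <= norm v * (3 / 16 * e)" using v e by (intro mult_right_mono) auto
   ultimately show ?thesis using 1 tr[OF i] by (simp add: algebra_simps)
  qed
  have b2: "e ^ 4 <= 6 * ?b 2 w" if w: "w \<in> ball c (e / 8)" for w
  proof -
   have "norm w <= norm c + norm (w - c)" by (metis norm_triangle_sub)
   also have "... <= e / 2" using w nc by (simp add: dist_norm norm_minus_commute)
   finally have "(norm w)^2 <= (e / 2)^2" by (intro power_mono) auto
   hence "w \<bullet> w <= e^2 / 4" by (simp add: dot_square_norm power_divide)
   hence "3 / 4 * e^2 <= max 0 (e^2 - (w - 0) \<bullet> (w - 0))" by (intro max.coboundedI2) simp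
   hence "(3 / 4 * e^2) ^ 2 <= ?b 2 w" unfolding bump_def by (intro power_mono) auto
   moreover have "(3 / 4 * e^2) ^ 2 = 9 / 16 * e ^ 4" by (simp add: power_mult_distrib power_divide flip: power_mult)
   moreover have "0 <= e ^ 4" using e by simp
   ultimately show ?thesis by linarith
  qed
  have "r i * (e / 16) * e ^ 4 * (l * (e / 8) ^ ?d) = (LINT w|lborel. indicator (ball c (e / 8)) w *\<^sub>R (r i * (e / 16) * e ^ 4))"
   using e vol(2)[of "e / 8" c] by simp
  also have "... <= (LINT w|lborel. ?B w * (6 * ?b 2 w))"
  proof (rule integral_mono[OF _ wint])
   show "integrable lborel (%w. indicator (ball c (e / 8)) w *\<^sub>R (r i * (e / 16) * e ^ 4))"
    by (intro integrable_scaleR_left integrable_real_indicator emeasure_bounded_finite) auto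
   fix w
   have "0 <= ?B w" using p0[of "x + w"] by simp
   hence "r i * (e / 16) * e ^ 4 <= ?B w * (6 * ?b 2 w)" if "w \<in> ball c (e / 8)"
    by (intro mult_mono B[OF that] b2[OF that]) (use e in auto)
   moreover have "0 <= ?B w * (6 * ?b 2 w)" using p0[of "x + w"] by (intro mult_nonneg_nonneg) (simp_all add: bump_nonneg)
   ultimately show "indicator (ball c (e / 8)) w *\<^sub>R (r i * (e / 16) * e ^ 4) <= ?B w * (6 * ?b 2 w)"
    by (cases "w \<in> ball c (e / 8)") (auto simp del: mem_ball)
  qed
  also have "... <= (\<Sum>i\<in>UNIV. H i x $ i)" by (rule lap[OF x p0])
  \<comment> \<open>This identity fixes the constant \<open>L\<close>.\<close>
  also have "r i * (e / 16) * e ^ 4 * (l * (e / 8) ^ ?d) = 2 * F i"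
  proof -
   have "r i * (e / 16) * e ^ 4 * (l * (e / 8) ^ ?d) = r i * N / (e * 16 * 8 ^ ?d)"
    using e by (simp add: N_def power_add power_divide field_simps eval_nat_numeral)
   also have "... = L * (F i * h) / (e * 16 * 8 ^ ?d)" using N by (simp add: r_def)
   also have "... = 2 * F i" using h d by (simp add: L_def e_def field_simps)
   finally show ?thesis .
  qed
  finally show ?thesis .
 qed
 have op: "1 / 2 * (ell * (\<Sum>i\<in>UNIV. H i x $ i)) - norm (b x) * s <= diffusion_operator a b U x"
  if x: "x \<in> W" and a: "a x \<in> ellipticity_class ell" for a b x ell
 proof -
  have "ell * (\<Sum>i\<in>UNIV. H i x $ i) <= (\<Sum>i\<in>UNIV. \<Sum>j\<in>UNIV. a x $ i $ j * H j x $ i)"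
   by (rule elliptic_trace_lower_bound[OF a convex_on_hessian_nonneg[OF UG GH W(1) Ucvx x]])
  moreover have "- (norm (b x) * s) <= b x \<bullet> G x"
  proof -
   have "abs (b x \<bullet> G x) <= norm (b x) * s"
    using Gnorm[OF x] by (intro order_trans[OF Cauchy_Schwarz_ineq2] mult_left_mono) auto
   thus ?thesis by simp
  qed
  ultimately show ?thesis unfolding diffusion_operator_gradient[OF UG GH] by simp
 qed
 show ?thesis
 proof (rule that[OF _ s sd])
  show "C2_compact_support U" unfolding U_def using moll_C2_compact_support[OF \<phi>c] e by simp
  show "abs (U x - U x') <= s * norm (x - x')" if "x \<in> cball z \<rho>" "x' \<in> cball z \<rho>" for x x'
   using Ulip that CW by blast
 next
  fix a :: "real^'n => real^'n^'n" and b :: "real^'n => real^'n" and x and ell :: real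
  assume x: "x \<in> cball z \<rho>" and ell: "0 < ell" and a: "a x \<in> ellipticity_class ell"
  have xW: "x \<in> W" using x CW by blast
  have "0 <= 1 / 2 * (ell * (\<Sum>i\<in>UNIV. H i x $ i))" using lap0[OF xW] ell by simp
  thus "- norm (b x) * s <= diffusion_operator a b U x" using op[of x a ell b, OF xW a] by simp
  fix i assume i: "i \<in> I" and xi: "norm (x - y i) <= sqrt ?d * h"
  have "ell * (2 * F i) <= ell * (\<Sum>i\<in>UNIV. H i x $ i)" using lapF[OF xW i xi] ell by (intro mult_left_mono) auto
  thus "ell * F i - norm (b x) * s <= diffusion_operator a b U x" using op[of x a ell b, OF xW a] by simp
 qed
qed

section \<open>Path space and the Markov property\<close>

context continuous_markov_process
begin

definition Om :: "'w set" where "Om = space (P 0)"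

sublocale Px: prob_space "P x" for x by (rule prob_space_P)

lemma space_P [simp]: "space (P x) = Om" unfolding Om_def by (rule sets_eq_imp_space_eq[OF sets_P])

lemma space_F: "0 <= t ==> space (F t) = Om" using subalgebra_F[of t 0] by (simp add: subalgebra_def)

lemma sets_F: "0 <= t ==> sets (F t) <= sets (P x)" using subalgebra_F[of t x] by (simp add: subalgebra_def)

lemma X_measurable [measurable]: "0 <= t ==> X t \<in> P x \<rightarrow>\<^sub>M borel"
 by (rule measurable_from_subalg[OF subalgebra_F adapted])

text \<open>The target of the shift operators. It may be smaller than the common domain of the
  measures \<open>P x\<close>, into which an arbitrarily chosen shift need not be
  measurable.\<close>

definition path_algebra :: "'w measure" where
 "path_algebra = sigma Om {X s -` G Int Om | s G. 0 <= s & G \<in> sets borel}"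

lemma space_path_algebra [simp]: "space path_algebra = Om" by (auto simp: path_algebra_def space_measure_of_conv)

lemma sets_path_algebra: "sets path_algebra = sigma_sets Om {X s -` G Int Om | s G. 0 <= s & G \<in> sets borel}"
 unfolding path_algebra_def by (rule sets_measure_of) auto

lemma path_algebra_subset: "sets path_algebra <= sets (P x)"
proof -
 have "sigma_sets (space (P x)) {X s -` G Int Om | s G. 0 <= s & G \<in> sets borel} <= sets (P x)"
  using measurable_sets[OF X_measurable[of _ x]] by (intro sets.sigma_sets_subset) auto
 thus ?thesis by (simp add: sets_path_algebra)
qed

lemma measurable_path_algebra: "f \<in> path_algebra \<rightarrow>\<^sub>M N ==> f \<in> P x \<rightarrow>\<^sub>M N"
 using path_algebra_subset by (auto simp: measurable_def)

lemma X_path_measurable [measurable]: "0 <= t ==> X t \<in> path_algebra \<rightarrow>\<^sub>M borel"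
 by (rule measurableI) (auto simp: sets_path_algebra intro!: sigma_sets.Basic)

text \<open>The Markov property does not determine the shift operators; any choice will do, because only
events generated by the coordinates are shifted.\<close>

definition path_shift :: "real => 'w => 'w" where
 "path_shift t w = (SOME \<omega>'. \<omega>' \<in> Om & (ALL s>=0. X s \<omega>' = X (t + s) w))"

lemma path_shift:
 assumes "0 <= t" "w \<in> Om"
 shows "path_shift t w \<in> Om" "0 <= s ==> X s (path_shift t w) = X (t + s) w"
proof -
 have "\<exists>\<omega>'. \<omega>' \<in> Om & (ALL s>=0. X s \<omega>' = X (t + s) w)"
  using shift[of t w 0] assms by auto
 hence *: "path_shift t w \<in> Om & (ALL s>=0. X s (path_shift t w) = X (t + s) w)"
  unfolding path_shift_def by (rule someI_ex)
 show "path_shift t w \<in> Om" "0 <= s ==> X s (path_shift t w) = X (t + s) w" using * by auto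
qed

lemma path_shift_measurable [measurable]:
 assumes "0 <= t"
 shows "path_shift t \<in> P x \<rightarrow>\<^sub>M path_algebra" unfolding path_algebra_def
proof (rule measurable_sigma_sets[OF refl[of "sets (sigma Om _)", THEN trans]])
 show "sets (sigma Om {X s -` G Int Om |s G. 0 <= s & G \<in> sets borel}) = sigma_sets Om {X s -` G Int Om | s G. 0 <= s & G \<in> sets borel}"
  by (rule sets_measure_of) auto
 show "path_shift t \<in> space (P x) \<rightarrow> Om" using path_shift[OF assms] by auto
 fix E assume "E \<in> {X s -` G Int Om |s G. 0 <= s & G \<in> sets borel}"
 then obtain s G where s: "0 <= s" "G \<in> sets borel" "E = X s -` G Int Om" by auto
 have "path_shift t -` E Int space (P x) = X (t + s) -` G Int space (P x)" using path_shift[OF assms] s by auto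
 thus "path_shift t -` E Int space (P x) \<in> sets (P x)"
  using measurable_sets[OF X_measurable[of "t + s" x] s(2)] s assms by simp
qed auto

lemma id_path_measurable: "(%w. w) \<in> P x \<rightarrow>\<^sub>M path_algebra"
 using path_algebra_subset[of x] sets.top[of "P x"] by (auto intro!: measurableI sets.Int)

lemma AE_start: "AE w in P x. X 0 w = x"
proof -
 have "{w \<in> space (P x). X 0 w = x} \<in> sets (P x)" by measurable
 from Px.prob_eq_1[OF this] start[of x] show ?thesis by simp
qed

lemma transition_emeasurable:
 assumes "0 <= s" "G \<in> sets borel"
 shows "(%y. emeasure (P y) {w \<in> Om. X s w \<in> G}) \<in> borel_measurable borel"
proof -
 have "emeasure (P y) {w \<in> Om. X s w \<in> G} = ennreal (measure (P y) {w \<in> space (P y). X s w \<in> G})" for y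
 proof -
  show ?thesis by (simp add: Px.emeasure_eq_measure)
 qed
 thus ?thesis using transition_measurable[OF assms] by simp
qed

text \<open>Integrated over a past event the Markov property becomes an identity of nonnegative
  integrals, the form that extends to more general events and functions of the future.\<close>

lemma markov_set:
 assumes t: "0 <= t" and s: "0 <= s" and G: "G \<in> sets borel" and A: "A \<in> sets (F t)"
 shows "emeasure (P x) (A Int {w \<in> Om. X (t + s) w \<in> G}) =
  (\<integral>\<^sup>+w. indicator A w * emeasure (P (X t w)) {\<omega>' \<in> Om. X s \<omega>' \<in> G} \<partial>P x)"
proof -
 interpret fin: finite_measure_subalgebra "P x" "F t" by unfold_locales (rule subalgebra_F[OF t])
 have AP[measurable]: "A \<in> sets (P x)" using A sets_F[OF t] by auto
 define B where "B = {w \<in> Om. X (t + s) w \<in> G}"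
 have B[measurable]: "B \<in> sets (P x)" unfolding B_def using measurable_sets[OF X_measurable[of "t + s" x] G] t s
  by (simp add: vimage_def Int_def conj_commute)
 define q where "q y = measure (P y) {\<omega>' \<in> Om. X s \<omega>' \<in> G}" for y
 have q[measurable]: "q \<in> borel_measurable borel" unfolding q_def using transition_measurable[OF s G] by simp
 have q01: "0 <= q y" "q y <= 1" for y
 proof -
  show "0 <= q y" "q y <= 1" by (auto simp: q_def)
 qed
 have qX[measurable]: "(%w. q (X t w)) \<in> borel_measurable (P x)" using t by measurable
 have ib: "integrable (P x) (indicator B :: _ => real)" by (simp add: Px.integrable_const_bound[where B=1])
 have "A Int B Int Om = A Int B" by (auto simp: B_def)
 hence "measure (P x) (A Int B) = (LINT w|P x. indicator (A Int B) w)" by simp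
 also have "... = (LINT w:A|P x. indicator B w)"
  unfolding set_lebesgue_integral_def by (simp add: indicator_inter_arith)
 also have "... = (LINT w:A|P x. real_cond_exp (P x) (F t) (indicator B) w)" by (rule fin.real_cond_exp_intA[OF ib A])
 also have "... = (LINT w:A|P x. q (X t w))"
 proof -
  have "AE w in P x. real_cond_exp (P x) (F t) (indicator B) w = q (X t w)"
   using markov[OF s t G, of x] by (simp add: B_def q_def)
  thus ?thesis unfolding set_lebesgue_integral_def by (intro integral_cong_AE) auto
 qed
 finally have 1: "measure (P x) (A Int B) = (LINT w|P x. indicator A w * q (X t w))"
  by (simp add: set_lebesgue_integral_def)
 have "emeasure (P x) (A Int B) = ennreal (LINT w|P x. indicator A w * q (X t w))"
  using 1 by (simp add: Px.emeasure_eq_measure)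
 also have "... = (\<integral>\<^sup>+w. ennreal (indicator A w * q (X t w)) \<partial>P x)"
 proof (rule nn_integral_eq_integral[symmetric])
  show "integrable (P x) (%w. indicator A w * q (X t w))"
   using q01 by (intro Px.integrable_const_bound[where B=1]) (auto simp: indicator_def)
 qed (use q01 in auto)
 also have "... = (\<integral>\<^sup>+w. indicator A w * emeasure (P (X t w)) {\<omega>' \<in> Om. X s \<omega>' \<in> G} \<partial>P x)"
 proof (rule nn_integral_cong)
  fix w
  show "ennreal (indicator A w * q (X t w)) = indicator A w * emeasure (P (X t w)) {\<omega>' \<in> Om. X s \<omega>' \<in> G}"
   by (auto simp: q_def Px.emeasure_eq_measure indicator_def)
 qed
 finally show ?thesis unfolding B_def .
qed

text \<open>Both sides, as functions of the event, are finite measures: an image of the restriction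
  of \<open>P x\<close> to \<open>A\<close>, and the composition of this restriction with the kernel
  \<open>q (X t w)\<close>. Agreement on an intersection-stable generator therefore suffices.
  \<open>T\<close> is the future, either a single coordinate or the shifted path.\<close>

lemma markov_of_generator:
 assumes t: "0 <= t" and A: "A \<in> sets (F t)"
  and M: "sets M = sigma_sets (space M) G" "Int_stable G" "G <= Pow (space M)" "space M \<in> G"
  and T: "T \<in> P x \<rightarrow>\<^sub>M M" and q: "!!y. prob_space (q y)" "!!y. sets (q y) = sets M"
  and m: "!!D. D \<in> G ==> (%y. emeasure (q y) D) \<in> borel_measurable borel"
  and eq: "!!D. D \<in> G ==> emeasure (P x) (A Int T -` D) = (\<integral>\<^sup>+w. indicator A w * emeasure (q (X t w)) D \<partial>P x)"
  and f: "f \<in> borel_measurable M"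
 shows "(%y. \<integral>\<^sup>+z. f z \<partial>q y) \<in> borel_measurable borel"
  and "(\<integral>\<^sup>+w. indicator A w * f (T w) \<partial>P x) = (\<integral>\<^sup>+w. indicator A w * (\<integral>\<^sup>+z. f z \<partial>q (X t w)) \<partial>P x)"
proof -
 have k: "q \<in> borel \<rightarrow>\<^sub>M subprob_algebra M"
  by (rule measurable_prob_algebraD[OF measurable_prob_algebra_generated[OF M(1-3)]]) (use q m in auto)
 thus 1: "(%y. \<integral>\<^sup>+z. f z \<partial>q y) \<in> borel_measurable borel"
  by (rule measurable_compose[OF _ nn_integral_measurable_subprob_algebra[OF f]])
 have AP: "A \<in> sets (P x)" using A sets_F[OF t] by auto
 have AO: "A <= Om" using sets.sets_into_space[OF AP] by simp
 have Xt: "X t \<in> P x \<rightarrow>\<^sub>M borel" using t by simp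
 define N where "N = density (P x) (indicator A)"
 have TN: "T \<in> N \<rightarrow>\<^sub>M M" and kN: "(%w. q (X t w)) \<in> N \<rightarrow>\<^sub>M subprob_algebra M"
  unfolding N_def using T measurable_compose[OF Xt k] by simp_all
 have ne: "space N ~= {}" using Px.not_empty[of x] by (simp add: N_def)
 have int: "(\<integral>\<^sup>+w. g w \<partial>N) = (\<integral>\<^sup>+w. indicator A w * g w \<partial>P x)" if "g \<in> borel_measurable (P x)" for g
  unfolding N_def using that AP by (intro nn_integral_density) auto
 have "distr N M T = N \<bind> (%w. q (X t w))"
 proof (rule measure_eqI_generator_eq[OF M(2,3), where A="%_. space M"])
  fix D assume D: "D \<in> G"
  have DM: "D \<in> sets M" using D M(1) by auto
  have "emeasure (distr N M T) D = (\<integral>\<^sup>+w. indicator A w * indicator D (T w) \<partial>P x)"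
   using int[OF measurable_compose[OF T borel_measurable_indicator[OF DM]]] DM
   by (simp add: nn_integral_distr[OF TN, symmetric] flip: nn_integral_indicator)
  also have "... = (\<integral>\<^sup>+w. indicator (A Int (T -` D Int space (P x))) w \<partial>P x)"
   using AO by (intro nn_integral_cong) (auto simp: indicator_def)
  also have "... = emeasure (P x) (A Int T -` D)"
   using AP measurable_sets[OF T DM] AO by (subst nn_integral_indicator) (auto intro!: arg_cong[where f="emeasure (P x)"])
  also have "... = emeasure (N \<bind> (%w. q (X t w))) D"
   unfolding eq[OF D] emeasure_bind[OF ne kN DM] by (rule int[OF measurable_compose[OF Xt m[OF D]], symmetric])
  finally show "emeasure (distr N M T) D = emeasure (N \<bind> (%w. q (X t w))) D" .
 next
  have "emeasure (distr N M T) (space M) <= emeasure N (space N)"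
   by (subst emeasure_distr[OF TN]) (auto intro!: emeasure_mono)
  also have "... = (\<integral>\<^sup>+w. indicator A w * 1 \<partial>P x)" using int[of "%_. 1"] by simp
  also have "... <= (\<integral>\<^sup>+w. 1 \<partial>P x)" by (intro nn_integral_mono) (auto simp: indicator_def)
  also have "... < \<infinity>" using Px.emeasure_space_1 by simp
  finally show "emeasure (distr N M T) (space M) ~= \<infinity>" by simp
  show "sets (N \<bind> (%w. q (X t w))) = sigma_sets (space M) G" using sets_bind[OF q(2) ne] M(1) by simp
 qed (use M in auto)
 hence "(\<integral>\<^sup>+z. f z \<partial>distr N M T) = (\<integral>\<^sup>+w. (\<integral>\<^sup>+z. f z \<partial>q (X t w)) \<partial>N)"
  by (simp add: nn_integral_bind[OF f kN])
 thus "(\<integral>\<^sup>+w. indicator A w * f (T w) \<partial>P x) = (\<integral>\<^sup>+w. indicator A w * (\<integral>\<^sup>+z. f z \<partial>q (X t w)) \<partial>P x)"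
  using f by (simp add: nn_integral_distr[OF TN] int[OF measurable_compose[OF T f]] int[OF measurable_compose[OF Xt 1]])
qed

lemma markov_fun:
 assumes t: "0 <= t" and s: "0 <= s" and A: "A \<in> sets (F t)" and f: "f \<in> borel_measurable borel"
 shows "(%y. \<integral>\<^sup>+w. f (X s w) \<partial>P y) \<in> borel_measurable borel"
  and "(\<integral>\<^sup>+w. indicator A w * f (X (t + s) w) \<partial>P x) = (\<integral>\<^sup>+w. indicator A w * (\<integral>\<^sup>+\<omega>'. f (X s \<omega>') \<partial>P (X t w)) \<partial>P x)"
proof -
 have Xm: "X (t + s) \<in> P y \<rightarrow>\<^sub>M borel" "X s \<in> P y \<rightarrow>\<^sub>M borel" for y using t s by auto
 have AO: "A <= Om" using sets.sets_into_space[of A "F t"] A space_F[OF t] by auto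
 have em: "emeasure (distr (P y) borel (X s)) D = emeasure (P y) {w \<in> Om. X s w \<in> D}" if "D \<in> sets borel" for y D
  using emeasure_distr[OF Xm(2) that, of y] by (simp add: vimage_def Int_def conj_commute)
 have e: "emeasure (P x) (A Int X (t + s) -` D) = (\<integral>\<^sup>+w. indicator A w * emeasure (distr (P (X t w)) borel (X s)) D \<partial>P x)" if D: "D \<in> sets borel" for D
 proof -
  have "A Int X (t + s) -` D = A Int {w \<in> Om. X (t + s) w \<in> D}" using AO by auto
  thus ?thesis using markov_set[OF t s D A, of x] by (simp add: em[OF D])
 qed
 have st: "sets borel = sigma_sets (space borel) (sets (borel :: 'e measure))" by (simp add: sets.sigma_sets_eq[of borel, simplified])
 have Is: "Int_stable (sets (borel :: 'e measure))" by (auto simp: Int_stable_def)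
 have d: "(\<integral>\<^sup>+z. f z \<partial>distr (P y) borel (X s)) = (\<integral>\<^sup>+w. f (X s w) \<partial>P y)" for y
  using nn_integral_distr[OF Xm(2), of f] f by simp
 have m: "(%y. emeasure (distr (P y) borel (X s)) D) \<in> borel_measurable borel" if "D \<in> sets borel" for D
  using transition_emeasurable[OF s that] by (simp add: em[OF that])
 note g = markov_of_generator[OF t A st Is _ _ Xm(1) prob_space.prob_space_distr[OF prob_space_P Xm(2)] _ m e f, unfolded d]
 show "(%y. \<integral>\<^sup>+w. f (X s w) \<partial>P y) \<in> borel_measurable borel" by (rule g(1)) simp_all
 show "(\<integral>\<^sup>+w. indicator A w * f (X (t + s) w) \<partial>P x) = (\<integral>\<^sup>+w. indicator A w * (\<integral>\<^sup>+\<omega>'. f (X s \<omega>') \<partial>P (X t w)) \<partial>P x)"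
  by (rule g(2)) simp_all
qed

end

section \<open>The Markov property for functionals of the future path\<close>

context continuous_markov_process
begin

definition cylinder :: "real set => (real => 'e set) => 'w set" where
 "cylinder S G = {w \<in> Om. ALL s:S. X s w \<in> G s}"

lemma cylinder_sets:
 assumes "finite S" "S <= {0..}" "!!s. G s \<in> sets borel"
 shows "cylinder S G \<in> sets path_algebra"
proof -
 have "{w \<in> space path_algebra. X s w \<in> G s} \<in> sets path_algebra" if "s \<in> S" for s
  using measurable_sets[OF X_path_measurable assms(3), of s s] assms(2) that
  by (auto simp: vimage_def Int_def conj_commute)
 hence "{w \<in> space path_algebra. ALL s:S. X s w \<in> G s} \<in> sets path_algebra"
  using assms(1) by (intro sets.sets_Collect_finite_All) auto
 thus ?thesis by (simp add: cylinder_def)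
qed

text \<open>Induction on the number of times. The condition at the earliest time is moved into the
  past event, and the Markov property is applied at that time; measurability in the starting point
  is carried along because the next step integrates this function.\<close>

lemma markov_cylinder:
 assumes "finite S" "S <= {0..}" "!!s. G s \<in> sets borel" "0 <= t" "A \<in> sets (F t)"
 shows "(%y. emeasure (P y) (cylinder S G)) \<in> borel_measurable borel &
  emeasure (P x) (A Int {w \<in> Om. ALL s:S. X (t + s) w \<in> G s}) = (\<integral>\<^sup>+w. indicator A w * emeasure (P (X t w)) (cylinder S G) \<partial>P x)"
 using assms
proof (induction "card S" arbitrary: S G t A x)
 case 0
 hence S: "S = {}" by simp
 have 1: "emeasure (P y) Om = 1" for y using Px.emeasure_space_1 by simp
 have "A Int Om = A" using 0 sets.sets_into_space[of A "F t"] space_F by auto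
 thus ?case using 0 sets_F[of t x] by (auto simp: S cylinder_def 1)
next
 case (Suc n)
 have "S ~= {}" using Suc by auto
 define s0 where "s0 = Min S"
 have s0: "s0 \<in> S" "!!s. s \<in> S ==> s0 <= s" "0 <= s0"
  using Suc \<open>S ~= {}\<close> by (auto simp: s0_def dest: Min_in)
 define S' where "S' = (%s. s - s0) ` (S - {s0})"
 define G' where "G' r = G (r + s0)" for r
 have card: "n = card S'" using Suc s0 by (simp add: S'_def card_image inj_on_def)
 have S': "finite S'" "S' <= {0..}" using Suc s0 by (auto simp: S'_def)
 have G': "G' r \<in> sets borel" for r using Suc by (simp add: G'_def)
 define q where "q y = emeasure (P y) (cylinder S' G')" for y
 have IH: "q \<in> borel_measurable borel &
  emeasure (P x) (A Int {w \<in> Om. ALL s:S'. X (t + s) w \<in> G' s}) = (\<integral>\<^sup>+w. indicator A w * q (X t w) \<partial>P x)"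
  if "0 <= t" "A \<in> sets (F t)" for t A x unfolding q_def[abs_def] by (rule Suc.hyps(1)[OF card S' G' that])
 hence q[measurable]: "q \<in> borel_measurable borel" by auto
 define f where "f y = indicator (G s0) y * q y" for y
 have f[measurable]: "f \<in> borel_measurable borel" unfolding f_def using Suc(5) by measurable
 have split: "(ALL s:S. X (t + s) w \<in> G s) \<longleftrightarrow> X (t + s0) w \<in> G s0 & (ALL r:S'. X (t + s0 + r) w \<in> G' r)" for t w
  using s0(1) by (auto simp: S'_def G'_def)
 have step: "emeasure (P x) (A Int {w \<in> Om. ALL s:S. X (t + s) w \<in> G s}) = (\<integral>\<^sup>+w. indicator A w * f (X (t + s0) w) \<partial>P x)"
  if t: "0 <= t" and A: "A \<in> sets (F t)" for t A x
 proof -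
  define A' where "A' = A Int {w \<in> Om. X (t + s0) w \<in> G s0}"
  have "X (t + s0) -` G s0 Int space (F (t + s0)) \<in> sets (F (t + s0))"
   using t s0 Suc(5) by (intro measurable_sets[OF adapted]) auto
  hence "{w \<in> Om. X (t + s0) w \<in> G s0} \<in> sets (F (t + s0))"
   using t s0 by (simp add: space_F vimage_def Int_def conj_commute)
  moreover have "A \<in> sets (F (t + s0))" using F_mono[of t "t + s0"] t s0 A by auto
  ultimately have A': "A' \<in> sets (F (t + s0))" unfolding A'_def by auto
  have "A Int {w \<in> Om. ALL s:S. X (t + s) w \<in> G s} = A' Int {w \<in> Om. ALL r:S'. X (t + s0 + r) w \<in> G' r}"
   unfolding split A'_def by auto
  also have "emeasure (P x) ... = (\<integral>\<^sup>+w. indicator A' w * q (X (t + s0) w) \<partial>P x)"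
   using IH[OF _ A', of x] t s0 by simp
  also have "... = (\<integral>\<^sup>+w. indicator A w * f (X (t + s0) w) \<partial>P x)"
   by (intro nn_integral_cong) (auto simp: A'_def f_def indicator_def)
  finally show ?thesis .
 qed
 have cyl: "emeasure (P y) (cylinder S G) = (\<integral>\<^sup>+w. f (X s0 w) \<partial>P y)" for y
 proof -
  have "Om \<in> sets (F 0)" using sets.top[of "F 0"] space_F[of 0] by simp
  from step[OF order_refl this, of y]
  have "emeasure (P y) (cylinder S G) = (\<integral>\<^sup>+w. indicator Om w * f (X s0 w) \<partial>P y)"
   by (simp add: cylinder_def Int_absorb1 subset_iff)
  also have "... = (\<integral>\<^sup>+w. f (X s0 w) \<partial>P y)" by (intro nn_integral_cong) simp
  finally show ?thesis .
 qed
 show ?case unfolding cyl step[OF Suc(6,7)]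
  using markov_fun(1)[OF Suc(6) s0(3) Suc(7) f] markov_fun(2)[OF Suc(6) s0(3) Suc(7) f, where x=x] by auto
qed

lemma markov_path:
 assumes t: "0 <= t" and A: "A \<in> sets (F t)" and f: "f \<in> borel_measurable path_algebra"
 shows "(%y. \<integral>\<^sup>+w. f w \<partial>P y) \<in> borel_measurable borel"
  and "(\<integral>\<^sup>+w. indicator A w * f (path_shift t w) \<partial>P x) = (\<integral>\<^sup>+w. indicator A w * (\<integral>\<^sup>+\<omega>'. f \<omega>' \<partial>P (X t w)) \<partial>P x)"
proof -
 define \<C> where "\<C> = {cylinder S G | S G. finite S & S <= {0..} & (ALL s. G s \<in> sets borel)}"
 have Isub: "\<C> <= Pow (space path_algebra)" by (auto simp: \<C>_def cylinder_def)
 have OmC: "space path_algebra \<in> \<C>" unfolding \<C>_def by (auto intro!: exI[of _ "{}"] simp: cylinder_def)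
 have stable: "Int_stable \<C>"
 proof (rule Int_stableI)
  fix a b assume "a \<in> \<C>" "b \<in> \<C>"
  then obtain S G T H where *: "a = cylinder S G" "b = cylinder T H" "finite S" "finite T" "S <= {0..}" "T <= {0..}"
   "ALL s. G s \<in> sets borel" "ALL s. H s \<in> sets borel" by (auto simp: \<C>_def)
  define K where "K s = (if s \<in> S then G s else UNIV) Int (if s \<in> T then H s else UNIV)" for s
  have "a Int b = cylinder (S Un T) K" using * by (auto simp: cylinder_def K_def)
  moreover have "K s \<in> sets borel" for s using * by (auto simp: K_def)
  ultimately show "a Int b \<in> \<C>" unfolding \<C>_def using * by blast
 qed
 have gen: "sets path_algebra = sigma_sets (space path_algebra) \<C>"
 proof
  have "\<C> <= sets path_algebra" unfolding \<C>_def using cylinder_sets by auto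
  thus "sigma_sets (space path_algebra) \<C> <= sets path_algebra" by (rule sets.sigma_sets_subset)
  have "{X s -` G Int Om | s G. 0 <= s & G \<in> sets borel} <= \<C>"
  proof safe
   fix s :: real and G :: "'e set" assume "0 <= s" "G \<in> sets borel"
   moreover have "X s -` G Int Om = cylinder {s} (%_. G)" by (auto simp: cylinder_def)
   ultimately show "X s -` G Int Om \<in> \<C>" unfolding \<C>_def by blast
  qed
  thus "sets path_algebra <= sigma_sets (space path_algebra) \<C>"
   unfolding sets_path_algebra space_path_algebra by (intro sigma_sets_mono) auto
 qed
 have AO: "A <= Om" using sets.sets_into_space[of A "F t"] A space_F[OF t] by auto
 have em: "emeasure (distr (P y) path_algebra (%w. w)) D = emeasure (P y) D" if "D \<in> \<C>" for y D
 proof -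
  have "D \<in> sets path_algebra" using that gen by auto
  thus ?thesis using sets.sets_into_space[of D path_algebra] by (subst emeasure_distr[OF id_path_measurable]) (auto simp: Int_absorb2)
 qed
 have cyl: "(%y. emeasure (P y) D) \<in> borel_measurable borel & emeasure (P x) (A Int path_shift t -` D) = (\<integral>\<^sup>+w. indicator A w * emeasure (P (X t w)) D \<partial>P x)"
  if DC: "D \<in> \<C>" for D
 proof -
  obtain S G where D: "D = cylinder S G" "finite S" "S <= {0..}" "!!s. G s \<in> sets borel" using DC unfolding \<C>_def by blast
  have "A Int path_shift t -` D = A Int {w \<in> Om. ALL s:S. X (t + s) w \<in> G s}"
   using AO D(3) path_shift[OF t] by (auto simp: D(1) cylinder_def subset_iff)
  thus ?thesis using markov_cylinder[OF D(2-4) t A, where x=x] D(1) by auto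
 qed
 have d: "(\<integral>\<^sup>+z. f z \<partial>distr (P y) path_algebra (%w. w)) = (\<integral>\<^sup>+w. f w \<partial>P y)" for y
  using nn_integral_distr[OF id_path_measurable, of f y] f by simp
 have m: "(%y. emeasure (distr (P y) path_algebra (%w. w)) D) \<in> borel_measurable borel"
  and e: "emeasure (P x) (A Int path_shift t -` D) = (\<integral>\<^sup>+w. indicator A w * emeasure (distr (P (X t w)) path_algebra (%w. w)) D \<partial>P x)"
  if "D \<in> \<C>" for D using cyl[OF that] by (simp_all add: em[OF that])
 note g = markov_of_generator[OF t A gen stable Isub OmC path_shift_measurable[OF t] prob_space.prob_space_distr[OF prob_space_P id_path_measurable] _ m e f, unfolded d]
 show "(%y. \<integral>\<^sup>+w. f w \<partial>P y) \<in> borel_measurable borel" by (rule g(1)) simp_all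
 show "(\<integral>\<^sup>+w. indicator A w * f (path_shift t w) \<partial>P x) = (\<integral>\<^sup>+w. indicator A w * (\<integral>\<^sup>+\<omega>'. f \<omega>' \<partial>P (X t w)) \<partial>P x)"
  by (rule g(2)) simp_all
qed

end

section \<open>Joint measurability and the event of staying in a set\<close>

context continuous_markov_process
begin

lemma continuous_path: "w \<in> Om ==> continuous_on {0..} (%t. X t w)" using continuous_paths[of w 0] by simp

lemma path_tendsto:
 assumes "w \<in> Om" "!!n. 0 <= t n" "0 <= s" "t \<longlonglongrightarrow> s"
 shows "(%n. X (t n) w) \<longlonglongrightarrow> X s w"
 using continuous_on_tendsto_compose[OF continuous_path[OF assms(1)] assms(4)] assms by auto

text \<open>Continuity of paths lets the time be rounded down to a grid, where only countably many
  coordinates occur. Negative times are cut off at 0, as \<open>X\<close> is unspecified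
  there.\<close>

lemma joint_measurable:
 "(%(w, s). X (max 0 s) w) \<in> borel_measurable (path_algebra \<Otimes>\<^sub>M lborel)"
proof (rule borel_measurable_LIMSEQ_metric)
 fix n :: nat
 define g where "g s = \<lfloor>real (Suc n) * s\<rfloor>" for s :: real
 have "(%p. (%i p. X (max 0 (of_int i / real (Suc n))) (fst p)) (g (snd p)) p) \<in> borel_measurable (path_algebra \<Otimes>\<^sub>M lborel)"
 proof (rule measurable_compose_countable[where f="%i p. X (max 0 (of_int i / real (Suc n))) (fst p)" and g="%p. g (snd p)"])
  show "(%p. X (max 0 (of_int i / real (Suc n))) (fst p)) \<in> borel_measurable (path_algebra \<Otimes>\<^sub>M lborel)" for i :: int
   by (rule measurable_compose[OF measurable_fst X_path_measurable]) simp
  show "(%p. g (snd p)) \<in> path_algebra \<Otimes>\<^sub>M lborel \<rightarrow>\<^sub>M count_space UNIV"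
   unfolding g_def by measurable
 qed
 thus "(%(w, s). X (max 0 (of_int (g s) / real (Suc n))) w) \<in> borel_measurable (path_algebra \<Otimes>\<^sub>M lborel)"
  by (simp add: case_prod_beta')
next
 fix p assume p: "p \<in> space (path_algebra \<Otimes>\<^sub>M (lborel :: real measure))"
 obtain w s where ps: "p = (w, s)" "w \<in> Om" using p by (auto simp: space_pair_measure)
 have "(%n. of_int \<lfloor>real (Suc n) * s\<rfloor> / real (Suc n)) \<longlonglongrightarrow> s"
 proof (rule tendsto_sandwich[where f="%n. s - 1 / real (Suc n)" and h="%n. s"])
  show "\<forall>\<^sub>F n in sequentially. s - 1 / real (Suc n) <= of_int \<lfloor>real (Suc n) * s\<rfloor> / real (Suc n)"
  proof (rule always_eventually, rule allI)
   fix n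
   have "real (Suc n) * s - 1 <= of_int \<lfloor>real (Suc n) * s\<rfloor>" by linarith
   hence "s <= (of_int \<lfloor>real (Suc n) * s\<rfloor> + 1) / real (Suc n)"
    by (subst pos_le_divide_eq) (auto simp: mult.commute simp del: of_nat_Suc)
   thus "s - 1 / real (Suc n) <= of_int \<lfloor>real (Suc n) * s\<rfloor> / real (Suc n)"
    by (simp add: add_divide_distrib del: of_nat_Suc)
  qed
  show "\<forall>\<^sub>F n in sequentially. of_int \<lfloor>real (Suc n) * s\<rfloor> / real (Suc n) <= s"
   by (rule always_eventually, rule allI) (simp add: field_simps del: of_nat_Suc)
  show "(%n. s - 1 / real (Suc n)) \<longlonglongrightarrow> s"
   using tendsto_diff[OF tendsto_const LIMSEQ_inverse_real_of_nat, of s] by (simp add: divide_inverse)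
 qed simp
 hence "(%n. max 0 (of_int \<lfloor>real (Suc n) * s\<rfloor> / real (Suc n))) \<longlonglongrightarrow> max 0 s"
  by (intro tendsto_max tendsto_const)
 from path_tendsto[OF ps(2) _ _ this]
 show "(%n. case p of (w, s) => X (max 0 (of_int \<lfloor>real (Suc n) * s\<rfloor> / real (Suc n))) w) \<longlonglongrightarrow> (case p of (w, s) => X (max 0 s) w)"
  by (simp add: ps)
qed

lemma joint_measurable_comp [measurable (raw)]:
 assumes "f \<in> M \<rightarrow>\<^sub>M path_algebra" "g \<in> borel_measurable M"
 shows "(%p. X (max 0 (g p)) (f p)) \<in> borel_measurable M"
proof -
 have "(%p. (f p, g p)) \<in> M \<rightarrow>\<^sub>M path_algebra \<Otimes>\<^sub>M lborel" using assms by measurable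
 from measurable_compose[OF this joint_measurable] show ?thesis by simp
qed

text \<open>Survival up to a fixed time replaces the exit time in the Markov arguments: for closed
  sets and for balls it is an event in \<open>F t\<close>.\<close>

definition stay :: "'e set => real => 'w set" where
 "stay C t = {w \<in> Om. ALL s:{0..t}. X s w \<in> C}"

lemma stay_mono: "C <= D ==> s <= t ==> stay C t <= stay D s" by (auto simp: stay_def)

lemma stay_Om: "stay C t <= Om" by (auto simp: stay_def)

text \<open>Rational fractions of \<open>t\<close>, rather than rational times, include the endpoint
  \<open>t\<close> and vary continuously with \<open>t\<close>, as joint measurability in the path
  and \<open>t\<close> requires.\<close>

lemma stay_closed_iff:
 assumes C: "closed C" and t: "0 <= t" and w: "w \<in> Om"
 shows "w \<in> stay C t \<longleftrightarrow> (ALL q:\<rat> Int {0..1}. X (q * t) w \<in> C)"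
proof
 assume *: "ALL q:\<rat> Int {0..1}. X (q * t) w \<in> C"
 have "X s w \<in> C" if s: "s \<in> {0..t}" for s
 proof (cases "t = 0")
  case True
  thus ?thesis using s *[rule_format, of 0] by simp
 next
  case False
  hence t: "t > 0" using t by simp
  have r: "s / t \<in> {0..1}" using s t by (auto simp: field_simps)
  have "EX q. ALL n. q n \<in> \<rat> Int {0..1} & \<bar>q n - s / t\<bar> < 1 / real (Suc n)"
  proof (rule choice, rule allI)
   fix n
   consider "s / t < 1" | "s / t = 1" using r by force
   thus "EX q. q \<in> \<rat> Int {0..1} & \<bar>q - s / t\<bar> < 1 / real (Suc n)"
   proof cases
    case 1
    obtain q where "q \<in> \<rat>" "s / t < q" "q < min 1 (s / t + 1 / real (Suc n))"
     using Rats_dense_in_real[of "s / t" "min 1 (s / t + 1 / real (Suc n))"] 1 by auto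
    thus ?thesis using r by (intro exI[of _ q]) auto
   qed (auto intro!: exI[of _ 1])
  qed
  then obtain q where q: "!!n. q n \<in> \<rat> Int {0..1}" "!!n. abs (q n - s / t) < 1 / real (Suc n)" by blast
  have "q \<longlonglongrightarrow> s / t"
  proof (rule LIM_zero_cancel, rule Lim_null_comparison)
   show "\<forall>\<^sub>F n in sequentially. norm (q n - s / t) <= inverse (real (Suc n))"
    using q(2) by (intro always_eventually allI) (auto simp: divide_inverse intro: less_imp_le)
  qed (rule LIMSEQ_inverse_real_of_nat)
  hence "(%n. q n * t) \<longlonglongrightarrow> s / t * t" by (intro tendsto_intros)
  hence "(%n. q n * t) \<longlonglongrightarrow> s" using t by simp
  hence "(%n. X (q n * t) w) \<longlonglongrightarrow> X s w" using q(1) s t by (intro path_tendsto[OF w]) auto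
  thus "X s w \<in> C" by (rule closed_sequentially[OF C, rotated]) (use * q(1) in auto)
 qed
 thus "w \<in> stay C t" using w by (auto simp: stay_def)
next
 assume "w \<in> stay C t"
 thus "ALL q:\<rat> Int {0..1}. X (q * t) w \<in> C" using t by (auto simp: stay_def mult_left_le_one_le)
qed

lemma stay_closed_F:
 assumes C: "closed C" and t: "0 <= t"
 shows "stay C t \<in> sets (F t)"
proof -
 have "stay C t = {w \<in> space (F t). ALL q:\<rat> Int {0..1}. X (q * t) w \<in> C}"
  using stay_closed_iff[OF C t] stay_Om[of C t] by (auto simp: space_F[OF t])
 also have "... \<in> sets (F t)"
 proof (rule sets.sets_Collect_countable_All')
  show "countable (\<rat> Int {0..1::real})" by (simp add: countable_rat)
  fix q :: real assume q: "q \<in> \<rat> Int {0..1}"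
  hence qt: "0 <= q * t" "q * t <= t" using t by (auto simp: mult_left_le_one_le)
  have "X (q * t) -` C Int space (F (q * t)) \<in> sets (F (q * t))"
   by (rule measurable_sets[OF adapted[OF qt(1)]]) (simp add: C)
  thus "{w \<in> space (F t). X (q * t) w \<in> C} \<in> sets (F t)"
   using F_mono[OF qt] by (auto simp: space_F t qt vimage_def Int_def conj_commute)
 qed
 finally show ?thesis .
qed

lemma stay_closed_path:
 assumes C: "closed C" and t: "0 <= t"
 shows "stay C t \<in> sets path_algebra"
proof -
 have "stay C t = {w \<in> space path_algebra. ALL q:\<rat> Int {0..1}. X (q * t) w \<in> C}"
  using stay_closed_iff[OF C t] stay_Om[of C t] by auto
 also have "... \<in> sets path_algebra"
 proof (rule sets.sets_Collect_countable_All')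
  show "countable (\<rat> Int {0..1::real})" by (simp add: countable_rat)
  fix q :: real assume q: "q \<in> \<rat> Int {0..1}"
  thus "{w \<in> space path_algebra. X (q * t) w \<in> C} \<in> sets path_algebra"
   using measurable_sets[OF X_path_measurable[of "q * t"], of C] C t by (simp add: vimage_def Int_def conj_commute)
 qed
 finally show ?thesis .
qed

lemma stay_closed_joint:
 assumes C: "closed C"
 shows "{p \<in> space (path_algebra \<Otimes>\<^sub>M lborel). fst p \<in> stay C (max 0 (snd p))} \<in> sets (path_algebra \<Otimes>\<^sub>M lborel)"
proof -
 have "{p \<in> space (path_algebra \<Otimes>\<^sub>M lborel). fst p \<in> stay C (max 0 (snd p))}
  = {p \<in> space (path_algebra \<Otimes>\<^sub>M lborel). ALL q:\<rat> Int {0..1}. X (max 0 (q * max 0 (snd p))) (fst p) \<in> C}"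
  using stay_closed_iff[OF C] by (auto simp: space_pair_measure max_absorb2)
 also have "... \<in> sets (path_algebra \<Otimes>\<^sub>M lborel)"
 proof (rule sets.sets_Collect_countable_All')
  show "countable (\<rat> Int {0..1::real})" by (simp add: countable_rat)
  fix q :: real
  have "(%p. X (max 0 (q * max 0 (snd p))) (fst p)) \<in> borel_measurable (path_algebra \<Otimes>\<^sub>M lborel)"
   by measurable
  from measurable_sets[OF this, of C]
  show "{p \<in> space (path_algebra \<Otimes>\<^sub>M lborel). X (max 0 (q * max 0 (snd p))) (fst p) \<in> C} \<in> sets (path_algebra \<Otimes>\<^sub>M lborel)"
   using C by (simp add: vimage_def Int_def conj_commute)
 qed
 finally show ?thesis .
qed

text \<open>On the compact interval \<open>[0, t]\<close> a path in an open ball keeps a positive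
  distance from the sphere; this reduces open balls to closed ones.\<close>

lemma stay_ball_eq:
 assumes t: "0 <= t"
 shows "stay (ball z r) t = (\<Union>n. stay (cball z (r - 1 / real (Suc n))) t)"
proof
 show "stay (ball z r) t <= (\<Union>n. stay (cball z (r - 1 / real (Suc n))) t)"
 proof
  fix w assume *: "w \<in> stay (ball z r) t"
  hence w: "w \<in> Om" by (simp add: stay_def)
  have "continuous_on {0..t} (%s. dist z (X s w))"
   by (intro continuous_intros continuous_on_subset[OF continuous_path[OF w]]) auto
  from continuous_attains_sup[OF compact_Icc _ this] t
  obtain s where s: "s \<in> {0..t}" "!!r. r \<in> {0..t} ==> dist z (X r w) <= dist z (X s w)" by auto
  have "0 < r - dist z (X s w)" using * s(1) by (auto simp: stay_def)
  then obtain n where n: "inverse (real (Suc n)) < r - dist z (X s w)" using reals_Archimedean by blast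
  have "w \<in> stay (cball z (r - 1 / real (Suc n))) t"
   unfolding stay_def using w s(2) n by (force simp: divide_inverse)
  thus "w \<in> (\<Union>n. stay (cball z (r - 1 / real (Suc n))) t)" by blast
 qed
 show "(\<Union>n. stay (cball z (r - 1 / real (Suc n))) t) <= stay (ball z r) t"
 proof (rule UN_least, rule stay_mono[OF _ order_refl])
  show "cball z (r - 1 / real (Suc n)) <= ball z r" for n
  proof
   fix y assume "y \<in> cball z (r - 1 / real (Suc n))"
   moreover have "0 < 1 / real (Suc n)" by simp
   ultimately show "y \<in> ball z r" unfolding mem_cball mem_ball by linarith
  qed
 qed
qed

lemma stay_ball_F: "0 <= t ==> stay (ball z r) t \<in> sets (F t)"
 unfolding stay_ball_eq by (intro sets.countable_UN) (auto intro!: stay_closed_F)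

lemma stay_ball_path: "0 <= t ==> stay (ball z r) t \<in> sets path_algebra"
 unfolding stay_ball_eq by (intro sets.countable_UN) (auto intro!: stay_closed_path)

lemma stay_ball_joint:
 "{p \<in> space (path_algebra \<Otimes>\<^sub>M lborel). fst p \<in> stay (ball z r) (max 0 (snd p))} \<in> sets (path_algebra \<Otimes>\<^sub>M lborel)"
proof -
 have "{p \<in> space (path_algebra \<Otimes>\<^sub>M lborel). fst p \<in> stay (ball z r) (max 0 (snd p))} =
  (\<Union>n. {p \<in> space (path_algebra \<Otimes>\<^sub>M lborel). fst p \<in> stay (cball z (r - 1 / real (Suc n))) (max 0 (snd p))})"
  by (auto simp: stay_ball_eq simp del: of_nat_Suc)
 also have "... \<in> sets (path_algebra \<Otimes>\<^sub>M lborel)"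
  by (intro sets.countable_UN image_subsetI stay_closed_joint closed_cball)
 finally show ?thesis .
qed

lemma stay_shift:
 assumes "0 <= s" "0 <= t"
 shows "stay C (s + t) = stay C s Int {w \<in> Om. path_shift s w \<in> stay C t}"
proof (intro set_eqI iffI)
 fix w assume "w \<in> stay C (s + t)"
 thus "w \<in> stay C s Int {w \<in> Om. path_shift s w \<in> stay C t}"
  using assms path_shift[of s w] by (auto simp: stay_def)
next
 fix w assume *: "w \<in> stay C s Int {w \<in> Om. path_shift s w \<in> stay C t}"
 hence w: "w \<in> Om" by auto
 have "X r w \<in> C" if "r \<in> {0..s + t}" for r
 proof (cases "r <= s")
  case False
  hence "X (r - s) (path_shift s w) \<in> C" using * that by (auto simp: stay_def)
  thus ?thesis using path_shift(2)[OF assms(1) w, of "r - s"] False by simp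
 qed (use * that in \<open>auto simp: stay_def\<close>)
 thus "w \<in> stay C (s + t)" using w by (auto simp: stay_def)
qed

end

section \<open>Dynkin's formula for the exit from a closed set\<close>

lemma pderivative_zero_on_open:
 assumes "open U" "!!x. x \<in> U ==> v x = 0" "x \<in> U"
 shows "pderivative i v x = 0"
proof -
 have "continuous_on UNIV (%h. x + h *\<^sub>R axis i 1)" by (intro continuous_intros)
 hence "open ((%h. x + h *\<^sub>R axis i 1) -` U)" using assms(1) by (simp add: continuous_on_open_vimage)
 hence "\<forall>\<^sub>F h in nhds 0. x + h *\<^sub>R axis i 1 \<in> U"
  using assms(3) eventually_nhds_in_open[of "(%h. x + h *\<^sub>R axis i 1) -` U" 0] by simp
 hence "\<forall>\<^sub>F h in nhds 0. v (x + h *\<^sub>R axis i 1) = 0"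
  by (rule eventually_mono) (use assms(2) in auto)
 hence "deriv (%h. v (x + h *\<^sub>R axis i 1)) 0 = deriv (%h::real. 0) 0" by (intro deriv_cong_ev) auto
 thus ?thesis by (simp add: pderivative_def)
qed

lemma continuous_compact_support_bounded:
 fixes f :: "'a::topological_space => real"
 assumes "continuous_on UNIV f" "compact K" "!!x. x ~: K ==> f x = 0"
 obtains M where "!!x. abs (f x) <= M"
proof -
 have "bounded (f ` K)"
  by (intro compact_imp_bounded compact_continuous_image continuous_on_subset[OF assms(1)] assms(2)) auto
 then obtain M where M: "!!x. x \<in> K ==> \<bar>f x\<bar> <= M" by (auto simp: bounded_iff)
 have "abs (f x) <= abs M" for x using M[of x] assms(3)[of x] by (cases "x \<in> K") auto
 thus ?thesis by (rule that)
qed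

lemma C2_compact_support_bounds:
 fixes u :: "real^'n => real"
 assumes "C2_compact_support u"
 shows "continuous_on UNIV u" "continuous_on UNIV (pderivative i u)" "continuous_on UNIV (pderivative i (pderivative j u))"
  and "EX M>=0. (ALL x. abs (u x) <= M) & (ALL i x. abs (pderivative i u x) <= M) & (ALL i j x. abs (pderivative i (pderivative j u) x) <= M)"
proof -
 define K where "K = closure {x. u x ~= 0}"
 have K: "compact K" using assms by (simp add: C2_compact_support_def K_def)
 have c: "continuous_on UNIV u" "continuous_on UNIV (pderivative i u)" "continuous_on UNIV (pderivative i (pderivative j u))" for i j
  using assms differentiable_imp_continuous_on by (auto simp: C2_compact_support_def)
 have oK: "open (- K)" unfolding K_def by (intro open_Compl closed_closure)
 have z0: "u x = 0" if "x ~: K" for x using that closure_subset[of "{x. u x ~= 0}"] by (auto simp: K_def)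
 have z1: "pderivative i u x = 0" if "x ~: K" for x i using pderivative_zero_on_open[OF oK, of u x i] z0 that by auto
 have z2: "pderivative i (pderivative j u) x = 0" if "x ~: K" for x i j
  using pderivative_zero_on_open[OF oK, of "pderivative j u" x i] z1 that by auto
 obtain M0 where M0: "!!x. abs (u x) <= M0" using continuous_compact_support_bounded[OF c(1) K z0] by blast
 have "ALL i. EX M. ALL x. abs (pderivative i u x) <= M"
  using continuous_compact_support_bounded[OF c(2) K z1] by metis
 then obtain M1 where M1: "!!i x. abs (pderivative i u x) <= M1 i" by metis
 have "ALL i j. EX M. ALL x. abs (pderivative i (pderivative j u) x) <= M"
  using continuous_compact_support_bounded[OF c(3) K z2] by metis
 then obtain M2 where M2: "!!i j x. abs (pderivative i (pderivative j u) x) <= M2 i j" by metis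
 define M where "M = abs M0 + (\<Sum>i\<in>UNIV. abs (M1 i)) + (\<Sum>i\<in>UNIV. \<Sum>j\<in>UNIV. abs (M2 i j))"
 have n: "0 <= (\<Sum>i\<in>UNIV. abs (M1 i))" "0 <= (\<Sum>i\<in>UNIV. \<Sum>j\<in>UNIV. abs (M2 i j))" by (auto intro!: sum_nonneg)
 have 1: "abs (M1 i) <= (\<Sum>i\<in>UNIV. abs (M1 i))" for i by (rule member_le_sum) auto
 have 2: "abs (M2 i j) <= (\<Sum>i\<in>UNIV. \<Sum>j\<in>UNIV. abs (M2 i j))" for i j
 proof -
  have "abs (M2 i j) <= (\<Sum>j\<in>UNIV. abs (M2 i j))" by (rule member_le_sum) auto
  also have "... <= (\<Sum>i\<in>UNIV. \<Sum>j\<in>UNIV. abs (M2 i j))" by (rule member_le_sum) (auto intro: sum_nonneg)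
  finally show ?thesis .
 qed
 have "abs (u x) <= M" for x using M0[of x] n unfolding M_def by linarith
 moreover have "abs (pderivative i u x) <= M" for i x using M1[of i x] 1[of i] n unfolding M_def by linarith
 moreover have "abs (pderivative i (pderivative j u) x) <= M" for i j x using M2[of i j x] 2[of i j] n unfolding M_def by linarith
 moreover have "0 <= M" using n unfolding M_def by linarith
 ultimately show "EX M>=0. (ALL x. abs (u x) <= M) & (ALL i x. abs (pderivative i u x) <= M) & (ALL i j x. abs (pderivative i (pderivative j u) x) <= M)" by blast
 show "continuous_on UNIV u" "continuous_on UNIV (pderivative i u)" "continuous_on UNIV (pderivative i (pderivative j u))"
  using c by auto
qed

text \<open>By the spectral decomposition and \<open>2 |v_i v_j| <= v_i^2 + v_j^2\<close>, where the
  resolution of the identity sums the squares to 1.\<close>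

lemma ellipticity_class_entry_le:
 fixes A :: "real^'n^'n"
 assumes A: "A \<in> ellipticity_class ell" and ell: "0 < ell"
 shows "abs (A $ i $ j) <= 1 / ell"
proof -
 obtain B and c :: "real^'n => real" where B: "finite B" "!!v. v \<in> B ==> norm v = 1" "!!v. v \<in> B ==> c v \<in> {ell..1 / ell}"
  "!!i j. A $ i $ j = (\<Sum>v\<in>B. c v * (v $ i * v $ j))"
  "!!i j. (\<Sum>v\<in>B. v $ i * v $ j) = (if i = j then 1 else 0)"
  by (rule ellipticity_class_spectral[OF A]) (rule that, (assumption | blast)+)
 have "abs (A $ i $ j) <= (\<Sum>v\<in>B. abs (c v * (v $ i * v $ j)))" unfolding B(4) by (rule sum_abs)
 also have "... <= (\<Sum>v\<in>B. 1 / ell * ((v $ i * v $ i + v $ j * v $ j) / 2))"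
 proof (rule sum_mono)
  fix v assume v: "v \<in> B"
  have "abs (v $ i * v $ j) <= (v $ i * v $ i + v $ j * v $ j) / 2"
   using zero_le_power2[of "v $ i - v $ j"] zero_le_power2[of "v $ i + v $ j"]
   by (auto simp: abs_le_iff power2_eq_square algebra_simps)
  moreover have "abs (c v) <= 1 / ell" using B(3)[OF v] ell by auto
  ultimately show "abs (c v * (v $ i * v $ j)) <= 1 / ell * ((v $ i * v $ i + v $ j * v $ j) / 2)"
   unfolding abs_mult[of "c v"] using ell by (intro mult_mono) auto
 qed
 also have "... = 1 / ell * (((\<Sum>v\<in>B. v $ i * v $ i) + (\<Sum>v\<in>B. v $ j * v $ j)) / 2)"
  by (simp only: sum_distrib_left sum_divide_distrib sum.distrib add_divide_distrib distrib_left)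
 also have "... = 1 / ell" by (simp add: B(5))
 finally show ?thesis .
qed

locale elliptic_quasi_diffusion = quasi_diffusion X F P a b
 for X :: "real => 'w => real^'n" and F :: "real => 'w measure" and P :: "real^'n => 'w measure"
  and a :: "real^'n => real^'n^'n" and b :: "real^'n => real^'n" +
 fixes ell :: real
 assumes ell: "0 < ell" and a_measurable [measurable]: "a \<in> borel_measurable borel"
  and b_measurable [measurable]: "b \<in> borel_measurable borel"
  and elliptic: "a x \<in> ellipticity_class ell"
begin

abbreviation pos :: "'w \<times> real => real^'n" where "pos p == X (max 0 (snd p)) (fst p)"

abbreviation L :: "(real^'n => real) => real^'n => real" where "L == diffusion_operator a b"

lemma L_measurable:
 assumes "C2_compact_support u"
 shows "L u \<in> borel_measurable borel"
proof -
 have [measurable]: "pderivative i u \<in> borel_measurable borel" "pderivative i (pderivative j u) \<in> borel_measurable borel" for i j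
  using C2_compact_support_bounds(2,3)[OF assms] by (auto intro: borel_measurable_continuous_onI)
 have [measurable]: "(%x. a x $ i $ j) \<in> borel_measurable borel" "(%x. b x $ i) \<in> borel_measurable borel" for i j
 proof -
  have "(%x. a x $ i $ j) = (%x. a x \<bullet> axis i (axis j 1))" "(%x. b x $ i) = (%x. b x \<bullet> axis i 1)"
   by (auto simp: inner_axis)
  thus "(%x. a x $ i $ j) \<in> borel_measurable borel" "(%x. b x $ i) \<in> borel_measurable borel" by simp_all
 qed
 show ?thesis unfolding diffusion_operator_def [abs_def] by measurable
qed

text \<open>The bound is linear in \<open>|b|\<close> because the drift is controlled only through
  its integral along the path; it is the source of the dominating functions in Dynkin's
  formula.\<close>

lemma L_bound:
 assumes "C2_compact_support u"
 obtains M where "0 <= M" "!!x. abs (L u x) <= M * (1 + norm (b x))" "!!x. abs (u x) <= M"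
proof -
 obtain M where M: "0 <= M" "!!x. abs (u x) <= M" "!!i x. abs (pderivative i u x) <= M" "!!i j x. abs (pderivative i (pderivative j u) x) <= M"
  using C2_compact_support_bounds(4)[OF assms] by blast
 let ?d = "real CARD('n)"
 define M' where "M' = M + 1/2 * (?d * (?d * (1 / ell * M))) + ?d * M"
 have d1: "1 <= ?d" using zero_less_card_finite[where 'a='n] by linarith
 show ?thesis
 proof (rule that[of M'])
  have n: "0 <= 1/2 * (?d * (?d * (1 / ell * M)))" "0 <= ?d * M" using M(1) ell by auto
  thus "0 <= M'" using M(1) by (simp add: M'_def)
  show "abs (u x) <= M'" for x using M(2)[of x] n unfolding M'_def by linarith
  fix x
  have "abs (\<Sum>i\<in>UNIV. \<Sum>j\<in>UNIV. a x $ i $ j * pderivative i (pderivative j u) x) <= (\<Sum>i\<in>(UNIV::'n set). \<Sum>j\<in>(UNIV::'n set). 1 / ell * M)"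
  proof (intro order_trans[OF sum_abs] sum_mono)
   fix i j
   show "abs (a x $ i $ j * pderivative i (pderivative j u) x) <= 1 / ell * M"
    unfolding abs_mult using ellipticity_class_entry_le[OF elliptic ell] M ell by (intro mult_mono) auto
  qed
  hence 1: "abs (1/2 * (\<Sum>i\<in>UNIV. \<Sum>j\<in>UNIV. a x $ i $ j * pderivative i (pderivative j u) x)) <= 1/2 * (?d * (?d * (1 / ell * M)))"
   by (simp add: abs_mult)
  have 2: "abs (\<Sum>i\<in>UNIV. b x $ i * pderivative i u x) <= ?d * M * norm (b x)"
  proof -
   have "abs (\<Sum>i\<in>UNIV. b x $ i * pderivative i u x) <= (\<Sum>i\<in>(UNIV::'n set). norm (b x) * M)"
    using M by (intro order_trans[OF sum_abs] sum_mono) (auto simp: abs_mult component_le_norm_cart intro!: mult_mono)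
   thus ?thesis by (simp add: mult_ac)
  qed
  have "abs (L u x) <= 1/2 * (?d * (?d * (1 / ell * M))) + ?d * M * norm (b x)"
   unfolding diffusion_operator_def using 1 2 by linarith
  also have "... <= M' * 1 + M' * norm (b x)" using n M(1) by (intro add_mono mult_right_mono) (auto simp: M'_def)
  finally show "abs (L u x) <= M' * (1 + norm (b x))" by (simp add: algebra_simps)
 qed
qed

text \<open>Expectations of time integrals along the path become single integrals over this
  product.\<close>

definition space_time :: "real^'n => ('w \<times> real) measure" where
 "space_time x = P x \<Otimes>\<^sub>M lborel"

lemma sigma_finite_P: "sigma_finite_measure (P x)"
proof -
 show ?thesis by unfold_locales
qed

lemma pair_sigma_finite_P: "pair_sigma_finite (P x) (lborel :: real measure)"
 using sigma_finite_P[of x] lborel.sigma_finite_measure_axioms by (simp add: pair_sigma_finite_def)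

lemma space_time_X [measurable]: "(%p. pos p) \<in> borel_measurable (space_time x)"
proof -
 have "fst \<in> space_time x \<rightarrow>\<^sub>M path_algebra"
  unfolding space_time_def by (rule measurable_compose[OF measurable_fst id_path_measurable])
 moreover have "snd \<in> borel_measurable (space_time x)" unfolding space_time_def by measurable
 ultimately show ?thesis by (rule joint_measurable_comp)
qed

lemma space_time_path:
 assumes "S \<in> sets (path_algebra \<Otimes>\<^sub>M lborel)"
 shows "S \<in> sets (space_time x)"
proof -
 have "(%p. (fst p, snd p)) \<in> space_time x \<rightarrow>\<^sub>M path_algebra \<Otimes>\<^sub>M lborel"
  unfolding space_time_def by (intro measurable_Pair measurable_compose[OF measurable_fst id_path_measurable]) auto
 hence "id \<in> space_time x \<rightarrow>\<^sub>M path_algebra \<Otimes>\<^sub>M lborel" by (simp add: id_def)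
 from measurable_sets[OF this assms] show ?thesis
  using sets.sets_into_space[OF assms] by (simp add: space_time_def space_pair_measure Int_absorb2)
qed

lemma space_space_time: "space (space_time x) = Om \<times> UNIV" by (simp add: space_time_def space_pair_measure)

lemma drift_space_time:
 assumes "0 <= T"
 shows "integrable (space_time x) (%p. indicator {0..T} (snd p) * norm (b (pos p)))"
proof (rule integrableI_nonneg)
 have [measurable]: "snd \<in> space_time x \<rightarrow>\<^sub>M lborel" unfolding space_time_def by measurable
 have bm: "(%p. norm (b (pos p))) \<in> borel_measurable (space_time x)"
  by (rule measurable_compose[OF measurable_compose[OF space_time_X b_measurable] borel_measurable_norm])
 show m: "(%p. indicator {0..T} (snd p) * norm (b (pos p))) \<in> borel_measurable (space_time x)"
 proof (rule borel_measurable_times[OF _ bm])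
  show "(%p. indicator {0..T} (snd p) :: real) \<in> borel_measurable (space_time x)"
   unfolding space_time_def by measurable
 qed
 interpret pair_sigma_finite "P x" "lborel :: real measure" by (rule pair_sigma_finite_P)
 have "(\<integral>\<^sup>+p. ennreal (indicator {0..T} (snd p) * norm (b (pos p))) \<partial>space_time x)
  = (\<integral>\<^sup>+w. \<integral>\<^sup>+s. ennreal (indicator {0..T} s * norm (b (X (max 0 s) w))) \<partial>lborel \<partial>P x)"
  unfolding space_time_def
  by (subst lborel.nn_integral_fst[symmetric]) (use m in \<open>auto simp: space_time_def case_prod_beta'\<close>)
 also have "... = (\<integral>\<^sup>+w. (\<integral>\<^sup>+s\<in>{0..T}. ennreal (norm (b (X s w))) \<partial>lborel) \<partial>P x)"
  by (intro nn_integral_cong) (auto simp: indicator_def max_def)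
 also have "... < \<infinity>" by (rule drift_integrable[OF assms])
 finally show "(\<integral>\<^sup>+p. ennreal (indicator {0..T} (snd p) * norm (b (pos p))) \<partial>space_time x) < \<infinity>" .
qed auto

lemma time_space_time: "integrable (space_time x) (%p. indicator {0..T} (snd p) :: real)"
proof -
 interpret pair_sigma_finite "P x" "lborel :: real measure" by (rule pair_sigma_finite_P)
 have "integrable (space_time x) (indicator (Om \<times> {0..T}) :: _ => real)"
 proof (rule integrable_real_indicator)
  have O: "Om \<in> sets (P x)" using sets.top[of "P x"] by simp
  thus "Om \<times> {0..T} \<in> sets (space_time x)" by (simp add: space_time_def)
  have "emeasure (space_time x) (Om \<times> {0..T}) = emeasure (P x) Om * emeasure lborel {0..T}"
   unfolding space_time_def using O by (intro lborel.emeasure_pair_measure_Times) auto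
  also have "emeasure (P x) Om = 1" using Px.emeasure_space_1 by simp
  finally show "emeasure (space_time x) (Om \<times> {0..T}) < \<infinity>" by (simp add: emeasure_lborel_Icc_eq)
 qed
 thus ?thesis by (rule Bochner_Integration.integrable_cong[OF refl, THEN iffD1, rotated])
   (auto simp: space_space_time indicator_def)
qed

lemma L_space_time:
 assumes u: "C2_compact_support u" and "0 <= T"
  and [measurable]: "w \<in> borel_measurable (space_time x)" and w: "!!p. abs (w p) <= indicator {0..T} (snd p)"
 shows "integrable (space_time x) (%p. w p * L u (pos p))"
proof -
 obtain M where M: "0 <= M" "!!x. abs (L u x) <= M * (1 + norm (b x))" "!!x. abs (u x) <= M" by (rule L_bound[OF u]) (rule that, (assumption | blast)+)
 show ?thesis
 proof (rule Bochner_Integration.integrable_bound)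
  show "integrable (space_time x) (%p. M * (indicator {0..T} (snd p) + indicator {0..T} (snd p) * norm (b (pos p))))"
   by (intro integrable_mult_right Bochner_Integration.integrable_add time_space_time drift_space_time[OF assms(2)])
  show "(%p. w p * L u (pos p)) \<in> borel_measurable (space_time x)"
   by (intro borel_measurable_times measurable_compose[OF space_time_X L_measurable[OF u]]) measurable
  show "AE p in space_time x. norm (w p * L u (pos p)) <= norm (M * (indicator {0..T} (snd p) + indicator {0..T} (snd p) * norm (b (pos p))))"
  proof (rule AE_I2)
   fix p
   have "abs (w p) * abs (L u (pos p)) <= indicator {0..T} (snd p) * (M * (1 + norm (b (pos p))))"
    by (intro mult_mono w M) auto
   thus "norm (w p * L u (pos p)) <= norm (M * (indicator {0..T} (snd p) + indicator {0..T} (snd p) * norm (b (pos p))))"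
    using M(1) by (simp add: abs_mult algebra_simps)
  qed
 qed
qed

end

lemma integral_zero_iff_positive_negative_parts:
 fixes Z :: "'a => real"
 assumes "integrable M Z"
 shows "(LINT x|M. Z x) = 0 \<longleftrightarrow> (\<integral>\<^sup>+x. ennreal (Z x) \<partial>M) = (\<integral>\<^sup>+x. ennreal (- Z x) \<partial>M)"
proof -
 have "(\<integral>\<^sup>+x. ennreal (Z x) \<partial>M) ~= \<infinity>" "(\<integral>\<^sup>+x. ennreal (- Z x) \<partial>M) ~= \<infinity>"
  using assms by (auto simp: real_integrable_def)
 then obtain p q where pq: "0 <= p" "(\<integral>\<^sup>+x. ennreal (Z x) \<partial>M) = ennreal p" "0 <= q" "(\<integral>\<^sup>+x. ennreal (- Z x) \<partial>M) = ennreal q"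
  by (cases "\<integral>\<^sup>+x. ennreal (Z x) \<partial>M"; cases "\<integral>\<^sup>+x. ennreal (- Z x) \<partial>M") auto
 thus ?thesis unfolding real_lebesgue_integral_def[OF assms] by simp
qed

text \<open>The Markov property is known for nonnegative functions; mean zero is equality of the
  integrals of the positive and negative parts, and that passes to the shifted variable. If the
  product fails to be integrable, its Bochner integral is 0 by default, so the equation has no side
  condition.\<close>

lemma (in continuous_markov_process) markov_path_centered:
 fixes Z :: "'w => real"
 assumes Z: "Z \<in> borel_measurable path_algebra" and int: "!!y. integrable (P y) Z" and 0: "!!y. (LINT w|P y. Z w) = 0"
  and t: "0 <= t" and A: "A \<in> sets (F t)"
 shows "(LINT w|P x. indicator A w * Z (path_shift t w)) = 0"
proof (cases "integrable (P x) (%w. indicator A w * Z (path_shift t w))")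
 case True
 have eq: "(\<integral>\<^sup>+w. ennreal (Z w) \<partial>P y) = (\<integral>\<^sup>+w. ennreal (- Z w) \<partial>P y)" for y
  using integral_zero_iff_positive_negative_parts[OF int] 0 by blast
 have m: "(%w. ennreal (Z w)) \<in> borel_measurable path_algebra" "(%w. ennreal (- Z w)) \<in> borel_measurable path_algebra"
  using Z by auto
 have "(\<integral>\<^sup>+w. ennreal (indicator A w * Z (path_shift t w)) \<partial>P x) = (\<integral>\<^sup>+w. indicator A w * ennreal (Z (path_shift t w)) \<partial>P x)"
  by (intro nn_integral_cong) (auto simp: indicator_def)
 also have "... = (\<integral>\<^sup>+w. indicator A w * ennreal (- Z (path_shift t w)) \<partial>P x)"
  unfolding markov_path(2)[OF t A m(1)] markov_path(2)[OF t A m(2)] eq ..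
 also have "... = (\<integral>\<^sup>+w. ennreal (- (indicator A w * Z (path_shift t w))) \<partial>P x)"
  by (intro nn_integral_cong) (auto simp: indicator_def)
 finally show ?thesis using integral_zero_iff_positive_negative_parts[OF True] by blast
qed (simp add: not_integrable_integral_eq)

lemma sum_indicator_grid:
 assumes "0 <= (h::real)"
 shows "(\<Sum>k<m. indicator {real k * h..<real (Suc k) * h} s) = (indicator {0..<real m * h} s :: real)"
proof (induction m)
 case (Suc m)
 have "real m * h <= real (Suc m) * h" using assms by (intro mult_right_mono) auto
 moreover have "0 <= real m * h" using assms by simp
 ultimately show ?case using Suc by (auto simp: indicator_def)
qed simp

section \<open>First exits from a closed set, on a time grid and in continuous time\<close>

context continuous_markov_process
begin

definition grid_exit :: "'e set => real => nat => 'w => nat" where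
 "grid_exit C h N w = (LEAST k. k >= N \<or> X (real k * h) w ~: C)"

lemma grid_exit_le: "grid_exit C h N w <= N" unfolding grid_exit_def by (rule Least_le) simp

lemma less_grid_exit_iff: "k < grid_exit C h N w \<longleftrightarrow> k < N & (ALL j<=k. X (real j * h) w \<in> C)"
proof
 assume k: "k < grid_exit C h N w"
 hence *: "~ (j >= N \<or> X (real j * h) w ~: C)" if "j <= k" for j
  using not_less_Least[of j "%k. k >= N \<or> X (real k * h) w ~: C"] that unfolding grid_exit_def by auto
 from *[OF order_refl] * show "k < N & (ALL j<=k. X (real j * h) w \<in> C)" by (auto simp: not_le)
next
 assume *: "k < N & (ALL j<=k. X (real j * h) w \<in> C)"
 have "grid_exit C h N w >= N \<or> X (real (grid_exit C h N w) * h) w ~: C"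
  unfolding grid_exit_def by (rule LeastI[of _ N]) simp
 thus "k < grid_exit C h N w" using * by (metis leD leI order_less_le_trans)
qed

text \<open>Inserting the horizon \<open>T\<close> caps the exit time and keeps the infimum away
  from the empty set; \<open>grid_exit\<close> is capped at \<open>N\<close> in the same
  spirit.\<close>

definition closed_exit :: "'e set => real => 'w => real" where
 "closed_exit C T w = Inf (insert T {t \<in> {0..T}. X t w ~: C})"

lemma closed_exit_bounds: "0 <= T ==> 0 <= closed_exit C T w" "0 <= T ==> closed_exit C T w <= T"
 unfolding closed_exit_def by (auto intro!: cInf_greatest cInf_lower bdd_belowI[of _ 0])

lemma closed_exit_le: "0 <= t ==> t <= T ==> X t w ~: C ==> closed_exit C T w <= t"
 unfolding closed_exit_def by (auto intro!: cInf_lower bdd_belowI[of _ 0])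

lemma closed_exit_less:
 assumes "0 <= T" "closed_exit C T w < s" "s <= T"
 obtains t where "closed_exit C T w <= t" "t < s" "X t w ~: C" "0 <= t"
proof -
 obtain t where t: "t \<in> insert T {t \<in> {0..T}. X t w ~: C}" "t < s"
  using assms(2) unfolding closed_exit_def by (subst (asm) cInf_less_iff) (auto intro!: bdd_belowI[of _ 0] simp: assms(1))
 hence "t \<in> {t \<in> {0..T}. X t w ~: C}" using assms(3) by auto
 thus ?thesis using closed_exit_le[of t T w C] t(2) by (intro that[of t]) auto
qed

lemma closed_exit_in:
 assumes C: "closed C" and T: "0 <= T" and w: "w \<in> Om" and X0: "X 0 w \<in> C"
 shows "X (closed_exit C T w) w \<in> C"
proof (cases "closed_exit C T w = 0")
 case False
 define s where "s = closed_exit C T w"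
 have s: "0 < s" "s <= T" using False closed_exit_bounds[OF T, of C w] by (auto simp: s_def)
 define t where "t n = s * (1 - inverse (real (Suc n)))" for n
 have t: "0 <= t n" "t n < s" for n
 proof -
  have "inverse (real (Suc n)) <= 1" "0 < inverse (real (Suc n))" by (auto simp: field_simps)
  thus "0 <= t n" "t n < s" using s by (auto simp: t_def)
 qed
 have "t \<longlonglongrightarrow> s * (1 - 0)" unfolding t_def by (intro tendsto_intros LIMSEQ_inverse_real_of_nat)
 hence "(%n. X (t n) w) \<longlonglongrightarrow> X s w" using t(1) s by (intro path_tendsto[OF w]) auto
 thus ?thesis unfolding s_def[symmetric]
 proof (rule closed_sequentially[OF C, rotated])
  fix n
  show "X (t n) w \<in> C" using closed_exit_le[of "t n" T w C] t[of n] s by (force simp: s_def)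
 qed
qed (use X0 in simp)

lemma closed_exit_closure:
 assumes T: "0 <= T" and w: "w \<in> Om" and not: "w ~: stay C T"
 shows "X (closed_exit C T w) w \<in> closure (- C)"
proof -
 define q where "q = closed_exit C T w"
 have q: "0 <= q" "q <= T" using closed_exit_bounds[OF T, of C w] by (auto simp: q_def)
 show ?thesis
 proof (cases "q = T")
  case True
  obtain s where s: "s \<in> {0..T}" "X s w ~: C" using not w by (auto simp: stay_def)
  hence "T <= s" using closed_exit_le[of s T w C] True by (simp add: q_def)
  hence "s = T" using s by auto
  hence "X q w \<in> - C" using s True by simp
  thus ?thesis unfolding q_def[symmetric] using closure_subset by blast
 next
  case False
  hence \<sigma>T: "q < T" using q by simp
  have "EX t. q <= t & t < min T (q + inverse (real (Suc n))) & X t w ~: C & 0 <= t" for n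
   using closed_exit_less[OF T, of C w "min T (q + inverse (real (Suc n)))"] \<sigma>T
   by (auto simp: q_def simp del: of_nat_Suc)
  then obtain t where t: "!!n. q <= t n" "!!n. t n < min T (q + inverse (real (Suc n)))" "!!n. X (t n) w ~: C" "!!n. 0 <= t n"
   by metis
  have "t \<longlonglongrightarrow> q"
  proof (rule tendsto_sandwich[where f="%n. q" and h="%n. q + inverse (real (Suc n))"])
   show "(%n. q + inverse (real (Suc n))) \<longlonglongrightarrow> q"
    using tendsto_add[OF tendsto_const LIMSEQ_inverse_real_of_nat, of q] by simp
  qed (use t in \<open>auto intro!: always_eventually less_imp_le simp del: of_nat_Suc\<close>)
  hence "(%n. X (t n) w) \<longlonglongrightarrow> X q w" using t(4) q by (intro path_tendsto[OF w]) auto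
  thus ?thesis unfolding q_def[symmetric] closure_sequential using t(3) by (intro exI[of _ "%n. X (t n) w"]) auto
 qed
qed

text \<open>The complement of \<open>C\<close> is open, so a path that is outside at some time is
  outside at all nearby times, and a fine grid catches it. This is why Dynkin's formula is proved
  for closed sets.\<close>

lemma grid_exit_tendsto:
 assumes C: "closed C" and T: "0 < T" and w: "w \<in> Om"
 defines "s == closed_exit C T w"
 shows "s <= real (grid_exit C (T / real (Suc n)) (Suc n) w) * (T / real (Suc n))"
  and "(%n. real (grid_exit C (T / real (Suc n)) (Suc n) w) * (T / real (Suc n))) \<longlonglongrightarrow> s"
proof -
 define q where "q n = grid_exit C (T / real (Suc n)) (Suc n) w" for n
 have T0: "0 <= T" using T by simp
 have le: "real (q n) * (T / real (Suc n)) <= T" for n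
 proof -
  have "real (q n) * (T / real (Suc n)) <= real (Suc n) * (T / real (Suc n))"
   using T grid_exit_le[of C _ "Suc n" w] unfolding q_def by (intro mult_right_mono) (auto simp del: of_nat_Suc)
  thus ?thesis by simp
 qed
 have ge: "s <= real (q n) * (T / real (Suc n))" for n
 proof (cases "q n = Suc n")
  case True
  thus ?thesis using closed_exit_bounds[OF T0, of C w] by (simp add: s_def)
 next
  case False
  hence "q n < Suc n" using grid_exit_le[of C "T / real (Suc n)" "Suc n" w] by (simp add: q_def)
  moreover have "q n >= Suc n \<or> X (real (q n) * (T / real (Suc n))) w ~: C"
   unfolding q_def grid_exit_def by (rule LeastI[of _ "Suc n"]) simp
  ultimately have "X (real (q n) * (T / real (Suc n))) w ~: C" by simp
  thus ?thesis unfolding s_def using T le[of n] by (intro closed_exit_le) auto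
 qed
 show "s <= real (grid_exit C (T / real (Suc n)) (Suc n) w) * (T / real (Suc n))" using ge[of n] by (simp add: q_def)
 have "(%n. real (q n) * (T / real (Suc n))) \<longlonglongrightarrow> s"
 proof (rule order_tendstoI)
  fix a assume "a < s"
  thus "\<forall>\<^sub>F n in sequentially. a < real (q n) * (T / real (Suc n))"
   using ge by (intro always_eventually allI) (meson less_le_trans)
 next
  fix c assume c: "s < c"
  show "\<forall>\<^sub>F n in sequentially. real (q n) * (T / real (Suc n)) < c"
  proof (cases "T < c")
   case True
   thus ?thesis using le by (intro always_eventually allI) (meson le_less_trans)
  next
   case False
   hence "c <= T" by simp
   obtain t where t: "s <= t" "t < c" "X t w ~: C" "0 <= t"
    using closed_exit_less[OF T0 c[unfolded s_def] \<open>c <= T\<close>] by (auto simp: s_def)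
   have "continuous (at t within {0..}) (%t. X t w)"
    using continuous_path[OF w] t(4) by (simp add: continuous_on_eq_continuous_within)
   hence "\<forall>\<^sub>F r in at t within {0..}. X r w \<in> - C"
    unfolding continuous_within using C t(3) by (intro topological_tendstoD) auto
   then obtain e where e: "e > 0" "!!r. r \<in> {0..} ==> r ~= t ==> dist r t < e ==> X r w ~: C"
    unfolding eventually_at by auto
   define \<eta>' where "\<eta>' = min e (c - t)"
   have \<eta>': "\<eta>' > 0" using e t by (simp add: \<eta>'_def)
   have "(%n. T * inverse (real (Suc n))) \<longlonglongrightarrow> T * 0" by (intro tendsto_intros LIMSEQ_inverse_real_of_nat)
   hence "\<forall>\<^sub>F n in sequentially. T / real (Suc n) < \<eta>'"
    using order_tendstoD(2)[of _ "T * 0" sequentially \<eta>'] \<eta>' by (simp add: divide_inverse)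
   thus ?thesis
   proof (rule eventually_mono)
    fix n assume n: "T / real (Suc n) < \<eta>'"
    define h where "h = T / real (Suc n)"
    have h: "h > 0" using T by (simp add: h_def)
    define k where "k = nat \<lceil>t / h\<rceil>"
    have "0 <= t / h" using t h by simp
    hence "real k = of_int \<lceil>t / h\<rceil>" by (simp add: k_def)
    hence "t / h <= real k" "real k < t / h + 1" by linarith+
    hence k: "t <= real k * h" "real k * h < t + h" using h by (auto simp: field_simps)
    have "X (real k * h) w ~: C"
    proof (cases "real k * h = t")
     case False
     thus ?thesis using k n t(4) by (intro e(2)) (auto simp: dist_real_def h_def \<eta>'_def)
    qed (use t in simp)
    hence "q n <= k" unfolding q_def grid_exit_def h_def by (intro Least_le) auto
    hence "real (q n) * h <= real k * h" using h by (intro mult_right_mono) auto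
    thus "real (q n) * (T / real (Suc n)) < c" using k n by (simp add: h_def \<eta>'_def)
   qed
  qed
 qed
 thus "(%n. real (grid_exit C (T / real (Suc n)) (Suc n) w) * (T / real (Suc n))) \<longlonglongrightarrow> s"
  by (simp add: q_def)
qed

text \<open>The two notions of survival can differ only at the exit time itself, a single instant
  without effect on time integrals.\<close>

lemma stay_iff_closed_exit:
 assumes "0 <= s" "s < T" "w \<in> Om" "s ~= closed_exit C T w"
 shows "w \<in> stay C s \<longleftrightarrow> s < closed_exit C T w"
proof
 assume *: "w \<in> stay C s"
 show "s < closed_exit C T w"
 proof (rule ccontr)
  assume "~ ?thesis"
  hence "closed_exit C T w < s" using assms by simp
  then obtain t where "t < s" "X t w ~: C" "0 <= t" using closed_exit_less[of T C w s] assms by auto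
  thus False using * by (auto simp: stay_def)
 qed
next
 assume *: "s < closed_exit C T w"
 have "X r w \<in> C" if "r \<in> {0..s}" for r using closed_exit_le[of r T w C] that assms * by force
 thus "w \<in> stay C s" using assms by (auto simp: stay_def)
qed

end

lemma integrable_indicator_mult:
 fixes f :: "'a => real"
 shows "A \<in> sets M ==> integrable M f ==> integrable M (%x. indicator A x * f x)"
 using integrable_real_mult_indicator[of A M f] by (simp add: mult.commute)

section \<open>Dynkin's formula on a time grid\<close>

context elliptic_quasi_diffusion
begin

lemma window_measurable: "(%p. indicator {s..<t} (snd p) :: real) \<in> borel_measurable (space_time x)"
 unfolding space_time_def by measurable

context
 fixes u :: "real^'n => real"
 assumes u: "C2_compact_support u"
begin

lemma u_measurable [measurable]: "u \<in> borel_measurable borel"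
 using C2_compact_support_bounds(1)[OF u] by (rule borel_measurable_continuous_onI)

lemmas L_u_measurable [measurable] = L_measurable[OF u]

lemma uX_integrable: "0 <= t ==> integrable (P x) (%w. u (X t w))"
proof -
 assume t: "0 <= t"
 obtain M where M: "0 <= M" "!!x. abs (L u x) <= M * (1 + norm (b x))" "!!x. abs (u x) <= M"
  by (rule L_bound[OF u]) (rule that, (assumption | blast)+)
 have [measurable]: "X t \<in> P x \<rightarrow>\<^sub>M borel" using t by simp
 show ?thesis by (rule Px.integrable_const_bound[where B=M]) (use M in auto)
qed

definition drift_part :: "real => real => 'w => real" where
 "drift_part s t w = (LINT r|lborel. indicator {s..<t} r * L u (X (max 0 r) w))"

lemma window_integrable:
 assumes "0 <= s"
 shows "integrable (space_time x) (%p. indicator {s..<t} (snd p) * L u (pos p))"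
proof (cases "0 <= t")
 case True
 show ?thesis by (rule L_space_time[OF u True window_measurable]) (use assms in \<open>auto simp: indicator_def\<close>)
next
 case False
 hence "(%p. indicator {s..<t} (snd p) * L u (pos p)) = (%p::'w \<times> real. 0)"
  using assms by (auto simp: indicator_def)
 thus ?thesis by simp
qed

lemma drift_part_integrable:
 assumes "0 <= s"
 shows "integrable (P x) (drift_part s t)"
proof -
 interpret pair_sigma_finite "P x" "lborel :: real measure" by (rule pair_sigma_finite_P)
 have "integrable (P x) (%w. LINT r|lborel. indicator {s..<t} (snd (w, r)) * L u (X (max 0 (snd (w, r))) (fst (w, r))))"
  using window_integrable[OF assms] unfolding space_time_def by (rule integrable_fst')
 thus ?thesis by (simp add: drift_part_def [abs_def])
qed

lemma drift_part_path: "drift_part s t \<in> borel_measurable path_algebra" unfolding drift_part_def [abs_def]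
proof (rule lborel.borel_measurable_lebesgue_integral)
 have "(%p. pos p) \<in> borel_measurable (path_algebra \<Otimes>\<^sub>M (lborel::real measure))" by measurable
 from measurable_compose[OF this L_measurable[OF u]]
 show "(%(w, r). indicator {s..<t} r * L u (X (max 0 r) w)) \<in> borel_measurable (path_algebra \<Otimes>\<^sub>M lborel)"
  by (simp add: case_prod_beta')
qed

text \<open>The increment over \<open>[0, h]\<close> of the martingale \<open>u (X t)\<close> minus
  the time integral of \<open>L u\<close>, written as a path functional so that it can be
  shifted.\<close>

definition increment :: "real => 'w => real" where
 "increment h w = u (X h w) - u (X 0 w) - drift_part 0 h w"

lemma increment_shift:
 assumes "0 <= t" "0 <= h" "w \<in> Om"
 shows "increment h (path_shift t w) = u (X (t + h) w) - u (X t w) - drift_part t (t + h) w"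
proof -
 have "drift_part 0 h (path_shift t w) = (LINT r|lborel. indicator {0..<h} r * L u (X (t + max 0 r) w))"
  unfolding drift_part_def using path_shift(2)[OF assms(1,3)] by simp
 also have "... = (LINT r|lborel. indicator {t..<t + h} (t + r) * L u (X (max 0 (t + r)) w))"
  using assms(1) by (intro Bochner_Integration.integral_cong) (auto simp: indicator_def max_def)
 also have "... = drift_part t (t + h) w"
  unfolding drift_part_def using lborel_integral_real_affine[of 1 "%r. indicator {t..<t + h} r * L u (X (max 0 r) w)" t] by simp
 finally show ?thesis using path_shift(2)[OF assms(1,3)] assms(2) by (simp add: increment_def)
qed

lemma increment_integrable: "0 <= h ==> integrable (P x) (increment h)" unfolding increment_def [abs_def]
 by (intro Bochner_Integration.integrable_diff uX_integrable drift_part_integrable) auto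

lemma increment_path: "0 <= h ==> increment h \<in> borel_measurable path_algebra"
 unfolding increment_def [abs_def] using drift_part_path X_path_measurable[of h] X_path_measurable[of 0] by measurable

lemma increment_zero:
 assumes h: "0 <= h"
 shows "(LINT w|P x. increment h w) = 0"
proof -
 have X0: "(LINT w|P x. u (X 0 w)) = u x"
 proof -
  have [measurable]: "X 0 \<in> P x \<rightarrow>\<^sub>M borel" by simp
  have "(LINT w|P x. u (X 0 w)) = (LINT w|P x. u x)" using AE_start[of x] by (intro integral_cong_AE) auto
  thus ?thesis using Px.prob_space by simp
 qed
 have "(LINT w|P x. drift_part 0 h w) = (LINT w|P x. (LINT s:{0..h}|lborel. L u (X s w)))"
 proof (rule Bochner_Integration.integral_cong[OF refl])
  fix w
  have "(%r. X (max 0 r) w) \<in> borel_measurable lborel" if "w \<in> Om"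
   using joint_measurable_comp[of "%_. w" lborel "%r. r"] that by simp
  have "AE r in lborel. r ~= h" by (rule AE_lborel_singleton)
  thus "drift_part 0 h w = (LINT s:{0..h}|lborel. L u (X s w))" if "w \<in> space (P x)"
  proof -
   have m: "(%r. X (max 0 r) w) \<in> borel_measurable lborel"
    using joint_measurable_comp[of "%_. w" lborel "%r. r"] that by simp
   have "drift_part 0 h w = (LINT r|lborel. indicator {0..h} r * L u (X (max 0 r) w))" unfolding drift_part_def
    using measurable_compose[OF m L_measurable[OF u]]  \<open>AE r in lborel. r ~= h\<close>
    by (intro integral_cong_AE) (auto simp: indicator_def)
   also have "... = (LINT s:{0..h}|lborel. L u (X s w))"
    unfolding set_lebesgue_integral_def by (intro Bochner_Integration.integral_cong) (auto simp: indicator_def max_def)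
   finally show ?thesis .
  qed
 qed
 thus ?thesis unfolding increment_def using generator[OF u h, of x] X0 h uX_integrable drift_part_integrable by simp
qed

lemma path_window_integrable:
 "AE w in P x. ALL n::nat. integrable lborel (%r. indicator {0..<real n} r * L u (X (max 0 r) w))"
proof (subst AE_all_countable, rule allI)
 fix n :: nat
 interpret pair_sigma_finite "P x" "lborel :: real measure" by (rule pair_sigma_finite_P)
 have "AE w in P x. integrable lborel (%r. indicator {0..<real n} (snd (w, r)) * L u (X (max 0 (snd (w, r))) (fst (w, r))))"
  using window_integrable[of 0 x "real n"] unfolding space_time_def by (intro AE_integrable_fst') auto
 thus "AE w in P x. integrable lborel (%r. indicator {0..<real n} r * L u (X (max 0 r) w))" by simp
qed

text \<open>A discrete stochastic integral: the event \<open>A k\<close> that the path is inside at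
  all grid times up to \<open>k h\<close> belongs to the past of time \<open>k h\<close>, so the
  next increment restricted to it has mean zero. Summing over \<open>k\<close> telescopes the values
  of \<open>u\<close> and glues the drift integrals together.\<close>

lemma dynkin_grid:
 assumes C: "closed C" and h: "0 < h"
 shows "(LINT w|P x. u (X (real (grid_exit C h N w) * h) w)) =
  u x + (LINT w|P x. drift_part 0 (real (grid_exit C h N w) * h) w)"
  and "integrable (P x) (%w. u (X (real (grid_exit C h N w) * h) w))"
  and "integrable (P x) (%w. drift_part 0 (real (grid_exit C h N w) * h) w)"
proof -
 define A where "A k = {w \<in> Om. ALL j<=k. X (real j * h) w \<in> C}" for k
 have kh: "0 <= real k * h" for k using h by simp
 have AF: "A k \<in> sets (F (real k * h))" for k
 proof -
  have "{w \<in> space (F (real k * h)). ALL j:{..k}. X (real j * h) w \<in> C} \<in> sets (F (real k * h))"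
  proof (rule sets.sets_Collect_finite_All)
   fix j assume j: "j \<in> {..k}"
   hence le: "0 <= real j * h" "real j * h <= real k * h" using h by (auto intro!: mult_right_mono)
   have "X (real j * h) -` C Int space (F (real j * h)) \<in> sets (F (real j * h))"
    by (rule measurable_sets[OF adapted[OF le(1)]]) (simp add: C)
   moreover have "{w \<in> space (F (real k * h)). X (real j * h) w \<in> C} = X (real j * h) -` C Int space (F (real j * h))"
    unfolding space_F[OF kh] space_F[OF le(1)] by auto
   ultimately show "{w \<in> space (F (real k * h)). X (real j * h) w \<in> C} \<in> sets (F (real k * h))"
    using F_mono[OF le] by auto
  qed simp
  thus ?thesis unfolding A_def space_F[OF kh] Ball_def atMost_iff .
 qed
 have AP: "A k \<in> sets (P x)" for k using AF[of k] sets_F[OF kh[of k], of x] by blast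
 let ?q = "grid_exit C h N"
 let ?W = "%k w. indicator (A k) w * increment h (path_shift (real k * h) w)"
 let ?U = "%k w. indicator (A k) w * (u (X (real (Suc k) * h) w) - u (X (real k * h) w))"
 let ?D = "%k w. indicator (A k) w * drift_part (real k * h) (real (Suc k) * h) w"
 have step: "real k * h + h = real (Suc k) * h" for k by (simp add: algebra_simps)
 have Uint: "integrable (P x) (?U k)" for k
  by (intro integrable_indicator_mult Bochner_Integration.integrable_diff uX_integrable kh AP)
 have Dint: "integrable (P x) (?D k)" for k by (intro integrable_indicator_mult drift_part_integrable kh AP)
 have Weq: "?W k w = ?U k w - ?D k w" if "w \<in> Om" for k w
  using increment_shift[OF kh[of k] less_imp_le[OF h] that] unfolding step by (simp add: right_diff_distrib)
 have W0: "(LINT w|P x. ?W k w) = 0" for k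
  using h by (intro markov_path_centered[OF increment_path increment_integrable increment_zero kh AF]) auto
 have UD: "(LINT w|P x. ?U k w) = (LINT w|P x. ?D k w)" for k
 proof -
  have "(LINT w|P x. ?U k w) - (LINT w|P x. ?D k w) = (LINT w|P x. ?U k w - ?D k w)"
   by (rule Bochner_Integration.integral_diff[OF Uint Dint, symmetric])
  also have "... = (LINT w|P x. ?W k w)" by (intro Bochner_Integration.integral_cong) (simp_all add: Weq)
  finally show ?thesis using W0[of k] by simp
 qed
 have Aind: "indicator (A k) w = (if k < ?q w then 1 else (0::real))" if "w \<in> Om" "k < N" for k w
  using that by (auto simp: A_def less_grid_exit_iff)
 have cut: "(\<Sum>k<N. indicator (A k) w * f k) = (\<Sum>k<?q w. f k)" if "w \<in> Om" for w and f :: "nat => real"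
 proof -
  have "(\<Sum>k<N. indicator (A k) w * f k) = (\<Sum>k<N. if k < ?q w then f k else 0)"
   by (intro sum.cong) (auto simp: Aind that)
  also have "... = (\<Sum>k<?q w. f k)" using grid_exit_le[of C h N w] by (intro sum.mono_neutral_cong_right) auto
  finally show ?thesis .
 qed
 have Usum: "(\<Sum>k<N. ?U k w) = u (X (real (?q w) * h) w) - u (X 0 w)" if "w \<in> Om" for w
  unfolding cut[OF that] by (subst sum_lessThan_telescope) simp
 \<comment> \<open>Only almost surely: adding the integrals over the windows requires
   \<open>L u\<close> to be integrable along the path.\<close>
 have Dsum: "AE w in P x. (\<Sum>k<N. ?D k w) = drift_part 0 (real (?q w) * h) w"
  using path_window_integrable AE_space
 proof eventually_elim
  case (elim w)
  hence w: "w \<in> Om" by simp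
  obtain n :: nat where n: "real N * h <= real n" using real_arch_simple by blast
  have i: "integrable lborel (%r. indicator {real k * h..<real (Suc k) * h} r * L u (X (max 0 r) w))" if k: "k < N" for k
  proof -
   have "real (Suc k) * h <= real n" using n k h by (intro order_trans[OF _ n] mult_right_mono) auto
   hence "(%r. indicator {real k * h..<real (Suc k) * h} r * L u (X (max 0 r) w)) =
    (%r. indicator {real k * h..<real (Suc k) * h} r * (indicator {0..<real n} r * L u (X (max 0 r) w)))"
    using kh[of k] by (auto simp: indicator_def fun_eq_iff)
   moreover have "integrable lborel (%r. indicator {real k * h..<real (Suc k) * h} r * (indicator {0..<real n} r * L u (X (max 0 r) w)))"
    by (rule integrable_indicator_mult[OF _ elim(1)[rule_format]]) simp
   ultimately show ?thesis by (simp only:)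
  qed
  have "(\<Sum>k<N. ?D k w) = (\<Sum>k<?q w. LINT r|lborel. indicator {real k * h..<real (Suc k) * h} r * L u (X (max 0 r) w))"
   unfolding cut[OF w] drift_part_def ..
  also have "... = (LINT r|lborel. (\<Sum>k<?q w. indicator {real k * h..<real (Suc k) * h} r * L u (X (max 0 r) w)))"
   using grid_exit_le[of C h N w] by (intro Bochner_Integration.integral_sum[symmetric] i) auto
  also have "... = drift_part 0 (real (?q w) * h) w"
   unfolding drift_part_def sum_distrib_right[symmetric] sum_indicator_grid[OF less_imp_le[OF h]] ..
  finally show ?case .
 qed
 have Usum': "(\<Sum>k<N. ?U k w) + u (X 0 w) = u (X (real (?q w) * h) w)" if "w \<in> space (P x)" for w
 proof -
  have "w \<in> Om" using that by simp
  from Usum[OF this] show ?thesis by linarith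
 qed
 have int1: "integrable (P x) (%w. \<Sum>k<N. ?U k w)" "integrable (P x) (%w. \<Sum>k<N. ?D k w)"
  by (intro Bochner_Integration.integrable_sum Uint Dint)+
 have "integrable (P x) (%w. (\<Sum>k<N. ?U k w) + u (X 0 w))"
  by (intro Bochner_Integration.integrable_add int1 uX_integrable) simp
 thus Ui: "integrable (P x) (%w. u (X (real (?q w) * h) w))"
  by (subst Bochner_Integration.integrable_cong[OF refl Usum'[symmetric]])
 have \<kappa>m: "?q \<in> P x \<rightarrow>\<^sub>M count_space UNIV"
 proof (rule measurable_count_space_eq2_countable[THEN iffD2, OF _ ], intro conjI ballI)
  fix n
  have "?q -` {n} Int space (P x) = {w \<in> space (P x). n = 0 \<or> (n - 1 < ?q w)} - {w \<in> space (P x). n < ?q w}"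
   by auto
  moreover have m: "{w \<in> space (P x). k < ?q w} \<in> sets (P x)" for k
  proof (cases "k < N")
   case True
   hence "{w \<in> space (P x). k < ?q w} = A k" by (auto simp: A_def less_grid_exit_iff)
   thus ?thesis using AP by simp
  next
   case False
   hence "{w \<in> space (P x). k < ?q w} = {}" by (auto simp: less_grid_exit_iff)
   thus ?thesis by (simp only: sets.empty_sets)
  qed
  ultimately show "?q -` {n} Int space (P x) \<in> sets (P x)"
   using sets.Diff[OF sets.top m[of n]] sets.Diff[OF m[of "n - 1"] m[of n]] by (cases "n = 0") (simp_all del: space_P)
 qed auto
 have dm: "(%w. drift_part 0 (real (?q w) * h) w) \<in> borel_measurable (P x)"
  by (rule measurable_compose_countable[where f="%k w. drift_part 0 (real k * h) w" and g="?q", OF _ \<kappa>m])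
   (rule measurable_path_algebra[OF drift_part_path])
 show Di: "integrable (P x) (%w. drift_part 0 (real (?q w) * h) w)"
  using int1(2) Dsum by (subst integrable_cong_AE[symmetric, OF _ dm]) auto
 have X0: "(LINT w|P x. u (X 0 w)) = u x"
 proof -
  have [measurable]: "X 0 \<in> P x \<rightarrow>\<^sub>M borel" by simp
  have "(LINT w|P x. u (X 0 w)) = (LINT w|P x. u x)" using AE_start[of x] by (intro integral_cong_AE) auto
  thus ?thesis using Px.prob_space by simp
 qed
 have "(LINT w|P x. u (X (real (?q w) * h) w)) = (LINT w|P x. (\<Sum>k<N. ?U k w) + u (X 0 w))"
  by (rule Bochner_Integration.integral_cong[OF refl Usum'[symmetric]])
 also have "... = (\<Sum>k<N. LINT w|P x. ?U k w) + u x"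
  unfolding Bochner_Integration.integral_add[OF int1(1) uX_integrable[OF order_refl]] X0
   Bochner_Integration.integral_sum[OF Uint] ..
 also have "(\<Sum>k<N. LINT w|P x. ?U k w) = (LINT w|P x. (\<Sum>k<N. ?D k w))"
  unfolding UD Bochner_Integration.integral_sum[OF Dint] ..
 also have "... = (LINT w|P x. drift_part 0 (real (?q w) * h) w)"
  using int1(2) Dsum dm by (intro integral_cong_AE) auto
 finally show "(LINT w|P x. u (X (real (?q w) * h) w)) = u x + (LINT w|P x. drift_part 0 (real (?q w) * h) w)" by simp
qed

end

end

section \<open>Dynkin's formula in continuous time\<close>

context elliptic_quasi_diffusion
begin

definition killed :: "(real^'n) set => real => 'w \<times> real => real" where
 "killed C T p = indicator {0..<T} (snd p) * indicator (stay C (max 0 (snd p))) (fst p)"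

lemma killed_bounds: "0 <= killed C T p" "killed C T p <= 1" "abs (killed C T p) <= indicator {0..T} (snd p)"
 by (auto simp: killed_def indicator_def)

lemma killed_measurable_aux:
 assumes "{p \<in> space (path_algebra \<Otimes>\<^sub>M lborel). fst p \<in> stay C (max 0 (snd p))} \<in> sets (path_algebra \<Otimes>\<^sub>M lborel)"
 shows "killed C T \<in> borel_measurable (space_time x)"
proof -
 let ?S = "{p \<in> space (path_algebra \<Otimes>\<^sub>M lborel). fst p \<in> stay C (max 0 (snd p))}"
 have "?S \<in> sets (space_time x)" by (rule space_time_path[OF assms])
 hence "(%p. indicator {0..<T} (snd p) * indicator ?S p :: real) \<in> borel_measurable (space_time x)"
  by (intro borel_measurable_times window_measurable borel_measurable_indicator)
 moreover have "killed C T p = indicator {0..<T} (snd p) * indicator ?S p" if "p \<in> space (space_time x)" for p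
  using that stay_Om by (auto simp: killed_def space_space_time space_pair_measure indicator_def)
 ultimately show ?thesis by (subst measurable_cong)
qed

lemma killed_closed_measurable: "closed C ==> killed C T \<in> borel_measurable (space_time x)"
 by (rule killed_measurable_aux[OF stay_closed_joint])

lemma killed_ball_measurable: "killed (ball z r) T \<in> borel_measurable (space_time x)"
 by (rule killed_measurable_aux[OF stay_ball_joint])

text \<open>Refine the grid: the stopped positions converge by continuity of the paths, and the
  drift integrals are dominated by the integral of \<open>|L u|\<close> up to
  \<open>T\<close>.\<close>

theorem dynkin_closed_exit:
 assumes u: "C2_compact_support u" and C: "closed C" and T: "0 < T"
 shows "(LINT v|P x. u (X (closed_exit C T v) v)) =
  u x + (LINT p|space_time x. killed C T p * L u (pos p))"
  and "(%v. u (X (closed_exit C T v) v)) \<in> borel_measurable (P x)"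
proof -
 interpret pair_sigma_finite "P x" "lborel :: real measure" by (rule pair_sigma_finite_P)
 obtain M where M: "0 <= M" "!!x. abs (L u x) <= M * (1 + norm (b x))" "!!x. abs (u x) <= M"
  by (rule L_bound[OF u]) (rule that, (assumption | blast)+)
 have T0: "0 <= T" using T by simp
 define s where "s n v = real (grid_exit C (T / real (Suc n)) (Suc n) v) * (T / real (Suc n))" for n v
 have h: "0 < T / real (Suc n)" for n using T by simp
 have grid: "(LINT v|P x. u (X (s n v) v)) = u x + (LINT v|P x. drift_part u 0 (s n v) v)"
  "integrable (P x) (%v. u (X (s n v) v))" "integrable (P x) (%v. drift_part u 0 (s n v) v)" for n
  unfolding s_def using dynkin_grid[OF u C h[of n], where x=x and N="Suc n"] by blast+
 have s0: "0 <= s n v" for n v using T by (simp add: s_def)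
 have sT: "s n v <= T" for n v
 proof -
  have "s n v <= real (Suc n) * (T / real (Suc n))"
   unfolding s_def using T grid_exit_le[of C _ "Suc n" v] by (intro mult_right_mono) (auto simp del: of_nat_Suc)
  thus ?thesis by simp
 qed
 let ?q = "closed_exit C T"
 have \<sigma>0: "0 <= ?q v" "?q v <= T" for v using closed_exit_bounds[OF T0] by auto
 have s_lim: "(%n. s n v) \<longlonglongrightarrow> ?q v" and s_ge: "?q v <= s n v" if "v \<in> Om" for v n
  using grid_exit_tendsto[OF C T that] by (auto simp: s_def)
 have u_lim: "(%n. u (X (s n v) v)) \<longlonglongrightarrow> u (X (?q v) v)" if "v \<in> Om" for v
 proof -
  have "(%n. X (s n v) v) \<longlonglongrightarrow> X (?q v) v"
   by (rule path_tendsto[OF that s0 \<sigma>0(1) s_lim[OF that]])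
  thus ?thesis using C2_compact_support_bounds(1)[OF u] by (auto intro!: continuous_on_tendsto_compose[of UNIV u])
 qed
 show um: "(%v. u (X (?q v) v)) \<in> borel_measurable (P x)"
  by (rule borel_measurable_LIMSEQ_metric[of "%n v. u (X (s n v) v)"])
   (use grid(2) u_lim in auto)
 have "(%n. LINT v|P x. u (X (s n v) v)) \<longlonglongrightarrow> (LINT v|P x. u (X (?q v) v))"
 proof (rule integral_dominated_convergence[where w="%_. M"])
  show "AE v in P x. (%n. u (X (s n v) v)) \<longlonglongrightarrow> u (X (?q v) v)" using u_lim by (intro AE_I2) auto
 qed (use grid(2) um M in auto)
 let ?k = "%v r. killed C T (v, r) * L u (X (max 0 r) v)"
 let ?g = "%v r. indicator {0..<T} r * L u (X (max 0 r) v)"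
 have kint: "integrable (space_time x) (%p. killed C T p * L u (pos p))"
  by (rule L_space_time[OF u T0 killed_closed_measurable[OF C] killed_bounds(3)])
 have gint: "integrable (space_time x) (%p. abs (indicator {0..<T} (snd p) * L u (pos p)))"
  by (intro integrable_abs window_integrable[OF u]) simp
 have ae1: "AE v in P x. integrable lborel (%r. abs (?g v r))"
  using AE_integrable_fst'[OF gint[unfolded space_time_def]] by simp
 have ae2: "AE v in P x. integrable lborel (?k v)" using AE_integrable_fst'[OF kint[unfolded space_time_def]] by simp
 have Lm: "(%r. L u (X (max 0 r) v)) \<in> borel_measurable lborel" if "v \<in> Om" for v
 proof -
  have m: "(%r. X (max 0 r) v) \<in> borel_measurable lborel"
   using joint_measurable_comp[of "%_. v" lborel "%r. r"] that by simp
  show ?thesis by (rule measurable_compose[OF m L_measurable[OF u]])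
 qed
 have conv: "AE v in P x. (%n. drift_part u 0 (s n v) v) \<longlonglongrightarrow> (LINT r|lborel. ?k v r)"
  using ae1 ae2 AE_space
 proof eventually_elim
  case (elim v)
  hence v: "v \<in> Om" by simp
  show ?case unfolding drift_part_def[OF u]
  proof (rule integral_dominated_convergence[where w="%r. abs (?g v r)"])
   show "AE r in lborel. (%n. indicator {0..<s n v} r * L u (X (max 0 r) v)) \<longlonglongrightarrow> ?k v r"
    using AE_lborel_singleton[of "?q v"]
   proof eventually_elim
    case (elim r)
    consider "r < 0" | "0 <= r" "r < ?q v" | "?q v < r" "r < T" "0 <= r" | "T <= r" using elim by linarith
    thus ?case
    proof cases
     case 2
     hence "indicator {0..<s n v} r = (1::real)" for n using s_ge[OF v, of n] by (simp add: indicator_def)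
     moreover have "r < T" using 2 \<sigma>0(2)[of v] by simp
     hence "killed C T (v, r) = 1" using stay_iff_closed_exit[of r T v C] 2 v elim by (simp add: killed_def)
     ultimately show ?thesis by simp
    next
     case 3
     hence "killed C T (v, r) = 0" using stay_iff_closed_exit[of r T v C] v elim by (simp add: killed_def)
     moreover have "\<forall>\<^sub>F n in sequentially. indicator {0..<s n v} r * L u (X (max 0 r) v) = 0"
      using order_tendstoD(2)[OF s_lim[OF v] 3(1)] by (rule eventually_mono) simp
     ultimately show ?thesis by (simp add: tendsto_eventually)
    next
     case 4
     hence "indicator {0..<s n v} r = (0::real)" for n using sT[of n v] by (simp add: indicator_def)
     thus ?thesis using 4 by (simp add: killed_def)
    qed (simp add: killed_def)
   qed
   show "AE r in lborel. norm (indicator {0..<s n v} r * L u (X (max 0 r) v)) <= abs (?g v r)" for n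
    using sT[of n v] by (intro AE_I2) (auto simp: indicator_def)
   show "(%r. indicator {0..<s n v} r * L u (X (max 0 r) v)) \<in> borel_measurable lborel" for n
    using Lm[OF v] by measurable
  qed (use elim in auto)
 qed
 have bound: "AE v in P x. ALL n. abs (drift_part u 0 (s n v) v) <= (LINT r|lborel. abs (?g v r))" using ae1 AE_space
 proof eventually_elim
  case (elim v)
  hence i: "integrable lborel (%r. abs (?g v r))" and \<omega>': "v \<in> Om" by auto
  have "abs (drift_part u 0 (s n v) v) <= (LINT r|lborel. abs (?g v r))" for n unfolding drift_part_def[OF u]
  proof (rule order_trans[OF integral_abs_bound], rule integral_mono[OF _ i])
   show le: "abs (indicator {0..<s n v} r * L u (X (max 0 r) v)) <= abs (?g v r)" for r
    using sT[of n v] by (auto simp: indicator_def)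
   show "integrable lborel (%r. abs (indicator {0..<s n v} r * L u (X (max 0 r) v)))"
    using Lm[OF \<omega>'] le by (intro Bochner_Integration.integrable_bound[OF i]) auto
  qed
  thus ?case by blast
 qed
 have Lint: "(LINT v|P x. LINT r|lborel. ?k v r) = (LINT p|space_time x. killed C T p * L u (pos p))"
  using integral_fst'[OF kint[unfolded space_time_def]] by (simp add: space_time_def)
 have "(%n. LINT v|P x. drift_part u 0 (s n v) v) \<longlonglongrightarrow> (LINT v|P x. LINT r|lborel. ?k v r)"
 proof (rule integral_dominated_convergence[where w="%v. LINT r|lborel. abs (?g v r)"])
  show "integrable (P x) (%v. LINT r|lborel. abs (?g v r))"
   using integrable_fst'[OF gint[unfolded space_time_def]] by simp
  show "(%v. LINT r|lborel. ?k v r) \<in> borel_measurable (P x)"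
   using integrable_fst'[OF kint[unfolded space_time_def]] by auto
  show "(%v. drift_part u 0 (s n v) v) \<in> borel_measurable (P x)" for n using grid(3) by auto
  show "AE v in P x. norm (drift_part u 0 (s n v) v) <= (LINT r|lborel. abs (?g v r))" for n
   using bound by (rule eventually_mono) auto
 qed (rule conv)
 hence "(%n. u x + (LINT v|P x. drift_part u 0 (s n v) v)) \<longlonglongrightarrow> u x + (LINT p|space_time x. killed C T p * L u (pos p))"
  unfolding Lint by (intro tendsto_add tendsto_const)
 hence "(%n. LINT v|P x. u (X (s n v) v)) \<longlonglongrightarrow> u x + (LINT p|space_time x. killed C T p * L u (pos p))"
  using grid(1) by simp
 with \<open>(%n. LINT v|P x. u (X (s n v) v)) \<longlonglongrightarrow> (LINT v|P x. u (X (?q v) v))\<close>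
 show "(LINT v|P x. u (X (?q v) v)) = u x + (LINT p|space_time x. killed C T p * L u (pos p))" by (rule LIMSEQ_unique)
qed

end

section \<open>Dyadic cubes\<close>

definition didx :: "nat => real^'n => int^'n" where
 "didx k x = (\<chi> i. \<lfloor>2 ^ k * x $ i\<rfloor>)"

text \<open>As fibres of the index map, the half-open cubes of one level partition the space by
  construction.\<close>

definition dcube :: "nat => int^'n => (real^'n) set" where
 "dcube k q = {x. didx k x = q}"

definition dcorner :: "nat => int^'n => real^'n" where
 "dcorner k q = (\<chi> i. of_int (q $ i) / 2 ^ k)"

lemma mem_dcube: "x \<in> dcube k q \<longleftrightarrow> (ALL i. of_int (q $ i) / 2 ^ k <= x $ i & x $ i < (of_int (q $ i) + 1) / 2 ^ k)"
 by (auto simp: dcube_def didx_def vec_eq_iff floor_eq_iff field_simps)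

lemma mem_dcube_didx [simp]: "x \<in> dcube k (didx k x)" by (simp add: dcube_def)

lemma dcube_borel [measurable]: "dcube k q \<in> sets borel"
proof -
 have "dcube k q = {x. ALL i. of_int (q $ i) / 2 ^ k <= x \<bullet> axis i 1 & x \<bullet> axis i 1 < (of_int (q $ i) + 1) / 2 ^ k}"
  by (auto simp: mem_dcube inner_axis)
 thus ?thesis by simp
qed

lemma norm_diff_le_cube:
 fixes x y :: "real^'n"
 assumes "!!i. abs (x $ i - y $ i) <= h"
 shows "norm (x - y) <= sqrt CARD('n) * h"
proof -
 have h: "0 <= h" using assms[of undefined] by linarith
 have "(norm (x - y))^2 = (\<Sum>i\<in>UNIV. (x $ i - y $ i)^2)"
  unfolding power2_norm_eq_inner inner_vec_def by (simp add: power2_eq_square)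
 also have "... <= (\<Sum>i\<in>(UNIV::'n set). h^2)"
  using assms by (intro sum_mono) (metis abs_ge_zero power2_abs power_mono)
 also have "... = (sqrt CARD('n) * h)^2" by (simp add: power_mult_distrib)
 finally show ?thesis by (rule power2_le_imp_le) (use h in auto)
qed

lemma dcube_corner_dist: "x \<in> dcube k q ==> norm (x - dcorner k q) <= sqrt CARD('n) * (1 / 2 ^ k)" for x :: "real^'n"
proof (rule norm_diff_le_cube)
 fix i assume "x \<in> dcube k q"
 hence "of_int (q $ i) / 2 ^ k <= x $ i" "x $ i < of_int (q $ i) / 2 ^ k + 1 / 2 ^ k"
  by (auto simp: mem_dcube add_divide_distrib)
 thus "abs (x $ i - dcorner k q $ i) <= 1 / 2 ^ k" by (simp add: dcorner_def)
qed

lemma dcube_diameter: "x \<in> dcube k q ==> y \<in> dcube k q ==> norm (x - y) <= sqrt CARD('n) * (1 / 2 ^ k)" for x :: "real^'n"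
proof (rule norm_diff_le_cube)
 fix i assume "x \<in> dcube k q" "y \<in> dcube k q"
 hence "of_int (q $ i) / 2 ^ k <= x $ i" "x $ i < of_int (q $ i) / 2 ^ k + 1 / 2 ^ k"
  "of_int (q $ i) / 2 ^ k <= y $ i" "y $ i < of_int (q $ i) / 2 ^ k + 1 / 2 ^ k"
  by (auto simp: mem_dcube add_divide_distrib)
 thus "abs (x $ i - y $ i) <= 1 / 2 ^ k" by linarith
qed

lemma dcube_sandwich:
 fixes q :: "int^'n" and k :: nat
 defines "u == dcorner k (\<chi> i. q $ i + 1)"
 shows "box (dcorner k q) u <= dcube k q" "dcube k q <= cbox (dcorner k q) u"
 by (auto simp: mem_dcube mem_box_cart dcorner_def u_def less_imp_le)

lemma measure_dcube: "measure lborel (dcube k (q::int^'n)) = (1 / 2 ^ k) ^ CARD('n)"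
 and emeasure_dcube: "emeasure lborel (dcube k (q::int^'n)) = ennreal ((1 / 2 ^ k) ^ CARD('n))"
proof -
 let ?l = "dcorner k q" and ?u = "dcorner k (\<chi> i. q $ i + 1)"
 have le: "ALL b:Basis. ?l \<bullet> b <= ?u \<bullet> b"
  by (auto simp: Basis_vec_def inner_axis dcorner_def divide_right_mono)
 have "(\<Prod>b\<in>Basis. (?u - ?l) \<bullet> b) = (\<Prod>b\<in>(Basis::(real^'n) set). 1 / 2 ^ k)"
  by (intro prod.cong) (auto simp: Basis_vec_def inner_axis dcorner_def field_simps)
 hence p: "(\<Prod>b\<in>Basis. (?u - ?l) \<bullet> b) = (1 / 2 ^ k) ^ CARD('n)" by simp
 have "emeasure lborel (dcube k q) <= emeasure lborel (cbox ?l ?u)"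
  using dcube_sandwich[of k q] by (intro emeasure_mono) auto
 moreover have "emeasure lborel (box ?l ?u) <= emeasure lborel (dcube k q)"
  using dcube_sandwich[of k q] by (intro emeasure_mono) auto
 ultimately show e: "emeasure lborel (dcube k q) = ennreal ((1 / 2 ^ k) ^ CARD('n))"
  using le p by (simp add: emeasure_lborel_cbox_eq emeasure_lborel_box_eq)
 thus "measure lborel (dcube k q) = (1 / 2 ^ k) ^ CARD('n)" by (simp add: measure_def)
qed

lemma dcube_eventually_subset_open:
 fixes x :: "real^'n"
 assumes "open U" "x \<in> U"
 shows "\<forall>\<^sub>F k in sequentially. dcube k (didx k x) <= U"
proof -
 obtain e where e: "e > 0" "ball x e <= U" using assms open_contains_ball by blast
 have "(%k. sqrt CARD('n) * (1 / 2) ^ k) \<longlonglongrightarrow> sqrt CARD('n) * 0"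
  by (intro tendsto_intros LIMSEQ_power_zero) auto
 hence "\<forall>\<^sub>F k in sequentially. sqrt CARD('n) * (1 / 2) ^ k < e"
  using order_tendstoD(2)[of _ "sqrt CARD('n) * 0" sequentially e] e by simp
 thus ?thesis
 proof (rule eventually_mono, intro subsetI)
  fix k y assume k: "sqrt CARD('n) * (1 / 2) ^ k < e" and y: "y \<in> dcube k (didx k x)"
  have "norm (x - y) <= sqrt CARD('n) * (1 / 2 ^ k)" by (rule dcube_diameter[OF mem_dcube_didx y])
  thus "y \<in> U" using k e by (intro subsetD[OF e(2)]) (simp add: dist_norm power_one_over)
 qed
qed

lemma finite_vec_set:
 assumes "finite S"
 shows "finite {q :: 'a^'n. ALL l. q $ l \<in> S}"
proof (rule finite_subset)
 show "{q :: 'a^'n. ALL l. q $ l \<in> S} <= vec_lambda ` (Pi\<^sub>E UNIV (%_. S))"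
  by (auto simp: PiE_UNIV_domain intro!: image_eqI[of _ _ "vec_nth _"])
 show "finite (vec_lambda ` (Pi\<^sub>E (UNIV :: 'n set) (%_. S)))"
  using assms by (intro finite_imageI finite_PiE) auto
qed

definition dstep :: "nat => (int^'n) set => (int^'n => real) => real^'n => real" where
 "dstep k I F x = (if didx k x \<in> I then F (didx k x) else 0)"

lemma dstep_eq_sum: "finite I ==> dstep k I F x = (\<Sum>q\<in>I. F q * indicator (dcube k q) x)"
 unfolding dstep_def dcube_def by (auto simp: indicator_def sum.delta' if_distrib[of "%c. _ * c"] cong: if_cong)

lemma dstep_measurable: "finite I ==> dstep k I F \<in> borel_measurable borel"
proof -
 assume "finite I"
 hence "dstep k I F = (%x. \<Sum>q\<in>I. F q * indicator (dcube k q) x)" using dstep_eq_sum by blast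
 also have "... \<in> borel_measurable borel"
  by (intro borel_measurable_sum borel_measurable_times borel_measurable_indicator) auto
 finally show ?thesis .
qed

text \<open>A finite measure need not be absolutely continuous, so a Borel function is dominated from
 above by open level sets, whose indicators are limits of dyadic step functions everywhere.\<close>

lemma lorentz_bound_from_steps:
 fixes y :: "(real^'n) measure" and f :: "real^'n => real"
 assumes y: "sets y = sets borel" and c: "0 <= c"
  and step: "!!k I F. finite I ==> (!!q. q \<in> I ==> 0 < F q) ==>
   (\<integral>\<^sup>+x. ennreal (dstep k I F x) \<partial>y) <= ennreal (c * root CARD('n) (\<Sum>q\<in>I. (F q * (1 / 2 ^ k)) ^ CARD('n)))"
  and f[measurable]: "f \<in> borel_measurable borel" and f0: "!!x. 0 <= f x"
  and int: "integrable lborel (%x. f x ^ CARD('n))"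
 shows "(\<integral>\<^sup>+x. ennreal (f x) \<partial>y) <= ennreal (2 * c * root CARD('n) (LINT x|lborel. f x ^ CARD('n)))"
proof -
 let ?d = "CARD('n)"
 define J where "J = (LINT x|lborel. f x ^ ?d)"
 have J: "0 <= J" unfolding J_def using f0 by (intro integral_nonneg_AE) auto
 \<comment> \<open>All integer powers of 2, enumerated by the natural numbers.\<close>
 define v :: "nat => real" where "v i = 2 powr of_int (int_decode i)" for i
 have v: "v i > 0" for i by (simp add: v_def)
 \<comment> \<open>On this level set \<open>2 * v i\<close> dominates \<open>f\<close> and is less
   than \<open>2 * f\<close>, which is the factor 2 of the conclusion.\<close>
 define E where "E i = {x. v i < f x & f x <= 2 * v i}" for i
 have E[measurable]: "E i \<in> sets borel" for i unfolding E_def by measurable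
 have Efin: "emeasure lborel (E i) < \<infinity>" for i
 proof -
  have "integrable lborel (%x. indicator (E i) x :: real)"
  proof (rule Bochner_Integration.integrable_bound[OF integrable_mult_right[OF int, of "1 / v i ^ ?d"]])
   show "AE x in lborel. norm (indicator (E i) x :: real) <= norm (1 / v i ^ ?d * f x ^ ?d)"
   proof (rule AE_I2)
    fix x
    have "v i ^ ?d <= f x ^ ?d" if "x \<in> E i" using that v[of i] by (intro power_mono) (auto simp: E_def)
    thus "norm (indicator (E i) x :: real) <= norm (1 / v i ^ ?d * f x ^ ?d)"
     using v[of i] f0[of x] by (auto simp: indicator_def)
   qed
  qed auto
  thus ?thesis by (simp add: integrable_indicator_iff)
 qed
 have cover: "EX i. x \<in> E i" if "f x > 0" for x
 proof
  define j where "j = \<lceil>log 2 (f x)\<rceil> - 1"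
  have "of_int j < log 2 (f x)" "log 2 (f x) <= of_int j + 1" unfolding j_def by linarith+
  hence "2 powr of_int j < f x" "f x <= 2 powr (of_int j + 1)" using that by (auto simp: less_log_iff log_le_iff)
  thus "x \<in> E (int_encode j)" by (simp add: E_def v_def powr_add)
 qed
 have disj: "E i Int E k = {}" if "i ~= k" for i k
 proof (rule ccontr)
  assume "E i Int E k ~= {}"
  then obtain x where x: "v i < 2 * v k" "v k < 2 * v i" by (fastforce simp: E_def)
  have lt: "int_decode a <= int_decode b" if "v a < 2 * v b" for a b
  proof -
   have "(2::real) powr of_int (int_decode a) < 2 powr (of_int (int_decode b) + 1)"
    using that by (simp add: v_def powr_add)
   hence "real_of_int (int_decode a) < of_int (int_decode b) + 1" by simp
   thus ?thesis by linarith
  qed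
  have "int_decode i = int_decode k" using lt[OF x(1)] lt[OF x(2)] by simp
  thus False using that by (simp add: int_decode_eq)
 qed
 have fin: "(\<Sum>i<n. v i ^ ?d * measure lborel (E i)) <= J" for n
 proof -
  have "(\<Sum>i<n. v i ^ ?d * measure lborel (E i)) = (\<Sum>i<n. LINT x|lborel. v i ^ ?d * indicator (E i) x)" by simp
  also have "... = (LINT x|lborel. (\<Sum>i<n. v i ^ ?d * indicator (E i) x))"
   using Efin by (intro Bochner_Integration.integral_sum[symmetric] integrable_mult_right integrable_real_indicator) auto
  also have "... <= J" unfolding J_def
  proof (rule integral_mono[OF _ int])
   show "integrable lborel (%x. \<Sum>i<n. v i ^ ?d * indicator (E i) x)"
    using Efin by (intro Bochner_Integration.integrable_sum integrable_mult_right integrable_real_indicator) auto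
   fix x
   show "(\<Sum>i<n. v i ^ ?d * indicator (E i) x) <= f x ^ ?d"
   proof (cases "EX k<n. x \<in> E k")
    case True
    then obtain k where k: "k < n" "x \<in> E k" by blast
    have "(\<Sum>i<n. v i ^ ?d * indicator (E i) x) = (\<Sum>i<n. if i = k then v k ^ ?d else 0)"
     using k disj by (intro sum.cong) (auto simp: indicator_def)
    also have "... = v k ^ ?d" using k by simp
    also have "... <= f x ^ ?d" using k v[of k] by (intro power_mono) (auto simp: E_def)
    finally show ?thesis .
   next
    case False
    hence "(\<Sum>i<n. v i ^ ?d * indicator (E i) x) = 0" by (intro sum.neutral) auto
    thus ?thesis using f0[of x] by simp
   qed
  qed
  finally show ?thesis .
 qed
 have main: "(\<integral>\<^sup>+x. ennreal (f x) \<partial>y) <= ennreal (c * root ?d (2 ^ ?d * J + 2 * h))" if h: "0 < h" for h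
 proof -
  \<comment> \<open>Outer regularity, with the excess weighted so that its total over all
    \<open>i\<close> is at most \<open>2 * h\<close>.\<close>
  have "EX U. open U & E i <= U & emeasure lborel U < \<infinity> & (2 * v i) ^ ?d * measure lborel U <= (2 * v i) ^ ?d * measure lborel (E i) + h * (1 / 2) ^ i" for i
  proof -
   define e where "e = h * (1 / 2) ^ i / (2 * v i) ^ ?d"
   have e: "e > 0" using h v[of i] by (simp add: e_def)
   obtain U where U: "open U" "E i <= U" "emeasure lborel (U - E i) < ennreal e"
    using outer_regular_lborel[OF E e] by blast
   have Um: "U \<in> sets lborel" using U by simp
   have "emeasure lborel U = emeasure lborel (E i) + emeasure lborel (U - E i)"
    using U Um by (subst plus_emeasure) (auto intro!: arg_cong[where f="emeasure lborel"])
   also have "... <= emeasure lborel (E i) + ennreal e" using U by (intro add_left_mono) auto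
   also have "... = ennreal (measure lborel (E i) + e)"
    using Efin[of i] e by (simp add: emeasure_eq_ennreal_measure ennreal_plus)
   finally have le: "emeasure lborel U <= ennreal (measure lborel (E i) + e)" .
   hence "emeasure lborel U < \<infinity>" by (simp add: order_le_less_trans)
   have "measure lborel U <= enn2real (ennreal (measure lborel (E i) + e))"
    unfolding measure_def[of _ U] by (rule enn2real_mono[OF le]) (rule ennreal_less_top)
   hence "measure lborel U <= measure lborel (E i) + e" using e by (subst (asm) enn2real_ennreal) auto
   hence "(2 * v i) ^ ?d * measure lborel U <= (2 * v i) ^ ?d * (measure lborel (E i) + e)"
    using v[of i] by (intro mult_left_mono) auto
   also have "... = (2 * v i) ^ ?d * measure lborel (E i) + h * (1 / 2) ^ i"
    using v[of i] by (simp add: e_def distrib_left)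
   finally show ?thesis using U \<open>emeasure lborel U < \<infinity>\<close> by blast
  qed
  then obtain U where U: "!!i. open (U i)" "!!i. E i <= U i" "!!i. emeasure lborel (U i) < \<infinity>"
   "!!i. (2 * v i) ^ ?d * measure lborel (U i) <= (2 * v i) ^ ?d * measure lborel (E i) + h * (1 / 2) ^ i" by metis
  \<comment> \<open>Only the first \<open>n\<close> level sets and a bounded range of indices are
    used, which keeps the step function finite; every point is reached as \<open>n\<close>
    grows.\<close>
  define I where "I n = {q :: int^'n. (ALL l. abs (q $ l) <= int n * 2 ^ n) & (EX i<n. dcube n q <= U i)}" for n
  define G where "G n q = Max {2 * v i | i. i < n & dcube n q <= U i}" for n and q :: "int^'n"
  have finI: "finite (I n)" for n
  proof -
   have fin0: "finite {q :: int^'n. ALL l. q $ l \<in> {- (int n * 2 ^ n)..int n * 2 ^ n}}"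
    by (rule finite_vec_set) simp
   have bd: "- (int n * 2 ^ n) <= a & a <= int n * 2 ^ n" if "abs a <= int n * 2 ^ n" for a using that by linarith
   show ?thesis by (rule rev_finite_subset[OF fin0]) (use bd in \<open>auto simp: I_def\<close>)
  qed
  have finG: "finite {2 * v i | i. i < n & dcube n q <= U i}" for n and q :: "int^'n" by simp
  have G_ge: "2 * v i <= G n q" if "i < n" "dcube n q <= U i" for i n q
   unfolding G_def using that by (intro Max_ge) auto
  have G_ex: "EX i<n. dcube n q <= U i & G n q = 2 * v i" if "q \<in> I n" for n q
   using Max_in[OF finG, of n q] that unfolding G_def[symmetric] by (auto simp: I_def)
  have G0: "0 < G n q" if "q \<in> I n" for n q using G_ex[OF that] v by auto
  have sumI: "(\<Sum>q\<in>I n. (G n q * (1 / 2 ^ n)) ^ ?d) <= 2 ^ ?d * J + 2 * h" for n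
  proof -
   have "(\<Sum>q\<in>I n. (G n q * (1 / 2 ^ n)) ^ ?d) <= (\<Sum>q\<in>I n. \<Sum>i<n. (2 * v i) ^ ?d * (if dcube n q <= U i then (1 / 2 ^ n) ^ ?d else 0))"
   proof (rule sum_mono)
    fix q assume "q \<in> I n"
    from G_ex[OF this] obtain i where i: "i < n" "dcube n q <= U i" "G n q = 2 * v i" by blast
    have "(G n q * (1 / 2 ^ n)) ^ ?d = (2 * v i) ^ ?d * (if dcube n q <= U i then (1 / 2 ^ n) ^ ?d else 0)"
     using i by (simp add: power_mult_distrib power_divide)
    also have "... <= (\<Sum>i<n. (2 * v i) ^ ?d * (if dcube n q <= U i then (1 / 2 ^ n) ^ ?d else 0))"
     using i less_imp_le[OF v] by (intro member_le_sum) auto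
    finally show "(G n q * (1 / 2 ^ n)) ^ ?d <= (\<Sum>i<n. (2 * v i) ^ ?d * (if dcube n q <= U i then (1 / 2 ^ n) ^ ?d else 0))" .
   qed
   also have "... = (\<Sum>i<n. (2 * v i) ^ ?d * (\<Sum>q\<in>I n. if dcube n q <= U i then (1 / 2 ^ n) ^ ?d else 0))"
    by (subst sum.swap) (simp add: sum_distrib_left)
   also have "... <= (\<Sum>i<n. (2 * v i) ^ ?d * measure lborel (U i))"
   proof (intro sum_mono mult_left_mono)
    fix i
    let ?Q = "{q \<in> I n. dcube n q <= U i}"
    have fQ: "finite ?Q" using finI by simp
    have "(\<Sum>q\<in>I n. if dcube n q <= U i then (1 / 2 ^ n) ^ ?d else 0) = (\<Sum>q\<in>?Q. measure lborel (dcube n q))"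
     by (simp only: measure_dcube sum.inter_filter[OF finI])
    also have "... = measure lborel (\<Union>q\<in>?Q. dcube n q)"
     using fQ by (intro measure_finite_Union[symmetric]) (auto simp: disjoint_family_on_def emeasure_dcube, auto simp: dcube_def)
    also have "... <= measure lborel (U i)"
     using U(1,3)[of i] by (intro measure_mono_fmeasurable) (auto intro!: fmeasurableI)
    finally show "(\<Sum>q\<in>I n. if dcube n q <= U i then (1 / 2 ^ n) ^ ?d else 0) <= measure lborel (U i)" .
    show "0 <= (2 * v i) ^ ?d" using v[of i] by simp
   qed
   also have "... <= (\<Sum>i<n. (2 * v i) ^ ?d * measure lborel (E i) + h * (1 / 2) ^ i)" by (intro sum_mono U)
   also have "... = 2 ^ ?d * (\<Sum>i<n. v i ^ ?d * measure lborel (E i)) + h * (\<Sum>i<n. (1 / 2) ^ i)"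
    by (simp add: sum.distrib sum_distrib_left power_mult_distrib mult_ac)
   also have "... <= 2 ^ ?d * J + h * 2"
   proof (intro add_mono mult_left_mono fin)
    have "(\<Sum>i<n. (1 / 2 :: real) ^ i) = 2 - 2 * (1 / 2) ^ n" by (induction n) auto
    thus "(\<Sum>i<n. (1 / 2 :: real) ^ i) <= 2" by (simp only:) simp
   qed (use h in auto)
   finally show ?thesis by (simp add: mult.commute)
  qed
  \<comment> \<open>Openness of the sets \<open>U i\<close> is used here: around a point of
    \<open>E i\<close> the dyadic cubes eventually lie in \<open>U i\<close>.\<close>
  have lim: "ennreal (f x) <= liminf (%n. ennreal (dstep n (I n) (G n) x))" for x
  proof (cases "f x > 0")
   case True
   then obtain i where i: "x \<in> E i" using cover by blast
   hence "\<forall>\<^sub>F n in sequentially. dcube n (didx n x) <= U i"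
    using U by (intro dcube_eventually_subset_open) auto
   moreover have "\<forall>\<^sub>F n in sequentially. i < n" by (rule eventually_gt_at_top)
   moreover obtain m :: nat where m: "norm x + 1 <= real m" using real_arch_simple by blast
   have "\<forall>\<^sub>F n in sequentially. m <= n" by (rule eventually_ge_at_top)
   ultimately have "\<forall>\<^sub>F n in sequentially. ennreal (f x) <= ennreal (dstep n (I n) (G n) x)"
   proof eventually_elim
    case (elim n)
    have "abs (didx n x $ l) <= int n * 2 ^ n" for l
    proof -
     have xl: "abs (x $ l) + 1 <= real n" using component_le_norm_cart[of x l] m elim by linarith
     have p: "1 <= (2::real) ^ n" by simp
     have "abs (real_of_int \<lfloor>2 ^ n * x $ l\<rfloor>) <= abs (2 ^ n * x $ l) + 1" by linarith
     also have "... <= 2 ^ n * abs (x $ l) + 2 ^ n" using p by (simp add: abs_mult)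
     also have "... = 2 ^ n * (abs (x $ l) + 1)" by (simp add: distrib_left)
     also have "... <= 2 ^ n * real n" using xl by (intro mult_left_mono) auto
     finally have "real_of_int \<bar>\<lfloor>2 ^ n * x $ l\<rfloor>\<bar> <= real_of_int (int n * 2 ^ n)" by (simp add: mult.commute)
     thus ?thesis unfolding didx_def of_int_le_iff by simp
    qed
    hence "didx n x \<in> I n" using elim by (auto simp: I_def)
    hence "dstep n (I n) (G n) x = G n (didx n x)" by (simp add: dstep_def)
    moreover have "2 * v i <= G n (didx n x)" using elim by (intro G_ge) auto
    ultimately show ?case using i by (intro ennreal_leI) (simp add: E_def)
   qed
   thus ?thesis by (rule Liminf_bounded)
  qed (use f0[of x] in simp)
  have "(\<integral>\<^sup>+x. ennreal (f x) \<partial>y) <= (\<integral>\<^sup>+x. liminf (%n. ennreal (dstep n (I n) (G n) x)) \<partial>y)"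
   by (intro nn_integral_mono lim)
  also have "... <= liminf (%n. \<integral>\<^sup>+x. ennreal (dstep n (I n) (G n) x) \<partial>y)"
  proof (rule nn_integral_liminf)
   fix n
   have "dstep n (I n) (G n) \<in> borel_measurable y"
    using dstep_measurable[OF finI] by (simp add: measurable_cong_sets[OF y refl])
   thus "(%x. ennreal (dstep n (I n) (G n) x)) \<in> borel_measurable y" by measurable
  qed
  also have "... <= liminf (%n. ennreal (c * root ?d (2 ^ ?d * J + 2 * h)))"
  proof (intro Liminf_mono always_eventually allI)
   fix n
   have "(\<integral>\<^sup>+x. ennreal (dstep n (I n) (G n) x) \<partial>y) <= ennreal (c * root ?d (\<Sum>q\<in>I n. (G n q * (1 / 2 ^ n)) ^ ?d))"
    by (rule step[OF finI G0])
   also have "... <= ennreal (c * root ?d (2 ^ ?d * J + 2 * h))"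
    using sumI[of n] c by (intro ennreal_leI mult_left_mono) auto
   finally show "(\<integral>\<^sup>+x. ennreal (dstep n (I n) (G n) x) \<partial>y) <= ennreal (c * root ?d (2 ^ ?d * J + 2 * h))" .
  qed
  also have "... = ennreal (c * root ?d (2 ^ ?d * J + 2 * h))" by (simp add: Liminf_const)
  finally show ?thesis .
 qed
 have "(%n. ennreal (c * root ?d (2 ^ ?d * J + 2 * inverse (real (Suc n))))) \<longlonglongrightarrow> ennreal (c * root ?d (2 ^ ?d * J + 2 * 0))"
  by (intro tendsto_ennrealI tendsto_intros LIMSEQ_inverse_real_of_nat)
 hence "(\<integral>\<^sup>+x. ennreal (f x) \<partial>y) <= ennreal (c * root ?d (2 ^ ?d * J + 2 * 0))"
  by (rule LIMSEQ_le_const) (auto intro!: main)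
 also have "c * root ?d (2 ^ ?d * J + 2 * 0) = 2 * c * root ?d J" by (simp add: real_root_mult real_root_power_cancel)
 finally show ?thesis by (simp add: J_def)
qed

section \<open>Krylov's estimate for small drift\<close>

locale Ld_quasi_diffusion = elliptic_quasi_diffusion X F P a b ell
 for X :: "real => 'w => real^'n" and F P a b ell +
 assumes b_Ld: "integrable lborel (%x. norm (b x) ^ CARD('n))"
begin

text \<open>The \<open>d\<close>-th power of the norm rather than the norm itself, because it is
  additive over disjoint sets.\<close>

definition local_drift :: "(real^'n) set => real" where
 "local_drift W = (LINT x|lborel. (indicator W x * norm (b x)) ^ CARD('n))"

lemma local_drift_integrable:
 assumes "W \<in> sets borel"
 shows "integrable lborel (%x. (indicator W x * norm (b x)) ^ CARD('n))"
 by (rule Bochner_Integration.integrable_bound[OF b_Ld]) (use assms in \<open>auto simp: indicator_def zero_power\<close>)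

lemma local_drift_mono:
 assumes "V <= W" "V \<in> sets borel" "W \<in> sets borel"
 shows "local_drift V <= local_drift W" unfolding local_drift_def using assms
 by (intro integral_mono local_drift_integrable) (auto simp: indicator_def zero_power)

lemma local_drift_nonneg: "0 <= local_drift W" unfolding local_drift_def by (intro integral_nonneg_AE AE_I2) simp

definition abp_norm :: real where
 "abp_norm = root CARD('n) (abp_const CARD('n)) / ell"

lemma abp_const_pos: "0 < abp_const CARD('n)" by (simp add: abp_const_def)

lemma abp_norm_pos: "0 < abp_norm" using abp_const_pos ell by (simp add: abp_norm_def)

lemma pos_measurable: "f \<in> borel_measurable borel ==> (%p. f (pos p)) \<in> borel_measurable (space_time x)"
 by (rule measurable_compose[OF space_time_X])

lemma killed_pos: "killed C T p ~= 0 ==> pos p \<in> C"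
 by (auto simp: killed_def stay_def indicator_def split: if_splits)

lemma killed_integrable:
 assumes C: "closed C" and f: "f \<in> borel_measurable borel" "!!y. abs (f y) <= B"
 shows "integrable (space_time x) (%p. killed C T p * f (pos p))"
proof (rule Bochner_Integration.integrable_bound[OF integrable_mult_right[where c=B, OF time_space_time]])
 show "(%p. killed C T p * f (pos p)) \<in> borel_measurable (space_time x)"
  by (intro borel_measurable_times killed_closed_measurable[OF C] pos_measurable f)
 show "AE p in space_time x. norm (killed C T p * f (pos p)) <= norm (B * indicator {0..T} (snd p))"
 proof (rule AE_I2)
  fix p
  have "0 <= B" using f(2)[of undefined] by linarith
  have "abs (killed C T p) * abs (f (pos p)) <= indicator {0..T} (snd p) * B"
   by (intro mult_mono killed_bounds f) auto
  thus "norm (killed C T p * f (pos p)) <= norm (B * indicator {0..T} (snd p))"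
   using \<open>0 <= B\<close> by (simp add: abs_mult mult.commute)
 qed
qed

lemma killed_drift_integrable:
 assumes C: "closed C" and T: "0 <= T"
 shows "integrable (space_time x) (%p. killed C T p * norm (b (pos p)))"
proof (rule Bochner_Integration.integrable_bound[OF drift_space_time[OF T]])
 have [measurable]: "(%y. norm (b y)) \<in> borel_measurable borel" by measurable
 show "(%p. killed C T p * norm (b (pos p))) \<in> borel_measurable (space_time x)"
  by (intro borel_measurable_times killed_closed_measurable[OF C] pos_measurable) simp
 show "AE p in space_time x. norm (killed C T p * norm (b (pos p))) <= norm (indicator {0..T} (snd p) * norm (b (pos p)))"
  using killed_bounds(3)[of C T] by (intro AE_I2) (auto simp: abs_mult intro!: mult_right_mono)
qed

context
 fixes z :: "real^'n" and r T :: real and x :: "real^'n"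
 assumes r: "0 < r" and T: "0 < T" and x: "x \<in> cball z r"
begin

abbreviation "zball == cball z r"

definition drift_time :: real where
 "drift_time = (LINT p|space_time x. killed zball T p * norm (b (pos p)))"

lemma drift_time_nonneg: "0 <= drift_time"
 unfolding drift_time_def by (intro integral_nonneg_AE AE_I2 mult_nonneg_nonneg killed_bounds) auto

text \<open>The horizon \<open>T\<close> keeps this measure finite; absolute continuity is not known
  at this stage.\<close>

definition occupation :: "(real^'n) measure" where
 "occupation = distr (density (space_time x) (%p. ennreal (killed zball T p))) borel pos"

lemma nn_integral_occupation:
 assumes f: "f \<in> borel_measurable borel"
 shows "(\<integral>\<^sup>+y. f y \<partial>occupation) = (\<integral>\<^sup>+p. ennreal (killed zball T p) * f (pos p) \<partial>space_time x)"
proof -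
 have k: "(%p. ennreal (killed zball T p)) \<in> borel_measurable (space_time x)"
  using killed_closed_measurable[of zball T x] by simp
 have "(\<integral>\<^sup>+y. f y \<partial>occupation) = (\<integral>\<^sup>+p. f (pos p) \<partial>density (space_time x) (%p. ennreal (killed zball T p)))"
  unfolding occupation_def using f space_time_X[of x]
  by (intro nn_integral_distr) (auto simp: measurable_cong_sets[OF sets_density refl])
 also have "... = (\<integral>\<^sup>+p. ennreal (killed zball T p) * f (pos p) \<partial>space_time x)"
  by (rule nn_integral_density[OF k measurable_compose[OF space_time_X f]])
 finally show ?thesis .
qed

lemma closed_exit_AE: "AE w in P x. X (closed_exit zball T w) w \<in> zball" using AE_start AE_space
proof eventually_elim
 case (elim w)
 thus ?case using closed_exit_in[of zball T w] T x by auto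
qed

text \<open>Dynkin's formula for the test function: \<open>U\<close> changes by at most
  \<open>2 r s\<close> between the starting and the stopped position, while on the ball
  \<open>L U\<close> dominates \<open>ell\<close> times the step function minus
  \<open>s |b|\<close>. The last term leaves \<open>drift_time\<close> on the right.\<close>

lemma abp_steps:
 assumes I: "finite I" and wt: "!!q. q \<in> I ==> 0 < wt q"
 shows "(\<integral>\<^sup>+y. ennreal (dstep k I wt y) \<partial>occupation) <=
  ennreal (abp_norm * (2 * r + drift_time) * root CARD('n) (\<Sum>q\<in>I. (wt q * (1 / 2 ^ k)) ^ CARD('n)))"
proof (cases "I = {}")
 case True
 thus ?thesis by (simp add: dstep_def)
next
 case False
 let ?d = "CARD('n)" and ?h = "1 / 2 ^ k :: real"
 let ?S = "\<Sum>q\<in>I. (wt q * ?h) ^ ?d"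
 obtain U s where U: "C2_compact_support U" and s: "0 <= s" "s ^ ?d = abp_const ?d * ?S"
  and lip: "!!x x'. x \<in> zball ==> x' \<in> zball ==> \<bar>U x - U x'\<bar> <= s * norm (x - x')"
  and L0: "!!(a :: real^'n => real^'n^'n) b x ell. x \<in> zball ==> 0 < ell ==> a x \<in> ellipticity_class ell ==>
   - norm (b x) * s <= diffusion_operator a b U x"
  and L1: "!!(a :: real^'n => real^'n^'n) b x ell q. x \<in> zball ==> 0 < ell ==> a x \<in> ellipticity_class ell ==> q \<in> I ==>
   norm (x - dcorner k q) <= sqrt ?d * ?h ==> ell * wt q - norm (b x) * s <= diffusion_operator a b U x"
  by (rule ABP_test_function[where y="dcorner k" and F=wt and h="?h" and z=z and \<rho>=r, OF I False wt _ less_imp_le[OF r]])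
   (assumption, simp, rule that, assumption+)
 have sr: "s = root ?d (abp_const ?d) * root ?d ?S"
 proof -
  have "s = root ?d (s ^ ?d)" using s(1) by (simp add: real_root_power_cancel)
  thus ?thesis using s(2) by (simp add: real_root_mult)
 qed
 let ?f = "dstep k I wt"
 have f0: "0 <= ?f y" for y using wt by (auto simp: dstep_def less_imp_le)
 have fm: "?f \<in> borel_measurable borel" by (rule dstep_measurable[OF I])
 have fb: "abs (?f y) <= (\<Sum>q\<in>I. wt q)" for y
 proof -
  have nn: "0 <= wt q" if "q \<in> I" for q using wt[OF that] by simp
  have "wt q <= (\<Sum>q\<in>I. wt q)" if "q \<in> I" for q using nn that I by (intro member_le_sum) auto
  thus ?thesis using nn sum_nonneg[of I wt] by (auto simp: dstep_def)
 qed
 have fint: "integrable (space_time x) (%p. killed zball T p * ?f (pos p))"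
  by (rule killed_integrable[OF closed_cball fm fb])
 have bint: "integrable (space_time x) (%p. killed zball T p * norm (b (pos p)))"
  using T by (intro killed_drift_integrable) auto
 have LU: "ell * ?f y - s * norm (b y) <= L U y" if "y \<in> zball" for y
  using L0[OF that ell elliptic, of b] L1[OF that ell elliptic _ dcube_corner_dist[OF mem_dcube_didx], of b]
  by (auto simp: dstep_def mult.commute)
 have "ell * (LINT p|space_time x. killed zball T p * ?f (pos p)) - s * drift_time
  = (LINT p|space_time x. killed zball T p * (ell * ?f (pos p) - s * norm (b (pos p))))"
  unfolding drift_time_def using fint bint by (simp add: right_diff_distrib mult.left_commute)
 also have "... <= (LINT p|space_time x. killed zball T p * L U (pos p))"
 proof (rule integral_mono)
  show "integrable (space_time x) (%p. killed zball T p * (ell * ?f (pos p) - s * norm (b (pos p))))"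
   using fint bint by (simp add: right_diff_distrib mult.left_commute[of "killed zball T _"])
  show "integrable (space_time x) (%p. killed zball T p * L U (pos p))"
   using T by (intro L_space_time[OF U _ killed_closed_measurable killed_bounds(3)]) auto
  show "killed zball T p * (ell * ?f (pos p) - s * norm (b (pos p))) <= killed zball T p * L U (pos p)" for p
   using LU[of "pos p"] killed_pos[of zball T p] killed_bounds(1)[of zball T p]
   by (cases "killed zball T p = 0") (auto intro!: mult_left_mono)
 qed
 also have "... = (LINT w|P x. U (X (closed_exit zball T w) w)) - U x"
  using dynkin_closed_exit(1)[OF U _ T, of zball x] by simp
 also have "... <= s * (2 * r)"
 proof -
  have "AE w in P x. U (X (closed_exit zball T w) w) <= U x + s * (2 * r)" using closed_exit_AE
  proof eventually_elim
   case (elim w)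
   have "norm (X (closed_exit zball T w) w - x) <= 2 * r"
    using elim x dist_triangle_le[of "X (closed_exit zball T w) w" z x "2 * r"] by (simp add: dist_norm norm_minus_commute)
   hence "s * norm (X (closed_exit zball T w) w - x) <= s * (2 * r)" using s by (intro mult_left_mono)
   thus ?case using lip[OF elim x] by linarith
  qed
  moreover obtain M where M: "0 <= M" "!!x. abs (L U x) <= M * (1 + norm (b x))" "!!x. abs (U x) <= M"
   by (rule L_bound[OF U]) (rule that, (assumption | blast)+)
  moreover have "integrable (P x) (%w. U (X (closed_exit zball T w) w))"
   using M dynkin_closed_exit(2)[OF U _ T, of zball x] by (intro Px.integrable_const_bound[where B=M]) auto
  ultimately have "(LINT w|P x. U (X (closed_exit zball T w) w)) <= U x + s * (2 * r)" by (intro Px.integral_le_const)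
  thus ?thesis by simp
 qed
 finally have "ell * (LINT p|space_time x. killed zball T p * ?f (pos p)) <= s * (2 * r + drift_time)"
  by (simp add: algebra_simps)
 hence 1: "(LINT p|space_time x. killed zball T p * ?f (pos p)) <= abp_norm * (2 * r + drift_time) * root ?d ?S"
  using ell by (simp add: sr abp_norm_def field_simps)
 have "(\<integral>\<^sup>+y. ennreal (?f y) \<partial>occupation) = (\<integral>\<^sup>+p. ennreal (killed zball T p * ?f (pos p)) \<partial>space_time x)"
  using fm f0 killed_bounds(1) by (subst nn_integral_occupation) (auto simp: ennreal_mult)
 also have "... = ennreal (LINT p|space_time x. killed zball T p * ?f (pos p))"
  using f0 killed_bounds(1) by (intro nn_integral_eq_integral[OF fint]) auto
 also have "... <= ennreal (abp_norm * (2 * r + drift_time) * root ?d ?S)" using 1 by (rule ennreal_leI)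
 finally show ?thesis .
qed

lemma abp_drift:
 assumes f: "f \<in> borel_measurable borel" "!!y. 0 <= f y" "integrable lborel (%y. f y ^ CARD('n))"
 shows "(\<integral>\<^sup>+p. ennreal (killed zball T p * f (pos p)) \<partial>space_time x) <=
  ennreal (2 * (abp_norm * (2 * r + drift_time)) * root CARD('n) (LINT y|lborel. f y ^ CARD('n)))"
proof -
 have "(\<integral>\<^sup>+p. ennreal (killed zball T p * f (pos p)) \<partial>space_time x) = (\<integral>\<^sup>+y. ennreal (f y) \<partial>occupation)"
  using f killed_bounds(1) by (subst nn_integral_occupation) (auto simp: ennreal_mult)
 also have "... <= ennreal (2 * (abp_norm * (2 * r + drift_time)) * root CARD('n) (LINT y|lborel. f y ^ CARD('n)))"
  using r abp_norm_pos drift_time_nonneg by (intro lorentz_bound_from_steps f abp_steps) (auto simp: occupation_def)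
 finally show ?thesis .
qed

lemma killed_drift_indicator: "killed zball T p * norm (b (pos p)) = killed zball T p * (indicator zball (pos p) * norm (b (pos p)))"
 using killed_pos[of zball T p] by (cases "killed zball T p = 0") auto

text \<open>The estimate is applied to \<open>|b|\<close> on the ball, so \<open>drift_time\<close>
  occurs on both sides.\<close>

lemma drift_time_le_abp:
 "drift_time <= 2 * (abp_norm * (2 * r + drift_time)) * root CARD('n) (local_drift zball)"
proof -
 let ?R = "2 * (abp_norm * (2 * r + drift_time)) * root CARD('n) (local_drift zball)"
 have R: "0 <= ?R" using r abp_norm_pos drift_time_nonneg local_drift_nonneg[of zball] by simp
 have "ennreal drift_time = (\<integral>\<^sup>+p. ennreal (killed zball T p * norm (b (pos p))) \<partial>space_time x)"
  unfolding drift_time_def using T killed_bounds(1)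
  by (intro nn_integral_eq_integral[symmetric] killed_drift_integrable) auto
 also have "... <= ennreal ?R" unfolding killed_drift_indicator local_drift_def
 proof (intro abp_drift local_drift_integrable)
  have "(%y. norm (b y)) \<in> borel_measurable borel" by measurable
  thus "(%y. indicator zball y * norm (b y)) \<in> borel_measurable borel"
   by (intro borel_measurable_times borel_measurable_indicator) auto
 qed auto
 finally show ?thesis using R by (simp add: ennreal_le_iff)
qed

text \<open>Under the smallness condition the coefficient of \<open>drift_time\<close> on the right
  is at most 1/2. As \<open>drift_time\<close> is the integral of an integrable function, by the
  integrability of the drift along paths, it can be absorbed.\<close>

lemma drift_time_small:
 assumes "4 * abp_norm * root CARD('n) (local_drift zball) <= 1"
 shows "drift_time <= 2 * r" "drift_time <= 8 * abp_norm * r * root CARD('n) (local_drift zball)"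
proof -
 let ?k = "root CARD('n) (local_drift zball)"
 have "2 * (abp_norm * (2 * r + drift_time)) * ?k = (2 * r + drift_time) * (4 * abp_norm * ?k) / 2" by simp
 also have "... <= (2 * r + drift_time) * 1 / 2"
  using assms r drift_time_nonneg by (intro divide_right_mono mult_left_mono) auto
 finally show le: "drift_time <= 2 * r" using drift_time_le_abp by simp
 have "2 * (abp_norm * (2 * r + drift_time)) * ?k <= 2 * (abp_norm * (2 * r + 2 * r)) * ?k"
  using le abp_norm_pos local_drift_nonneg[of zball] by (intro mult_right_mono mult_left_mono) auto
 thus "drift_time <= 8 * abp_norm * r * ?k" using drift_time_le_abp by (simp add: mult_ac)
qed

lemma abp:
 assumes small: "4 * abp_norm * root CARD('n) (local_drift zball) <= 1"
  and f: "f \<in> borel_measurable borel" "!!y. 0 <= f y" "integrable lborel (%y. f y ^ CARD('n))"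
 shows "(\<integral>\<^sup>+p. ennreal (killed zball T p * f (pos p)) \<partial>space_time x) <=
  ennreal (8 * abp_norm * r * root CARD('n) (LINT y|lborel. f y ^ CARD('n)))"
proof -
 let ?J = "LINT y|lborel. f y ^ CARD('n)"
 have "0 <= ?J" using f by (intro integral_nonneg_AE) auto
 hence "2 * (abp_norm * (2 * r + drift_time)) * root CARD('n) ?J <= 2 * (abp_norm * (2 * r + 2 * r)) * root CARD('n) ?J"
  using drift_time_small(1)[OF small] abp_norm_pos by (intro mult_right_mono mult_left_mono) auto
 hence "ennreal (2 * (abp_norm * (2 * r + drift_time)) * root CARD('n) ?J) <= ennreal (8 * abp_norm * r * root CARD('n) ?J)"
  by (intro ennreal_leI) (simp add: mult_ac)
 thus ?thesis using abp_drift[OF f] by (rule order_trans[rotated])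
qed

end

end

section \<open>Occupation of a small ball\<close>

text \<open>The exponent \<open>m\<close> is such that the second-order part of \<open>L\<close> applied to the barrier
\<open>(r^2 - |x - z|^2)^m\<close> is nonnegative outside the ball of radius \<open>l r\<close>.\<close>

definition occ_exp :: "nat => real => real => nat" where
 "occ_exp d ell l = 3 + nat \<lceil>d / (2 * ell^2 * l^2)\<rceil>"

definition abp_bound :: "nat => real => real" where
 "abp_bound d ell = root d (abp_const d) / ell"

text \<open>Times \<open>r^2\<close> it bounds the mean exit time from a ball of radius
  \<open>r\<close>: the occupation estimate for the indicator of that ball.\<close>

definition exit_bound :: "nat => real => real" where
 "exit_bound d ell = 8 * abp_bound d ell * root d (unit_ball_vol d)"

text \<open>Times \<open>r^2\<close> it bounds from below the mean time spent in the ball of radius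
  \<open>l r\<close>; the number \<open>7/16 = 1 - (3/4)^2\<close> measures the barrier on the
  starting ball of radius \<open>3/4 r\<close>.\<close>

definition occ_low :: "nat => real => real => real" where
 "occ_low d ell l = ell / (2 * occ_exp d ell l * d) * (7 / 16) ^ occ_exp d ell l"

text \<open>Chosen so that the drift costs at most a quarter of the initial value of the
  barrier.\<close>

definition drift_tol :: "nat => real => real => real" where
 "drift_tol d ell l = (7 / 16) ^ occ_exp d ell l / (64 * occ_exp d ell l * abp_bound d ell)"

text \<open>A set of measure at most \<open>vol_tol * r^d\<close> in the ball is occupied for at
  most half of the guaranteed time \<open>occ_low * r^2\<close>.\<close>

definition vol_tol :: "nat => real => real => real" where
 "vol_tol d ell l = (occ_low d ell l / (16 * abp_bound d ell)) ^ d"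

lemma occ_constants_pos:
 assumes "0 < ell" "0 < d"
 shows "0 < abp_bound d ell" "0 < exit_bound d ell" "0 < occ_low d ell l" "0 < drift_tol d ell l" "0 < vol_tol d ell l"
proof -
 have "0 < abp_const d" using assms by (simp add: abp_const_def)
 thus 1: "0 < abp_bound d ell" using assms by (simp add: abp_bound_def)
 thus "0 < exit_bound d ell" using assms by (simp add: exit_bound_def)
 have m: "0 < occ_exp d ell l" by (simp add: occ_exp_def)
 thus 2: "0 < occ_low d ell l" using assms by (simp add: occ_low_def)
 show "0 < drift_tol d ell l" using 1 m by (simp add: drift_tol_def)
 show "0 < vol_tol d ell l" using 1 2 by (simp add: vol_tol_def)
qed

lemma root_ball_volume:
 assumes "0 <= r"
 shows "root CARD('n) (measure lborel (cball (z::real^'n) r)) = r * root CARD('n) (unit_ball_vol CARD('n))"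
 using content_cball[OF assms, of z] assms by (simp add: real_root_mult real_root_power_cancel)

lemma integral_indicator_power:
 "A \<in> sets borel ==> (LINT y|lborel. indicator A y ^ CARD('n)) = measure lborel (A :: (real^'n) set)"
proof -
 have "(indicator A y :: real) ^ CARD('n) = indicator A y" for y by (auto simp: indicator_def zero_power)
 thus "A \<in> sets borel ==> ?thesis" by simp
qed

lemma integrable_indicator_power:
 "A \<in> sets borel ==> bounded A ==> integrable lborel (%y. (indicator A y :: real) ^ CARD('n))" for A :: "(real^'n) set"
proof -
 have "(indicator A y :: real) ^ CARD('n) = indicator A y" for y by (auto simp: indicator_def zero_power)
 thus "A \<in> sets borel ==> bounded A ==> ?thesis"
  using emeasure_bounded_finite[of A] by (simp add: integrable_indicator_iff)
qed

context Ld_quasi_diffusion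
begin

lemma abp_norm_eq: "abp_norm = abp_bound CARD('n) ell" by (simp add: abp_norm_def abp_bound_def)

lemma abp_set:
 assumes r: "0 < r" and T: "0 < T" and x: "x \<in> cball z r"
  and small: "4 * abp_bound CARD('n) ell * root CARD('n) (local_drift (cball z r)) <= 1"
  and A: "A \<in> sets borel" "bounded A"
 shows "(LINT p|space_time x. killed (cball z r) T p * indicator A (pos p)) <=
  8 * abp_bound CARD('n) ell * r * root CARD('n) (measure lborel A)"
proof -
 have "ennreal (LINT p|space_time x. killed (cball z r) T p * indicator A (pos p))
  = (\<integral>\<^sup>+p. ennreal (killed (cball z r) T p * indicator A (pos p)) \<partial>space_time x)"
  using A killed_bounds(1) by (intro nn_integral_eq_integral[symmetric] killed_integrable[where B=1]) auto
 also have "... <= ennreal (8 * abp_bound CARD('n) ell * r * root CARD('n) (LINT y|lborel. indicator A y ^ CARD('n)))"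
  using small A unfolding abp_norm_eq[symmetric] by (intro abp r T x integrable_indicator_power) auto
 also have "(LINT y|lborel. indicator A y ^ CARD('n)) = measure lborel A" by (rule integral_indicator_power[OF A(1)])
 finally show ?thesis using r occ_constants_pos(1)[OF ell, of "CARD('n)"] by (subst (asm) ennreal_le_iff) auto
qed

lemma killed_time_le:
 assumes r: "0 < r" and T: "0 < T" and x: "x \<in> cball z r"
  and small: "4 * abp_bound CARD('n) ell * root CARD('n) (local_drift (cball z r)) <= 1"
 shows "(LINT p|space_time x. killed (cball z r) T p) <= exit_bound CARD('n) ell * r^2"
proof -
 have "killed (cball z r) T p = killed (cball z r) T p * indicator (cball z r) (pos p)" for p
  using killed_pos[of "cball z r" T p] by (cases "killed (cball z r) T p = 0") auto
 hence "(LINT p|space_time x. killed (cball z r) T p) = (LINT p|space_time x. killed (cball z r) T p * indicator (cball z r) (pos p))"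
  by (intro Bochner_Integration.integral_cong) auto
 also have "... <= 8 * abp_bound CARD('n) ell * r * root CARD('n) (measure lborel (cball z r))"
  by (intro abp_set assms) auto
 also have "... = exit_bound CARD('n) ell * r^2"
  using r by (simp add: root_ball_volume exit_bound_def power2_eq_square)
 finally show ?thesis .
qed

lemma stay_prob_le:
 assumes r: "0 < r" and T: "0 < T" and x: "x \<in> cball z r"
  and small: "4 * abp_bound CARD('n) ell * root CARD('n) (local_drift (cball z r)) <= 1"
 shows "measure (P x) (stay (cball z r) T) * T <= exit_bound CARD('n) ell * r^2"
proof -
 let ?C = "cball z r" and ?S = "stay (cball z r) T \<times> {0..<T}"
 have SP: "stay ?C T \<in> sets (P x)" using stay_closed_path[of ?C T] path_algebra_subset[of x] T by auto
 hence S: "?S \<in> sets (space_time x)" by (simp add: space_time_def)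
 have em: "emeasure (space_time x) ?S = ennreal (measure (P x) (stay ?C T) * T)" unfolding space_time_def using SP T
  by (subst lborel.emeasure_pair_measure_Times) (auto simp: Px.emeasure_eq_measure ennreal_mult)
 have kint: "integrable (space_time x) (%p. killed ?C T p)"
  using killed_integrable[where B=1 and f="%_. 1" and x=x and T=T and C="?C"] by simp
 have "measure (P x) (stay ?C T) * T = measure (space_time x) ?S" using em T by (simp add: measure_def)
 also have "... = (LINT p|space_time x. indicator ?S p)" using S sets.sets_into_space[OF S] by (simp add: Int_absorb2)
 also have "... <= (LINT p|space_time x. killed ?C T p)"
 proof (rule integral_mono[OF _ kint])
  show "integrable (space_time x) (indicator ?S :: _ => real)" using S em by (intro integrable_real_indicator) auto
  show "indicator ?S p <= killed ?C T p" for p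
   using stay_mono[of ?C ?C "max 0 (snd p)" T] T by (cases p) (auto simp: killed_def indicator_def subset_iff)
 qed
 also have "... <= exit_bound CARD('n) ell * r^2" by (rule killed_time_le[OF assms])
 finally show ?thesis .
qed

text \<open>The Hessian of the barrier has a radial part that helps and a trace part that hurts.
  Outside the ball of radius \<open>l r\<close> the exponent lets the radial part win; inside, only
  the trace part is bounded, which yields the indicator.\<close>

lemma L_bump_lower:
 assumes y: "y \<in> cball z r" and r: "0 < r" and l: "0 < l" and m: "m = occ_exp CARD('n) ell l"
 shows "- (real m * real CARD('n) / ell * r ^ (2 * m - 2)) * indicator (ball z (l * r)) y - 2 * real m * r ^ (2 * m - 1) * norm (b y) <= L (bump z (r^2) m) y"
proof -
 let ?d = "real CARD('n)"
 have m3: "3 <= m" by (simp add: m occ_exp_def)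
 define q where "q = y - z"
 define s where "s = q \<bullet> q"
 have s: "0 <= s" "s <= r^2"
  using y by (auto simp: s_def q_def dot_square_norm dist_norm norm_minus_commute intro: power_mono)
 define g where "g k = (r^2 - s) ^ k" for k
 have bg: "bump z (r^2) k y = g k" for k using s by (simp add: bump_eq g_def s_def q_def)
 have g: "0 <= g k" "g k <= r ^ (2 * k)" for k using s by (auto simp: g_def power_mult intro!: power_mono)
 define Q where "Q = (\<Sum>i\<in>UNIV. \<Sum>j\<in>UNIV. a y $ i $ j * (q $ j *\<^sub>R q) $ i)"
 have Q: "ell * s <= Q"
 proof -
  have "ell * (\<Sum>i\<in>UNIV. (q $ i *\<^sub>R q) $ i) <= Q" unfolding Q_def
  proof (rule elliptic_trace_lower_bound[OF elliptic])
   fix v :: "real^'n"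
   have "(\<Sum>i\<in>UNIV. \<Sum>j\<in>UNIV. v $ i * v $ j * (q $ j *\<^sub>R q) $ i) = (v \<bullet> q) * (v \<bullet> q)"
    by (simp add: inner_vec_def sum_product mult_ac)
   thus "0 <= (\<Sum>i\<in>UNIV. \<Sum>j\<in>UNIV. v $ i * v $ j * (q $ j *\<^sub>R q) $ i)" by simp
  qed
  thus ?thesis by (simp add: s_def inner_vec_def)
 qed
 define R where "R = (\<Sum>i\<in>UNIV. a y $ i $ i)"
 have R: "R <= ?d / ell"
 proof -
  have "R <= (\<Sum>i\<in>(UNIV::'n set). 1 / ell)" unfolding R_def
   using ellipticity_class_entry_le[OF elliptic ell] by (intro sum_mono) (meson abs_le_D1)
  thus ?thesis by simp
 qed
 have "(\<Sum>i\<in>UNIV. \<Sum>j\<in>UNIV. a y $ i $ j * bump_hess z (r^2) m j y $ i) = 4 * real m * real (m - 1) * g (m - 2) * Q - 2 * real m * g (m - 1) * R"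
 proof -
  have "(\<Sum>j\<in>UNIV. a y $ i $ j * bump_hess z (r^2) m j y $ i) =
   (\<Sum>j\<in>UNIV. 4 * real m * real (m - 1) * g (m - 2) * (a y $ i $ j * (q $ j *\<^sub>R q) $ i)) - (\<Sum>j\<in>UNIV. if j = i then 2 * real m * g (m - 1) * a y $ i $ i else 0)" for i
   unfolding sum_subtractf[symmetric]
   by (intro sum.cong) (auto simp: bump_hess_def bg q_def[symmetric] axis_def algebra_simps)
  thus ?thesis by (simp add: Q_def R_def sum_subtractf sum_distrib_left)
 qed
 hence L: "L (bump z (r^2) m) y = 1/2 * (4 * real m * real (m - 1) * g (m - 2) * Q - 2 * real m * g (m - 1) * R) + b y \<bullet> ((- 2 * real m * g (m - 1)) *\<^sub>R q)"
  using diffusion_operator_gradient[of "bump z (r^2) m" "%y. (- 2 * real m * bump z (r^2) (m - 1) y) *\<^sub>R (y - z)" "bump_hess z (r^2) m" a b y,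
    OF bump_has_derivative bump_gradient_has_derivative] m3 by (simp add: bg q_def)
 have drift: "- (2 * real m * r ^ (2 * m - 1) * norm (b y)) <= b y \<bullet> ((- 2 * real m * g (m - 1)) *\<^sub>R q)"
 proof -
  have "abs (b y \<bullet> q) <= norm (b y) * r"
   using y by (intro order_trans[OF Cauchy_Schwarz_ineq2] mult_left_mono) (auto simp: q_def dist_norm norm_minus_commute)
  hence "2 * real m * g (m - 1) * abs (b y \<bullet> q) <= 2 * real m * r ^ (2 * (m - 1)) * (norm (b y) * r)"
   using g by (intro mult_mono) auto
  also have "... = 2 * real m * r ^ (2 * m - 1) * norm (b y)"
  proof -
   have "2 * m - 1 = Suc (2 * (m - 1))" using m3 by simp
   thus ?thesis by (simp add: mult_ac)
  qed
  finally have "2 * real m * g (m - 1) * abs (b y \<bullet> q) <= 2 * real m * r ^ (2 * m - 1) * norm (b y)" .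
  moreover have "2 * real m * g (m - 1) * (b y \<bullet> q) <= 2 * real m * g (m - 1) * abs (b y \<bullet> q)" using g(1) by (intro mult_left_mono) auto
  ultimately show ?thesis by simp
 qed
 have main: "- (m * ?d / ell * r ^ (2 * m - 2)) * indicator (ball z (l * r)) y <= 1/2 * (4 * real m * real (m - 1) * g (m - 2) * Q - 2 * real m * g (m - 1) * R)"
 proof -
  have g1: "g (m - 1) = g (m - 2) * (r^2 - s)"
  proof -
   have "m - 1 = Suc (m - 2)" using m3 by simp
   thus ?thesis by (simp add: g_def mult.commute)
  qed
  have "m * g (m - 2) * (2 * real (m - 1) * (ell * s) - (r^2 - s) * (?d / ell)) <= m * g (m - 2) * (2 * real (m - 1) * Q - (r^2 - s) * R)"
   using g s Q R by (intro mult_left_mono diff_mono) auto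
  also have "... = 1/2 * (4 * real m * real (m - 1) * g (m - 2) * Q - 2 * real m * g (m - 1) * R)"
   unfolding g1 by (simp add: algebra_simps)
  finally have 1: "m * g (m - 2) * (2 * real (m - 1) * (ell * s) - (r^2 - s) * (?d / ell)) <= 1/2 * (4 * real m * real (m - 1) * g (m - 2) * Q - 2 * real m * g (m - 1) * R)" .
  show ?thesis
  proof (cases "y \<in> ball z (l * r)")
   case True
   have "g (m - 2) * (r^2 - s) <= r ^ (2 * (m - 2)) * r^2" using g s by (intro mult_mono) auto
   also have "... = r ^ (2 * m - 2)"
   proof -
    have "2 * m - 2 = 2 * (m - 2) + 2" using m3 by simp
    thus ?thesis by (simp only: power_add)
   qed
   finally have "m * (?d / ell) * (g (m - 2) * (r^2 - s)) <= m * (?d / ell) * r ^ (2 * m - 2)"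
    using ell by (intro mult_left_mono) auto
   moreover have "0 <= m * g (m - 2) * (2 * real (m - 1) * (ell * s))" using g s ell by simp
   ultimately have "- (m * (?d / ell) * r ^ (2 * m - 2)) <= m * g (m - 2) * (2 * real (m - 1) * (ell * s) - (r^2 - s) * (?d / ell))"
    by (simp add: algebra_simps)
   moreover have "m * ?d / ell = m * (?d / ell)" by simp
   moreover have "indicator (ball z (l * r)) y = (1::real)" using True by simp
   ultimately show ?thesis using 1 by (simp only: mult_1_right)
  next
   case False
   hence "(l * r)^2 <= s"
    using l r by (auto simp: s_def q_def dot_square_norm dist_norm norm_minus_commute intro!: power_mono)
   hence ts: "l^2 * r^2 <= s" by (simp add: power_mult_distrib)
   \<comment> \<open>The choice of the exponent enters here: the radial coefficient
     \<open>2 (m - 1) ell l^2\<close> dominates the trace bound \<open>d / ell\<close>.\<close>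
   have "nat \<lceil>?d / (2 * ell^2 * l^2)\<rceil> <= m - 1" unfolding m occ_exp_def by linarith
   hence "?d / (2 * ell^2 * l^2) <= real (m - 1)" using real_nat_ceiling_ge[of "?d / (2 * ell^2 * l^2)"] by linarith
   hence dm: "?d / ell <= 2 * real (m - 1) * ell * l^2" using ell l by (simp add: field_simps power2_eq_square)
   have "(r^2 - s) * (?d / ell) <= r^2 * (?d / ell)" using s ell by (intro mult_right_mono) auto
   moreover have "r^2 * (?d / ell) <= r^2 * (2 * real (m - 1) * ell * l^2)" using dm by (intro mult_left_mono) auto
   moreover have "2 * real (m - 1) * ell * (l^2 * r^2) <= 2 * real (m - 1) * ell * s" using ts ell by (intro mult_left_mono) auto
   ultimately have "0 <= 2 * real (m - 1) * (ell * s) - (r^2 - s) * (?d / ell)" by (simp add: mult_ac)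
   hence "0 <= m * g (m - 2) * (2 * real (m - 1) * (ell * s) - (r^2 - s) * (?d / ell))" using g by simp
   moreover have "indicator (ball z (l * r)) y = (0::real)" using False by simp
   ultimately show ?thesis using 1 by (simp only: mult_zero_right)
  qed
 qed
 show ?thesis unfolding L using main drift by linarith
qed

lemma bump_center_lower:
 assumes "x \<in> cball z (3 / 4 * r)" "0 < r"
 shows "(7 / 16) ^ m * r ^ (2 * m) <= bump z (r^2) m x"
proof -
 have "(norm (x - z))^2 <= (3 / 4 * r)^2" using assms by (intro power_mono) (auto simp: dist_norm norm_minus_commute)
 hence "7 / 16 * r^2 <= max 0 (r^2 - (x - z) \<bullet> (x - z))"
  by (intro max.coboundedI2) (simp add: dot_square_norm power_mult_distrib power_divide)
 hence "(7 / 16 * r^2) ^ m <= bump z (r^2) m x" unfolding bump_def by (intro power_mono) auto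
 thus ?thesis unfolding power_mult_distrib power_mult .
qed

lemma drift_tol_abp:
 assumes "root CARD('n) r <= drift_tol CARD('n) ell l"
 shows "4 * abp_bound CARD('n) ell * root CARD('n) r <= 1"
proof -
 let ?N = "abp_bound CARD('n) ell" and ?m = "occ_exp CARD('n) ell l"
 have N: "0 < ?N" using occ_constants_pos(1)[OF ell, of "CARD('n)"] by simp
 have "1 <= ?m" by (simp add: occ_exp_def)
 hence m: "1 <= real ?m" by linarith
 have "4 * ?N * root CARD('n) r <= 4 * ?N * drift_tol CARD('n) ell l" using assms N by (intro mult_left_mono) auto
 also have "... = (7 / 16) ^ ?m / (16 * real ?m)" using N m by (simp add: drift_tol_def)
 also have "... <= 1 / 1"
 proof (rule frac_le)
  show "(7 / 16 :: real) ^ ?m <= 1" by (rule power_le_one) auto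
  show "1 <= 16 * real ?m" using m by linarith
 qed auto
 finally show ?thesis by simp
qed

text \<open>The barrier vanishes on the sphere, so its initial value must be accounted for by paths
  still inside at time \<open>T\<close>, by the drift, and by time spent in the small ball. The
  first two take at most a quarter each.\<close>

lemma occupation_ball:
 assumes r: "0 < r" and x: "x \<in> cball z (3 / 4 * r)" and l: "0 < l"
  and small: "root CARD('n) (local_drift (cball z r)) <= drift_tol CARD('n) ell l"
 obtains T where "0 < T" "occ_low CARD('n) ell l * r^2 <= (LINT p|space_time x. killed (cball z r) T p * indicator (ball z (l * r)) (pos p))"
proof -
 let ?d = "CARD('n)" and ?C = "cball z r"
 define N where "N = abp_bound ?d ell"
 define H where "H = exit_bound ?d ell"
 define m where "m = occ_exp ?d ell l"
 define k where "k = root ?d (local_drift ?C)"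
 have m3: "3 <= m" by (simp add: m_def occ_exp_def)
 have N: "0 < N" and H: "0 < H" using occ_constants_pos[OF ell, of ?d] by (auto simp: N_def H_def)
 have small4: "4 * abp_bound ?d ell * root ?d (local_drift ?C) <= 1" by (rule drift_tol_abp[OF small])
 have xC: "x \<in> ?C" using x r by auto
 define q where "q = (7 / 16 :: real) ^ m"
 have q: "0 < q" by (simp add: q_def)
 \<comment> \<open>By the bound for the mean exit time, survival up to this \<open>T\<close> has
   probability at most \<open>q / 4\<close>.\<close>
 define T where "T = 4 * H * r^2 / q"
 have T: "0 < T" using H r q by (simp add: T_def)
 let ?u = "bump z (r^2) m"
 have u: "C2_compact_support ?u" using m3 r by (intro bump_C2_compact_support) auto
 let ?A = "drift_time z r T x"
 let ?O = "LINT p|space_time x. killed ?C T p * indicator (ball z (l * r)) (pos p)"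
 have A: "?A <= 8 * N * r * k" using drift_time_small(2)[OF r T xC] small4 by (simp add: abp_norm_eq N_def k_def)
 have oint: "integrable (space_time x) (%p. killed ?C T p * indicator (ball z (l * r)) (pos p))"
  by (rule killed_integrable[where B=1]) (auto intro!: borel_measurable_indicator)
 have dint: "integrable (space_time x) (%p. killed ?C T p * norm (b (pos p)))"
  using T by (intro killed_drift_integrable) auto
 define K1 where "K1 = m * real ?d / ell * r ^ (2 * m - 2)"
 define K2 where "K2 = 2 * m * r ^ (2 * m - 1)"
 have K: "0 <= K1" "0 <= K2" using ell r by (auto simp: K1_def K2_def)
 have Llow: "- K1 * ?O - K2 * ?A <= (LINT p|space_time x. killed ?C T p * L ?u (pos p))"
 proof -
  have "- K1 * ?O - K2 * ?A = (LINT p|space_time x. killed ?C T p * (- K1 * indicator (ball z (l * r)) (pos p) - K2 * norm (b (pos p))))"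
   unfolding drift_time_def[OF r T xC] using oint dint by (simp add: right_diff_distrib mult.left_commute[of "killed ?C T _"])
  also have "... <= (LINT p|space_time x. killed ?C T p * L ?u (pos p))"
  proof (rule integral_mono)
   show "integrable (space_time x) (%p. killed ?C T p * (- K1 * indicator (ball z (l * r)) (pos p) - K2 * norm (b (pos p))))"
    using oint dint by (simp add: right_diff_distrib mult.left_commute[of "killed ?C T _"])
   show "integrable (space_time x) (%p. killed ?C T p * L ?u (pos p))"
    using T by (intro L_space_time[OF u _ killed_closed_measurable killed_bounds(3)]) auto
   fix p
   show "killed ?C T p * (- K1 * indicator (ball z (l * r)) (pos p) - K2 * norm (b (pos p))) <= killed ?C T p * L ?u (pos p)"
    using L_bump_lower[OF killed_pos[of ?C T p] r l m_def] killed_bounds(1)[of ?C T p]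
    by (cases "killed ?C T p = 0") (auto intro!: mult_left_mono simp: K1_def K2_def)
  qed
  finally show ?thesis .
 qed
 have Eu: "(LINT w|P x. ?u (X (closed_exit ?C T w) w)) <= r ^ (2 * m) * measure (P x) (stay ?C T)"
 proof -
  have SP: "stay ?C T \<in> sets (P x)" using stay_closed_path[of ?C T] path_algebra_subset[of x] T by auto
  have bm: "?u y <= r ^ (2 * m)" for y using bump_le[of "r^2" z m y] by (simp add: power_mult)
  have "(LINT w|P x. ?u (X (closed_exit ?C T w) w)) <= (LINT w|P x. r ^ (2 * m) * indicator (stay ?C T) w)"
  proof (rule integral_mono)
   show "integrable (P x) (%w. ?u (X (closed_exit ?C T w) w))" using bm dynkin_closed_exit(2)[OF u _ T, of ?C x]
    by (intro Px.integrable_const_bound[where B="r ^ (2 * m)"]) (auto simp: bump_nonneg)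
   show "integrable (P x) (%w. r ^ (2 * m) * indicator (stay ?C T) w)"
    using SP by (intro integrable_mult_right integrable_real_indicator) (auto simp: Px.emeasure_eq_measure)
   fix w assume "w \<in> space (P x)"
   hence w: "w \<in> Om" by simp
   show "?u (X (closed_exit ?C T w) w) <= r ^ (2 * m) * indicator (stay ?C T) w"
   proof (cases "w \<in> stay ?C T")
    case False
    hence "X (closed_exit ?C T w) w \<in> closure (- ?C)" using T w by (intro closed_exit_closure) auto
    hence "X (closed_exit ?C T w) w ~: ball z r"
     using closure_minimal[of "- ?C" "- ball z r"] ball_subset_cball[of z r] by blast
    hence "?u (X (closed_exit ?C T w) w) = 0" using m3 r by (intro bump_outside) auto
    thus ?thesis using False by simp
   qed (use bm in simp)
  qed
  also have "... = r ^ (2 * m) * measure (P x) (stay ?C T)"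
   using sets.sets_into_space[OF SP] SP by (simp add: Int_absorb2)
  finally show ?thesis .
 qed
 have stayT: "measure (P x) (stay ?C T) <= q / 4"
 proof -
  have "measure (P x) (stay ?C T) * T <= H * r^2" unfolding H_def by (rule stay_prob_le[OF r T xC small4])
  also have "H * r^2 = q / 4 * T" using q by (simp add: T_def)
  finally show ?thesis using T by simp
 qed
 have "q * r ^ (2 * m) <= ?u x" unfolding q_def by (rule bump_center_lower[OF x r])
 also have "... <= r ^ (2 * m) * (q / 4) + K1 * ?O + K2 * (8 * N * r * k)"
 proof -
  have "?u x = (LINT w|P x. ?u (X (closed_exit ?C T w) w)) - (LINT p|space_time x. killed ?C T p * L ?u (pos p))"
   using dynkin_closed_exit(1)[OF u _ T, of ?C x] by simp
  moreover have "r ^ (2 * m) * measure (P x) (stay ?C T) <= r ^ (2 * m) * (q / 4)" using stayT r by (intro mult_left_mono) auto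
  moreover have "K2 * ?A <= K2 * (8 * N * r * k)" using A K by (intro mult_left_mono) auto
  ultimately show ?thesis using Eu Llow by linarith
 qed
 also have "K2 * (8 * N * r * k) <= q / 4 * r ^ (2 * m)"
 proof -
  have "2 * m = Suc (2 * m - 1)" using m3 by simp
  hence "r ^ (2 * m) = r * r ^ (2 * m - 1)" by (metis power_Suc)
  hence "K2 * (8 * N * r * k) = 16 * m * N * k * r ^ (2 * m)" by (simp add: K2_def mult_ac)
  also have "... <= 16 * m * N * drift_tol ?d ell l * r ^ (2 * m)"
   using small N r by (intro mult_right_mono mult_left_mono) (auto simp: k_def)
  also have "16 * m * N * drift_tol ?d ell l = q / 4"
   using N m3 unfolding drift_tol_def m_def[symmetric] N_def[symmetric] q_def by simp
  finally show ?thesis .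
 qed
 finally have "q / 2 * r ^ (2 * m) <= K1 * ?O" by simp
 also have "r ^ (2 * m) = r ^ (2 * m - 2) * r^2"
 proof -
  have "2 * m = (2 * m - 2) + 2" using m3 by simp
  thus ?thesis by (metis power_add)
 qed
 finally have "r ^ (2 * m - 2) * (q / 2 * r^2) <= r ^ (2 * m - 2) * (m * real ?d / ell * ?O)"
  by (simp add: K1_def mult_ac)
 hence "q / 2 * r^2 <= m * real ?d / ell * ?O" by (rule mult_left_le_imp_le) (use r in simp)
 hence "occ_low ?d ell l * r^2 <= ?O"
  using ell m3 unfolding occ_low_def m_def[symmetric] q_def[symmetric] by (simp add: field_simps)
 thus ?thesis using that T by blast
qed

text \<open>The version of \<open>killed\<close> without horizon, for nonnegative integrals.\<close>

definition kill :: "(real^'n) set => 'w \<times> real => real" where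
 "kill C p = indicator {0..} (snd p) * indicator (stay C (max 0 (snd p))) (fst p)"

lemma killed_eq_kill: "killed C T p = indicator {..<T} (snd p) * kill C p"
 by (auto simp: killed_def kill_def indicator_def)

lemma kill_bounds: "0 <= kill C p" "kill C p <= 1" by (auto simp: kill_def indicator_def)

lemma kill_measurable_aux:
 assumes "!!T. killed C T \<in> borel_measurable (space_time x)"
 shows "kill C \<in> borel_measurable (space_time x)"
proof (rule borel_measurable_LIMSEQ_metric[of "%n. killed C (real n)"])
 fix p :: "'w \<times> real"
 have ev: "\<forall>\<^sub>F n in sequentially. snd p < real n"
  using filterlim_real_sequentially by (simp add: filterlim_at_top_dense)
 show "(%n. killed C (real n) p) \<longlonglongrightarrow> kill C p"
  by (intro tendsto_eventually) (rule eventually_mono[OF ev], simp add: killed_eq_kill)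
qed (rule assms)

lemmas kill_closed_measurable = kill_measurable_aux[OF killed_closed_measurable]
lemmas kill_ball_measurable = kill_measurable_aux[OF killed_ball_measurable]

text \<open>By \<open>abp_set\<close> the part of the small ball outside \<open>G\<close> takes at
  most half of the time guaranteed by \<open>occupation_ball\<close>.\<close>

theorem occupation_lower_bound:
 assumes r: "0 < r" and x: "x \<in> cball z (3 / 4 * r)" and l: "0 < l"
  and small: "root CARD('n) (local_drift (cball z r)) <= drift_tol CARD('n) ell l"
  and G: "G \<in> sets borel" "measure lborel (ball z (l * r) - G) <= vol_tol CARD('n) ell l * r ^ CARD('n)"
 shows "ennreal (occ_low CARD('n) ell l / 2 * r^2) <= (\<integral>\<^sup>+p. ennreal (kill (cball z r) p * indicator G (pos p)) \<partial>space_time x)"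
proof -
 let ?d = "CARD('n)" and ?C = "cball z r" and ?B = "ball z (l * r)"
 obtain T where T: "0 < T" and O: "occ_low ?d ell l * r^2 <= (LINT p|space_time x. killed ?C T p * indicator ?B (pos p))"
  by (rule occupation_ball[OF r x l small])
 have xC: "x \<in> ?C" using x r by auto
 define N where "N = abp_bound ?d ell"
 have N: "0 < N" using occ_constants_pos(1)[OF ell, of ?d] by (simp add: N_def)
 have low: "0 < occ_low ?d ell l" using occ_constants_pos(3)[OF ell, of ?d] by simp
 have int: "integrable (space_time x) (%p. killed ?C T p * indicator A (pos p))" if "A \<in> sets borel" for A
  using that by (intro killed_integrable[where B=1]) auto
 have "(LINT p|space_time x. killed ?C T p * indicator ?B (pos p)) <= (LINT p|space_time x. killed ?C T p * indicator G (pos p) + killed ?C T p * indicator (?B - G) (pos p))"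
  using G by (intro integral_mono Bochner_Integration.integrable_add int) (auto simp: indicator_def killed_bounds)
 also have "... = (LINT p|space_time x. killed ?C T p * indicator G (pos p)) + (LINT p|space_time x. killed ?C T p * indicator (?B - G) (pos p))"
  using G by (intro Bochner_Integration.integral_add int) auto
 also have "(LINT p|space_time x. killed ?C T p * indicator (?B - G) (pos p)) <= 8 * N * r * root ?d (measure lborel (?B - G))"
  unfolding N_def using G by (intro abp_set r T xC drift_tol_abp[OF small]) (auto intro: bounded_subset[OF bounded_ball])
 also have "... <= 8 * N * r * root ?d (vol_tol ?d ell l * r ^ ?d)" using G(2) N r by (intro mult_left_mono) auto
 also have "... = occ_low ?d ell l / 2 * r^2"
  using N r low by (simp add: vol_tol_def N_def[symmetric] real_root_mult real_root_power_cancel power2_eq_square)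
 finally have "occ_low ?d ell l / 2 * r^2 <= (LINT p|space_time x. killed ?C T p * indicator G (pos p))"
  using O by simp
 hence "ennreal (occ_low ?d ell l / 2 * r^2) <= ennreal (LINT p|space_time x. killed ?C T p * indicator G (pos p))"
  by (rule ennreal_leI)
 also have "... = (\<integral>\<^sup>+p. ennreal (killed ?C T p * indicator G (pos p)) \<partial>space_time x)"
  using killed_bounds(1) by (intro nn_integral_eq_integral[symmetric] int G) auto
 also have "... <= (\<integral>\<^sup>+p. ennreal (kill ?C p * indicator G (pos p)) \<partial>space_time x)"
  by (intro nn_integral_mono ennreal_leI) (auto simp: killed_eq_kill indicator_def kill_bounds)
 finally show ?thesis .
qed

theorem exit_time_bound:
 assumes r: "0 < r" and x: "x \<in> cball z r"
  and small: "4 * abp_bound CARD('n) ell * root CARD('n) (local_drift (cball z r)) <= 1"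
 shows "(\<integral>\<^sup>+p. ennreal (kill (cball z r) p) \<partial>space_time x) <= ennreal (exit_bound CARD('n) ell * r^2)"
proof -
 let ?C = "cball z r"
 have "ennreal (kill ?C p) <= liminf (%n. ennreal (killed ?C (real (Suc n)) p))" for p
 proof (rule Liminf_bounded)
  obtain n :: nat where n: "snd p < real n" using reals_Archimedean2 by blast
  show "\<forall>\<^sub>F n in sequentially. ennreal (kill ?C p) <= ennreal (killed ?C (real (Suc n)) p)"
   using eventually_ge_at_top[of n] by (rule eventually_mono) (use n in \<open>auto simp: killed_eq_kill\<close>)
 qed
 hence "(\<integral>\<^sup>+p. ennreal (kill ?C p) \<partial>space_time x) <= (\<integral>\<^sup>+p. liminf (%n. ennreal (killed ?C (real (Suc n)) p)) \<partial>space_time x)"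
  by (rule nn_integral_mono)
 also have "... <= liminf (%n. \<integral>\<^sup>+p. ennreal (killed ?C (real (Suc n)) p) \<partial>space_time x)"
  using killed_closed_measurable[of ?C] by (intro nn_integral_liminf) auto
 also have "... <= liminf (%n. ennreal (exit_bound CARD('n) ell * r^2))"
 proof (intro Liminf_mono always_eventually allI)
  fix n
  have "(\<integral>\<^sup>+p. ennreal (killed ?C (real (Suc n)) p) \<partial>space_time x) = ennreal (LINT p|space_time x. killed ?C (real (Suc n)) p)"
   using killed_bounds(1) killed_integrable[where B=1 and f="%_. 1" and x=x and T="real (Suc n)" and C="?C"]
   by (intro nn_integral_eq_integral) auto
  also have "... <= ennreal (exit_bound CARD('n) ell * r^2)" by (intro ennreal_leI killed_time_le r x small) simp
  finally show "(\<integral>\<^sup>+p. ennreal (killed ?C (real (Suc n)) p) \<partial>space_time x) <= ennreal (exit_bound CARD('n) ell * r^2)" .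
 qed
 also have "... = ennreal (exit_bound CARD('n) ell * r^2)" by (simp add: Liminf_const)
 finally show ?thesis .
qed

end

section \<open>Excessive functions and the growth lemma\<close>

lemma sum_indicator_grid_ennreal:
 "0 <= h ==> (\<Sum>k<m. indicator {real k * h..<real (Suc k) * h} s) = (indicator {0..<real m * h} s :: ennreal)"
proof (induction m)
 case (Suc m)
 have "real m * h <= real (Suc m) * h" using Suc by (intro mult_right_mono) auto
 moreover have "real m * h <= s ==> 0 <= s" using mult_nonneg_nonneg[of "real m" h] Suc by linarith
 ultimately show ?case using Suc by (auto simp: indicator_def)
qed simp

section \<open>Exit times and the killed semigroup\<close>

context continuous_markov_process
begin

lemma exit_time_le_iff:
 assumes "0 <= t" "w \<in> Om"
 shows "exit_time X z r w <= ereal t \<longleftrightarrow> w ~: stay (ball z r) t"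
proof
 assume "w ~: stay (ball z r) t"
 then obtain s where "s \<in> {0..t}" "X s w ~: ball z r" using assms by (auto simp: stay_def)
 hence "exit_time X z r w <= ereal s" unfolding exit_time_def by (intro Inf_lower) auto
 thus "exit_time X z r w <= ereal t" using \<open>s \<in> {0..t}\<close> by (metis atLeastAtMost_iff ereal_less_eq(3) order_trans)
next
 assume le: "exit_time X z r w <= ereal t"
 show "w ~: stay (ball z r) t"
 proof
  assume st: "w \<in> stay (ball z r) t"
  hence Xt: "X t w \<in> ball z r" using assms by (auto simp: stay_def)
  have "continuous (at t within {0..}) (%t. X t w)"
   using continuous_path[OF assms(2)] assms(1) by (simp add: continuous_on_eq_continuous_within)
  hence "\<forall>\<^sub>F s in at t within {0..}. X s w \<in> ball z r"
   unfolding continuous_within using Xt by (intro topological_tendstoD) auto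
  then obtain h where h: "h > 0" "!!s. s \<in> {0..} ==> s ~= t ==> dist s t < h ==> X s w \<in> ball z r"
   unfolding eventually_at by auto
  have "ereal (t + h) <= exit_time X z r w" unfolding exit_time_def
  proof (rule Inf_greatest)
   fix e assume "e \<in> {ereal s |s. 0 <= s & X s w ~: ball z r}"
   then obtain s where s: "e = ereal s" "0 <= s" "X s w ~: ball z r" by auto
   have "t < s" using s st by (force simp: stay_def)
   hence "t + h <= s" using h(2)[of s] s by (force simp: dist_real_def)
   thus "ereal (t + h) <= e" using s by simp
  qed
  thus False using le h(1) by (metis add_le_same_cancel1 ereal_less_eq(3) not_le order_trans)
 qed
qed

lemma exit_time_nonneg: "0 <= exit_time X z r w" unfolding exit_time_def by (intro Inf_greatest) auto

lemma exit_time_measurable: "exit_time X z r \<in> borel_measurable path_algebra"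
proof (rule borel_measurableI_le)
 fix y
 show "{w \<in> space path_algebra. exit_time X z r w <= y} \<in> sets path_algebra"
 proof (cases "y < 0")
  case True
  hence "~ exit_time X z r w <= y" for w
   using exit_time_nonneg[of z r w] by (meson leD order_less_le_trans order_trans)
  hence "{w \<in> space path_algebra. exit_time X z r w <= y} = {}" by blast
  thus ?thesis by (simp only: sets.empty_sets)
 next
  case False
  show ?thesis
  proof (cases y)
   case (real t)
   hence t: "0 <= t" using False by simp
   hence "{w \<in> space path_algebra. exit_time X z r w <= y} = space path_algebra - stay (ball z r) t"
    using exit_time_le_iff real by auto
   thus ?thesis using sets.compl_sets[OF stay_ball_path[OF t, of z r]] by simp
  next
   case PInf
   thus ?thesis using sets.top[of path_algebra] by simp
  qed (use False in simp)
 qed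
qed

lemma exit_point_measurable: "exit_point X z r \<in> borel_measurable path_algebra"
proof -
 have "(%w. X (max 0 (real_of_ereal (exit_time X z r w))) w) \<in> borel_measurable path_algebra"
  using exit_time_measurable by (intro joint_measurable_comp) auto
 moreover have "max 0 (real_of_ereal (exit_time X z r w)) = real_of_ereal (exit_time X z r w)" for w
  using exit_time_nonneg[of z r w] by (simp add: real_of_ereal_pos)
 ultimately show ?thesis by (simp add: exit_point_def [abs_def])
qed

text \<open>Before the exit, restarting the clock does not change where the path leaves. Combined
  with the Markov property at a fixed time, this suffices for functionals of the exit point.\<close>

lemma exit_shift:
 assumes t: "0 <= t" and w: "w \<in> stay (ball z r) t"
 shows "exit_time X z r (path_shift t w) < \<infinity> \<longleftrightarrow> exit_time X z r w < \<infinity>"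
  and "exit_time X z r w < \<infinity> ==> exit_point X z r (path_shift t w) = exit_point X z r w"
proof -
 have \<omega>O: "w \<in> Om" using w by (simp add: stay_def)
 let ?e = "exit_time X z r w" and ?e' = "exit_time X z r (path_shift t w)"
 have "{ereal s |s. 0 <= s & X s w ~: ball z r} = (%e. ereal t + e) ` {ereal s |s. 0 <= s & X s (path_shift t w) ~: ball z r}"
 proof (intro set_eqI iffI)
  fix e assume "e \<in> {ereal s |s. 0 <= s & X s w ~: ball z r}"
  then obtain s where s: "e = ereal s" "0 <= s" "X s w ~: ball z r" by auto
  have "t < s" using s w by (force simp: stay_def)
  hence "X (s - t) (path_shift t w) = X s w" using path_shift(2)[OF t \<omega>O, of "s - t"] by simp
  thus "e \<in> (%e. ereal t + e) ` {ereal s |s. 0 <= s & X s (path_shift t w) ~: ball z r}"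
   using s \<open>t < s\<close> by (intro image_eqI[of _ _ "ereal (s - t)"]) auto
 next
  fix e assume "e \<in> (%e. ereal t + e) ` {ereal s |s. 0 <= s & X s (path_shift t w) ~: ball z r}"
  then obtain s where "e = ereal (t + s)" "0 <= s" "X s (path_shift t w) ~: ball z r" by auto
  thus "e \<in> {ereal s |s. 0 <= s & X s w ~: ball z r}" using t path_shift(2)[OF t \<omega>O, of s] by auto
 qed
 hence "?e = Inf ((%e. ereal t + e) ` {ereal s |s. 0 <= s & X s (path_shift t w) ~: ball z r})"
  unfolding exit_time_def by simp
 also have "... = ereal t + ?e'"
 proof (cases "{ereal s |s. 0 <= s & X s (path_shift t w) ~: ball z r} = {}")
  case True
  show ?thesis unfolding exit_time_def True by (simp add: top_ereal_def)
 next
  case False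
  have "(INF e\<in>{ereal s |s. 0 <= s & X s (path_shift t w) ~: ball z r}. ereal t + e) =
    ereal t + (INF e\<in>{ereal s |s. 0 <= s & X s (path_shift t w) ~: ball z r}. e)"
   by (rule INF_ereal_add_right[OF False]) auto
  thus ?thesis unfolding exit_time_def by (simp only: image_ident)
 qed
 finally have e: "?e = ereal t + ?e'" .
 show "?e' < \<infinity> \<longleftrightarrow> ?e < \<infinity>" unfolding e by (cases ?e') auto
 assume "?e < \<infinity>"
 then obtain s where s: "?e' = ereal s" using exit_time_nonneg[of z r "path_shift t w"] e by (cases ?e') auto
 hence "0 <= s" using exit_time_nonneg[of z r "path_shift t w"] by simp
 thus "exit_point X z r (path_shift t w) = exit_point X z r w"
  unfolding exit_point_def e s using path_shift(2)[OF t \<omega>O, of s] by simp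
qed

text \<open>The transition semigroup of the process killed on leaving \<open>B\<close>.\<close>

definition kernel :: "'e set => real => ('e => ennreal) => 'e => ennreal" where
 "kernel B t f x = (\<integral>\<^sup>+w. indicator (stay B t) w * f (X t w) \<partial>P x)"

lemma kernel_path:
 fixes f :: "'e => ennreal"
 assumes "0 <= t" "f \<in> borel_measurable borel"
 shows "(%w. indicator (stay (ball z r) t) w * f (X t w)) \<in> borel_measurable path_algebra"
 by (rule borel_measurable_times_ennreal[OF borel_measurable_indicator[OF stay_ball_path[OF assms(1)]]
   measurable_compose[OF X_path_measurable[OF assms(1)] assms(2)]])

lemma kernel_measurable:
 assumes "0 <= t" "f \<in> borel_measurable borel"
 shows "kernel (ball z r) t f \<in> borel_measurable borel" unfolding kernel_def [abs_def]
 by (rule markov_path(1)[OF order_refl _ kernel_path[OF assms]]) (rule sets.empty_sets)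

lemma kernel_semigroup:
 assumes s: "0 <= s" and t: "0 <= t" and f: "f \<in> borel_measurable borel"
 shows "kernel (ball z r) (s + t) f x = kernel (ball z r) s (kernel (ball z r) t f) x"
proof -
 let ?B = "ball z r"
 have "kernel ?B (s + t) f x = (\<integral>\<^sup>+w. indicator (stay ?B s) w * (indicator (stay ?B t) (path_shift s w) * f (X t (path_shift s w))) \<partial>P x)"
  unfolding kernel_def by (intro nn_integral_cong) (auto simp: stay_shift[OF s t] path_shift(2)[OF s] t indicator_def)
 also have "... = (\<integral>\<^sup>+w. indicator (stay ?B s) w * (\<integral>\<^sup>+\<omega>'. indicator (stay ?B t) \<omega>' * f (X t \<omega>') \<partial>P (X s w)) \<partial>P x)"
  by (rule markov_path(2)[OF s stay_ball_F[OF s] kernel_path[OF t f]])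
 finally show ?thesis by (simp add: kernel_def)
qed

lemma kernel_mono:
 assumes "0 <= t" "!!y. y \<in> B ==> f y <= g y"
 shows "kernel B t f x <= kernel B t g x"
 unfolding kernel_def using assms by (intro nn_integral_mono) (auto simp: stay_def indicator_def)

lemma kernel_cmult:
 assumes "0 <= t" "f \<in> borel_measurable borel"
 shows "kernel (ball z r) t (%y. c * f y) x = c * kernel (ball z r) t f x"
 unfolding kernel_def using measurable_path_algebra[OF kernel_path[OF assms, of z r], of x]
 by (subst nn_integral_cmult[symmetric]) (auto simp: mult_ac)

lemma kernel_sum:
 assumes "0 <= t" "!!k. f k \<in> borel_measurable borel"
 shows "kernel (ball z r) t (%y. \<Sum>k\<in>I. f k y) x = (\<Sum>k\<in>I. kernel (ball z r) t (f k) x)"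
 unfolding kernel_def sum_distrib_left by (intro nn_integral_sum measurable_path_algebra[OF kernel_path[OF assms]])

end

context Ld_quasi_diffusion
begin

lemma kill_integrand_measurable:
 assumes "f \<in> borel_measurable borel"
 shows "(%p. ennreal (kill (ball z r) p) * f (pos p)) \<in> borel_measurable (space_time x)"
 using kill_ball_measurable[of z r x] pos_measurable[OF assms, of x] by (intro borel_measurable_times_ennreal) auto

lemma kill_kernel:
 assumes f: "f \<in> borel_measurable borel"
 shows "(\<integral>\<^sup>+p. ennreal (kill (ball z r) p) * f (pos p) \<partial>space_time x) = (\<integral>\<^sup>+s. indicator {0..} s * kernel (ball z r) (max 0 s) f x \<partial>lborel)"
  and "(%s. indicator {0..} s * kernel (ball z r) (max 0 s) f x) \<in> borel_measurable lborel"
proof -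
 interpret pair_sigma_finite "P x" "lborel :: real measure" by (rule pair_sigma_finite_P)
 let ?g = "%p. ennreal (kill (ball z r) p) * f (pos p)"
 have m: "?g \<in> borel_measurable (P x \<Otimes>\<^sub>M lborel)" using kill_integrand_measurable[OF f] by (simp add: space_time_def)
 have eq: "(\<integral>\<^sup>+w. ?g (w, s) \<partial>P x) = indicator {0..} s * kernel (ball z r) (max 0 s) f x" for s
 proof (cases "0 <= s")
  case True
  thus ?thesis unfolding kernel_def by (auto simp: kill_def indicator_def intro!: nn_integral_cong)
 qed (simp add: kill_def)
 show "(\<integral>\<^sup>+p. ?g p \<partial>space_time x) = (\<integral>\<^sup>+s. indicator {0..} s * kernel (ball z r) (max 0 s) f x \<partial>lborel)"
  unfolding space_time_def nn_integral_snd[OF m, symmetric] eq ..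
 have "(%s. \<integral>\<^sup>+w. ?g (w, s) \<partial>P x) \<in> borel_measurable lborel"
  using Px.borel_measurable_nn_integral_fst[OF measurable_compose[OF measurable_pair_swap' m]] by simp
 thus "(%s. indicator {0..} s * kernel (ball z r) (max 0 s) f x) \<in> borel_measurable lborel" unfolding eq .
qed

lemma kernel_0:
 assumes "x \<in> B"
 shows "kernel B 0 f x = f x"
proof -
 have "kernel B 0 f x = (\<integral>\<^sup>+w. f x \<partial>P x)"
  unfolding kernel_def using AE_start[of x] AE_space assms by (intro nn_integral_cong_AE) (auto simp: stay_def)
 thus ?thesis by (simp add: Px.emeasure_space_1[unfolded space_P])
qed

text \<open>The process is observed only at multiples of \<open>h\<close>. Decomposing at the first such time at which it
is in \<open>G\<close> needs nothing but the Markov property at fixed times; a strong Markov property, which the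
definition of the process does not provide, is avoided.\<close>

theorem domination:
 fixes z :: "real^'n" and r h H :: real and v :: "real^'n => ennreal"
 assumes h: "0 < h" and G: "G \<in> sets borel" and v: "v \<in> borel_measurable borel"
  and exc: "!!x t. x \<in> ball z r ==> 0 <= t ==> kernel (ball z r) t v x <= v x"
  and v1: "!!x. x \<in> G ==> x \<in> ball z r ==> 1 <= v x" and H: "0 <= H"
  and time: "!!x. x \<in> ball z r ==> (\<integral>\<^sup>+p. ennreal (kill (ball z r) p) \<partial>space_time x) <= ennreal H"
  and x: "x \<in> ball z r"
 shows "(\<integral>\<^sup>+p. ennreal (kill (ball z r) p * indicator G (pos p)) \<partial>space_time x) <= ennreal (h + H) * v x"
proof -
 let ?B = "ball z r" and ?M = "ennreal (h + H)"
 let ?K = "%s. kernel ?B s (indicator G)"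
 have \<Gamma>m: "(indicator G :: real^'n => ennreal) \<in> borel_measurable borel" using G by simp
 have kh: "0 <= real k * h" for k using h by simp
 have Km: "?K (real k * h) \<in> borel_measurable borel" for k by (rule kernel_measurable[OF kh \<Gamma>m])
 \<comment> \<open>\<open>h\<close> times the expected number of visits to \<open>G\<close> at the
   first \<open>n\<close> grid times, before the ball is left.\<close>
 define W where "W n y = (\<Sum>k<n. ennreal h * ?K (real k * h) y)" for n y
 have Wm: "W n \<in> borel_measurable borel" for n
  unfolding W_def [abs_def] using Km by (intro borel_measurable_sum borel_measurable_times_ennreal) auto
 \<comment> \<open>Survival is nonincreasing in time, so the sum is at most its first term plus the
   time integral; the first term gives the extra \<open>h\<close>.\<close>
 have W_bound: "W n y <= ?M" if y: "y \<in> ?B" for n y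
 proof -
  let ?j = "%s. kernel ?B s (%_. 1) y"
  have anti: "?j t <= ?j s" if "s <= t" for s t
   unfolding kernel_def using stay_mono[OF subset_refl that, of ?B] by (intro nn_integral_mono) (auto simp: indicator_def)
  have K\<kappa>: "?K s y <= ?j s" for s unfolding kernel_def by (intro nn_integral_mono) (auto simp: indicator_def)
  have step: "ennreal h * ?j (real (Suc k) * h) <= (\<integral>\<^sup>+s. indicator {real k * h..<real (Suc k) * h} s * (indicator {0..} s * ?j (max 0 s)) \<partial>lborel)" for k
  proof -
   have "ennreal h * ?j (real (Suc k) * h) = (\<integral>\<^sup>+s. ?j (real (Suc k) * h) * indicator {real k * h..<real (Suc k) * h} s \<partial>lborel)"
   proof -
    have "emeasure lborel {real k * h..<real (Suc k) * h} = ennreal h" using h by (subst emeasure_lborel_Ico) (auto simp: algebra_simps)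
    thus ?thesis by (subst nn_integral_cmult_indicator) (simp_all only: mult.commute sets_lborel atLeastLessThan_borel)
   qed
   also have "... <= (\<integral>\<^sup>+s. indicator {real k * h..<real (Suc k) * h} s * (indicator {0..} s * ?j (max 0 s)) \<partial>lborel)"
   proof (intro nn_integral_mono)
    fix s
    show "?j (real (Suc k) * h) * indicator {real k * h..<real (Suc k) * h} s <= indicator {real k * h..<real (Suc k) * h} s * (indicator {0..} s * ?j (max 0 s))"
    proof (cases "s \<in> {real k * h..<real (Suc k) * h}")
     case True
     hence "0 <= s" "s <= real (Suc k) * h" using kh[of k] by auto
     thus ?thesis using True anti[of s "real (Suc k) * h"] by (simp add: max_absorb2)
    qed simp
   qed
   finally show ?thesis .
  qed
  have "W n y <= (\<Sum>k<n. ennreal h * ?j (real k * h))"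
   unfolding W_def by (intro sum_mono mult_left_mono K\<kappa>) auto
  also have "... <= (\<Sum>k<Suc n. ennreal h * ?j (real k * h))" by simp
  also have "... = ennreal h * ?j 0 + (\<Sum>k<n. ennreal h * ?j (real (Suc k) * h))"
   by (subst sum.lessThan_Suc_shift) simp
  also have "... <= ennreal h + (\<Sum>k<n. \<integral>\<^sup>+s. indicator {real k * h..<real (Suc k) * h} s * (indicator {0..} s * ?j (max 0 s)) \<partial>lborel)"
   using kernel_0[OF y, of "%_. 1"] by (intro add_mono sum_mono step) auto
  also have "(\<Sum>k<n. \<integral>\<^sup>+s. indicator {real k * h..<real (Suc k) * h} s * (indicator {0..} s * ?j (max 0 s)) \<partial>lborel)
   = (\<integral>\<^sup>+s. (\<Sum>k<n. indicator {real k * h..<real (Suc k) * h} s) * (indicator {0..} s * ?j (max 0 s)) \<partial>lborel)"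
   unfolding sum_distrib_right using kill_kernel(2)[of "%_. 1" z r y] by (intro nn_integral_sum[symmetric]) auto
  also have "... <= (\<integral>\<^sup>+s. indicator {0..} s * ?j (max 0 s) \<partial>lborel)"
   unfolding sum_indicator_grid_ennreal[OF less_imp_le[OF h]] by (intro nn_integral_mono) (auto simp: indicator_def)
  also have "... = (\<integral>\<^sup>+p. ennreal (kill ?B p) \<partial>space_time y)" using kill_kernel(1)[of "%_. 1" y z r] by simp
  also have "... <= ennreal H" by (rule time[OF y])
  finally show ?thesis using h H by (simp add: add_left_mono)
 qed
 have W_shift: "W (Suc n) y = ennreal h * indicator G y + kernel ?B h (W n) y" if "y \<in> ?B" for n y
 proof -
  have h0: "0 <= h" using h by simp
  have sg: "?K (real (Suc k) * h) y = kernel ?B h (?K (real k * h)) y" for k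
   using kernel_semigroup[OF h0 kh \<Gamma>m, of z r k y] by (simp add: algebra_simps)
  have "W (Suc n) y = ennreal h * ?K 0 y + (\<Sum>k<n. ennreal h * ?K (real (Suc k) * h) y)"
   unfolding W_def by (subst sum.lessThan_Suc_shift) simp
  also have "(\<Sum>k<n. ennreal h * ?K (real (Suc k) * h) y) = (\<Sum>k<n. ennreal h * kernel ?B h (?K (real k * h)) y)"
   using sg by (intro sum.cong) auto
  also have "(\<Sum>k<n. ennreal h * kernel ?B h (?K (real k * h)) y) = kernel ?B h (W n) y" unfolding W_def using Km
   by (subst kernel_sum[OF h0]) (auto simp: kernel_cmult[OF h0] intro!: borel_measurable_times_ennreal)
  finally show ?thesis using kernel_0[OF that, of "indicator G"] by simp
 qed
 \<comment> \<open>On \<open>G\<close> the uniform bound suffices because \<open>v >= 1\<close>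
   there; off \<open>G\<close> one step of the semigroup leads back to the previous
   \<open>n\<close>, and excessivity closes the induction.\<close>
 have W_le: "W n y <= ?M * v y" if "y \<in> ?B" for n y using that
 proof (induction n arbitrary: y)
  case (Suc n)
  show ?case
  proof (cases "y \<in> G")
   case True
   have "W (Suc n) y <= ?M * 1" using W_bound[OF Suc.prems] by simp
   also have "... <= ?M * v y" using v1[OF True Suc.prems] by (intro mult_left_mono) auto
   finally show ?thesis .
  next
   case False
   have h0: "0 <= h" using h by simp
   have "W (Suc n) y = kernel ?B h (W n) y" using W_shift[OF Suc.prems] False by simp
   also have "... <= kernel ?B h (%y. ?M * v y) y" using Suc.IH h by (intro kernel_mono) auto
   also have "... = ?M * kernel ?B h v y" by (rule kernel_cmult[OF h0 v])
   also have "... <= ?M * v y" using exc[OF Suc.prems h0] by (intro mult_left_mono) auto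
   finally show ?thesis .
  qed
 qed (simp add: W_def)
 let ?q = "%s. indicator {0..} s * ?K (max 0 s) x"
 have qm: "?q \<in> borel_measurable lborel" by (rule kill_kernel(2)[OF \<Gamma>m])
 \<comment> \<open>The time integral is the integral, over the offset \<open>s\<close> in
   \<open>[0, h)\<close>, of grid sums started at time \<open>s\<close>.\<close>
 have trunc: "(\<integral>\<^sup>+s. indicator {0..<real n * h} s * ?q s \<partial>lborel) <= ?M * v x" for n
 proof -
  have part: "(\<integral>\<^sup>+s. indicator {real k * h..<real (Suc k) * h} s * ?q s \<partial>lborel) = (\<integral>\<^sup>+s. indicator {0..<h} s * kernel ?B s (?K (real k * h)) x \<partial>lborel)" for k
  proof -
   have "(\<integral>\<^sup>+s. indicator {real k * h..<real (Suc k) * h} s * ?q s \<partial>lborel) = (\<integral>\<^sup>+s. indicator {real k * h..<real (Suc k) * h} (real k * h + 1 * s) * ?q (real k * h + 1 * s) \<partial>lborel)"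
    using nn_integral_real_affine[of "%s. indicator {real k * h..<real (Suc k) * h} s * ?q s" 1 "real k * h"] qm by simp
   also have "... = (\<integral>\<^sup>+s. indicator {0..<h} s * kernel ?B s (?K (real k * h)) x \<partial>lborel)"
   proof (rule nn_integral_cong)
    fix s
    have "(real k * h + 1 * s \<in> {real k * h..<real (Suc k) * h}) = (s \<in> {0..<h})" by (auto simp: algebra_simps)
    moreover have "?q (real k * h + 1 * s) = kernel ?B s (?K (real k * h)) x" if "s \<in> {0..<h}"
     using that kh[of k] kernel_semigroup[of s "real k * h" "indicator G" z r x] \<Gamma>m by (simp add: add.commute max_absorb2)
    ultimately show "indicator {real k * h..<real (Suc k) * h} (real k * h + 1 * s) * ?q (real k * h + 1 * s) = indicator {0..<h} s * kernel ?B s (?K (real k * h)) x"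
     by (simp add: indicator_def)
   qed
   finally show ?thesis .
  qed
  have partm: "(%s. indicator {0..<h} s * kernel ?B s (?K (real k * h)) x) \<in> borel_measurable lborel" for k
  proof -
   have "(%s. indicator {0..<h} s * (indicator {0..} s * kernel ?B (max 0 s) (?K (real k * h)) x)) \<in> borel_measurable lborel"
    using kill_kernel(2)[OF Km] by measurable
   also have "(%s. indicator {0..<h} s * (indicator {0..} s * kernel ?B (max 0 s) (?K (real k * h)) x)) = (%s. indicator {0..<h} s * kernel ?B s (?K (real k * h)) x)"
    by (auto simp: indicator_def fun_eq_iff max_absorb2)
   finally show ?thesis .
  qed
  have "(\<integral>\<^sup>+s. indicator {0..<real n * h} s * ?q s \<partial>lborel) = (\<integral>\<^sup>+s. (\<Sum>k<n. indicator {real k * h..<real (Suc k) * h} s * ?q s) \<partial>lborel)"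
   unfolding sum_distrib_right[symmetric] sum_indicator_grid_ennreal[OF less_imp_le[OF h]] ..
  also have "... = (\<Sum>k<n. \<integral>\<^sup>+s. indicator {0..<h} s * kernel ?B s (?K (real k * h)) x \<partial>lborel)"
   unfolding part[symmetric] by (intro nn_integral_sum borel_measurable_times_ennreal qm) auto
  also have "... = (\<integral>\<^sup>+s. (\<Sum>k<n. indicator {0..<h} s * kernel ?B s (?K (real k * h)) x) \<partial>lborel)"
   by (rule nn_integral_sum[symmetric]) (rule partm)
  finally have "ennreal h * (\<integral>\<^sup>+s. indicator {0..<real n * h} s * ?q s \<partial>lborel) = (\<integral>\<^sup>+s. ennreal h * (\<Sum>k<n. indicator {0..<h} s * kernel ?B s (?K (real k * h)) x) \<partial>lborel)"
   by (subst nn_integral_cmult[OF borel_measurable_sum[OF partm]]) simp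
  also have "... <= (\<integral>\<^sup>+s. (?M * v x) * indicator {0..<h} s \<partial>lborel)"
  proof (rule nn_integral_mono)
   fix s
   show "ennreal h * (\<Sum>k<n. indicator {0..<h} s * kernel ?B s (?K (real k * h)) x) <= (?M * v x) * indicator {0..<h} s"
   proof (cases "s \<in> {0..<h}")
    case True
    hence s: "0 <= s" by simp
    have "ennreal h * (\<Sum>k<n. kernel ?B s (?K (real k * h)) x) = kernel ?B s (W n) x"
     unfolding W_def sum_distrib_left using Km
     by (subst kernel_sum[OF s]) (auto simp: kernel_cmult[OF s] intro!: borel_measurable_times_ennreal)
    also have "... <= kernel ?B s (%y. ?M * v y) x" by (intro kernel_mono s W_le)
    also have "... = ?M * kernel ?B s v x" by (rule kernel_cmult[OF s v])
    also have "... <= ?M * v x" using exc[OF x s] by (intro mult_left_mono) auto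
    finally show ?thesis using True by simp
   qed simp
  qed
  also have "... = ennreal h * (?M * v x)" using h by (subst nn_integral_cmult_indicator) (simp_all add: mult.commute)
  finally show ?thesis using h by (simp add: ennreal_mult_le_mult_iff)
 qed
 have "(\<integral>\<^sup>+p. ennreal (kill ?B p * indicator G (pos p)) \<partial>space_time x) = (\<integral>\<^sup>+p. ennreal (kill ?B p) * indicator G (pos p) \<partial>space_time x)"
  by (intro nn_integral_cong) (auto simp: indicator_def)
 also have "... = (\<integral>\<^sup>+s. ?q s \<partial>lborel)" by (rule kill_kernel(1)[OF \<Gamma>m])
 also have "... <= (\<integral>\<^sup>+s. liminf (%n. indicator {0..<real n * h} s * ?q s) \<partial>lborel)"
 proof (intro nn_integral_mono Liminf_bounded)
  fix s
  obtain m :: nat where m: "s / h < real m" using reals_Archimedean2 by blast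
  show "\<forall>\<^sub>F n in sequentially. ?q s <= indicator {0..<real n * h} s * ?q s"
   using eventually_ge_at_top[of m]
  proof eventually_elim
   case (elim n)
   have "s / h < real n" using m elim by linarith
   hence "s < real n * h" using h by (simp add: field_simps)
   thus ?case by (auto simp: indicator_def)
  qed
 qed
 also have "... <= liminf (%n. \<integral>\<^sup>+s. indicator {0..<real n * h} s * ?q s \<partial>lborel)"
  by (intro nn_integral_liminf borel_measurable_times_ennreal qm) auto
 also have "... <= liminf (%n. ?M * v x)" using trunc by (intro Liminf_mono always_eventually allI)
 also have "... = ?M * v x" by (simp add: Liminf_const)
 finally show ?thesis .
qed

end

section \<open>Excessive functions and exit probabilities\<close>

context continuous_markov_process
begin

definition excessive :: "'e => real => ('e => ennreal) => bool" where
 "excessive z r v \<longleftrightarrow> v \<in> borel_measurable borel & (ALL x:ball z r. ALL t>=0. kernel (ball z r) t v x <= v x)"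

lemma excessive_cmult: "excessive z r v ==> excessive z r (%y. c * v y)"
 unfolding excessive_def by (auto simp: kernel_cmult intro!: mult_left_mono)

lemma exit_time_finite_iff: "exit_time X z r w < \<infinity> \<longleftrightarrow> (EX t>=0. X t w ~: ball z r)"
 unfolding exit_time_def Inf_less_iff by force

definition exits :: "'e => real => 'w set" where
 "exits z r = {w \<in> Om. EX t>=0. X t w ~: ball z r}"

lemma exits_iff: "w \<in> exits z r \<longleftrightarrow> w \<in> Om & exit_time X z r w < \<infinity>"
 unfolding exits_def exit_time_finite_iff by simp

lemma exits_path: "exits z r \<in> sets path_algebra"
proof -
 have "{w \<in> space path_algebra. exit_time X z r w < \<infinity>} \<in> sets path_algebra"
  using exit_time_measurable[of z r] by measurable
 thus ?thesis unfolding exits_def exit_time_finite_iff by simp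
qed

lemma exits_P: "exits z r \<in> sets (P x)" using exits_path path_algebra_subset by blast

lemma exits_shift: "0 <= t ==> w \<in> Om ==> path_shift t w \<in> exits z r ==> w \<in> exits z r"
 using path_shift(2)[of t w] by (auto simp: exits_def) (metis add_nonneg_nonneg mem_ball)

definition hit :: "'e => real => 'e => ennreal" where
 "hit z r y = emeasure (P y) (exits z r)"

lemma hit_eq: "hit z r y = (\<integral>\<^sup>+w. indicator (exits z r) w \<partial>P y)"
 by (simp add: hit_def exits_P)

lemma hit_measurable: "hit z r \<in> borel_measurable borel" unfolding hit_eq [abs_def]
 by (rule markov_path(1)[OF order_refl _ borel_measurable_indicator[OF exits_path]]) (rule sets.empty_sets)

lemma hit_outside:
 assumes "y ~: ball z r"
 shows "hit z r y = 1"
proof -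
 have "AE w in P y. w \<in> exits z r"
  using AE_start[of y] AE_space by (eventually_elim) (use assms in \<open>auto simp: exits_def\<close>)
 thus ?thesis unfolding hit_def using Px.emeasure_eq_1_AE exits_P by blast
qed

lemma stay_hit:
 assumes t: "0 <= t"
 shows "kernel (ball z' r') t (hit z r) x = (\<integral>\<^sup>+w. indicator (stay (ball z' r') t) w * indicator (exits z r) (path_shift t w) \<partial>P x)"
 unfolding kernel_def hit_eq
 by (rule markov_path(2)[OF t stay_ball_F[OF t] borel_measurable_indicator[OF exits_path], symmetric])

lemma hit_excessive: "excessive z' r' (hit z r)" unfolding excessive_def
proof (intro conjI hit_measurable ballI allI impI)
 fix x and t :: real assume t: "0 <= t"
 show "kernel (ball z' r') t (hit z r) x <= hit z r x"
  unfolding stay_hit[OF t] hit_eq using exits_shift[OF t, of _ z r]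
  by (intro nn_integral_mono) (auto simp: indicator_def stay_def)
qed

text \<open>By the Markov property at time \<open>n\<close>, at least the fraction \<open>e\<close>
  of the paths that survive until then leaves later; but the event of surviving until
  \<open>n\<close> and still leaving at some time shrinks to the empty set as \<open>n\<close>
  grows.\<close>

lemma exits_AE_of_hit:
 assumes e: "0 < e" "!!y. ennreal e <= hit z r y"
 shows "AE w in P x. w \<in> exits z r"
proof -
 let ?B = "ball z r" and ?E = "exits z r"
 have S: "stay ?B (real n) \<in> sets (P x)" for n using stay_ball_path[of "real n" z r] path_algebra_subset by auto
 have EP: "?E \<in> sets (P x)" by (rule exits_P)
 have sub: "ennreal e * emeasure (P x) (Om - ?E) <= emeasure (P x) (stay ?B (real n) Int ?E)" for n
 proof -
  have n: "0 <= real n" by simp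
  have "Om - ?E <= stay ?B (real n)" by (auto simp: exits_def stay_def)
  hence "ennreal e * emeasure (P x) (Om - ?E) <= ennreal e * emeasure (P x) (stay ?B (real n))"
   by (intro mult_left_mono emeasure_mono S) auto
  also have "... = kernel ?B (real n) (%_. ennreal e) x"
   unfolding kernel_def using S by (subst nn_integral_multc) (auto simp: mult.commute)
  also have "... <= kernel ?B (real n) (hit z r) x" using e(2) by (intro kernel_mono) auto
  also have "... = (\<integral>\<^sup>+w. indicator (stay ?B (real n)) w * indicator ?E (path_shift (real n) w) \<partial>P x)"
   by (rule stay_hit[OF n])
  also have "... <= (\<integral>\<^sup>+w. indicator (stay ?B (real n) Int ?E) w \<partial>P x)"
   using exits_shift[OF n, of _ z r] by (intro nn_integral_mono) (auto simp: indicator_def stay_def)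
  finally show ?thesis using S EP by simp
 qed
 have "(%n. emeasure (P x) (stay ?B (real n) Int ?E)) \<longlonglongrightarrow> emeasure (P x) (\<Inter>n. stay ?B (real n) Int ?E)"
 proof (rule Lim_emeasure_decseq)
  show "decseq (%n. stay ?B (real n) Int ?E)" by (intro decseq_SucI) (auto simp: stay_def)
 qed (use S EP in auto)
 moreover have "(\<Inter>n. stay ?B (real n) Int ?E) = {}"
 proof (rule ccontr)
  assume "(\<Inter>n. stay ?B (real n) Int ?E) ~= {}"
  then obtain w where w: "!!n::nat. w \<in> stay ?B (real n)" "w \<in> ?E" by auto
  then obtain t where t: "0 <= t" "X t w ~: ?B" by (auto simp: exits_def)
  obtain n :: nat where "t < real n" using reals_Archimedean2 by blast
  thus False using w(1)[of n] t by (auto simp: stay_def)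
 qed
 ultimately have lim0: "(%n. emeasure (P x) (stay ?B (real n) Int ?E)) \<longlonglongrightarrow> 0" by (simp only: emeasure_empty)
 have "ennreal e * emeasure (P x) (Om - ?E) <= 0" by (rule LIMSEQ_le_const[OF lim0]) (use sub in auto)
 hence "emeasure (P x) (Om - ?E) = 0" using e(1) by (simp add: ennreal_eq_0_iff)
 thus ?thesis using sets.compl_sets[OF EP] by (intro AE_I[of _ _ "Om - ?E"]) auto
qed

lemma exit_point_sphere:
 assumes w: "w \<in> exits z r" and s: "X 0 w \<in> ball z r"
 shows "exit_point X z r w \<in> sphere z r"
proof -
 have O: "w \<in> Om" and fin: "exit_time X z r w < \<infinity>" using w by (simp_all only: exits_iff)
 obtain T where T: "exit_time X z r w = ereal T" "0 <= T"
  using fin exit_time_nonneg[of z r w] by (cases "exit_time X z r w") auto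
 have "w ~: stay (ball z r) T" using exit_time_le_iff[OF T(2) O, of z r] T(1) by simp
 have before: "X t w \<in> ball z r" if "0 <= t" "t < T" for t
 proof -
  have "~ exit_time X z r w <= ereal t" using T that by simp
  hence "w \<in> stay (ball z r) t" using exit_time_le_iff[OF that(1) O, of z r] by simp
  thus ?thesis using that by (auto simp: stay_def)
 qed
 obtain s' where s': "s' \<in> {0..T}" "X s' w ~: ball z r" using \<open>w ~: stay _ _\<close> O by (auto simp: stay_def)
 hence out: "X T w ~: ball z r" using before[of s'] by (cases "s' = T") auto
 hence T0: "0 < T" using s T(2) by (cases "T = 0") auto
 have "(%n. X (T - T / real (Suc n)) w) \<longlonglongrightarrow> X T w"
 proof (rule path_tendsto[OF O _ T(2)])
  show "0 <= T - T / real (Suc n)" for n using T(2) by (simp add: field_simps)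
  have "(%n. T - T * inverse (real (Suc n))) \<longlonglongrightarrow> T - T * 0"
   by (intro tendsto_diff tendsto_mult tendsto_const LIMSEQ_inverse_real_of_nat)
  thus "(%n. T - T / real (Suc n)) \<longlonglongrightarrow> T" by (simp add: divide_inverse)
 qed
 moreover have "X (T - T / real (Suc n)) w \<in> cball z r" for n
 proof -
  have "0 <= T - T / real (Suc n)" "T - T / real (Suc n) < T" using T0 by (auto simp: field_simps)
  thus ?thesis using before by (meson ball_subset_cball subsetD)
 qed
 ultimately have "X T w \<in> cball z r" using closed_sequentially[OF closed_cball, of "%n. X (T - T / real (Suc n)) w"] by metis
 thus ?thesis using out by (simp add: exit_point_def T)
qed

text \<open>On survival the shifted exit functional equals the original one, so the killed semigroup
  merely drops the paths that have left by time \<open>t\<close>. A mean value property at the exit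
  thus becomes an inequality at fixed times.\<close>

lemma exit_functional_excessive:
 fixes w :: "'e => real"
 assumes wm: "w \<in> borel_measurable borel" and w0: "!!y. 0 <= w y" and wC: "!!y. w y <= C"
  and mean: "!!y. y \<in> ball z r ==> w y = (LINT v|P y. indicator (exits z r) v * w (exit_point X z r v))"
 shows "excessive z r (%y. ennreal (w y))" unfolding excessive_def
proof (intro conjI ballI allI impI)
 show "(%y. ennreal (w y)) \<in> borel_measurable borel" using wm by simp
 fix x and t :: real assume x: "x \<in> ball z r" and t: "0 <= t"
 define Z where "Z v = indicator (exits z r) v * w (exit_point X z r v)" for v
 have Zm: "Z \<in> borel_measurable path_algebra"
  unfolding Z_def [abs_def] using measurable_compose[OF exit_point_measurable wm, of z r] exits_path
  by (intro borel_measurable_times borel_measurable_indicator) auto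
 have Z: "0 <= Z v" "Z v <= abs C" for v
  using w0[of "exit_point X z r v"] wC[of "exit_point X z r v"] by (auto simp: Z_def indicator_def)
 have rep: "ennreal (w y) = (\<integral>\<^sup>+v. ennreal (Z v) \<partial>P y)" if "y \<in> ball z r" for y
 proof -
  show ?thesis using mean[OF that] Z measurable_path_algebra[OF Zm, of y]
   by (subst nn_integral_eq_integral) (auto simp: Z_def[abs_def] intro!: Px.integrable_const_bound[where B="abs C"])
 qed
 have sh: "Z (path_shift t v) = Z v" if "v \<in> stay (ball z r) t" for v
  using exit_shift[OF t that] path_shift(1)[OF t, of v] that by (auto simp: Z_def indicator_def stay_def exits_iff)
 have Zm': "(%v. ennreal (Z v)) \<in> borel_measurable path_algebra" using Zm by simp
 have "kernel (ball z r) t (%y. ennreal (w y)) x = (\<integral>\<^sup>+v. indicator (stay (ball z r) t) v * (\<integral>\<^sup>+\<omega>'. ennreal (Z \<omega>') \<partial>P (X t v)) \<partial>P x)"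
  unfolding kernel_def using rep t by (intro nn_integral_cong) (auto simp: stay_def indicator_def)
 also have "... = (\<integral>\<^sup>+v. indicator (stay (ball z r) t) v * ennreal (Z (path_shift t v)) \<partial>P x)"
  by (rule markov_path(2)[OF t stay_ball_F[OF t] Zm', symmetric])
 also have "... <= (\<integral>\<^sup>+v. ennreal (Z v) \<partial>P x)"
  using sh by (intro nn_integral_mono) (auto simp: indicator_def)
 also have "... = ennreal (w x)" using rep[OF x] ..
 finally show "kernel (ball z r) t (%y. ennreal (w y)) x <= ennreal (w x)" .
qed

end

text \<open>The guaranteed time in \<open>G\<close>, half of \<open>occ_low * r^2\<close>, divided
  by the factor \<open>h + H\<close> of the domination bound, with \<open>h = r^2\<close> and
  \<open>H\<close> the bound for the mean exit time from radius \<open>2 r\<close>.\<close>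

definition growth_const :: "nat => real => real => real" where
 "growth_const d ell l = occ_low d ell l / (2 * (1 + 4 * exit_bound d ell))"

section \<open>The growth lemma and almost sure exit\<close>

context Ld_quasi_diffusion
begin

text \<open>The mean time spent in \<open>G\<close> is bounded below by the occupation estimate on
  the ball of radius \<open>r\<close> and above, in terms of \<open>v\<close>, by domination on the
  concentric ball of radius \<open>2 r\<close>.\<close>

theorem growth:
 assumes r: "0 < r" and l: "0 < l" and small: "root CARD('n) (local_drift (cball z (2 * r))) <= drift_tol CARD('n) ell l"
  and v: "excessive z (2 * r) v"
  and G: "G \<in> sets borel" "measure lborel (ball z (l * r) - G) <= vol_tol CARD('n) ell l * r ^ CARD('n)"
  and v1: "!!y. y \<in> G ==> y \<in> ball z (2 * r) ==> 1 <= v y"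
  and x: "x \<in> cball z (3 / 4 * r)"
 shows "ennreal (growth_const CARD('n) ell l) <= v x"
proof -
 let ?d = "CARD('n)" and ?B = "ball z (2 * r)"
 define e ol where "e = exit_bound ?d ell" and "ol = occ_low ?d ell l"
 have eo: "0 < e" "0 < ol" using occ_constants_pos(2)[OF ell, of ?d] occ_constants_pos(3)[OF ell, of ?d l] by (simp_all add: e_def ol_def)
 have "local_drift (cball z r) <= local_drift (cball z (2 * r))"
  using r by (intro local_drift_mono) (auto intro!: subset_cball)
 hence small1: "root ?d (local_drift (cball z r)) <= drift_tol ?d ell l"
  using small by (meson order_trans real_root_le_mono zero_less_card_finite)
 have x2: "x \<in> ?B" using x r by (auto simp: dist_commute)
 have "ennreal (ol / 2 * r^2) <= (\<integral>\<^sup>+p. ennreal (kill (cball z r) p * indicator G (pos p)) \<partial>space_time x)"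
  unfolding ol_def by (rule occupation_lower_bound[OF r x l small1 G])
 also have "... <= (\<integral>\<^sup>+p. ennreal (kill ?B p * indicator G (pos p)) \<partial>space_time x)"
 proof (intro nn_integral_mono ennreal_leI mult_right_mono)
  have "cball z r <= ?B" using r by auto
  thus "kill (cball z r) p <= kill ?B p" for p
   using stay_mono[OF _ order_refl, of "cball z r" ?B] by (force simp: kill_def indicator_def)
 qed simp
 also have "... <= ennreal (r^2 + e * (2 * r)^2) * v x"
 proof (rule domination[OF _ G(1) _ _ v1 _ _ x2])
  show "0 < r^2" using r by simp
  show "v \<in> borel_measurable borel" "!!x t. x \<in> ?B ==> 0 <= t ==> kernel ?B t v x <= v x" using v by (auto simp: excessive_def)
  show "0 <= e * (2 * r)^2" using eo by simp
  fix y assume y: "y \<in> ?B"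
  have "(\<integral>\<^sup>+p. ennreal (kill ?B p) \<partial>space_time y) <= (\<integral>\<^sup>+p. ennreal (kill (cball z (2 * r)) p) \<partial>space_time y)"
   using stay_mono[OF ball_subset_cball order_refl] by (intro nn_integral_mono ennreal_leI) (force simp: kill_def indicator_def)
  also have "... <= ennreal (e * (2 * r)^2)"
   unfolding e_def using r y by (intro exit_time_bound drift_tol_abp[OF small]) (auto intro: subsetD[OF ball_subset_cball])
  finally show "(\<integral>\<^sup>+p. ennreal (kill ?B p) \<partial>space_time y) <= ennreal (e * (2 * r)^2)" .
 qed
 finally have main: "ennreal (ol / 2 * r^2) <= ennreal (r^2 + e * (2 * r)^2) * v x" .
 define k where "k = 1 / (r^2 * (1 + 4 * e))"
 have k: "0 < k" using r eo by (simp add: k_def)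
 have k1: "k * (r^2 + e * (2 * r)^2) = 1"
 proof -
  have "r^2 + e * (2 * r)^2 = r^2 * (1 + 4 * e)" by (simp add: power2_eq_square algebra_simps)
  moreover have "0 < r^2 * (1 + 4 * e)" using r eo by simp
  ultimately show ?thesis unfolding k_def by (metis less_numeral_extra(3) nonzero_divide_eq_eq)
 qed
 have k2: "growth_const ?d ell l = k * (ol / 2 * r^2)"
 proof -
  have "ol / (2 * E) = 1 / (r^2 * E) * (ol / 2 * r^2)" if "0 < E" for E using that r by (simp add: field_simps)
  thus ?thesis using eo by (simp add: growth_const_def k_def e_def[symmetric] ol_def[symmetric])
 qed
 have "ennreal (growth_const ?d ell l) = ennreal k * ennreal (ol / 2 * r^2)" unfolding k2 by (rule ennreal_mult'[OF less_imp_le[OF k]])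
 also have "... <= ennreal k * (ennreal (r^2 + e * (2 * r)^2) * v x)" by (intro mult_left_mono main) simp
 also have "... = ennreal (k * (r^2 + e * (2 * r)^2)) * v x" using k by (simp add: ennreal_mult' mult.assoc)
 finally show ?thesis unfolding k1 by simp
qed

text \<open>Absolute continuity of the integral, uniform in the centre. The radius depends on
  \<open>b\<close> itself, so it may enter qualitative conclusions only.\<close>

lemma uniform_small_drift:
 assumes e: "0 < e"
 obtains r where "0 < r" "!!z. local_drift (cball z r) <= e"
proof -
 let ?d = "CARD('n)"
 define g where "g y = norm (b y) ^ ?d" for y
 have gi: "integrable lborel g" unfolding g_def [abs_def] by (rule b_Ld)
 have g0: "0 <= g y" for y by (simp add: g_def)
 have [measurable]: "g \<in> borel_measurable lborel" using gi by (rule borel_measurable_integrable)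
 have ti: "integrable lborel (%y. indicator {y. real n < g y} y * g y)" for n
  by (rule Bochner_Integration.integrable_bound[OF gi]) (auto simp: indicator_def g0)
 have "(%n. LINT y|lborel. indicator {y. real n < g y} y * g y) \<longlonglongrightarrow> (LINT y|(lborel :: (real^'n) measure). 0)"
 proof (rule integral_dominated_convergence[where w=g])
  show "AE y in lborel. (%n. indicator {y. real n < g y} y * g y) \<longlonglongrightarrow> 0"
  proof (rule AE_I2, rule tendsto_eventually)
   fix y :: "real^'n"
   obtain m :: nat where "g y < real m" using reals_Archimedean2 by blast
   hence "indicator {y. real n < g y} y * g y = 0" if "m <= n" for n using that by (auto simp: indicator_def)
   thus "\<forall>\<^sub>F n in sequentially. indicator {y. real n < g y} y * g y = 0" by (rule eventually_sequentiallyI)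
  qed
 qed (use g0 gi in \<open>auto simp: indicator_def\<close>)
 hence "\<forall>\<^sub>F n in sequentially. (LINT y|lborel. indicator {y. real n < g y} y * g y) < e / 2"
  using e by (intro order_tendstoD(2)) auto
 then obtain n where n: "(LINT y|lborel. indicator {y. real n < g y} y * g y) < e / 2"
  using eventually_happens trivial_limit_sequentially by blast
 define V where "V = unit_ball_vol (real ?d)"
 have V: "0 < V" by (simp add: V_def)
 define r where "r = min 1 (e / (2 * (real n * V + 1)))"
 have nV: "0 <= real n * V" using V by simp
 have r: "0 < r" "r <= 1" using e nV by (auto simp: r_def)
 show ?thesis
 proof (rule that[OF r(1)])
  fix z :: "real^'n"
  let ?W = "cball z r"
  have Wi: "integrable lborel (indicator ?W :: real^'n => real)"
   using emeasure_bounded_finite[of ?W] by (simp add: integrable_indicator_iff)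
  have "local_drift ?W <= (LINT y|lborel. real n * indicator ?W y + indicator {y. real n < g y} y * g y)"
   unfolding local_drift_def
   by (intro integral_mono local_drift_integrable Bochner_Integration.integrable_add ti integrable_mult_right Wi)
    (auto simp: indicator_def zero_power g_def not_less)
  also have "... = real n * measure lborel ?W + (LINT y|lborel. indicator {y. real n < g y} y * g y)"
   using Wi ti by simp
  also have "... <= real n * measure lborel ?W + e / 2" using n by simp
  also have "measure lborel ?W = V * r ^ ?d" using content_cball[of r z] r by (simp add: V_def)
  also have "real n * (V * r ^ ?d) <= real n * (V * r)"
   using r V power_decreasing[of 1 ?d r] by (intro mult_left_mono) (auto simp: Suc_leI)
  also have "real n * (V * r) <= (real n * V + 1) * r" using r by (simp add: algebra_simps)
  also have "... <= (real n * V + 1) * (e / (2 * (real n * V + 1)))"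
   using nV by (intro mult_left_mono) (auto simp: r_def)
  also have "... = e / 2" using nV by (simp add: field_simps)
  finally show "local_drift ?W <= e" by simp
 qed
qed

text \<open>The exit probability is 1 outside the ball. The growth lemma, at a scale where all balls
  have small drift, carries a positive lower bound inwards by \<open>j / 8\<close> per step, hence
  to every point after finitely many steps. The bound depends on \<open>b\<close>, and only its
  positivity is used.\<close>

theorem exit_finite: "AE h in P x. h \<in> exits z r"
proof -
 let ?d = "CARD('n)"
 define t where "t = drift_tol ?d ell (1/8)"
 define c where "c = growth_const ?d ell (1/8)"
 have t0: "0 < t" using occ_constants_pos(4)[OF ell, of ?d "1/8"] by (simp add: t_def)
 have c0: "0 < c" using occ_constants_pos(2)[OF ell, of ?d] occ_constants_pos(3)[OF ell, of ?d "1/8"] by (simp add: c_def growth_const_def add_pos_pos)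
 have "0 < t ^ ?d" using t0 by simp
 then obtain \<rho>' where \<rho>': "0 < \<rho>'" "!!z. local_drift (cball z \<rho>') <= t ^ ?d" using uniform_small_drift by blast
 define j where "j = \<rho>' / 2"
 have j: "0 < j" using \<rho>' by (simp add: j_def)
 have small: "root ?d (local_drift (cball w (2 * j))) <= drift_tol ?d ell (1/8)" for w
 proof -
  have "root ?d (local_drift (cball w (2 * j))) <= root ?d (t ^ ?d)" using \<rho>'(2)[of w] by (simp add: j_def)
  also have "... = t" using t0 by (intro real_root_power_cancel) auto
  finally show ?thesis by (simp add: t_def)
 qed
 have claim: "ennreal (c ^ k) <= hit z r y" if "r - real k * (j / 8) <= norm (y - z)" for k y using that
 proof (induction k arbitrary: y)
  case 0
  hence "y ~: ball z r" by (simp add: dist_norm norm_minus_commute)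
  thus ?case by (simp add: hit_outside)
 next
  case (Suc k)
  obtain e :: "real^'n" where e: "norm e = 1" "y - z = norm (y - z) *\<^sub>R e"
  proof (cases "y = z")
   case True
   thus ?thesis using that[of "axis undefined 1"] by (simp add: norm_axis_1)
  next
   case False
   thus ?thesis by (intro that[of "(1 / norm (y - z)) *\<^sub>R (y - z)"]) auto
  qed
  \<comment> \<open>A move outwards: all points of the ball of radius \<open>j / 8\<close> about
    \<open>w\<close> are farther from \<open>z\<close> than \<open>y\<close> by at least
    \<open>3/8 j\<close>, while \<open>y\<close> stays within \<open>3/4 j\<close> of
    \<open>w\<close>.\<close>
  define w where "w = y + (j / 2) *\<^sub>R e"
  have nw: "norm (w - z) = norm (y - z) + j / 2"
  proof -
   have "w - z = norm (y - z) *\<^sub>R e + (j / 2) *\<^sub>R e" using e(2) by (simp add: w_def algebra_simps)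
   also have "... = (norm (y - z) + j / 2) *\<^sub>R e" by (simp add: scaleR_add_left)
   finally show ?thesis using e(1) j by simp
  qed
  define G where "G = {q. ennreal (c ^ k) <= hit z r q}"
  define v where "v q = ennreal (1 / c ^ k) * hit z r q" for q
  have \<Gamma>m: "G \<in> sets borel"
  proof -
   have "{q \<in> space borel. ennreal (c ^ k) <= hit z r q} \<in> sets borel"
    using hit_measurable[of z r] by measurable
   thus ?thesis by (simp add: G_def)
  qed
  have sub: "ball w (1/8 * j) <= G"
  proof
   fix q assume "q \<in> ball w (1/8 * j)"
   hence "norm (w - q) < j / 8" by (simp add: dist_norm)
   moreover have "norm (w - z) <= norm (w - q) + norm (q - z)" using norm_triangle_ineq[of "w - q" "q - z"] by simp
   moreover have "r - (real k + 1) * (j / 8) <= norm (y - z)" using Suc.prems by (simp add: add.commute)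
   hence "r - real k * (j / 8) - j / 8 <= norm (y - z)" by (simp add: algebra_simps add_divide_distrib)
   ultimately have "r - real k * (j / 8) <= norm (q - z)" using nw j by linarith
   thus "q \<in> G" using Suc.IH by (simp add: G_def)
  qed
  have "ennreal c <= v y" unfolding c_def
  proof (rule growth[OF j _ small _ \<Gamma>m])
   show "excessive w (2 * j) v" unfolding v_def [abs_def] by (intro excessive_cmult hit_excessive)
   have "ball w (1/8 * j) - G = {}" using sub by blast
   hence "measure lborel (ball w (1/8 * j) - G) = 0" by (simp only: measure_empty)
   thus "measure lborel (ball w (1/8 * j) - G) <= vol_tol ?d ell (1/8) * j ^ ?d"
    using j occ_constants_pos(5)[OF ell, of ?d "1/8"] by (simp add: less_imp_le)
   show "y \<in> cball w (3 / 4 * j)" using e j by (simp add: w_def dist_norm)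
   fix q assume "q \<in> G"
   hence "ennreal (1 / c ^ k) * ennreal (c ^ k) <= v q" unfolding v_def G_def by (intro mult_left_mono) auto
   thus "1 <= v q" using c0 by (simp add: ennreal_mult'[symmetric])
  qed simp
  hence "ennreal (c ^ k) * ennreal c <= ennreal (c ^ k) * v y" by (intro mult_left_mono) auto
  also have "... = ennreal (c ^ k * (1 / c ^ k)) * hit z r y" unfolding v_def using c0 by (subst ennreal_mult') (auto simp: mult.assoc)
  also have "... = hit z r y" using c0 by simp
  finally show ?case using c0 by (simp add: ennreal_mult'[symmetric] mult.commute)
 qed
 obtain k :: nat where k: "r / (j / 8) < real k" using reals_Archimedean2 by blast
 have "r < real k * (j / 8)" using k j by (simp add: field_simps)
 hence "ennreal (c ^ k) <= hit z r y" for y using claim[of k y] norm_ge_zero[of "y - z"] by linarith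
 thus ?thesis using c0 by (intro exits_AE_of_hit[of "c ^ k"]) auto
qed

end

section \<open>The Harnack inequality from the growth property\<close>

text \<open>Integer division rounds down, so cubes with negative indices are covered as
  well.\<close>

definition dparent :: "int^'n => int^'n" where
 "dparent q = (\<chi> i. q $ i div 2)"

lemma didx_parent: "didx k x = dparent (didx (Suc k) x)"
proof -
 have "\<lfloor>2 ^ k * t\<rfloor> = \<lfloor>2 ^ Suc k * t\<rfloor> div 2" for t :: real
  using floor_divide_real_eq_div[of 2 "2 ^ Suc k * t"] by simp
 thus ?thesis by (simp add: didx_def dparent_def vec_eq_iff)
qed

lemma dcube_parent: "dcube (Suc k) q <= dcube k (dparent q)" by (auto simp: dcube_def didx_parent[of k])

lemma finite_dchildren: "finite {q'. dparent q' = (q :: int^'n)}"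
proof (rule finite_subset)
 show "{q'. dparent q' = q} <= {q'. ALL l. q' $ l \<in> (\<Union>i. {2 * q $ i..2 * q $ i + 1})}"
 proof (intro subsetI CollectI allI)
  fix q' l assume "q' \<in> {q'. dparent q' = q}"
  hence "q $ l = q' $ l div 2" by (auto simp: dparent_def)
  thus "q' $ l \<in> (\<Union>i. {2 * q $ i..2 * q $ i + 1})" by (intro UN_I[of l]) auto
 qed
 show "finite {q' :: int^'n. ALL l. q' $ l \<in> (\<Union>i. {2 * q $ i..2 * q $ i + 1})}"
  by (rule finite_vec_set) simp
qed

lemma dcube_finite: "emeasure lborel (S Int dcube k q) ~= \<infinity>" for S :: "(real^'n) set"
proof -
 have "emeasure lborel (S Int dcube k q) <= emeasure lborel (dcube k q)" by (intro emeasure_mono) auto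
 also have "... < \<infinity>" by (simp add: emeasure_dcube)
 finally show ?thesis by simp
qed

lemma measure_dcube_mono: "S <= T ==> T \<in> sets borel ==> measure lborel (S Int dcube k q) <= measure lborel (T Int dcube k q)" for S :: "(real^'n) set"
 unfolding measure_def using dcube_finite[of T k q] by (intro enn2real_mono emeasure_mono) (auto simp: less_top)

lemma measure_dchildren:
 assumes S: "S \<in> sets borel"
 shows "measure lborel (S Int dcube k q) = (\<Sum>q'\<in>{q'. dparent q' = q}. measure lborel (S Int dcube (Suc k) q'))"
proof -
 have "S Int dcube k q = (\<Union>q'\<in>{q'. dparent q' = q}. S Int dcube (Suc k) q')"
  by (auto simp: dcube_def didx_parent[of k])
 moreover have "measure lborel (\<Union>q'\<in>{q'. dparent q' = q}. S Int dcube (Suc k) q') = (\<Sum>q'\<in>{q'. dparent q' = q}. measure lborel (S Int dcube (Suc k) q'))"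
 proof (intro measure_finite_Union finite_dchildren dcube_finite)
  show "disjoint_family_on (%q'. S Int dcube (Suc k) q') {q'. dparent q' = q}" by (auto simp: disjoint_family_on_def dcube_def)
 qed (use S in auto)
 ultimately show ?thesis by simp
qed

text \<open>The third term on the right-hand side of the claim in the proof is what remains of the Lebesgue
 density theorem: a cube inside \<open>U\<close> in which \<open>A\<close> is not dense contains a fixed portion of \<open>U - A\<close>.\<close>

lemma ink_spots:
 fixes A B :: "(real^'n) set"
 assumes A: "A \<in> sets borel" "A <= dcube 0 0" and B: "B \<in> sets borel" and e: "0 < e" "e < 1"
  and sparse: "measure lborel A <= 1 - e"
  and dense: "!!k q. dcube k (dparent q) <= dcube 0 0 ==>
   (1 - e) * measure lborel (dcube (Suc k) q) < measure lborel (A Int dcube (Suc k) q) ==> dcube k (dparent q) <= B"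
 shows "measure lborel A <= (1 - e) * measure lborel (B Int dcube 0 0)"
proof (rule field_le_epsilon)
 fix h :: real assume h: "0 < h"
 let ?m = "measure (lborel :: (real^'n) measure)" and ?Q0 = "dcube 0 0 :: (real^'n) set"
 have "0 < h * e" using h e by simp
 moreover have "A \<in> sets lebesgue" using A by simp
 ultimately obtain U where U: "open U" "A <= U" "emeasure lebesgue (U - A) < ennreal (h * e)"
  using sets_lebesgue_outer_open by metis
 have UA: "U - A \<in> sets borel" using U A by auto
 have UA_less: "?m ((U - A) Int ?Q0) <= h * e"
 proof -
  have "emeasure lborel ((U - A) Int ?Q0) <= emeasure lborel (U - A)" using UA by (intro emeasure_mono) auto
  also have "... <= ennreal (h * e)" using U UA by simp
  finally show ?thesis unfolding measure_def using \<open>0 < h * e\<close> by (intro enn2real_leI) auto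
 qed
 define V where "V n = {x. dcube n (didx n x) <= U}" for n
 have Vm: "V n \<in> sets borel" for n
 proof -
  have "V n = (\<Union>q\<in>{q. dcube n q <= U}. dcube n q)" by (auto simp: V_def dcube_def)
  also have "... \<in> sets borel" by (intro sets.countable_UN'') (auto intro: countable_subset)
  finally show ?thesis .
 qed
 have AV: "A Int V n \<in> sets borel" for n using A Vm by auto
 \<comment> \<open>Induction from level \<open>n\<close> to coarser cubes. A sparse cube with a
   dense child lies in \<open>B\<close>; otherwise all children are sparse and their estimates add
   up.\<close>
 have claim: "?m ((A Int V n) Int dcube j q) <= (1 - e) * ?m (B Int dcube j q) + (1 / e) * ?m ((U - A) Int dcube j q)"
  if "j <= n" "dcube j q <= ?Q0" "?m (A Int dcube j q) <= (1 - e) * ?m (dcube j q)" for n j q using that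
 proof (induction "n - j" arbitrary: j q)
  case 0
  hence j: "j = n" by simp
  show ?case
  proof (cases "dcube n q <= U")
   case True
   have "?m (dcube n q) = ?m (A Int dcube n q) + ?m ((U - A) Int dcube n q)"
   proof -
    have "dcube n q = (A Int dcube n q) Un ((U - A) Int dcube n q)" using True by auto
    moreover have "?m ((A Int dcube n q) Un ((U - A) Int dcube n q)) = ?m (A Int dcube n q) + ?m ((U - A) Int dcube n q)"
     using A UA dcube_finite by (intro measure_Union) auto
    ultimately show ?thesis by simp
   qed
   hence "e * ?m (dcube n q) <= ?m ((U - A) Int dcube n q)" using 0(4) j by (simp add: algebra_simps)
   moreover have "?m ((A Int V n) Int dcube n q) <= ?m (dcube n q)" using measure_dcube_mono[of "A Int V n" UNIV n q] by simp
   ultimately have "e * ?m ((A Int V n) Int dcube n q) <= ?m ((U - A) Int dcube n q)"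
    using e by (meson mult_left_mono less_imp_le order_trans)
   hence "?m ((A Int V n) Int dcube n q) <= (1 / e) * ?m ((U - A) Int dcube n q)" using e by (simp add: field_simps)
   moreover have "0 <= (1 - e) * ?m (B Int dcube n q)" using e by simp
   ultimately show ?thesis using j by simp
  next
   case False
   hence "(A Int V n) Int dcube n q = {}" by (auto simp: V_def dcube_def)
   hence "?m ((A Int V n) Int dcube n q) = 0" by (simp only: measure_empty)
   thus ?thesis using e j by simp
  qed
 next
  case (Suc m)
  hence m: "m = n - Suc j" "Suc j <= n" by auto
  show ?case
  proof (cases "EX q'. dparent q' = q & (1 - e) * ?m (dcube (Suc j) q') < ?m (A Int dcube (Suc j) q')")
   case True
   hence "dcube j q <= B" using dense Suc.prems(2) by blast
   hence "B Int dcube j q = dcube j q" by auto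
   moreover have "?m ((A Int V n) Int dcube j q) <= ?m (A Int dcube j q)" using A by (intro measure_dcube_mono) auto
   moreover have "0 <= (1 / e) * ?m ((U - A) Int dcube j q)" using e by simp
   ultimately show ?thesis using Suc.prems(3) by simp
  next
   case False
   have "?m ((A Int V n) Int dcube j q) = (\<Sum>q'\<in>{q'. dparent q' = q}. ?m ((A Int V n) Int dcube (Suc j) q'))"
    by (rule measure_dchildren[OF AV])
   also have "... <= (\<Sum>q'\<in>{q'. dparent q' = q}. (1 - e) * ?m (B Int dcube (Suc j) q') + (1 / e) * ?m ((U - A) Int dcube (Suc j) q'))"
    using False Suc.prems(2) dcube_parent by (intro sum_mono Suc.hyps(1) m) (force simp: not_less)+
   also have "... = (1 - e) * ?m (B Int dcube j q) + (1 / e) * ?m ((U - A) Int dcube j q)"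
    unfolding measure_dchildren[OF B, of j q] measure_dchildren[OF UA, of j q] by (simp only: sum.distrib sum_distrib_left)
   finally show ?thesis .
  qed
 qed
 have A0: "A Int ?Q0 = A" using A by auto
 have bound: "?m (A Int V n) <= (1 - e) * ?m (B Int ?Q0) + h" for n
 proof -
  have "(A Int V n) Int ?Q0 = A Int V n" using A by auto
  hence "?m (A Int V n) <= (1 - e) * ?m (B Int ?Q0) + (1 / e) * ?m ((U - A) Int ?Q0)"
   using claim[of 0 n 0] sparse by (simp add: A0 measure_dcube)
  also have "(1 / e) * ?m ((U - A) Int ?Q0) <= (1 / e) * (h * e)" using UA_less e by (intro mult_left_mono) auto
  finally show ?thesis using e by simp
 qed
 have "(%n. ?m (A Int V n)) \<longlonglongrightarrow> ?m (\<Union>n. A Int V n)"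
 proof (rule Lim_measure_incseq)
  show "range (%n. A Int V n) <= sets lborel" using AV by auto
  show "incseq (%n. A Int V n)"
  proof (intro incseq_SucI subsetI)
   fix n x assume "x \<in> A Int V n"
   thus "x \<in> A Int V (Suc n)" using dcube_parent[of n "didx (Suc n) x"] by (auto simp: V_def didx_parent[symmetric])
  qed
  have "(\<Union>n. A Int V n) = (\<Union>n. A Int V n) Int ?Q0" using A by auto
  thus "emeasure lborel (\<Union>n. A Int V n) ~= \<infinity>" using dcube_finite by metis
 qed
 moreover have "(\<Union>n. A Int V n) = A"
 proof (intro equalityI subsetI)
  fix x assume x: "x \<in> A"
  hence "\<forall>\<^sub>F k in sequentially. dcube k (didx k x) <= U" using U by (intro dcube_eventually_subset_open) auto
  then obtain k where "dcube k (didx k x) <= U" using eventually_happens trivial_limit_sequentially by blast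
  thus "x \<in> (\<Union>n. A Int V n)" using x by (auto simp: V_def)
 qed auto
 ultimately have "(%n. ?m (A Int V n)) \<longlonglongrightarrow> ?m A" by simp
 thus "?m A <= (1 - e) * ?m (B Int ?Q0) + h" by (rule LIMSEQ_le_const2) (use bound in auto)
qed

text \<open>Normalization \<open>A u + B\<close> makes the property available for \<open>u\<close> as well as for constants minus \<open>u\<close>.\<close>

definition growth_property :: "real => real => real => (real^'n) set => (real^'n => real) => bool" where
 "growth_property c m k D u \<longleftrightarrow> (ALL A B y s l x. 0 < s --> cball y (2 * s) <= D --> (ALL q:cball y (2 * s). 0 <= A * u q + B) -->
  0 < l --> measure lborel {q \<in> ball y (k * s). A * u q + B < l} <= m * s ^ CARD('n) --> x \<in> cball y (3 / 4 * s) -->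
  c * l <= A * u x + B)"

text \<open>A cube of side \<open>l\<close> is treated at the scale \<open>s = 4 sqrt d l\<close>;
  then the ball of radius \<open>harnack_angle d * s = l / 2\<close> about its centre is inscribed
  in the cube.\<close>

abbreviation harnack_angle :: "nat => real" where
 "harnack_angle d == 1 / (8 * sqrt d)"

text \<open>If \<open>u > M^(k+1)\<close> on most of a cube, the growth property on its inscribed
  ball gives \<open>u > M^k\<close> on the parent cube, as \<open>c M > 1\<close>. The covering
  lemma then makes the measure drop by the factor \<open>1 - e\<close> per level; the point with
  \<open>u y0 <= 1\<close> keeps the unit cube itself from being dense.\<close>

lemma weak_type_bound:
 fixes u :: "real^'n => real"
 assumes g: "growth_property c h (harnack_angle CARD('n)) D u" and c: "0 < c" "1 < c * M" and M: "1 < M"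
  and e: "0 < e" "e < 1" "e <= h"
  and D: "!!y. y \<in> dcube 0 0 ==> cball y (8 * sqrt CARD('n)) <= D" and u: "u \<in> borel_measurable borel" "!!y. y \<in> D ==> 0 <= u y"
  and y0: "y0 \<in> dcube 0 0" "u y0 <= 1"
 shows "measure lborel {x \<in> dcube 0 0. M ^ k < u x} <= (1 - e) ^ k"
proof (induction k)
 case 0
 have "measure lborel ({x \<in> dcube 0 0. 1 < u x} Int dcube 0 0) <= measure lborel (UNIV Int (dcube 0 0 :: (real^'n) set))"
  by (intro measure_dcube_mono) auto
 moreover have "{x \<in> dcube 0 0. 1 < u x} Int dcube 0 0 = {x \<in> dcube 0 0. 1 < u x}" by auto
 ultimately show ?case by (simp add: measure_dcube)
next
 case (Suc k)
 let ?d = "CARD('n)" and ?m = "measure (lborel :: (real^'n) measure)"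
 define A where "A k = {x \<in> dcube 0 0. M ^ k < u x}" for k
 have Am: "A k \<in> sets borel" for k
 proof -
  have "{x \<in> space borel. M ^ k < u x} \<in> sets borel" using u(1) by measurable
  hence "dcube 0 0 Int {x \<in> space borel. M ^ k < u x} \<in> sets borel" by auto
  moreover have "A k = dcube 0 0 Int {x \<in> space borel. M ^ k < u x}" by (auto simp: A_def)
  ultimately show ?thesis by simp
 qed
 have sd: "1 <= sqrt ?d" by (simp add: Suc_leI)
 have fact: "M ^ k < u x" if q: "dcube j q <= dcube 0 0"
  and dense: "(1 - e) * ?m (dcube j q) < ?m (A (Suc k) Int dcube j q)"
  and near: "!!y. y \<in> dcube j q ==> norm (x - y) <= sqrt ?d * (2 / 2 ^ j)" for j q x
 proof -
  define l :: real where "l = 1 / 2 ^ j"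
  have l: "0 < l" "l <= 1" by (simp_all add: l_def)
  define y where "y = dcorner j q + (\<chi> i. l / 2)"
  have yi: "y $ i = of_int (q $ i) * l + l / 2" for i by (simp add: y_def dcorner_def l_def)
  have mem: "p \<in> dcube j q \<longleftrightarrow> (ALL i. of_int (q $ i) * l <= p $ i & p $ i < of_int (q $ i) * l + l)" for p
   unfolding mem_dcube by (simp add: l_def add_divide_distrib)
  have yq: "y \<in> dcube j q" using l by (simp add: mem yi)
  \<comment> \<open>The parent cube lies within \<open>2 sqrt d l\<close> of the centre, hence in
    the ball of radius \<open>3/4 s\<close> where the growth property speaks.\<close>
  define s where "s = 4 * sqrt ?d * l"
  have s: "0 < s" "l <= s" "s <= 4 * sqrt ?d"
  proof -
   show "0 < s" using l sd unfolding s_def by (intro mult_pos_pos) auto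
   have "1 * l <= 4 * sqrt ?d * l" using l sd by (intro mult_right_mono) linarith+
   thus "l <= s" by (simp add: s_def)
   have "4 * sqrt ?d * l <= 4 * sqrt ?d * 1" using l sd by (intro mult_left_mono) linarith+
   thus "s <= 4 * sqrt ?d" by (simp add: s_def)
  qed
  have \<theta>s: "harnack_angle ?d * s = l / 2" using sd by (simp add: s_def field_simps)
  have ball: "ball y (l / 2) <= dcube j q"
  proof
   fix p assume "p \<in> ball y (l / 2)"
   hence "abs (p $ i - y $ i) < l / 2" for i
    using component_le_norm_cart[of "p - y" i] by (simp add: dist_norm norm_minus_commute)
   hence "abs (p $ i - (of_int (q $ i) * l + l / 2)) < l / 2" for i unfolding yi .
   thus "p \<in> dcube j q" unfolding mem abs_less_iff by (smt (verit) field_sum_of_halves)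
  qed
  have "c * M ^ Suc k <= 1 * u x + 0"
  proof (rule g[unfolded growth_property_def, rule_format, of s y 1 0 "M ^ Suc k" x])
   show sub: "cball y (2 * s) <= D" using D[of y] yq q s by (intro order_trans[OF _ D[of y]]) (auto intro!: subset_cball)
   show "0 <= 1 * u p + 0" if "p \<in> cball y (2 * s)" for p using u(2) that sub by auto
   have "?m {p \<in> ball y (harnack_angle ?d * s). 1 * u p + 0 < M ^ Suc k} <= ?m (dcube j q - A (Suc k))"
   proof -
    let ?S = "{p \<in> ball y (l / 2). 1 * u p + 0 < M ^ Suc k}"
    have "?m (?S Int dcube j q) <= ?m (- A (Suc k) Int dcube j q)"
    proof (rule measure_dcube_mono)
     show "- A (Suc k) \<in> sets borel" using Am[of "Suc k"] by auto
    qed (auto simp: A_def)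
    moreover have "?S Int dcube j q = ?S" "- A (Suc k) Int dcube j q = dcube j q - A (Suc k)" using ball by auto
    ultimately show ?thesis unfolding \<theta>s by simp
   qed
   also have "... = ?m (dcube j q) - ?m (A (Suc k) Int dcube j q)"
   proof -
    have "?m ((A (Suc k) Int dcube j q) Un (- A (Suc k) Int dcube j q)) = ?m (A (Suc k) Int dcube j q) + ?m (- A (Suc k) Int dcube j q)"
    proof (rule measure_Union[OF dcube_finite dcube_finite])
     show "- A (Suc k) Int dcube j q \<in> sets lborel" using Am[of "Suc k"] by auto
    qed (use Am in auto)
    moreover have "(A (Suc k) Int dcube j q) Un (- A (Suc k) Int dcube j q) = dcube j q" "- A (Suc k) Int dcube j q = dcube j q - A (Suc k)" by auto
    ultimately show ?thesis by simp
   qed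
   also have "... <= e * ?m (dcube j q)" using dense by (simp add: algebra_simps)
   also have "... <= h * s ^ ?d" unfolding measure_dcube l_def[symmetric]
    using e s l by (intro mult_mono power_mono) auto
   finally show "?m {p \<in> ball y (harnack_angle ?d * s). 1 * u p + 0 < M ^ Suc k} <= h * s ^ ?d" .
   show "x \<in> cball y (3 / 4 * s)"
   proof -
    have "norm (x - y) <= 2 * (sqrt ?d * l)" using near[OF yq] by (simp add: l_def mult.commute)
    also have "... <= 3 / 4 * s" using l sd by (simp add: s_def)
    finally show ?thesis by (simp add: dist_norm norm_minus_commute)
   qed
  qed (use s M in auto)
  moreover have "1 * M ^ k < (c * M) * M ^ k" using c(2) M by (intro mult_strict_right_mono) auto
  ultimately show ?thesis by (simp add: mult.assoc)
 qed
 have "?m (A (Suc k)) <= (1 - e) * ?m (A k Int dcube 0 0)"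
 proof (rule ink_spots[OF Am _ Am e(1,2)])
  show "A (Suc k) <= dcube 0 0" by (auto simp: A_def)
  hence eq: "A (Suc k) Int dcube 0 0 = A (Suc k)" by auto
  show "?m (A (Suc k)) <= 1 - e"
  proof (rule ccontr)
   assume "~ ?thesis"
   hence "M ^ k < u y0"
   proof (intro fact[of 0 0])
    fix y :: "real^'n" assume "y \<in> dcube 0 0"
    hence "norm (y0 - y) <= sqrt ?d * 1" using dcube_diameter[OF y0(1), of y] by simp
    thus "norm (y0 - y) <= sqrt ?d * (2 / 2 ^ 0)" using sd by (simp del: real_sqrt_ge_1_iff)
   qed (auto simp: eq measure_dcube)
   thus False using y0(2) one_le_power[OF less_imp_le[OF M], of k] by linarith
  qed
  fix j and q :: "int^'n" assume par: "dcube j (dparent q) <= dcube 0 0"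
   and dense: "(1 - e) * ?m (dcube (Suc j) q) < ?m (A (Suc k) Int dcube (Suc j) q)"
  show "dcube j (dparent q) <= A k"
  proof
   fix x assume x: "x \<in> dcube j (dparent q)"
   have "M ^ k < u x"
   proof (rule fact[OF _ dense])
    show "dcube (Suc j) q <= dcube 0 0" using par dcube_parent by blast
    fix y assume "y \<in> dcube (Suc j) q"
    hence "norm (x - y) <= sqrt ?d * (1 / 2 ^ j)" using dcube_parent by (intro dcube_diameter[OF x]) blast
    thus "norm (x - y) <= sqrt ?d * (2 / 2 ^ Suc j)" by simp
   qed
   thus "x \<in> A k" using x par by (auto simp: A_def)
  qed
 qed
 also have "A k Int dcube 0 0 = A k" by (auto simp: A_def)
 also have "(1 - e) * ?m (A k) <= (1 - e) * (1 - e) ^ k" using Suc.IH e by (intro mult_left_mono) (auto simp: A_def)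
 finally show ?case by (simp add: A_def)
qed

lemma growth_property_mono:
 assumes "growth_property c m k D u" "c' <= c" "\<mu>' <= m" "D' <= D"
 shows "growth_property c' \<mu>' k D' (u :: real^'n => real)" unfolding growth_property_def
proof (intro allI impI)
 fix A B y s l x
 assume h: "0 < s" "cball y (2 * s) <= D'" "ALL q:cball y (2 * s). 0 <= A * u q + B" "0 < l"
  "measure lborel {q \<in> ball y (k * s). A * u q + B < l} <= \<mu>' * s ^ CARD('n)" "x \<in> cball y (3 / 4 * s)"
 have "\<mu>' * s ^ CARD('n) <= m * s ^ CARD('n)" using h(1) assms(3) by (intro mult_right_mono) auto
 hence "measure lborel {q \<in> ball y (k * s). A * u q + B < l} <= m * s ^ CARD('n)" using h(5) by linarith
 hence "c * l <= A * u x + B"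
  using h(1-4,6) assms(4) by (intro assms(1)[unfolded growth_property_def, rule_format, of s y A B l x]) auto
 moreover have "c' * l <= c * l" using h(4) assms(2) by (intro mult_right_mono) auto
 ultimately show "c' * l <= A * u x + B" by simp
qed

lemma growth_property_affine:
 fixes u :: "real^'n => real"
 assumes g: "growth_property c m k D u" and r: "0 < r" and u: "u \<in> borel_measurable borel"
 shows "growth_property c m k {y. r *\<^sub>R y + z \<in> D} (%y. t * u (r *\<^sub>R y + z))"
 unfolding growth_property_def
proof (intro allI impI)
 let ?h = "%y. r *\<^sub>R y + z"
 fix A B y s l x
 assume h: "0 < s" "cball y (2 * s) <= {y. ?h y \<in> D}" "ALL q:cball y (2 * s). 0 <= A * (t * u (?h q)) + B" "0 < l"
  "measure lborel {q \<in> ball y (k * s). A * (t * u (?h q)) + B < l} <= m * s ^ CARD('n)" "x \<in> cball y (3 / 4 * s)"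
 have bk: "?h ((1 / r) *\<^sub>R (p - z)) = p" for p using r by simp
 have dist: "dist (?h p) (?h q) = r * dist p q" for p q using r by (simp add: dist_norm scaleR_diff_right[symmetric])
 have pre: "EX q. p = ?h q & dist y q = dist (?h y) p / r" for p
  using bk[of p, symmetric] dist[of y "(1 / r) *\<^sub>R (p - z)"] r by (intro exI[of _ "(1 / r) *\<^sub>R (p - z)"]) auto
 let ?S = "{q \<in> ball y (k * s). A * (t * u (?h q)) + B < l}"
 let ?T = "{q \<in> ball (?h y) (k * (r * s)). A * t * u q + B < l}"
 have "?T = ?h ` ?S"
 proof (intro equalityI subsetI)
  fix p assume p: "p \<in> ?T"
  obtain q where q: "p = ?h q" "dist y q = dist (?h y) p / r" using pre by blast
  have "r * dist y q < r * (k * s)" using p q(1) unfolding dist[of y q, symmetric] by (simp add: mult_ac)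
  hence "q \<in> ?S" using p q(1) r by (simp add: mult.assoc)
  thus "p \<in> ?h ` ?S" using q by blast
 next
  fix p assume "p \<in> ?h ` ?S"
  then obtain q where q: "p = ?h q" "dist y q < k * s" "A * (t * u (?h q)) + B < l" by auto
  have "r * dist y q < r * (k * s)" using q(2) r by simp
  thus "p \<in> ?T" using q(3) unfolding q(1) mem_Collect_eq mem_ball dist by (simp add: mult_ac)
 qed
 moreover have Tm: "?T \<in> sets borel"
 proof -
  have "{q \<in> space borel. A * t * u q + B < l} \<in> sets borel" using u by measurable
  hence "ball (?h y) (k * (r * s)) Int {q \<in> space borel. A * t * u q + B < l} \<in> sets borel" by auto
  moreover have "?T = ball (?h y) (k * (r * s)) Int {q \<in> space borel. A * t * u q + B < l}" by auto
  ultimately show ?thesis by simp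
 qed
 moreover have Sm: "?S \<in> sets borel"
 proof -
  have "(%q. A * (t * u (?h q)) + B) \<in> borel_measurable borel"
   using measurable_compose[OF _ u, of ?h borel] by measurable
  hence "{q \<in> space borel. A * (t * u (?h q)) + B < l} \<in> sets borel" by measurable
  hence "ball y (k * s) Int {q \<in> space borel. A * (t * u (?h q)) + B < l} \<in> sets borel" by auto
  moreover have "?S = ball y (k * s) Int {q \<in> space borel. A * (t * u (?h q)) + B < l}" by auto
  ultimately show ?thesis by simp
 qed
 ultimately have "measure lborel ?T = r ^ CARD('n) * measure lborel ?S"
  using measure_lebesgue_affine[of r z ?S] r by simp
 also have "... <= r ^ CARD('n) * (m * s ^ CARD('n))" using h(5) r by (intro mult_left_mono) auto
 finally have small: "measure lborel ?T <= m * (r * s) ^ CARD('n)" by (simp add: power_mult_distrib mult_ac)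
 have sub: "p \<in> D & 0 <= A * t * u p + B" if "p \<in> cball (?h y) (2 * (r * s))" for p
 proof -
  obtain q where q: "p = ?h q" "dist y q = dist (?h y) p / r" using pre by blast
  have "r * dist y q <= r * (2 * s)" using that unfolding q(1) dist[of y q, symmetric] by (simp add: mult_ac)
  hence "q \<in> cball y (2 * s)" using r by simp
  thus ?thesis using h(2,3) q(1) by (auto simp: mult.assoc)
 qed
 have "c * l <= A * t * u (?h x) + B" using h(1,4,6) r sub small dist[of y x]
  by (intro g[unfolded growth_property_def, rule_format, of "r * s" "?h y" "A * t" B l "?h x"]) (auto simp: mult_ac)
 thus "c * l <= A * (t * u (?h x)) + B" by (simp add: mult.assoc)
qed

text \<open>Maximize \<open>u\<close> times a power of the distance to the boundary of the ball
  inscribed in the unit cube. Near a near-maximum with value \<open>l\<close> the function stays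
  below \<open>K l\<close>, so the growth property for \<open>K l - u\<close> forces
  \<open>u > l / 2\<close> on a set of measure comparable to the \<open>d\<close>-th power of that
  distance. The decay of the level sets then bounds the weighted value.\<close>

lemma unit_harnack:
 assumes c: "0 < c" "c < 1" and j: "0 < j"
 obtains C where "0 < C" "!!(u :: real^'n => real) D x y0. growth_property c j (harnack_angle CARD('n)) D u ==>
  (!!y. y \<in> dcube 0 0 ==> cball y (8 * sqrt CARD('n)) <= D) ==> u \<in> borel_measurable borel ==> (!!y. y \<in> D ==> 0 <= u y) ==>
  bdd_above (range u) ==> y0 \<in> dcube 0 0 ==> u y0 <= 1 ==> x \<in> cball (\<chi> i. 1 / 2) (1 / 4) ==> u x <= C"
proof -
 let ?d = "CARD('n)" and ?m = "measure (lborel :: (real^'n) measure)"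
 define M where "M = 2 / c"
 have M: "1 < M" "1 < c * M" using c by (simp_all add: M_def)
 define e where "e = min (1 / 2) j"
 have e: "0 < e" "e < 1" "e <= j" using j by (auto simp: e_def)
 \<comment> \<open>The exponent of the weight. It lets the decay of the level sets outweigh the
   growth of the levels: \<open>(1 - e)^q M^d <= 1\<close>.\<close>
 obtain q where q: "(1 - e) ^ q < 1 / M ^ ?d" using real_arch_pow_inv[of "1 / M ^ ?d" "1 - e"] M e by auto
 have qM: "(1 - e) ^ q * M ^ ?d <= 1" using q M by (simp add: field_simps)
 \<comment> \<open>The radius of comparison relative to the distance to the boundary; by Bernoulli's
   inequality the weight keeps at least the factor \<open>1 - c / 16\<close> over it.\<close>
 define h where "h = c / (16 * (real q + 1))"
 have h: "0 < h" "real q * h <= c / 16" "h < 1" "h <= 1"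
 proof -
  show "0 < h" using c by (simp add: h_def add_pos_pos)
  have "real q * h = c / 16 * (real q / (real q + 1))" by (simp add: h_def)
  also have "... <= c / 16 * 1" using c by (intro mult_left_mono) auto
  finally show "real q * h <= c / 16" by simp
  show "h < 1" using c by (simp add: h_def add_pos_pos)
  thus "h <= 1" by simp
 qed
 define m where "m = j * (h / 2) ^ ?d"
 have m: "0 < m" using j h by (simp add: m_def)
 define A where "A = max 1 ((1 / m) ^ q)"
 define G where "G = 2 * M * A"
 have A: "1 <= A" by (simp add: A_def)
 have G: "2 <= G" using M A mult_mono[of 1 M 1 A] by (simp add: G_def)
 show ?thesis
 proof (rule that[of "4 ^ q * (2 * G)"])
  show "0 < 4 ^ q * (2 * G)" using G by simp
  fix u :: "real^'n => real" and D and x y0 :: "real^'n"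
  assume g: "growth_property c j (harnack_angle ?d) D u" and D: "!!y. y \<in> dcube 0 0 ==> cball y (8 * sqrt ?d) <= D"
   and um: "u \<in> borel_measurable borel" and u0: "!!y. y \<in> D ==> 0 <= u y" and bdd: "bdd_above (range u)"
   and y0: "y0 \<in> dcube 0 0" "u y0 <= 1" and x: "x \<in> cball (\<chi> i. 1 / 2) (1 / 4)"
  let ?c = "(\<chi> i. 1 / 2) :: real^'n"
  let ?B = "ball ?c (1 / 2)"
  have weak: "?m {p \<in> dcube 0 0. M ^ k < u p} <= (1 - e) ^ k" for k
   by (rule weak_type_bound[OF g c(1) M(2,1) e D um u0 y0])
  have BQ: "?B <= dcube 0 0"
  proof
   fix p assume "p \<in> ?B"
   hence "abs (p $ i - 1 / 2) < 1 / 2" for i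
    using component_le_norm_cart[of "p - ?c" i] by (simp add: dist_norm norm_minus_commute)
   thus "p \<in> dcube 0 0" unfolding mem_dcube abs_less_iff by (auto simp: less_imp_le)
  qed
  have self: "p \<in> D" if "p \<in> dcube 0 0" for p
   using D[OF that] centre_in_cball[of p "8 * sqrt ?d"] by (auto simp: subset_eq)
  have uB: "0 <= u p" if "p \<in> ?B" for p using u0 self BQ that by blast
  define f where "f p = u p * (1 / 2 - dist ?c p) ^ q" for p
  obtain M' where M': "!!p. u p <= M'" using bdd by (auto simp: bdd_above_def)
  have fM: "f p <= abs M'" if "p \<in> ?B" for p
  proof -
   have "f p <= u p * 1" unfolding f_def using that uB[OF that] zero_le_dist[of ?c p]
    by (intro mult_left_mono power_le_one) (auto simp del: zero_le_dist)
   thus ?thesis using M'[of p] by linarith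
  qed
  define S where "S = Sup (f ` ?B)"
  have bf: "bdd_above (f ` ?B)" using fM by (auto intro!: bdd_aboveI)
  have fS: "f p <= S" if "p \<in> ?B" for p unfolding S_def using that bf by (intro cSup_upper) auto
  have "S <= 2 * G"
  proof (rule ccontr)
   assume "~ S <= 2 * G"
   hence S: "2 * G < S" "0 < S" using G by auto
   have "S / (1 + c / 16) < S" using S c by (simp add: field_simps)
   then obtain p where p: "p \<in> ?B" "S / (1 + c / 16) < f p"
    unfolding S_def using less_cSup_iff[of "f ` ?B"] bf by (force simp: S_def)
   define d0 l where "d0 = 1 / 2 - dist ?c p" and "l = u p"
   have d0: "0 < d0" "d0 <= 1" using p zero_le_dist[of ?c p] unfolding d0_def mem_ball by linarith+
   have fp: "f p = l * d0 ^ q" by (simp add: f_def d0_def l_def)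
   have fG: "G < l * d0 ^ q"
   proof -
    have "S / 2 <= S / (1 + c / 16)" using S c by (intro divide_left_mono) auto
    thus ?thesis using p(2) S(1) unfolding fp by linarith
   qed
   hence "0 < l * d0 ^ q" using G by linarith
   hence l: "0 < l" using d0 by (simp add: zero_less_mult_iff)
   define K where "K = 1 + c / 4"
   define s where "s = h * d0 / 2"
   have s: "0 < s" "s <= 1" using h d0 mult_mono[of h 1 d0 1] by (auto simp: s_def)
   have near: "p' \<in> ?B & u p' <= K * l" if "p' \<in> cball p (2 * s)" for p'
   proof -
    have d: "(1 - h) * d0 <= 1 / 2 - dist ?c p'"
    proof -
     have "dist p p' <= h * d0" using that by (simp add: s_def)
     thus ?thesis using dist_triangle[of ?c p' p] d0_def unfolding left_diff_distrib by linarith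
    qed
    have "0 < (1 - h) * d0" using h d0 by simp
    hence pB: "p' \<in> ?B" using d by simp
    have "1 - c / 16 <= 1 + real q * (- h)" using h by simp
    also have "... <= (1 + (- h)) ^ q" using h by (intro Bernoulli_inequality) auto
    finally have b: "1 - c / 16 <= (1 - h) ^ q" by simp
    have "u p' * ((1 - c / 16) * d0 ^ q) <= u p' * ((1 - h) ^ q * d0 ^ q)"
     using b d0 uB[OF pB] by (intro mult_left_mono mult_right_mono) auto
    also have "... <= f p'" unfolding f_def power_mult_distrib[symmetric]
     using d \<open>0 < (1 - h) * d0\<close> uB[OF pB] by (intro mult_left_mono power_mono) auto
    also have "... <= S" by (rule fS[OF pB])
    also have "... <= (1 + c / 16) * (l * d0 ^ q)" using p(2) c unfolding fp by (simp add: field_simps)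
    finally have "(u p' * (1 - c / 16)) * d0 ^ q <= ((1 + c / 16) * l) * d0 ^ q" by (simp add: mult_ac)
    hence "u p' * (1 - c / 16) <= (1 + c / 16) * l" using d0 by simp
    also have "... <= (K * (1 - c / 16)) * l"
    proof (intro mult_right_mono)
     have "c * c <= c * 1" using c by (intro mult_left_mono) auto
     moreover have "K * (1 - c / 16) = 1 + c / 4 - c / 16 - c * c / 64" by (simp add: K_def field_simps)
     ultimately show "1 + c / 16 <= K * (1 - c / 16)" using c by linarith
    qed (use l in auto)
    finally have "u p' * (1 - c / 16) <= (K * l) * (1 - c / 16)" by (simp add: mult_ac)
    thus ?thesis using pB c by simp
   qed
   let ?T = "{p' \<in> ball p (harnack_angle ?d * s). l / 2 < u p'}"
   \<comment> \<open>Otherwise growth at \<open>p\<close> would give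
     \<open>c (K - 1/2) l <= (K - 1) l\<close>, which \<open>K = 1 + c / 4\<close> excludes.\<close>
   have large: "j * s ^ ?d < ?m ?T"
   proof (rule ccontr)
    assume "~ ?thesis"
    moreover have "{p' \<in> ball p (harnack_angle ?d * s). - 1 * u p' + K * l < (K - 1 / 2) * l} = ?T"
     by (auto simp: algebra_simps)
    ultimately have "c * ((K - 1 / 2) * l) <= - 1 * u p + K * l"
    proof (intro g[unfolded growth_property_def, rule_format, of s p "-1" "K * l" "(K - 1 / 2) * l" p])
     show "cball p (2 * s) <= D" using near self BQ by blast
     show "0 <= - 1 * u p' + K * l" if "p' \<in> cball p (2 * s)" for p' using near[OF that] by simp
     show "0 < (K - 1 / 2) * l" using l c by (simp add: K_def)
    qed (use s in auto)
    hence "(c * (K - 1 / 2)) * l <= (K - 1) * l" by (simp add: l_def algebra_simps)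
    hence "c * (K - 1 / 2) <= K - 1" using l by simp
    hence "c / 4 + c * c / 4 <= 0" by (simp add: K_def algebra_simps)
    thus False using c by (smt (verit) divide_pos_pos mult_pos_pos)
   qed
   have "l * d0 ^ q <= G"
   proof (cases "l / 2 < 1")
    case True
    have "l * d0 ^ q <= l * 1" using d0 l by (intro mult_left_mono power_le_one) auto
    thus ?thesis using True G by simp
   next
    case False
    obtain n0 where n0: "l / 2 < M ^ n0" using real_arch_pow[OF M(1)] by blast
    define n where "n = (LEAST n. l / 2 < M ^ n)"
    have n: "l / 2 < M ^ n" unfolding n_def using n0 by (rule LeastI)
    then obtain k where k: "n = Suc k" using False by (cases n) auto
    have kM: "M ^ k <= l / 2" using not_less_Least[of k "%n. l / 2 < M ^ n"] k unfolding n_def[symmetric] by simp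
    have "?m ?T <= ?m {p' \<in> dcube 0 0. M ^ k < u p'}"
    proof -
     have Tm: "{p'. M ^ k < u p'} \<in> sets borel"
     proof -
      have "{p' \<in> space borel. M ^ k < u p'} \<in> sets borel" using um by measurable
      thus ?thesis by simp
     qed
     have "?m (?T Int dcube 0 0) <= ?m ({p'. M ^ k < u p'} Int dcube 0 0)"
      using kM by (intro measure_dcube_mono Tm) auto
     moreover have "ball p (harnack_angle ?d * s) <= dcube 0 0"
     proof -
      have "1 <= sqrt ?d" by (simp add: Suc_leI)
      hence "harnack_angle ?d * s <= 1 * s" using s by (intro mult_right_mono) (auto simp: field_simps simp del: real_sqrt_ge_1_iff)
      hence "ball p (harnack_angle ?d * s) <= cball p (2 * s)" using s by auto
      thus ?thesis using near BQ by blast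
     qed
     hence "?T Int dcube 0 0 = ?T" by auto
     moreover have "{p'. M ^ k < u p'} Int dcube 0 0 = {p' \<in> dcube 0 0. M ^ k < u p'}" by auto
     ultimately show ?thesis by simp
    qed
    also have "... <= (1 - e) ^ k" by (rule weak)
    finally have "j * s ^ ?d <= (1 - e) ^ k" using large by linarith
    hence "m * d0 ^ ?d <= (1 - e) ^ k" by (simp add: m_def s_def power_mult_distrib power_divide mult_ac)
    hence dd: "d0 ^ ?d <= (1 / m) * (1 - e) ^ k" using m by (simp add: field_simps)
    define t where "t = d0 ^ q * M ^ k"
    \<comment> \<open>The \<open>d\<close>-th power turns the bound for \<open>d0 ^ ?d\<close> into
      the balance for which \<open>q\<close> was chosen.\<close>
    have "t ^ ?d = (d0 ^ ?d) ^ q * (M ^ ?d) ^ k" by (simp add: t_def power_mult_distrib power_mult[symmetric] mult.commute)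
    also have "... <= ((1 / m) * (1 - e) ^ k) ^ q * (M ^ ?d) ^ k"
     using dd d0 M by (intro mult_right_mono power_mono) auto
    also have "... = (1 / m) ^ q * ((1 - e) ^ q * M ^ ?d) ^ k"
     unfolding power_mult_distrib power_mult[symmetric] by (simp only: mult.commute mult.left_commute)
    also have "... <= (1 / m) ^ q * 1" using qM m M e by (intro mult_left_mono power_le_one) auto
    also have "... <= A" by (simp add: A_def)
    finally have tA: "t ^ ?d <= A" .
    have "t <= A"
    proof (rule ccontr)
     assume "~ t <= A"
     hence "1 <= t" "A < t" using A by auto
     hence "t <= t ^ ?d" using self_le_power[of t ?d] by simp
     thus False using tA \<open>A < t\<close> by simp
    qed
    have "l * d0 ^ q <= (2 * M ^ Suc k) * d0 ^ q" using n k d0 by (intro mult_right_mono) auto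
    also have "... = 2 * M * t" by (simp add: t_def)
    also have "... <= G" unfolding G_def using \<open>t <= A\<close> M by (intro mult_left_mono) auto
    finally show ?thesis .
   qed
   thus False using fG by simp
  qed
  have xB: "x \<in> ?B" "1 / 4 <= 1 / 2 - dist ?c x" using x by auto
  have "u x * (1 / 4) ^ q <= f x" unfolding f_def using xB uB[OF xB(1)] by (intro mult_left_mono power_mono) auto
  also have "... <= 2 * G" using fS[OF xB(1)] \<open>S <= 2 * G\<close> by linarith
  finally show "u x <= 4 ^ q * (2 * G)" by (simp add: power_divide field_simps)
 qed
qed

text \<open>Scaling by \<open>4 r\<close> maps the ball of radius 1/4 about the centre of the unit
  cube onto the given ball. Points of the cube are within \<open>sqrt d\<close> of its centre, and
  \<open>4 * (1 + 8) = 36\<close> gives the size of the domain. Where \<open>u y = 0\<close>,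
  arbitrarily small normalizations \<open>l\<close> are used.\<close>

theorem harnack_of_growth:
 assumes c: "0 < c" and m: "0 < m"
 obtains C where "0 < C" "!!(u :: real^'n => real) D z r x y. growth_property c m (harnack_angle CARD('n)) D u ==>
  0 < r ==> cball z (36 * sqrt CARD('n) * r) <= D ==> u \<in> borel_measurable borel ==> (!!y. y \<in> D ==> 0 <= u y) ==>
  bdd_above (range u) ==> x \<in> cball z r ==> y \<in> cball z r ==> u x <= C * u y"
proof -
 let ?d = "CARD('n)"
 define c' where "c' = min c (1 / 2)"
 have c': "0 < c'" "c' < 1" "c' <= c" using c by (auto simp: c'_def)
 obtain C where C: "0 < C" "!!(u :: real^'n => real) D x y0. growth_property c' m (harnack_angle CARD('n)) D u ==>
  (!!y. y \<in> dcube 0 0 ==> cball y (8 * sqrt CARD('n)) <= D) ==> u \<in> borel_measurable borel ==> (!!y. y \<in> D ==> 0 <= u y) ==>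
  bdd_above (range u) ==> y0 \<in> dcube 0 0 ==> u y0 <= 1 ==> x \<in> cball (\<chi> i. 1 / 2) (1 / 4) ==> u x <= C"
  using unit_harnack[OF c'(1,2) m] by metis
 show ?thesis
 proof (rule that[OF C(1)])
  fix u :: "real^'n => real" and D z r x y
  assume g: "growth_property c m (harnack_angle ?d) D u" and r: "0 < r" and D: "cball z (36 * sqrt ?d * r) <= D"
   and um: "u \<in> borel_measurable borel" and u0: "!!y. y \<in> D ==> 0 <= u y" and bdd: "bdd_above (range u)"
   and x: "x \<in> cball z r" and y: "y \<in> cball z r"
  let ?c = "(\<chi> i. 1 / 2) :: real^'n"
  define z' where "z' = z - (4 * r) *\<^sub>R ?c"
  let ?h = "%p. (4 * r) *\<^sub>R p + z'"
  have hz: "norm (?h p - z) = 4 * r * norm (p - ?c)" for p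
  proof -
   have "?h p - z = (4 * r) *\<^sub>R (p - ?c)" by (simp add: z'_def algebra_simps)
   thus ?thesis using r by simp
  qed
  have sd: "1 <= sqrt ?d" by (simp add: Suc_leI)
  have cq: "?c \<in> dcube 0 0" by (simp add: mem_dcube)
  have pre: "EX p'. p = ?h p' & p' \<in> cball ?c (1 / 4)" if "p \<in> cball z r" for p
  proof -
   define p' where "p' = (1 / (4 * r)) *\<^sub>R (p - z')"
   have p: "p = ?h p'" using r by (simp add: p'_def)
   have "4 * r * norm (p' - ?c) <= r" using hz[of p'] that unfolding p[symmetric] by (simp add: dist_norm norm_minus_commute)
   hence "norm (p' - ?c) <= 1 / 4" using r by (simp add: field_simps)
   thus ?thesis using p by (auto simp: dist_norm norm_minus_commute)
  qed
  have in_cube: "p' \<in> dcube 0 0" if "p' \<in> cball ?c (1 / 4)" for p'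
  proof -
   have "0 <= p' $ i & p' $ i < 1" for i
   proof -
    have "abs (p' $ i - 1 / 2) <= 1 / 4"
     using component_le_norm_cart[of "p' - ?c" i] that by (simp add: dist_norm norm_minus_commute)
    thus ?thesis unfolding abs_le_iff by linarith
   qed
   thus ?thesis by (simp add: mem_dcube)
  qed
  have DD: "?h p \<in> D" if "q \<in> dcube 0 0" "p \<in> cball q (8 * sqrt ?d)" for p q
  proof -
   have "norm (p - ?c) <= norm (p - q) + norm (q - ?c)" using norm_triangle_ineq[of "p - q" "q - ?c"] by simp
   moreover have "norm (q - ?c) <= sqrt ?d" using dcube_diameter[OF that(1) cq] by simp
   ultimately have "norm (p - ?c) <= 9 * sqrt ?d" using that(2) by (simp add: dist_norm norm_minus_commute)
   hence "4 * r * norm (p - ?c) <= 4 * r * (9 * sqrt ?d)" using r by (intro mult_left_mono) auto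
   hence "norm (?h p - z) <= 36 * sqrt ?d * r" unfolding hz by (simp add: mult_ac)
   hence "?h p \<in> cball z (36 * sqrt ?d * r)" unfolding mem_cball dist_norm by (subst norm_minus_commute)
   thus ?thesis by (rule subsetD[OF D])
  qed
  have yD: "y \<in> D"
  proof -
   obtain p where p: "y = ?h p" "p \<in> cball ?c (1 / 4)" using pre[OF y] by blast
   show ?thesis unfolding p(1) by (rule DD[OF in_cube[OF p(2)]]) (use sd in simp)
  qed
  have key: "u x <= C * l" if l: "u y <= l" "0 < l" for l
  proof -
   obtain x' where x': "x = ?h x'" "x' \<in> cball ?c (1 / 4)" using pre[OF x] by blast
   obtain y' where y': "y = ?h y'" "y' \<in> cball ?c (1 / 4)" using pre[OF y] by blast
   define v where "v p = (1 / l) * u (?h p)" for p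
   have "v x' <= C"
   proof (rule C(2)[of "{p. ?h p \<in> D}" _ y'])
    have "growth_property c' m (harnack_angle ?d) D u" by (rule growth_property_mono[OF g]) (use c' in auto)
    from growth_property_affine[OF this _ um, of "4 * r" z' "1 / l"]
    show "growth_property c' m (harnack_angle ?d) {p. ?h p \<in> D} v" using r by (simp add: v_def [abs_def])
    show "cball q (8 * sqrt ?d) <= {p. ?h p \<in> D}" if "q \<in> dcube 0 0" for q using DD[OF that] by blast
    have "(%p. u (?h p)) \<in> borel_measurable borel" by (rule measurable_compose[OF _ um]) measurable
    thus "v \<in> borel_measurable borel" unfolding v_def [abs_def] by measurable
    show "0 <= v p" if "p \<in> {p. ?h p \<in> D}" for p using u0 that l by (simp add: v_def)
    obtain M where "!!p. u p <= M" using bdd by (auto simp: bdd_above_def)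
    hence "v p <= (1 / l) * M" for p unfolding v_def using l by (intro mult_left_mono) auto
    thus "bdd_above (range v)" by (auto simp: bdd_above_def)
    show "v y' <= 1" using l y'(1) by (simp add: v_def)
   qed (use x' y' in_cube in auto)
   thus ?thesis using l x'(1) by (simp add: v_def field_simps)
  qed
  show "u x <= C * u y"
  proof (cases "u y = 0")
   case True
   have "u x <= 0 + e" if "0 < e" for e using key[of "e / C"] True that C(1) by simp
   hence "u x <= 0" by (rule field_le_epsilon)
   thus ?thesis using True by simp
  qed (use key[of "u y"] u0[OF yD] in simp)
 qed
qed

section \<open>Harmonic functions\<close>

text \<open>\<open>u\<close> is controlled on \<open>D\<close> only; its extension by zero is Borel
  and bounded on the whole space and can be composed with the exit point.\<close>

lemma (in continuous_markov_process) harmonic_extension: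
 assumes u: "harmonic_on X P D u" and D: "D \<in> sets borel"
 shows "(%y. indicator D y * u y) \<in> borel_measurable borel" and "EX M. ALL y. abs (indicator D y * u y) <= M"
proof -
 show "(%y. indicator D y * u y) \<in> borel_measurable borel"
  using u D borel_measurable_restrict_space_iff[of D borel u] by (simp add: harmonic_on_def)
 obtain M where "!!y. y \<in> D ==> \<bar>u y\<bar> <= M" using u by (auto simp: harmonic_on_def bounded_iff)
 thus "EX M. ALL y. abs (indicator D y * u y) <= M" by (intro exI[of _ "abs M"]) (force simp: indicator_def)
qed

context Ld_quasi_diffusion
begin

lemma exit_AE:
 assumes "x \<in> ball z r"
 shows "AE w in P x. w \<in> exits z r & exit_point X z r w \<in> sphere z r"
 using exit_finite[of z r x] AE_start[of x]
proof eventually_elim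
 case (elim w)
 thus ?case using exit_point_sphere[of w z r] assms by auto
qed

text \<open>Almost sure exit removes the restriction to finite exit times, so the mean value becomes
  a full expectation.\<close>

lemma harmonic_mean:
 assumes u: "harmonic_on X P D u" and D: "D \<in> sets borel" "cball z r <= D" and r: "0 < r" and x: "x \<in> ball z r"
 shows "u x = (LINT v|P x. indicator D (exit_point X z r v) * u (exit_point X z r v))"
  and "integrable (P x) (%v. indicator D (exit_point X z r v) * u (exit_point X z r v))"
proof -
 let ?w = "%y. indicator D y * u y"
 have em: "exit_point X z r \<in> P x \<rightarrow>\<^sub>M borel" by (rule measurable_path_algebra[OF exit_point_measurable])
 obtain M where M: "!!y. abs (?w y) <= M" using harmonic_extension(2)[OF u D(1)] by blast
 have wm: "(%v. ?w (exit_point X z r v)) \<in> borel_measurable (P x)"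
  by (rule measurable_compose[OF em harmonic_extension(1)[OF u D(1)]])
 thus "integrable (P x) (%v. ?w (exit_point X z r v))" using M by (intro Px.integrable_const_bound[where B=M]) auto
 have "u x = (LINT v:{v \<in> space (P x). exit_time X z r v < \<infinity> & exit_point X z r v \<in> D}|P x. u (exit_point X z r v))"
  using u D r x by (auto simp: harmonic_on_def)
 also have "... = (LINT v|P x. indicator (exits z r) v * ?w (exit_point X z r v))" unfolding set_lebesgue_integral_def
  by (intro Bochner_Integration.integral_cong) (auto simp: exits_iff indicator_def)
 also have "... = (LINT v|P x. ?w (exit_point X z r v))"
  using exit_AE[OF x] wm exits_P[of z r x] by (intro integral_cong_AE) auto
 finally show "u x = (LINT v|P x. ?w (exit_point X z r v))" .
qed

lemma harmonic_le:
 assumes u: "harmonic_on X P D u" and D: "D \<in> sets borel" "cball z r <= D" and r: "0 < r" and x: "x \<in> ball z r"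
 shows "(!!y. y \<in> sphere z r ==> u y <= M) ==> u x <= M" and "(!!y. y \<in> sphere z r ==> M <= u y) ==> M <= u x"
proof -
 note h = harmonic_mean[OF u D r x]
 have sD: "sphere z r <= D" using D(2) by auto
 show "u x <= M" if "!!y. y \<in> sphere z r ==> u y <= M" unfolding h(1) using exit_AE[OF x] that sD
  by (intro Px.integral_le_const h(2)) (force elim!: eventually_mono simp: indicator_def)
 show "M <= u x" if "!!y. y \<in> sphere z r ==> M <= u y" unfolding h(1) using exit_AE[OF x] that sD
  by (intro Px.integral_ge_const h(2)) (force elim!: eventually_mono simp: indicator_def)
qed

text \<open>The additive constant is preserved because exit is almost sure, so the exit distribution
  has mass 1.\<close>

lemma harmonic_affine_excessive:
 assumes u: "harmonic_on X P D u" and D: "D \<in> sets borel" "cball z r <= D" and r: "0 < r"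
  and nonneg: "!!y. y \<in> cball z r ==> 0 <= A * u y + B"
 shows "excessive z r (%y. ennreal (indicator (cball z r) y * (A * u y + B)))"
proof -
 let ?w = "%y. indicator D y * u y" and ?v = "%y. indicator (cball z r) y * (A * u y + B)"
 obtain M where M: "!!y. abs (?w y) <= M" using harmonic_extension(2)[OF u D(1)] by blast
 have eq: "?v y = indicator (cball z r) y * (A * ?w y + B)" for y using D(2) by (auto simp: indicator_def)
 show ?thesis
 proof (rule exit_functional_excessive[where C="abs A * M + abs B"])
  show vm: "?v \<in> borel_measurable borel"
   unfolding eq by (rule borel_measurable_times[OF borel_measurable_indicator[OF borel_closed[OF closed_cball]]
    borel_measurable_add[OF borel_measurable_times[OF borel_measurable_const harmonic_extension(1)[OF u D(1)]] borel_measurable_const]])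
  show "0 <= ?v y" for y using nonneg by (auto simp: indicator_def)
  show "?v y <= abs A * M + abs B" for y
  proof -
   have M0: "0 <= M" using M[of 0] by linarith
   have "A * ?w y <= abs A * abs (?w y)" by (metis abs_ge_self abs_mult)
   also have "... <= abs A * M" by (intro mult_left_mono M) simp
   finally have "A * ?w y + B <= abs A * M + abs B" by linarith
   moreover have "0 <= abs A * M + abs B" using M0 by simp
   ultimately show ?thesis unfolding eq by (auto simp: indicator_def)
  qed
  fix y assume y: "y \<in> ball z r"
  note h = harmonic_mean[OF u D r y]
  have em: "exit_point X z r \<in> P y \<rightarrow>\<^sub>M borel" by (rule measurable_path_algebra[OF exit_point_measurable])
  have "?v y = A * u y + B" using y by (simp add: indicator_def less_imp_le)
  also have "... = (LINT q|P y. A * ?w (exit_point X z r q) + B)"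
   using h(2) by (subst Bochner_Integration.integral_add) (auto simp: h(1)[symmetric] Px.prob_space[unfolded space_P])
  also have "... = (LINT q|P y. indicator (exits z r) q * ?v (exit_point X z r q))"
  proof (rule integral_cong_AE)
   show "(%q. indicator (exits z r) q * ?v (exit_point X z r q)) \<in> borel_measurable (P y)"
    by (rule borel_measurable_times[OF borel_measurable_indicator[OF exits_P] measurable_compose[OF em vm]])
   show "AE q in P y. A * ?w (exit_point X z r q) + B = indicator (exits z r) q * ?v (exit_point X z r q)"
    using exit_AE[OF y] unfolding eq by eventually_elim (auto simp: indicator_def)
  qed (use h(2) in auto)
  finally show "?v y = (LINT q|P y. indicator (exits z r) q * ?v (exit_point X z r q))" .
 qed
qed

lemma harmonic_growth:
 assumes u: "harmonic_on X P D u" and D: "D \<in> sets borel" and D': "D' <= D" "D' \<in> sets borel"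
  and k: "0 < k" "k <= 2" and small: "root CARD('n) (local_drift D') <= drift_tol CARD('n) ell k"
 shows "growth_property (growth_const CARD('n) ell k) (vol_tol CARD('n) ell k) k D' (%y. indicator D y * u y)"
 unfolding growth_property_def
proof (intro allI impI)
 let ?d = "CARD('n)" and ?w = "%y. indicator D y * u y"
 fix A B y s l x
 assume s: "0 < s" and sub: "cball y (2 * s) <= D'" and nonneg: "ALL q:cball y (2 * s). 0 <= A * ?w q + B" and l: "0 < l"
  and vol: "measure lborel {q \<in> ball y (k * s). A * ?w q + B < l} <= vol_tol ?d ell k * s ^ ?d" and x: "x \<in> cball y (3 / 4 * s)"
 have wu: "?w q = u q" if "q \<in> cball y (2 * s)" for q using that sub D' by (auto simp: indicator_def)
 have nonneg': "0 <= A * u q + B" if "q \<in> cball y (2 * s)" for q using nonneg that wu[OF that] by (metis (no_types))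
 define v where "v q = ennreal (1 / l) * ennreal (indicator (cball y (2 * s)) q * (A * u q + B))" for q
 define G where "G = {q. l <= A * ?w q + B}"
 have "(%q. A * ?w q + B) \<in> borel_measurable borel" using harmonic_extension(1)[OF u D] by measurable
 hence "{q \<in> space borel. l <= A * ?w q + B} \<in> sets borel" by measurable
 hence \<Gamma>m: "G \<in> sets borel" by (simp add: G_def)
 have cD: "cball y (2 * s) <= D" using sub D' by auto
 have "ennreal (growth_const ?d ell k) <= v x"
 proof (rule growth[OF s k(1) _ _ \<Gamma>m _ _ x])
  have "local_drift (cball y (2 * s)) <= local_drift D'" by (intro local_drift_mono sub D') auto
  thus "root ?d (local_drift (cball y (2 * s))) <= drift_tol ?d ell k"
   using small by (meson order_trans real_root_le_mono zero_less_card_finite)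
  show "excessive y (2 * s) v" unfolding v_def [abs_def]
   using s nonneg' by (intro excessive_cmult harmonic_affine_excessive[OF u D cD]) auto
  have "ball y (k * s) - G = {q \<in> ball y (k * s). A * ?w q + B < l}" by (auto simp: G_def)
  thus "measure lborel (ball y (k * s) - G) <= vol_tol ?d ell k * s ^ ?d" using vol by simp
  fix q assume q: "q \<in> G" "q \<in> ball y (2 * s)"
  hence qc: "q \<in> cball y (2 * s)" by auto
  hence "l <= A * u q + B" using q(1) wu[OF qc] by (simp add: G_def)
  hence "1 <= (1 / l) * (A * u q + B)" using l by simp
  hence "ennreal 1 <= ennreal ((1 / l) * (A * u q + B))" by (rule ennreal_leI)
  also have "... = v q" unfolding v_def using l qc by (subst ennreal_mult') auto
  finally show "1 <= v q" by simp
 qed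
 moreover have xc: "x \<in> cball y (2 * s)" using x s by auto
 ultimately have "ennreal (growth_const ?d ell k) <= ennreal ((1 / l) * (A * u x + B))"
  unfolding v_def using l by (subst ennreal_mult') auto
 moreover have "0 <= (1 / l) * (A * u x + B)" using nonneg'[OF xc] l by simp
 ultimately have "growth_const ?d ell k <= (1 / l) * (A * u x + B)" by (simp only: ennreal_le_iff)
 thus "growth_const ?d ell k * l <= A * ?w x + B" unfolding wu[OF xc] using l by (simp add: field_simps)
qed

end

section \<open>Reduction to a shell of small drift\<close>

text \<open>Walk from \<open>p\<close> to \<open>q\<close> along a great circle in \<open>k\<close>
  equal arcs; the angle is at most \<open>pi\<close>, and a chord is no longer than its arc. For
  \<open>q = p\<close> or \<open>q = - p\<close> any unit vector orthogonal to \<open>p\<close>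
  spans the circle, and there is one in dimension at least 2.\<close>

lemma sphere_chain:
 fixes f :: "'a::euclidean_space => real"
 assumes d: "2 <= DIM('a)" and C: "0 < C" and k: "0 < k" "pi / real k <= \<epsilon>"
  and step: "!!p q. norm p = 1 ==> norm q = 1 ==> norm (p - q) <= \<epsilon> ==> f p <= C * f q"
  and p: "norm p = 1" and q: "norm q = 1"
 shows "f p <= C ^ k * f q"
proof -
 define t where "t = p \<bullet> q"
 have pp: "p \<bullet> p = 1" "q \<bullet> q = 1" using p q by (simp_all add: dot_square_norm)
 have t: "-1 <= t" "t <= 1" using Cauchy_Schwarz_ineq2[of p q] p q by (auto simp: t_def abs_le_iff)
 define h where "h = arccos t"
 have h: "0 <= h" "h <= pi" "cos h = t" using t by (auto simp: h_def arccos_lbound arccos_ubound cos_arccos)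
 have sin_sq: "(sin h)^2 = 1 - t^2" using h(3) by (simp add: sin_squared_eq)
 obtain e where e: "norm e = 1" "p \<bullet> e = 0" "q = cos h *\<^sub>R p + sin h *\<^sub>R e"
 proof (cases "q - t *\<^sub>R p = 0")
  case True
  obtain y where y: "y ~= 0" "orthogonal p y" using orthogonal_to_vector_exists[OF d] by blast
  have "q \<bullet> q = t * t" using True pp by (simp add: inner_commute)
  hence "sin h = 0" using sin_sq pp by (simp add: power2_eq_square)
  thus ?thesis using True y h(3) by (intro that[of "(1 / norm y) *\<^sub>R y"]) (auto simp: orthogonal_def)
 next
  case False
  define w where "w = q - t *\<^sub>R p"
  have ww: "w \<bullet> w = 1 - t^2" using pp by (simp add: w_def t_def inner_diff_left inner_diff_right inner_commute power2_eq_square)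
  have "(norm w)^2 = (sin h)^2" unfolding power2_norm_eq_inner ww sin_sq ..
  hence nw: "norm w = sin h" using sin_ge_zero[OF h(1,2)] by (simp add: power2_eq_iff_nonneg)
  have w0: "w ~= 0" using False by (simp add: w_def)
  have "p \<bullet> w = 0" using pp by (simp add: w_def t_def inner_diff_right)
  moreover have "q = cos h *\<^sub>R p + sin h *\<^sub>R ((1 / norm w) *\<^sub>R w)" using w0 by (simp add: nw[symmetric] h(3)) (simp add: w_def)
  ultimately show ?thesis using w0 by (intro that[of "(1 / norm w) *\<^sub>R w"]) auto
 qed
 define g where "g s = cos s *\<^sub>R p + sin s *\<^sub>R e" for s
 have ee: "e \<bullet> e = 1" "e \<bullet> p = 0" using e by (simp_all add: dot_square_norm inner_commute)
 have gn: "norm (g s) = 1" for s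
 proof -
  have "(norm (g s))^2 = (cos s)^2 + (sin s)^2"
   unfolding power2_norm_eq_inner by (simp add: g_def inner_add_left inner_add_right pp ee e(2) power2_eq_square)
  thus ?thesis using norm_ge_zero[of "g s"] by (simp add: power2_eq_1_iff)
 qed
 have gd: "norm (g s - g s') <= abs (s - s')" for s s'
 proof -
  have "(norm (g s - g s'))^2 = (cos s - cos s')^2 + (sin s - sin s')^2"
  proof -
   have "g s - g s' = (cos s - cos s') *\<^sub>R p + (sin s - sin s') *\<^sub>R e" by (simp add: g_def algebra_simps)
   thus ?thesis unfolding power2_norm_eq_inner by (simp add: inner_add_left inner_add_right pp ee e(2) power2_eq_square)
  qed
  also have "... = 2 - 2 * cos (s - s')"
   using sin_cos_squared_add[of s] sin_cos_squared_add[of s'] unfolding cos_diff power2_diff by (simp only: distrib_left mult.assoc[symmetric])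
  also have "... = (2 * sin ((s - s') / 2))^2"
  proof -
   have "2 * ((s - s') / 2) = s - s'" by simp
   thus ?thesis using cos_double_sin[of "(s - s') / 2"] by (simp only: power_mult_distrib) simp
  qed
  also have "... = (2 * abs (sin ((s - s') / 2)))^2" by (simp add: power_mult_distrib)
  finally have "norm (g s - g s') = 2 * abs (sin ((s - s') / 2))" by (rule power2_eq_imp_eq) auto
  also have "... <= 2 * abs ((s - s') / 2)" by (intro mult_left_mono abs_sin_x_le_abs_x) simp
  finally show ?thesis by simp
 qed
 have "f (g 0) <= C ^ j * f (g (real j * (h / real k)))" for j
 proof (induction j)
  case (Suc j)
  have "norm (g (real j * (h / real k)) - g (real (Suc j) * (h / real k))) <= abs (real j * (h / real k) - real (Suc j) * (h / real k))" by (rule gd)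
  also have "real j * (h / real k) - real (Suc j) * (h / real k) = - (h / real k)" by (simp add: algebra_simps add_divide_distrib)
  also have "abs (- (h / real k)) = h / real k" using h by simp
  also have "... <= \<epsilon>" using h k divide_right_mono[of h pi "real k"] by simp
  finally have "f (g (real j * (h / real k))) <= C * f (g (real (Suc j) * (h / real k)))" by (intro step gn)
  hence "C ^ j * f (g (real j * (h / real k))) <= C ^ j * (C * f (g (real (Suc j) * (h / real k))))" using C by (intro mult_left_mono) auto
  thus ?case using Suc.IH by (simp add: mult_ac)
 qed simp
 from this[of k] show ?thesis using k(1) by (simp add: g_def e(3)[symmetric])
qed

context Ld_quasi_diffusion
begin

text \<open>Pigeonhole principle: over disjoint sets the local drifts add up to at most the
  total.\<close>

lemma shell_small_drift:
 assumes S: "!!j. j < m ==> S j \<in> sets borel" "disjoint_family_on S {..<m}" and m: "0 < m"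
  and K: "(LINT x|lborel. norm (b x) ^ CARD('n)) <= real m * e"
 shows "EX j<m. local_drift (S j) <= e"
proof (rule ccontr)
 assume "~ ?thesis"
 hence "real m * e < (\<Sum>j<m. local_drift (S j))"
  using m sum_strict_mono[of "{..<m}" "%_. e" "%j. local_drift (S j)"] by (force simp: not_le)
 also have "... = (LINT x|lborel. (\<Sum>j<m. (indicator (S j) x * norm (b x)) ^ CARD('n)))"
  unfolding local_drift_def using S by (subst Bochner_Integration.integral_sum) (auto intro!: local_drift_integrable)
 also have "... <= (LINT x|lborel. norm (b x) ^ CARD('n))"
 proof (rule integral_mono[OF _ b_Ld])
  show "integrable lborel (%x. \<Sum>j<m. (indicator (S j) x * norm (b x)) ^ CARD('n))"
   using S by (intro Bochner_Integration.integrable_sum local_drift_integrable) auto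
  fix x
  have "(\<Sum>j<m. (indicator (S j) x * norm (b x)) ^ CARD('n)) = (\<Sum>j<m. indicator (S j) x * norm (b x) ^ CARD('n))"
   by (intro sum.cong) (auto simp: indicator_def zero_power)
  also have "... = indicator (\<Union>j<m. S j) x * norm (b x) ^ CARD('n)"
   unfolding sum_distrib_right[symmetric] indicator_UN_disjoint[OF finite_lessThan S(2)] ..
  also have "... <= norm (b x) ^ CARD('n)" by (auto simp: indicator_def)
  finally show "(\<Sum>j<m. (indicator (S j) x * norm (b x)) ^ CARD('n)) <= norm (b x) ^ CARD('n)" .
 qed
 finally show False using K by simp
qed

text \<open>The shell between the radii \<open>R\<close> and \<open>2 R\<close> is cut into
  \<open>m\<close> subshells, one of which has small drift. Chaining on the sphere in its middle
  compares any two values there with the factor \<open>C ^ k\<close>; the mean value property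
  compares \<open>u x\<close> and \<open>u y\<close> with the values on the sphere, at the cost of
  one such factor each.\<close>

lemma harnack_ball_of_local:
 fixes u :: "real^'n => real"
 assumes d: "2 <= CARD('n)" and C: "0 < C"
  and loc: "!!(u :: real^'n => real) D z r x y. growth_property (growth_const CARD('n) ell (harnack_angle CARD('n))) (vol_tol CARD('n) ell (harnack_angle CARD('n))) (harnack_angle CARD('n)) D u ==>
   0 < r ==> cball z (36 * sqrt CARD('n) * r) <= D ==> u \<in> borel_measurable borel ==> (!!y. y \<in> D ==> 0 <= u y) ==>
   bdd_above (range u) ==> x \<in> cball z r ==> y \<in> cball z r ==> u x <= C * u y"
  and m: "0 < m" "(LINT x|lborel. norm (b x) ^ CARD('n)) <= real m * drift_tol CARD('n) ell (harnack_angle CARD('n)) ^ CARD('n)"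
  and k: "0 < k" "288 * pi * sqrt CARD('n) * real m <= real k"
  and R: "0 < R" and u: "harmonic_on X P D u" and D: "D \<in> sets borel" "ball 0 (2 * R) <= D" and u0: "!!y. y \<in> D ==> 0 <= u y"
  and x: "x \<in> ball 0 R" and y: "y \<in> ball 0 R"
 shows "u x <= C ^ (2 * k) * u y"
proof -
 let ?d = "CARD('n)"
 let ?w = "%y. indicator D y * u y"
 define v where "v = harnack_angle ?d"
 define T where "T = drift_tol ?d ell v"
 have T: "0 < T" using occ_constants_pos(4)[OF ell, of ?d v] by (simp add: T_def)
 have sd: "1 <= sqrt ?d" by (simp add: Suc_leI)
 define h where "h = R / real m"
 have h: "0 < h" "real m * h = R" using R m by (simp_all add: h_def)
 define S where "S j = {p :: real^'n. R + real j * h < norm p & norm p < R + (real j + 1) * h}" for j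
 have S1: "S j \<in> sets borel" for j
 proof -
  have "open (S j)" unfolding S_def by (intro open_Collect_conj open_Collect_less continuous_intros)
  thus ?thesis by simp
 qed
 have S2: "disjoint_family_on S {..<m}"
 proof (unfold disjoint_family_on_def, intro ballI impI, rule ccontr)
  fix i j assume ne: "i ~= j" and "S i Int S j ~= {}"
  then obtain p where "p \<in> S i" "p \<in> S j" by auto
  hence "real i * h < (real j + 1) * h" "real j * h < (real i + 1) * h" unfolding S_def by simp_all
  hence "real i < real j + 1" "real j < real i + 1" using h by simp_all
  thus False using ne by simp
 qed
 obtain j where j: "j < m" "local_drift (S j) <= T ^ ?d"
  using shell_small_drift[OF S1 S2 m(1) m(2)] by (auto simp: T_def v_def)
 have SD: "S j <= D"
 proof
  fix p assume "p \<in> S j"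
  moreover have "(real j + 1) * h <= real m * h" using j h by (intro mult_right_mono) auto
  ultimately have "p \<in> ball 0 (2 * R)" using h by (simp add: S_def)
  thus "p \<in> D" using D(2) by blast
 qed
 have \<theta>2: "0 < v" "v <= 2" unfolding v_def using sd by (simp, simp add: divide_le_eq del: real_sqrt_ge_1_iff)
 have small: "root ?d (local_drift (S j)) <= drift_tol ?d ell v"
 proof -
  have "root ?d (local_drift (S j)) <= root ?d (T ^ ?d)" using j by simp
  also have "... = T" using T by (intro real_root_power_cancel) auto
  finally show ?thesis by (simp add: T_def)
 qed
 have grow: "growth_property (growth_const ?d ell v) (vol_tol ?d ell v) v (S j) ?w"
  by (rule harmonic_growth[OF u D(1) SD S1 \<theta>2 small])
 define l where "l = R + (real j + 1 / 2) * h"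
 have l: "R < l" "l < 2 * R"
 proof -
  show "R < l" using h unfolding l_def by (simp add: add_nonneg_pos)
  have "(real j + 1 / 2) * h < (real j + 1) * h" using h by (intro mult_strict_right_mono) auto
  also have "... <= real m * h" using j h by (intro mult_right_mono) auto
  finally show "l < 2 * R" unfolding l_def using h by simp
 qed
 \<comment> \<open>The domain of the local inequality, of radius \<open>36 sqrt d r = h / 4\<close>,
   fits into the subshell around its middle sphere.\<close>
 define r where "r = h / (144 * sqrt ?d)"
 have r: "0 < r" "36 * sqrt ?d * r = h / 4" using h sd by (simp_all add: r_def)
 obtain M where M: "!!p. abs (?w p) <= M" using harmonic_extension(2)[OF u D(1)] by blast
 have near: "u p <= C * u q" if p: "norm p = l" and q: "norm q = l" and pq: "norm (p - q) <= r" for p q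
 proof -
  have "?w p <= C * ?w q"
  proof (rule loc[OF grow[unfolded v_def] r(1), of p])
   show "cball p (36 * sqrt ?d * r) <= S j"
   proof
    fix p' assume "p' \<in> cball p (36 * sqrt ?d * r)"
    hence "norm (p - p') <= h / 4" unfolding r(2) by (simp add: dist_norm)
    hence "abs (norm p' - l) <= h / 4" using norm_triangle_ineq3[of p p'] p unfolding abs_minus_commute[of "norm p'"] by simp
    thus "p' \<in> S j" using h unfolding S_def l_def abs_le_iff by (simp add: algebra_simps)
   qed
   show "?w \<in> borel_measurable borel" by (rule harmonic_extension(1)[OF u D(1)])
   show "0 <= ?w p'" if "p' \<in> S j" for p' using u0 SD that by (auto simp: indicator_def)
   show "bdd_above (range ?w)" using M by (intro bdd_aboveI[of _ M]) (auto simp: abs_le_iff)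
  qed (use pq r in \<open>auto simp: dist_norm\<close>)
  moreover have "p \<in> D" "q \<in> D" using p q l by (auto intro!: subsetD[OF D(2)])
  ultimately show ?thesis by simp
 qed
 have sphere: "u p <= C ^ k * u q" if "norm p = l" "norm q = l" for p q
 proof -
  have "u (l *\<^sub>R ((1 / l) *\<^sub>R p)) <= C ^ k * u (l *\<^sub>R ((1 / l) *\<^sub>R q))"
  proof (rule sphere_chain[OF _ C k(1), where \<epsilon>="r / l" and f="%p. u (l *\<^sub>R p)"])
   show "2 <= DIM(real^'n)" using d by simp
   \<comment> \<open>The number 288 is \<open>2 * 144\<close>: the sphere has radius below
     \<open>2 R\<close>, and \<open>k\<close> arcs of length at most \<open>r\<close> must cover
     half of a great circle.\<close>
   have "288 * pi * sqrt ?d * R = (288 * pi * sqrt ?d * real m) * h" unfolding h(2)[symmetric] by simp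
   also have "... <= real k * h" using k h by (intro mult_right_mono) auto
   finally have *: "288 * pi * sqrt ?d * R <= real k * h" .
   have "pi * l <= pi * (2 * R)" using l by simp
   also have "... <= real k * r" using * sd unfolding r_def by (simp add: field_simps)
   finally show "pi / real k <= r / l" using k R l by (simp add: field_simps)
   fix p q :: "real^'n" assume pq: "norm p = 1" "norm q = 1" "norm (p - q) <= r / l"
   have "norm (l *\<^sub>R p - l *\<^sub>R q) = l * norm (p - q)" using R l by (simp add: scaleR_diff_right[symmetric])
   also have "... <= r" using pq(3) R l by (simp add: field_simps)
   finally show "u (l *\<^sub>R p) <= C * u (l *\<^sub>R q)" using pq R l by (intro near) auto
  qed (use that R l in auto)
  thus ?thesis using R l by simp
 qed
 obtain p :: "real^'n" where p: "norm p = l" using vector_choose_size[of l] R l by auto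
 have "cball 0 l <= ball 0 (2 * R)" using l by auto
 hence cb: "cball 0 l <= D" "0 < l" "x \<in> ball 0 l" "y \<in> ball 0 l" using D(2) l R x y by auto
 have "u x <= C ^ k * u p" using sphere[OF _ p] by (intro harmonic_le(1)[OF u D(1) cb(1,2,3)]) auto
 moreover have "(1 / C ^ k) * u p <= u y"
  using sphere[OF p] C by (intro harmonic_le(2)[OF u D(1) cb(1,2,4)]) (auto simp: field_simps)
 hence "C ^ k * u p <= C ^ k * (C ^ k * u y)" using C by (intro mult_left_mono) (auto simp: field_simps)
 ultimately show ?thesis by (simp add: mult_2 power_add mult.assoc)
qed

end

section \<open>Dimension one\<close>

text \<open>Truncate \<open>f\<close> in size and in support, then use that \<open>f\<close> is an
  almost everywhere limit of continuous functions; the truncation provides the dominating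
  function.\<close>

lemma integrable_continuous_approx:
 fixes f :: "'a::euclidean_space => real"
 assumes f: "integrable lborel f" and e: "0 < e"
 obtains g where "continuous_on UNIV g" "integrable lborel g" "(LINT x|lborel. abs (f x - g x)) < e"
proof -
 have fb: "f \<in> borel_measurable borel" using f by simp
 have "f \<in> borel_measurable lebesgue" by (rule measurable_completion) (simp add: fb)
 from lebesgue_measurable_imp_measurable_on[OF this, of UNIV] obtain N g where N: "negligible N" "!!n. continuous_on UNIV (g n)" "!!x. x ~: N ==> (%n. g n x) \<longlonglongrightarrow> f x"
  unfolding measurable_on_def by auto
 define c where "c M x = max 0 (min 1 (M - norm x))" for M and x :: 'a
 define cl where "cl M t x = max (- M) (min M t) * c M x" for M t :: real and x :: 'a
 have cc: "continuous_on UNIV (c M)" for M unfolding c_def by (intro continuous_on_max continuous_on_min continuous_intros)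
 have [measurable]: "c M \<in> borel_measurable borel" for M by (rule borel_measurable_continuous_onI[OF cc])
 have "integrable lborel (indicator (cball 0 M) :: 'a => real)" for M
  using emeasure_bounded_finite[of "cball 0 M"] by (simp add: integrable_indicator_iff)
 hence ci: "integrable lborel (%x. M * c M x)" for M
  by (intro integrable_mult_right Bochner_Integration.integrable_bound[of _ "indicator (cball 0 M)" "c M"])
   (auto simp: c_def indicator_def)
 have gc: "continuous_on UNIV (%x. cl M (g n x) x)" for M n unfolding cl_def by (intro continuous_intros cc N(2))
 have [measurable]: "g n \<in> borel_measurable borel" for n by (rule borel_measurable_continuous_onI[OF N(2)])
 have cl: "abs (cl M t x) <= M * c M x" if "0 <= M" for M t x
  unfolding cl_def abs_mult using that by (intro mult_mono) (auto simp: c_def)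
 have cli: "integrable lborel (%x. cl M (h x) x)" if "0 <= M" "h \<in> borel_measurable borel" for M h
  by (rule Bochner_Integration.integrable_bound[OF ci[of M]]) (use that cl[OF that(1)] in \<open>auto simp: cl_def c_def\<close>)
 have "(%k. LINT x|lborel. abs (f x - cl (real k) (f x) x)) \<longlonglongrightarrow> (LINT x|(lborel :: 'a measure). (0::real))"
 proof (rule integral_dominated_convergence[where w="%x. 2 * abs (f x)"])
  show "AE x in lborel. (%k. abs (f x - cl (real k) (f x) x)) \<longlonglongrightarrow> 0"
  proof (intro AE_I2 tendsto_eventually)
   fix x
   show "\<forall>\<^sub>F k in sequentially. abs (f x - cl (real k) (f x) x) = 0"
    using eventually_ge_at_top[of "nat \<lceil>\<bar>f x\<bar> + norm x + 1\<rceil>"]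
   proof eventually_elim
    case (elim k)
    hence "abs (f x) + norm x + 1 <= real k" by linarith
    hence "abs (f x) <= real k" "norm x + 1 <= real k" using norm_ge_zero[of x] by linarith+
    thus ?case by (simp add: cl_def c_def abs_le_iff)
   qed
  qed
  show "AE x in lborel. norm \<bar>f x - cl (real k) (f x) x\<bar> <= 2 * abs (f x)" for k
  proof (rule AE_I2)
   fix x
   have "abs (cl (real k) (f x) x) <= abs (f x) * 1" unfolding cl_def abs_mult by (intro mult_mono) (auto simp: c_def)
   thus "norm \<bar>f x - cl (real k) (f x) x\<bar> <= 2 * abs (f x)" by auto
  qed
 qed (use f fb in \<open>(auto simp: cl_def c_def; fail)\<close>)+
 from order_tendstoD(2)[OF this, of "e / 2"] obtain k where k: "(LINT x|lborel. abs (f x - cl (real k) (f x) x)) < e / 2"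
  using e eventually_happens' by force
 define M where "M = real k"
 have "(%n. LINT x|lborel. abs (cl M (f x) x - cl M (g n x) x)) \<longlonglongrightarrow> (LINT x|(lborel :: 'a measure). (0::real))"
 proof (rule integral_dominated_convergence[where w="%x. M * c M x + M * c M x"])
  have "AE x in lborel. x ~: N" using AE_not_in[of N lebesgue] N(1) by (simp add: negligible_iff_null_sets AE_completion_iff)
  thus "AE x in lborel. (%n. abs (cl M (f x) x - cl M (g n x) x)) \<longlonglongrightarrow> 0"
  proof eventually_elim
   case (elim x)
   have "(%n. abs (cl M (f x) x - cl M (g n x) x)) \<longlonglongrightarrow> \<bar>cl M (f x) x - cl M (f x) x\<bar>"
    unfolding cl_def by (intro tendsto_intros N(3)[OF elim])
   thus ?case by simp
  qed
  show "AE x in lborel. norm \<bar>cl M (f x) x - cl M (g n x) x\<bar> <= M * c M x + M * c M x" for n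
  proof (rule AE_I2)
   fix x
   show "norm \<bar>cl M (f x) x - cl M (g n x) x\<bar> <= M * c M x + M * c M x"
    using cl[of M "f x" x] cl[of M "g n x" x] by (simp add: M_def)
  qed
 qed (use fb ci in \<open>auto simp: cl_def c_def\<close>)
 from order_tendstoD(2)[OF this, of "e / 2"] obtain n where n: "(LINT x|lborel. abs (cl M (f x) x - cl M (g n x) x)) < e / 2"
  using e eventually_happens' by force
 have i: "integrable lborel (%x. cl M (f x) x)" "integrable lborel (%x. cl M (g n x) x)"
  using fb by (auto intro!: cli simp: M_def)
 have "(LINT x|lborel. abs (f x - cl M (g n x) x)) <= (LINT x|lborel. abs (f x - cl M (f x) x) + abs (cl M (f x) x - cl M (g n x) x))"
  using f i by (intro integral_mono) auto
 also have "... < e" using f i n k by (subst Bochner_Integration.integral_add) (auto simp: M_def)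
 finally show ?thesis using that[OF gc i(2)] by blast
qed

text \<open>The sign \<open>s\<close> orients the axis; later it selects one of the two endpoints of
  an interval.\<close>

lemma lborel_one_dim:
 assumes i: "(UNIV :: 'n::finite set) = {i}" and s: "s = 1 \<or> s = -1"
 shows "lborel = distr lborel borel (%x :: real^'n. s * x $ i)"
proof (rule lborel_eqI)
 have m: "(%x :: real^'n. s * x $ i) \<in> borel_measurable borel" by measurable
 fix l u :: real assume "!!b. b \<in> Basis ==> l \<bullet> b <= u \<bullet> b"
 hence lu: "l <= u" by simp
 have B: "Basis = {axis i 1 :: real^'n}" using i by (auto simp: Basis_vec_def)
 have c: "(\<chi> j. p) \<bullet> (axis i 1 :: real^'n) = p" for p :: real by (simp add: inner_axis)
 define p q where "p = (if s = 1 then l else - u)" and "q = (if s = 1 then u else - l)"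
 have pq: "p <= q" "q - p = u - l" using lu by (auto simp: p_def q_def)
 have all: "(ALL j. Q j) \<longleftrightarrow> Q i" for Q using i by (metis UNIV_I singletonD)
 have "(%x :: real^'n. s * x $ i) -` box l u Int space lborel = box (\<chi> j. p) (\<chi> j. q)"
  using s by (auto simp: mem_box_cart all box_real p_def q_def)
 thus "emeasure (distr lborel borel (%x :: real^'n. s * x $ i)) (box l u) = (\<Prod>b\<in>Basis. (u - l) \<bullet> b)"
  using pq m by (subst emeasure_distr) (auto simp: emeasure_lborel_box_eq B c inner_diff_left)
qed simp

lemma has_derivative_one_dim:
 assumes i: "(UNIV :: 'n::finite set) = {i}" and v: "!!t. (v has_real_derivative v' t) (at t)"
 shows "((%x :: real^'n. v (s * x $ i)) has_derivative (%h. h \<bullet> (\<chi> j. s * v' (s * x $ i)))) (at x)"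
proof -
 have "((%x :: real^'n. s * x $ i) has_derivative (%h. s * h $ i)) (at x)"
  by (intro derivative_intros bounded_linear_imp_has_derivative bounded_linear_vec_nth)
 from has_derivative_compose[OF this v[unfolded has_field_derivative_def]]
 have "((%x :: real^'n. v (s * x $ i)) has_derivative (%h. v' (s * x $ i) * (s * h $ i))) (at x)" .
 moreover have "(%h :: real^'n. v' (s * x $ i) * (s * h $ i)) = (%h. h \<bullet> (\<chi> j. s * v' (s * x $ i)))"
  by (simp add: inner_vec_def i fun_eq_iff)
 ultimately show ?thesis by simp
qed

lemma one_dim_operator:
 assumes i: "(UNIV :: 'n::finite set) = {i}" and s: "s = 1 \<or> s = -1"
  and v: "!!t. (v has_real_derivative v' t) (at t)" "!!t. (v' has_real_derivative v'' t) (at t)" "continuous_on UNIV v''"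
  and supp: "!!t. r < abs t ==> v t = 0"
 shows "C2_compact_support (%x :: real^'n. v (s * x $ i))"
  and "diffusion_operator a b (%x :: real^'n. v (s * x $ i)) x = 1 / 2 * (a x $ i $ i * v'' (s * x $ i)) + b x $ i * (s * v' (s * x $ i))"
proof -
 have ss: "s * (s * t) = t" for t using s by auto
 have 1: "((%x :: real^'n. v (s * x $ i)) has_derivative (%h. h \<bullet> (\<chi> j. s * v' (s * x $ i)))) (at x)" for x
  by (rule has_derivative_one_dim[OF i v(1)])
 have 2: "((%x :: real^'n. (\<chi> j. s * v' (s * x $ i)) $ k) has_derivative (%h. h \<bullet> (\<chi> j. v'' (s * x $ i)))) (at x)" for k :: 'n and x
 proof -
  have "((%t. s * v' t) has_real_derivative s * v'' t) (at t)" for t by (auto intro!: derivative_eq_intros v)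
  from has_derivative_one_dim[OF i this, of s x] show ?thesis by (simp add: ss)
 qed
 show "C2_compact_support (%x :: real^'n. v (s * x $ i))"
 proof (rule C2_compact_support_gradientI(1)[OF 1 2])
  show "continuous_on UNIV (%x :: real^'n. \<chi> j. v'' (s * x $ i))" for k :: 'n
   by (intro continuous_intros continuous_on_compose2[OF v(3)]) auto
  show "{x :: real^'n. v (s * x $ i) ~= 0} <= cball 0 r"
  proof
   fix x :: "real^'n" assume "x \<in> {x. v (s * x $ i) ~= 0}"
   hence "abs (s * x $ i) <= r" using supp[of "s * x $ i"] by force
   moreover have "norm x = abs (x $ i)" by (simp add: norm_vec_def L2_set_def i)
   ultimately show "x \<in> cball 0 r" using s by auto
  qed
 qed
 show "diffusion_operator a b (%x :: real^'n. v (s * x $ i)) x = 1 / 2 * (a x $ i $ i * v'' (s * x $ i)) + b x $ i * (s * v' (s * x $ i))"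
  by (subst diffusion_operator_gradient[OF 1 2]) (simp add: i inner_vec_def)
qed

text \<open>The cutoff is \<open>1 - (1 - k q^3)_+^3\<close> with
  \<open>q = (4 S^2 - t^2)_+\<close>: the two cubes make both truncations C2, and \<open>k\<close>
  is such that \<open>k q^3 >= 1\<close> on \<open>[-S, S]\<close>.\<close>

lemma cutoff:
 assumes S: "0 < S"
 obtains e \<eta>' \<eta>'' :: "real => real" where "!!t. (e has_real_derivative \<eta>' t) (at t)" "!!t. (\<eta>' has_real_derivative \<eta>'' t) (at t)" "continuous_on UNIV \<eta>''"
  "!!t. abs t <= S ==> e t = 1 & \<eta>' t = 0 & \<eta>'' t = 0" "!!t. 2 * S < abs t ==> e t = 0"
proof -
 define k where "k = 1 / (3 * S^2) ^ 3"
 define q where "q t = max 0 (4 * S^2 - t^2)" for t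
 define p where "p t = max 0 (1 - k * q t ^ 3)" for t
 have q3: "((%t. q t ^ 3) has_real_derivative 3 * q t ^ 2 * (- 2 * t)) (at t)" for t
  unfolding q_def by (rule DERIV_chain2[OF max0_power_has_derivative[of 3, simplified]]) (auto intro!: derivative_eq_intros)
 have q2: "((%t. q t ^ 2) has_real_derivative 2 * q t * (- 2 * t)) (at t)" for t
  unfolding q_def by (rule DERIV_chain2[OF max0_power_has_derivative[of 2, simplified]]) (auto intro!: derivative_eq_intros)
 have r: "((%t. 1 - k * q t ^ 3) has_real_derivative 6 * k * t * q t ^ 2) (at t)" for t
  by (rule DERIV_cong[OF DERIV_diff[OF DERIV_const DERIV_cmult[OF q3]]]) simp
 have p3: "((%t. p t ^ 3) has_real_derivative 3 * p t ^ 2 * (6 * k * t * q t ^ 2)) (at t)" for t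
  unfolding p_def by (rule DERIV_chain2[OF max0_power_has_derivative[of 3, simplified] r])
 have p2: "((%t. p t ^ 2) has_real_derivative 2 * p t * (6 * k * t * q t ^ 2)) (at t)" for t
  unfolding p_def by (rule DERIV_chain2[OF max0_power_has_derivative[of 2, simplified] r])
 have pz: "p t = 0" if "abs t <= S" for t
 proof -
  have "t^2 <= S^2" using that by (simp add: abs_le_square_iff[symmetric] S less_imp_le abs_of_pos)
  hence "3 * S^2 <= q t" by (simp add: q_def)
  hence "(3 * S^2) ^ 3 <= q t ^ 3" by (intro power_mono) auto
  hence "1 <= k * q t ^ 3" using S by (simp add: k_def)
  thus ?thesis by (simp add: p_def)
 qed
 show ?thesis
 proof (rule that[of "%t. 1 - p t ^ 3" "%t. - (3 * p t ^ 2 * (6 * k * t * q t ^ 2))"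
   "%t. - (3 * (2 * p t * (6 * k * t * q t ^ 2)) * (6 * k * t * q t ^ 2) + 3 * p t ^ 2 * (6 * k * q t ^ 2 + 6 * k * t * (2 * q t * (- 2 * t))))"])
  show "((%t. 1 - p t ^ 3) has_real_derivative - (3 * p t ^ 2 * (6 * k * t * q t ^ 2))) (at t)" for t
   by (rule DERIV_cong[OF DERIV_diff[OF DERIV_const p3]]) simp
  show "((%t. - (3 * p t ^ 2 * (6 * k * t * q t ^ 2))) has_real_derivative
   - (3 * (2 * p t * (6 * k * t * q t ^ 2)) * (6 * k * t * q t ^ 2) + 3 * p t ^ 2 * (6 * k * q t ^ 2 + 6 * k * t * (2 * q t * (- 2 * t))))) (at t)" for t
   by (rule DERIV_cong[OF DERIV_minus[OF DERIV_mult[OF DERIV_cmult[OF p2] DERIV_mult[OF DERIV_cmult_Id q2]]]]) (simp add: algebra_simps)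
  show "continuous_on UNIV (%t. - (3 * (2 * p t * (6 * k * t * q t ^ 2)) * (6 * k * t * q t ^ 2) + 3 * p t ^ 2 * (6 * k * q t ^ 2 + 6 * k * t * (2 * q t * (- 2 * t)))))"
   unfolding p_def q_def by (intro continuous_intros)
  show "1 - p t ^ 3 = 0" if "2 * S < abs t" for t
  proof -
   have "(2 * S)^2 <= abs t^2" using that S by (intro power_mono) auto
   hence "q t = 0" by (simp add: q_def power_mult_distrib)
   thus ?thesis by (simp add: p_def)
  qed
 qed (simp add: pz)
qed

text \<open>A scale function: it solves \<open>F'' = k g F'\<close> with \<open>F = 0\<close> and
  \<open>F' = 1\<close> at \<open>-S\<close>, which is convex enough to compensate any drift bounded
  by \<open>g\<close>. The integrating factor keeps \<open>F'\<close> between 1 and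
  \<open>exp (k B)\<close> to the right of \<open>-S\<close>.\<close>

lemma scale_function:
 assumes g: "continuous_on UNIV g" "!!t :: real. 0 <= g t" "integrable lborel g" "(LINT t|lborel. g t) <= B" and k: "0 < k"
 obtains F F' where "!!t. (F has_real_derivative F' t) (at t)" "!!t. (F' has_real_derivative k * g t * F' t) (at t)" "continuous_on UNIV F'"
  "!!t. -S <= t ==> 1 <= F' t & F' t <= exp (k * B)" "!!t. -S <= t ==> t + S <= F t & F t <= exp (k * B) * (t + S)"
proof -
 have anti: "EX G. ALL t. (G has_real_derivative f t) (at t)" if "continuous_on UNIV f" for f :: "real => real"
  using einterval_antiderivative[of "-\<infinity>" "\<infinity>" f] that by (auto simp: continuous_on_eq_continuous_at has_real_derivative_iff_has_vector_derivative)
 obtain G where G: "!!t. (G has_real_derivative g t) (at t)" using anti[OF g(1)] by blast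
 define F' where "F' t = exp (k * (G t - G (-S)))" for t
 have F': "(F' has_real_derivative k * g t * F' t) (at t)" for t
  unfolding F'_def by (rule derivative_eq_intros G refl)+ simp
 have F'c: "continuous_on UNIV F'" using F' by (meson DERIV_isCont continuous_at_imp_continuous_on)
 obtain F0 where F0: "!!t. (F0 has_real_derivative F' t) (at t)" using anti[OF F'c] by blast
 define F where "F t = F0 t - F0 (-S)" for t
 have F: "(F has_real_derivative F' t) (at t)" for t unfolding F_def by (rule derivative_eq_intros F0 refl)+ simp
 have B: "0 <= G t - G (-S) & G t - G (-S) <= B" if "-S <= t" for t
 proof -
  have "(g has_integral G t - G (-S)) {-S..t}"
   using G that by (intro fundamental_theorem_of_calculus) (auto simp: has_real_derivative_iff_has_vector_derivative[symmetric] intro: DERIV_subset)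
  hence eq: "G t - G (-S) = integral {-S..t} g" by (simp add: integral_unique)
  have si: "set_integrable lborel {-S..t} g" unfolding set_integrable_def by (rule integrable_mult_indicator[OF _ g(3)]) simp
  have "integral {-S..t} g = (LINT x:{-S..t}|lborel. g x)" by (rule set_borel_integral_eq_integral(2)[OF si, symmetric])
  also have "... <= (LINT x|lborel. g x)" unfolding set_lebesgue_integral_def
   using si g by (intro integral_mono) (auto simp: set_integrable_def indicator_def)
  finally show ?thesis using eq g(2,4) integral_nonneg[of g "{-S..t}"] si set_borel_integral_eq_integral(1)[OF si] by auto
 qed
 have F'b: "1 <= F' t & F' t <= exp (k * B)" if "-S <= t" for t
  using B[OF that] k by (auto simp: F'_def intro!: mult_left_mono)
 show ?thesis
 proof (rule that[OF F F' F'c F'b])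
  fix t assume t: "-S <= t"
  show "t + S <= F t & F t <= exp (k * B) * (t + S)"
  proof (cases "t = -S")
   case False
   then obtain z where z: "-S < z" "z < t" "F t - F (-S) = (t - (-S)) * F' z" using MVT2[of "-S" t F F'] F t by auto
   have "(t + S) * 1 <= (t + S) * F' z" "(t + S) * F' z <= (t + S) * exp (k * B)"
    using F'b[of z] z t by (auto intro!: mult_left_mono)
   thus ?thesis using z(3) by (simp add: F_def mult.commute)
  qed (simp add: F_def)
 qed
qed

text \<open>Dynkin's formula is available for closed balls and finite horizons; as both increase,
  the stopped positions converge to the exit point of the open ball.\<close>

lemma (in continuous_markov_process) closed_exit_tendsto:
 assumes w: "w \<in> exits z r" and X0: "X 0 w \<in> ball z r" and q: "!!n. q n < r" "q \<longlonglongrightarrow> r"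
 shows "(%n. X (closed_exit (cball z (q n)) (real n) w) w) \<longlonglongrightarrow> exit_point X z r w"
proof -
 have O: "w \<in> Om" and fin: "exit_time X z r w < \<infinity>" using w by (simp_all only: exits_iff)
 obtain T where T: "exit_time X z r w = ereal T" "0 <= T"
  using fin exit_time_nonneg[of z r w] by (cases "exit_time X z r w") auto
 have ep: "exit_point X z r w = X T w" by (simp add: exit_point_def T)
 have out: "dist z (X T w) = r" using exit_point_sphere[OF w X0] by (simp add: ep)
 define h where "h n = closed_exit (cball z (q n)) (real n) w" for n
 have \<sigma>0: "0 <= h n" for n unfolding h_def by (rule closed_exit_bounds) simp
 have "h \<longlonglongrightarrow> T"
 proof (rule order_tendstoI)
  fix s assume s: "s < T"
  show "\<forall>\<^sub>F n in sequentially. s < h n"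
  proof (cases "0 <= s")
   case False
   thus ?thesis using \<sigma>0 by (intro always_eventually allI) (meson not_le order_less_le_trans)
  next
   case True
   define s' where "s' = (s + T) / 2"
   have s': "s < s'" "s' < T" "0 <= s'" using s True by (auto simp: s'_def)
   have "~ exit_time X z r w <= ereal s'" using T s' by simp
   hence st: "w \<in> stay (ball z r) s'" using exit_time_le_iff[OF s'(3) O, of z r] by simp
   have "continuous_on {0..s'} (%t. dist z (X t w))"
    by (intro continuous_intros continuous_on_subset[OF continuous_path[OF O]]) auto
   then obtain t where t: "t \<in> {0..s'}" "!!t'. t' \<in> {0..s'} ==> dist z (X t' w) <= dist z (X t w)"
    using continuous_attains_sup[of "{0..s'}" "%t. dist z (X t w)"] s'(3) by auto
   have "dist z (X t w) < r" using st t(1) by (auto simp: stay_def)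
   hence "\<forall>\<^sub>F n in sequentially. dist z (X t w) < q n" using q(2) by (intro order_tendstoD(1))
   moreover have "\<forall>\<^sub>F n in sequentially. s' <= real n" by real_asymp
   ultimately show ?thesis
   proof eventually_elim
    case (elim n)
    have "s' <= h n" unfolding h_def closed_exit_def
    proof (rule cInf_greatest)
     fix t' assume t': "t' \<in> insert (real n) {t \<in> {0..real n}. X t w ~: cball z (q n)}"
     show "s' <= t'"
     proof (rule ccontr)
      assume "~ s' <= t'"
      hence "t' \<in> {0..s'}" "X t' w ~: cball z (q n)" using t' elim by auto
      thus False using t(2)[of t'] elim by simp
     qed
    qed simp
    thus ?case using s' by simp
   qed
  qed
 next
  fix s assume s: "T < s"
  have "\<forall>\<^sub>F n in sequentially. T <= real n" by real_asymp
  thus "\<forall>\<^sub>F n in sequentially. h n < s"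
  proof eventually_elim
   case (elim n)
   have "h n <= T" unfolding h_def using out q(1)[of n] elim T by (intro closed_exit_le) auto
   thus ?case using s by simp
  qed
 qed
 thus ?thesis unfolding ep h_def[symmetric] using \<sigma>0 T by (intro path_tendsto[OF O])
qed

lemma one_dim_elliptic:
 fixes A :: "real^'n^'n"
 assumes A: "A \<in> ellipticity_class ell" and i: "(UNIV :: 'n set) = {i}"
 shows "ell <= A $ i $ i"
proof -
 have "A *v axis i 1 = A $ i $ i *\<^sub>R axis i 1"
  unfolding vec_eq_iff matrix_vector_mult_def by (auto simp: i axis_def) (metis UNIV_I i singletonD)
 moreover have "axis i 1 ~= (0 :: real^'n)" by (simp add: axis_eq_0_iff)
 ultimately have "A $ i $ i \<in> {ell..1 / ell}" using A unfolding ellipticity_class_def by blast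
 thus ?thesis by simp
qed

context Ld_quasi_diffusion
begin

text \<open>The scale function is C2 only for continuous \<open>g\<close>; such a \<open>g\<close>
  dominates \<open>|b|\<close> up to an error that is small in the mean.\<close>

lemma one_dim_drift_approx:
 assumes i: "(UNIV :: 'n set) = {i}" and s: "s = 1 \<or> s = -1" and e: "0 < e"
 obtains g where "continuous_on UNIV g" "!!t. 0 <= g t" "integrable lborel g" "(LINT t|lborel. g t) <= (LINT x|lborel. norm (b x) ^ CARD('n)) + e"
  "integrable lborel (%x. max 0 (norm (b x) - g (s * x $ i)))" "(LINT x|lborel. max 0 (norm (b x) - g (s * x $ i))) <= e"
proof -
 let ?p = "%x :: real^'n. s * x $ i"
 have d1: "CARD('n) = 1" unfolding i by simp
 have "continuous_on UNIV ?p" by (intro continuous_intros)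
 hence pm: "?p \<in> lborel \<rightarrow>\<^sub>M borel" using borel_measurable_continuous_onI by simp
 define B where "B t = norm (b (\<chi> j. s * t))" for t
 have all: "j = i" for j using i by (metis UNIV_I singletonD)
 have \<beta>p: "B (?p x) = norm (b x)" for x
 proof -
  have "(\<chi> j. s * (s * x $ i)) $ j = x $ j" for j unfolding all[of j] using s by auto
  hence "(\<chi> j. s * (s * x $ i)) = x" unfolding vec_eq_iff by blast
  thus ?thesis by (simp add: B_def)
 qed
 have \<beta>m: "B \<in> borel_measurable borel" unfolding B_def
 proof (rule measurable_compose[OF measurable_compose[OF _ b_measurable] borel_measurable_norm])
  have "continuous_on UNIV (%t. (\<chi> j. s * t) :: real^'n)" by (intro continuous_intros)
  thus "(%t. (\<chi> j. s * t) :: real^'n) \<in> borel_measurable borel" by (rule borel_measurable_continuous_onI)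
 qed
 have push: "(LINT t|lborel. f t) = (LINT x|lborel. f (?p x))" "integrable lborel f \<longleftrightarrow> integrable lborel (%x. f (?p x))"
  if "f \<in> borel_measurable borel" for f :: "real => real"
  using that pm by (subst lborel_one_dim[OF i s], simp add: integral_distr integrable_distr_eq)+
 have \<beta>i: "integrable lborel B" using push(2)[OF \<beta>m] b_Ld by (simp add: \<beta>p d1)
 obtain g0 where g0: "continuous_on UNIV g0" "integrable lborel g0" "(LINT t|lborel. abs (B t - g0 t)) < e"
  using integrable_continuous_approx[OF \<beta>i e] by blast
 define g where "g t = max 0 (g0 t)" for t
 have gc: "continuous_on UNIV g" unfolding g_def by (intro continuous_intros g0)
 have gm: "g \<in> borel_measurable borel" by (rule borel_measurable_continuous_onI[OF gc])
 have gi: "integrable lborel g" unfolding g_def using g0 by (intro integrable_max) auto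
 have diff: "integrable lborel (%t. abs (B t - g0 t))" using \<beta>i g0 by auto
 have \<beta>0: "0 <= B t" for t by (simp add: B_def)
 let ?h = "%t. max 0 (B t - g t)"
 have hm: "?h \<in> borel_measurable borel" using \<beta>m gm by measurable
 have hi: "integrable lborel ?h" using \<beta>i gi by (intro integrable_max) auto
 have hle: "(LINT t|lborel. ?h t) <= (LINT t|lborel. abs (B t - g0 t))"
  using \<beta>0 by (intro integral_mono hi diff) (auto simp: g_def)
 show ?thesis
 proof (rule that[OF gc _ gi])
  show "0 <= g t" for t by (simp add: g_def)
  have "(LINT t|lborel. g t) <= (LINT t|lborel. B t + abs (B t - g0 t))"
  proof (intro integral_mono gi)
   show "integrable lborel (%t. B t + abs (B t - g0 t))" using \<beta>i diff by simp
   show "g t <= B t + abs (B t - g0 t)" for t using \<beta>0[of t] by (auto simp: g_def)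
  qed
  also have "... = (LINT t|lborel. B t) + (LINT t|lborel. abs (B t - g0 t))" using \<beta>i diff by simp
  also have "(LINT t|lborel. B t) = (LINT x|lborel. norm (b x) ^ CARD('n))" using push(1)[OF \<beta>m] by (simp add: \<beta>p d1)
  finally show "(LINT t|lborel. g t) <= (LINT x|lborel. norm (b x) ^ CARD('n)) + e" using g0(3) by simp
  show "integrable lborel (%x. max 0 (norm (b x) - g (?p x)))" using push(2)[OF hm] hi by (simp add: \<beta>p)
  show "(LINT x|lborel. max 0 (norm (b x) - g (?p x))) <= e" using push(1)[OF hm] hle g0(3) by (simp add: \<beta>p)
 qed
qed

lemma affine_cutoff_C2:
 assumes i: "(UNIV :: 'n set) = {i}" and s: "s = 1 \<or> s = -1"
  and e: "!!t. (e has_real_derivative \<eta>' t) (at t)" "!!t. (\<eta>' has_real_derivative \<eta>'' t) (at t)" "continuous_on UNIV \<eta>''"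
   "!!t. 2 * S < abs t ==> e t = 0"
 shows "C2_compact_support (%y :: real^'n. (s * y $ i + S) * e (s * y $ i))"
proof (rule one_dim_operator(1)[OF i s, where v="%t. (t + S) * e t"])
 show "((%t. (t + S) * e t) has_real_derivative e t + \<eta>' t * (t + S)) (at t)" for t
  by (rule derivative_eq_intros e refl)+ simp
 show "((%t. e t + \<eta>' t * (t + S)) has_real_derivative 2 * \<eta>' t + \<eta>'' t * (t + S)) (at t)" for t
  by (rule derivative_eq_intros e refl)+ simp
 show "continuous_on UNIV (%t. 2 * \<eta>' t + \<eta>'' t * (t + S))"
  using e(2) by (intro continuous_intros e(3)) (meson DERIV_isCont continuous_at_imp_continuous_on)
 show "(t + S) * e t = 0" if "2 * S < abs t" for t using e(4)[OF that] by simp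
qed

text \<open>Up to the exit, the scale function \<open>u\<close>, cut off outside the interval, is a
  submartingale except for an error controlled by \<open>(|b| - g)_+\<close>. The occupation
  integral of this error is small by \<open>abp_drift\<close>, whose norm is that of
  \<open>L_1\<close> in dimension one. Comparing \<open>u\<close> with the affine function
  \<open>h\<close> costs the exponential factor.\<close>

lemma closed_exit_position_lower:
 assumes i: "(UNIV :: 'n set) = {i}" and s: "s = 1 \<or> s = -1" and S: "0 < S"
  and K: "(LINT x|lborel. norm (b x) ^ CARD('n)) <= K" and r: "0 < r" "r <= S" and T: "0 < T" and x: "x \<in> cball 0 r"
  and l: "!!t. (l has_real_derivative \<eta>' t) (at t)" "!!t. (\<eta>' has_real_derivative \<eta>'' t) (at t)" "continuous_on UNIV \<eta>''"
   "!!t. abs t <= S ==> l t = 1 & \<eta>' t = 0 & \<eta>'' t = 0" "!!t. 2 * S < abs t ==> l t = 0"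
 defines "h == %y. (s * y $ i + S) * l (s * y $ i)"
 shows "s * x $ i + S <= exp (2 / ell * (K + 1)) * (LINT v|P x. h (X (closed_exit (cball 0 r) T v) v))"
proof (rule field_le_epsilon)
 fix e :: real assume e: "0 < e"
 let ?C = "cball 0 r :: (real^'n) set"
 \<comment> \<open>This gives \<open>1/2 a k >= 1\<close>, so the second-order term absorbs a drift
   of size \<open>g\<close>.\<close>
 define k where "k = 2 / ell"
 define E where "E = exp (k * (K + 1))"
 have k: "0 < k" using ell by (simp add: k_def)
 have E: "0 < E" by (simp add: E_def)
 have d1: "CARD('n) = 1" unfolding i by simp
 have all: "j = i" for j using i by (metis UNIV_I singletonD)
 have nrm: "norm y = abs (s * y $ i)" for y :: "real^'n" using s by (auto simp: norm_vec_def L2_set_def i abs_mult)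
 have ec: "continuous_on UNIV l" "continuous_on UNIV \<eta>'" using l(1,2) by (meson DERIV_isCont continuous_at_imp_continuous_on)+
 define c where "c = 2 * (abp_norm * (2 * r + drift_time 0 r T x))"
 have c: "0 <= c" using abp_norm_pos drift_time_nonneg[OF r(1) T x] r by (simp add: c_def)
 \<comment> \<open>\<open>c\<close> contains \<open>drift_time\<close>, which is finite but not
   bounded uniformly. The tolerance \<open>q\<close> is chosen after \<open>c\<close> and the error
   \<open>e\<close> is arbitrary, so the final constant is free of
   \<open>drift_time\<close>.\<close>
 define q where "q = min 1 (e / (E * (c + 1)))"
 have q: "0 < q" "q <= 1" using e E c by (auto simp: q_def)
 obtain g where g: "continuous_on UNIV g" "!!t. 0 <= g t" "integrable lborel g" "(LINT t|lborel. g t) <= (LINT x|lborel. norm (b x) ^ CARD('n)) + q"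
  "integrable lborel (%x. max 0 (norm (b x) - g (s * x $ i)))" "(LINT x|lborel. max 0 (norm (b x) - g (s * x $ i))) <= q"
  using one_dim_drift_approx[OF i s q(1)] by blast
 have gB: "(LINT t|lborel. g t) <= K + 1" using g(4) K q(2) by simp
 obtain F F' where F: "!!t. (F has_real_derivative F' t) (at t)" "!!t. (F' has_real_derivative k * g t * F' t) (at t)" "continuous_on UNIV F'"
  "!!t. -S <= t ==> 1 <= F' t & F' t <= E" "!!t. -S <= t ==> t + S <= F t & F t <= E * (t + S)"
  unfolding E_def using scale_function[OF g(1,2,3) gB k, where S=S] by blast
 have Fc: "continuous_on UNIV F" using F(1) by (meson DERIV_isCont continuous_at_imp_continuous_on)
 define u where "u y = F (s * y $ i) * l (s * y $ i)" for y :: "real^'n"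
 have vd: "((%t. F t * l t) has_real_derivative F' t * l t + \<eta>' t * F t) (at t)" for t
  by (rule DERIV_mult[OF F(1) l(1)])
 have vdd: "((%t. F' t * l t + \<eta>' t * F t) has_real_derivative (k * g t * F' t * l t + \<eta>' t * F' t) + (\<eta>'' t * F t + F' t * \<eta>' t)) (at t)" for t
  by (rule DERIV_add[OF DERIV_mult[OF F(2) l(1)] DERIV_mult[OF l(2) F(1)]])
 have vc: "continuous_on UNIV (%t. (k * g t * F' t * l t + \<eta>' t * F' t) + (\<eta>'' t * F t + F' t * \<eta>' t))"
  by (intro continuous_intros g F Fc ec l(3))
 have supp: "F t * l t = 0" if "2 * S < abs t" for t using l(5)[OF that] by simp
 have uC2: "C2_compact_support u"
  and Lu: "L u y = 1 / 2 * (a y $ i $ i * ((k * g t * F' t * l t + \<eta>' t * F' t) + (\<eta>'' t * F t + F' t * \<eta>' t))) + b y $ i * (s * (F' t * l t + \<eta>' t * F t))"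
  if "t = s * y $ i" for y t unfolding u_def [abs_def] that using one_dim_operator[OF i s vd vdd vc supp] by blast+
 define f where "f y = max 0 (norm (b y) - g (s * y $ i))" for y
 have inC: "abs (s * y $ i) <= S" if "y \<in> ?C" for y using that r nrm[of y] by simp
 have Llow: "- (E * f y) <= L u y" if y: "y \<in> ?C" for y
 proof -
  define t where "t = s * y $ i"
  have t: "abs t <= S" using inC[OF y] by (simp add: t_def)
  hence tS: "-S <= t" by simp
  have Lt: "L u y = 1 / 2 * (a y $ i $ i * (k * g t * F' t)) + b y $ i * (s * F' t)"
   unfolding Lu[OF t_def] using l(4)[OF t] by simp
  have F'1: "0 <= F' t" "F' t <= E" using F(4)[OF tS] by auto
  have "1 * (g t * F' t) <= (1 / 2 * a y $ i $ i * k) * (g t * F' t)"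
  proof (intro mult_right_mono)
   have "ell * k <= a y $ i $ i * k" using one_dim_elliptic[OF elliptic i] k by (intro mult_right_mono) auto
   moreover have "ell * k = 2" using ell by (simp add: k_def)
   ultimately show "1 <= 1 / 2 * a y $ i $ i * k" by (simp add: mult.assoc)
  qed (use g(2) F'1 in auto)
  moreover have "- (norm (b y) * F' t) <= b y $ i * (s * F' t)"
  proof -
   have "abs (b y $ i * (s * F' t)) = abs (b y $ i) * F' t" using s F'1 by (auto simp: abs_mult)
   also have "... <= norm (b y) * F' t" using component_le_norm_cart[of "b y" i] F'1 by (intro mult_right_mono) auto
   finally show ?thesis by linarith
  qed
  moreover have "(norm (b y) - g t) * F' t <= f y * F' t" using F'1 by (intro mult_right_mono) (auto simp: f_def t_def)
  moreover have "f y * F' t <= f y * E" using F'1 by (intro mult_left_mono) (auto simp: f_def)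
  ultimately show ?thesis unfolding Lt by (simp add: algebra_simps)
 qed
 have gsm: "(%y :: real^'n. g (s * y $ i)) \<in> borel_measurable borel"
  by (rule measurable_compose[OF _ borel_measurable_continuous_onI[OF g(1)]]) measurable
 have fm: "f \<in> borel_measurable borel" unfolding f_def [abs_def] using gsm by measurable
 have f0: "0 <= f y" "f y <= norm (b y)" for y using g(2) by (auto simp: f_def)
 have kfi: "integrable (space_time x) (%p. killed ?C T p * f (pos p))"
 proof (rule Bochner_Integration.integrable_bound[OF killed_drift_integrable[of ?C T x]])
  show "(%p. killed ?C T p * f (pos p)) \<in> borel_measurable (space_time x)"
   by (intro borel_measurable_times killed_closed_measurable pos_measurable fm) auto
  show "AE p in space_time x. norm (killed ?C T p * f (pos p)) <= norm (killed ?C T p * norm (b (pos p)))"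
   using f0 killed_bounds(1) by (intro AE_I2) (auto simp: abs_mult intro!: mult_left_mono)
 qed (use T in auto)
 have kf: "(LINT p|space_time x. killed ?C T p * f (pos p)) <= c * q"
 proof -
  have "ennreal (LINT p|space_time x. killed ?C T p * f (pos p)) = (\<integral>\<^sup>+p. ennreal (killed ?C T p * f (pos p)) \<partial>space_time x)"
   using kfi f0 killed_bounds(1) by (intro nn_integral_eq_integral[symmetric]) auto
  also have "... <= ennreal (c * root CARD('n) (LINT y|lborel. f y ^ CARD('n)))"
   unfolding c_def using g(5) by (intro abp_drift[OF r(1) T x fm f0(1)]) (simp add: d1 f_def)
  also have "root CARD('n) (LINT y|lborel. f y ^ CARD('n)) = (LINT y|lborel. f y)" by (simp add: d1)
  also have "ennreal (c * (LINT y|lborel. f y)) <= ennreal (c * q)" using g(6) c by (intro ennreal_leI mult_left_mono) (auto simp: f_def)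
  finally show ?thesis using c q by (simp add: ennreal_le_iff)
 qed
 have dyn: "(LINT v|P x. u (X (closed_exit ?C T v) v)) = u x + (LINT p|space_time x. killed ?C T p * L u (pos p))"
  and um: "(%v. u (X (closed_exit ?C T v) v)) \<in> borel_measurable (P x)"
  by (rule dynkin_closed_exit[OF uC2[OF refl] closed_cball T])+
 have "- (E * (LINT p|space_time x. killed ?C T p * f (pos p))) = (LINT p|space_time x. - (E * (killed ?C T p * f (pos p))))" by simp
 also have "... <= (LINT p|space_time x. killed ?C T p * L u (pos p))"
 proof (rule integral_mono)
  show "integrable (space_time x) (%p. - (E * (killed ?C T p * f (pos p))))" using kfi by simp
  show "integrable (space_time x) (%p. killed ?C T p * L u (pos p))"
   using T by (intro L_space_time[OF uC2[OF refl] _ killed_closed_measurable killed_bounds(3)]) auto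
  fix p
  show "- (E * (killed ?C T p * f (pos p))) <= killed ?C T p * L u (pos p)"
  proof (cases "killed ?C T p = 0")
   case False
   hence "killed ?C T p * - (E * f (pos p)) <= killed ?C T p * L u (pos p)"
    using Llow[OF killed_pos[OF False]] killed_bounds(1) by (intro mult_left_mono) auto
   thus ?thesis by (simp add: mult_ac)
  qed simp
 qed
 finally have low: "u x <= (LINT v|P x. u (X (closed_exit ?C T v) v)) + E * (c * q)"
  using dyn mult_left_mono[OF kf less_imp_le[OF E]] by linarith
 have "E * (c * q) <= E * (c * (e / (E * (c + 1))))" using E c by (intro mult_left_mono) (auto simp: q_def)
 also have "... = e * (c / (c + 1))" using E by simp
 also have "... <= e * 1" using e c by (intro mult_left_mono) auto
 finally have err: "E * (c * q) <= e" by simp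
 have \<phi>C2: "C2_compact_support h" unfolding h_def by (rule affine_cutoff_C2[OF i s l(1-3,5)])
 have \<phi>m: "(%v. h (X (closed_exit ?C T v) v)) \<in> borel_measurable (P x)"
  by (rule dynkin_closed_exit(2)[OF \<phi>C2 closed_cball T])
 have bnd: "EX M. ALL y. abs (w y) <= M" if "C2_compact_support w" for w :: "real^'n => real"
  using C2_compact_support_bounds(4)[OF that] by blast
 obtain M1 M2 where M: "!!y. abs (u y) <= M1" "!!y. abs (h y) <= M2" using bnd[OF uC2[OF refl]] bnd[OF \<phi>C2] by blast
 have "(LINT v|P x. u (X (closed_exit ?C T v) v)) <= (LINT v|P x. E * h (X (closed_exit ?C T v) v))"
 proof (rule integral_mono_AE)
  show "integrable (P x) (%v. u (X (closed_exit ?C T v) v))" using um M by (intro Px.integrable_const_bound[where B=M1]) auto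
  show "integrable (P x) (%v. E * h (X (closed_exit ?C T v) v))"
   using \<phi>m M by (intro integrable_mult_right Px.integrable_const_bound[where B=M2]) auto
  show "AE v in P x. u (X (closed_exit ?C T v) v) <= E * h (X (closed_exit ?C T v) v)" using AE_start[of x] AE_space
  proof eventually_elim
   case (elim v)
   have "X (closed_exit ?C T v) v \<in> ?C" using elim x T by (intro closed_exit_in) auto
   from inC[OF this] show ?case using l(4) F(5) by (simp add: u_def h_def abs_le_iff)
  qed
 qed
 also have "... = E * (LINT v|P x. h (X (closed_exit ?C T v) v))" by simp
 finally have "u x <= E * (LINT v|P x. h (X (closed_exit ?C T v) v)) + e" using low err by linarith
 moreover have "s * x $ i + S <= u x" using inC[OF x] l(4) F(5) by (simp add: u_def abs_le_iff)
 ultimately show "s * x $ i + S <= exp (2 / ell * (K + 1)) * (LINT v|P x. h (X (closed_exit ?C T v) v)) + e"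
  unfolding E_def k_def by linarith
qed

text \<open>Passage to the exit from the open interval. The indicator equals 1 at the exit point
  almost surely and makes the integrand bounded everywhere.\<close>

lemma exit_position_lower:
 assumes i: "(UNIV :: 'n set) = {i}" and s: "s = 1 \<or> s = -1" and S: "0 < S"
  and K: "(LINT x|lborel. norm (b x) ^ CARD('n)) <= K" and x: "x \<in> ball 0 S"
 shows "s * x $ i + S <= exp (2 / ell * (K + 1)) * (LINT v|P x. indicator {-S..S} (exit_point X 0 S v $ i) * (s * exit_point X 0 S v $ i + S))"
proof -
 obtain e \<eta>' \<eta>'' where e: "!!t. (e has_real_derivative \<eta>' t) (at t)" "!!t. (\<eta>' has_real_derivative \<eta>'' t) (at t)" "continuous_on UNIV \<eta>''"
  "!!t. abs t <= S ==> e t = 1 & \<eta>' t = 0 & \<eta>'' t = 0" "!!t. 2 * S < abs t ==> e t = 0"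
  using cutoff[OF S] by blast
 have all: "j = i" for j using i by (metis UNIV_I singletonD)
 have nrm: "norm y = abs (y $ i)" for y :: "real^'n" by (simp add: norm_vec_def L2_set_def i)
 define f where "f y = (s * y $ i + S) * e (s * y $ i)" for y :: "real^'n"
 have \<phi>C2: "C2_compact_support f" unfolding f_def [abs_def] by (rule affine_cutoff_C2[OF i s e(1-3,5)])
 obtain M where M: "!!y. abs (f y) <= M" using C2_compact_support_bounds(4)[OF \<phi>C2] by blast
 have \<phi>c: "continuous_on UNIV f" using \<phi>C2 by (auto simp: C2_compact_support_def intro: differentiable_imp_continuous_on)
 have \<phi>m: "f \<in> borel_measurable borel" by (rule borel_measurable_continuous_onI[OF \<phi>c])
 define E where "E = exp (2 / ell * (K + 1))"
 define r where "r n = S - (S - norm x) / 2 * inverse (real (Suc n))" for n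
 have xS: "norm x < S" using x by simp
 have r: "r n < S" "norm x < r n" for n
 proof -
  have *: "0 < inverse (real (Suc n))" "inverse (real (Suc n)) <= 1" by (auto simp: inverse_eq_divide)
  hence "0 < (S - norm x) / 2 * inverse (real (Suc n))" using xS by simp
  thus "r n < S" by (simp add: r_def)
  have "(S - norm x) / 2 * inverse (real (Suc n)) <= (S - norm x) / 2 * 1" using xS * by (intro mult_left_mono) auto
  also have "... < S - norm x" using xS by simp
  finally show "norm x < r n" unfolding r_def less_diff_eq by (simp only: add.commute)
 qed
 have \<rho>lim: "r \<longlonglongrightarrow> S"
 proof -
  have "(%n. S - (S - norm x) / 2 * inverse (real (Suc n))) \<longlonglongrightarrow> S - (S - norm x) / 2 * 0"
   by (intro tendsto_intros LIMSEQ_inverse_real_of_nat)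
  thus ?thesis by (simp add: r_def [abs_def])
 qed
 let ?Y = "%n v. X (closed_exit (cball 0 (r (Suc n))) (real (Suc n)) v) v"
 have em: "exit_point X 0 S \<in> P x \<rightarrow>\<^sub>M borel" by (rule measurable_path_algebra[OF exit_point_measurable])
 have "(%n. LINT v|P x. f (?Y n v)) \<longlonglongrightarrow> (LINT v|P x. f (exit_point X 0 S v))"
 proof (rule integral_dominated_convergence[where w="%_. M"])
  show "(%v. f (exit_point X 0 S v)) \<in> borel_measurable (P x)" by (rule measurable_compose[OF em \<phi>m])
  show "(%v. f (?Y n v)) \<in> borel_measurable (P x)" for n by (intro dynkin_closed_exit(2) \<phi>C2) auto
  show "AE v in P x. (%n. f (?Y n v)) \<longlonglongrightarrow> f (exit_point X 0 S v)"
   using AE_start[of x] exit_AE[OF x]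
  proof eventually_elim
   case (elim v)
   have "(%n. X (closed_exit (cball 0 (r n)) (real n) v) v) \<longlonglongrightarrow> exit_point X 0 S v"
    using elim x by (intro closed_exit_tendsto[OF _ _ r(1) \<rho>lim]) auto
   from LIMSEQ_Suc[OF this] show ?case using continuous_on_tendsto_compose[OF \<phi>c] by auto
  qed
  show "AE v in P x. norm (f (?Y n v)) <= M" for n using M by simp
 qed auto
 hence lim: "(%n. E * (LINT v|P x. f (?Y n v))) \<longlonglongrightarrow> E * (LINT v|P x. f (exit_point X 0 S v))" by (intro tendsto_mult tendsto_const)
 have "s * x $ i + S <= E * (LINT v|P x. f (?Y n v))" for n unfolding E_def f_def
 proof (rule closed_exit_position_lower[OF i s S K _ _ _ _ e])
  show "0 < r (Suc n)" using r(2)[of "Suc n"] norm_ge_zero[of x] by linarith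
 qed (use r[of "Suc n"] in auto)
 hence "s * x $ i + S <= E * (LINT v|P x. f (exit_point X 0 S v))" by (intro LIMSEQ_le_const[OF lim]) auto
 also have "(LINT v|P x. f (exit_point X 0 S v)) = (LINT v|P x. indicator {-S..S} (exit_point X 0 S v $ i) * (s * exit_point X 0 S v $ i + S))"
 proof (rule integral_cong_AE)
  show "(%v. f (exit_point X 0 S v)) \<in> borel_measurable (P x)" by (rule measurable_compose[OF em \<phi>m])
  have im: "(%v. exit_point X 0 S v $ i) \<in> borel_measurable (P x)"
   by (rule measurable_compose[OF em borel_measurable_continuous_onI]) (intro continuous_intros)
  show "(%v. indicator {-S..S} (exit_point X 0 S v $ i) * (s * exit_point X 0 S v $ i + S)) \<in> borel_measurable (P x)"
   by (intro borel_measurable_times borel_measurable_add measurable_compose[OF im borel_measurable_indicator] im borel_measurable_const) auto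
  show "AE v in P x. f (exit_point X 0 S v) = indicator {-S..S} (exit_point X 0 S v $ i) * (s * exit_point X 0 S v $ i + S)"
   using exit_AE[OF x]
  proof eventually_elim
   case (elim v)
   hence "abs (exit_point X 0 S v $ i) = S" using nrm by simp
   moreover from this have "abs (s * exit_point X 0 S v $ i) <= S" using s by auto
   ultimately show ?case using e(4) by (auto simp: f_def indicator_def)
  qed
 qed
 finally show ?thesis by (simp only: E_def)
qed

text \<open>With \<open>S = 3/2 R\<close> the weight \<open>s q + S\<close> is \<open>2 S\<close> at
  the endpoint \<open>p\<close> and 0 at the other one, while it is at least \<open>R / 2\<close> at
  \<open>y\<close>. The process started at \<open>y\<close> therefore leaves through
  \<open>p\<close> with probability at least \<open>1 / (6 E)\<close>, whence
  \<open>u p <= 6 E u y\<close> for both endpoints, and \<open>u x\<close> is at most the larger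
  endpoint value.\<close>

lemma harnack_one_dim:
 assumes d: "CARD('n) = 1" and K: "(LINT x|lborel. norm (b x) ^ CARD('n)) <= K"
  and R: "0 < R" and u: "harmonic_on X P D u" and D: "D \<in> sets borel" "ball 0 (2 * R) <= D" and u0: "!!y. y \<in> D ==> 0 <= u y"
  and x: "x \<in> ball 0 R" and y: "y \<in> ball 0 R"
 shows "u x <= 6 * exp (2 / ell * (K + 1)) * u y"
proof -
 obtain i where i: "(UNIV :: 'n set) = {i}" using d by (meson card_1_singletonE)
 have all: "j = i" for j using i by (metis UNIV_I singletonD)
 have nrm: "norm y = abs (y $ i)" for y :: "real^'n" by (simp add: norm_vec_def L2_set_def i)
 define E where "E = exp (2 / ell * (K + 1))"
 have E: "0 < E" by (simp add: E_def)
 define S where "S = 3 / 2 * R"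
 have S: "0 < S" using R by (simp add: S_def)
 have "cball 0 S <= ball 0 (2 * R)" using R by (auto simp: S_def)
 hence cb: "cball 0 S <= D" "x \<in> ball 0 S" "y \<in> ball 0 S" using D(2) R x y by (auto simp: S_def)
 note h = harmonic_mean[OF u D(1) cb(1) S cb(3)]
 have lower: "u p <= 6 * E * u y" if p: "p \<in> sphere 0 S" for p
 proof -
  obtain s where s: "s = 1 \<or> s = -1" "p $ i = s * S"
  proof -
   have "abs (p $ i) = S" using p nrm[of p] by simp
   hence "p $ i = 1 * S \<or> p $ i = -1 * S" by linarith
   thus ?thesis using that by blast
  qed
  let ?Z = "%w. indicator {-S..S} (exit_point X 0 S w $ i) * (s * exit_point X 0 S w $ i + S)"
  have "- R <= s * y $ i" using s(1) y nrm[of y] by auto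
  hence "R / 2 <= s * y $ i + S" by (simp add: S_def)
  also have "... <= E * (LINT w|P y. ?Z w)" unfolding E_def by (rule exit_position_lower[OF i s(1) S K cb(3)])
  finally have "R / 2 * u p <= (E * (LINT w|P y. ?Z w)) * u p" using u0[of p] p cb(1) by (intro mult_right_mono) auto
  also have "... = E * (LINT w|P y. u p * ?Z w)" by simp
  also have "(LINT w|P y. u p * ?Z w) <= (LINT w|P y. 2 * S * (indicator D (exit_point X 0 S w) * u (exit_point X 0 S w)))"
  proof (rule integral_mono_AE)
   have em: "exit_point X 0 S \<in> P y \<rightarrow>\<^sub>M borel" by (rule measurable_path_algebra[OF exit_point_measurable])
   have im: "(%w. exit_point X 0 S w $ i) \<in> borel_measurable (P y)"
    by (rule measurable_compose[OF em borel_measurable_continuous_onI]) (intro continuous_intros)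
   have Zm: "?Z \<in> borel_measurable (P y)"
    by (intro borel_measurable_times borel_measurable_add measurable_compose[OF im borel_measurable_indicator] im borel_measurable_const) auto
   have "abs (?Z w) <= 2 * S" for w using s(1) S by (auto simp: indicator_def abs_le_iff)
   thus "integrable (P y) (%w. u p * ?Z w)"
    using Zm by (intro integrable_mult_right Px.integrable_const_bound[where B="2 * S"]) auto
   show "integrable (P y) (%w. 2 * S * (indicator D (exit_point X 0 S w) * u (exit_point X 0 S w)))"
    using h(2) by (rule integrable_mult_right)
   show "AE w in P y. u p * ?Z w <= 2 * S * (indicator D (exit_point X 0 S w) * u (exit_point X 0 S w))"
    using exit_AE[OF cb(3)]
   proof eventually_elim
    case (elim w)
    define q where "q = exit_point X 0 S w"
    have q: "q \<in> sphere 0 S" using elim by (simp add: q_def)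
    hence qD: "q \<in> D" using cb(1) by auto
    have "q $ i = S \<or> q $ i = - S" using q nrm[of q] by auto
    then consider "q $ i = p $ i" | "s * q $ i = - S" using s by auto
    thus ?case
    proof cases
     case 1
     have "q $ j = p $ j" for j unfolding all[of j] by (rule 1)
     hence qp: "q = p" unfolding vec_eq_iff by blast
     have "s * p $ i = S" "p $ i \<in> {-S..S}" using s S by auto
     thus ?thesis using qD unfolding q_def[symmetric] qp by (simp add: mult.commute)
    next
     case 2
     thus ?thesis unfolding q_def[symmetric] using u0[OF qD] S by simp
    qed
   qed
  qed
  also have "... = 2 * S * u y" using h(1) by simp
  finally have "R / 2 * u p <= E * (2 * S * u y)" using E by simp
  also have "... = R / 2 * (6 * E * u y)" by (simp add: S_def)
  finally show ?thesis using R by simp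
 qed
 show ?thesis unfolding E_def[symmetric] by (rule harmonic_le(1)[OF u D(1) cb(1) S cb(2) lower])
qed

end

section \<open>Existence of a Harnack constant\<close>

lemma centered_ball_ereal: "centered_ball (ereal R) = ball 0 R" "centered_ball \<infinity> = UNIV"
 by (auto simp: centered_ball_def)

text \<open>\<open>?good\<close> is the inequality for finite radii and Borel domains, with
  \<open>N\<close> fixed before all coefficients and processes. An infinite radius is reduced to a
  finite one because only two points are compared at a time.\<close>

lemma harnack_constant_exists:
 assumes ell: "0 < ell" and K: "0 < K"
 shows "EX N. harnack_constant TYPE('w) TYPE('n::finite) ell K N"
proof -
 let ?d = "CARD('n)"
 let ?good = "%N. ALL (a :: real^'n => real^'n^'n) b (X :: real => 'w => real^'n) F P (R :: real) D u x y.
  Ld_quasi_diffusion X F P a b ell & (LINT x|lborel. norm (b x) ^ ?d) <= K ^ ?d & 0 < R & harmonic_on X P D u & D \<in> sets borel &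
  ball 0 (2 * R) <= D & (ALL y:D. 0 <= u y) & x \<in> ball 0 R & y \<in> ball 0 R --> u x <= N * u y"
 have "EX N. ?good N"
 proof (cases "?d = 1")
  case True
  hence "?good (6 * exp (2 / ell * (K ^ ?d + 1)))"
   by (intro allI impI, elim conjE) (rule Ld_quasi_diffusion.harnack_one_dim, auto)
  thus ?thesis by blast
 next
  case False
  hence d2: "2 <= ?d" using zero_less_card_finite by (metis One_nat_def Suc_leI le_neq_implies_less one_add_one plus_1_eq_Suc)
  define l where "l = harnack_angle ?d"
  have "0 < growth_const ?d ell l"
   using occ_constants_pos(2)[OF ell, of ?d] occ_constants_pos(3)[OF ell, of ?d l] by (simp add: growth_const_def add_pos_pos)
  moreover have "0 < vol_tol ?d ell l" using occ_constants_pos(5)[OF ell, of ?d l] by simp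
  ultimately obtain C where C: "0 < C" "!!(u :: real^'n => real) D z r x y. growth_property (growth_const ?d ell l) (vol_tol ?d ell l) (harnack_angle ?d) D u ==>
   0 < r ==> cball z (36 * sqrt ?d * r) <= D ==> u \<in> borel_measurable borel ==> (!!y. y \<in> D ==> 0 <= u y) ==>
   bdd_above (range u) ==> x \<in> cball z r ==> y \<in> cball z r ==> u x <= C * u y"
   using harnack_of_growth by metis
  define T where "T = drift_tol ?d ell l"
  have T: "0 < T ^ ?d" using occ_constants_pos(4)[OF ell, of ?d l] by (simp add: T_def)
  \<comment> \<open>The number of subshells: \<open>m\<close> times the tolerance
    \<open>T ^ ?d\<close> must reach the total drift \<open>K ^ ?d\<close>.\<close>
  obtain m0 :: nat where m0: "K ^ ?d / T ^ ?d < real m0" using reals_Archimedean2 by blast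
  define m where "m = Suc m0"
  have m: "0 < m" "K ^ ?d <= real m * T ^ ?d" using m0 T by (auto simp: m_def field_simps)
  obtain k0 :: nat where k0: "288 * pi * sqrt ?d * real m < real k0" using reals_Archimedean2 by blast
  define k where "k = Suc k0"
  have k: "0 < k" "288 * pi * sqrt ?d * real m <= real k" using k0 by (auto simp: k_def)
  have "?good (C ^ (2 * k))"
  proof (intro allI impI, elim conjE)
   fix a :: "real^'n => real^'n^'n" and b and X :: "real => 'w => real^'n" and F P and R :: real and D u and x y :: "real^'n"
   assume Q: "Ld_quasi_diffusion X F P a b ell" and I: "(LINT x|lborel. norm (b x) ^ ?d) <= K ^ ?d"
    and h: "0 < R" "harmonic_on X P D u" "D \<in> sets borel" "ball 0 (2 * R) <= D" "ALL y:D. 0 <= u y" "x \<in> ball 0 R" "y \<in> ball 0 R"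
   interpret Ld_quasi_diffusion X F P a b ell by (rule Q)
   show "u x <= C ^ (2 * k) * u y"
   proof (rule harnack_ball_of_local[OF d2 C(1) _ m(1) _ k h(1-4) _ h(6,7)])
    show "(LINT x|lborel. norm (b x) ^ ?d) <= real m * drift_tol ?d ell (harnack_angle ?d) ^ ?d"
     using I m(2) by (simp add: T_def l_def)
    show "!!y. y \<in> D ==> 0 <= u y" using h(5) by blast
   qed (rule C(2)[unfolded l_def])
  qed
  thus ?thesis by blast
 qed
 then obtain N where N: "?good N" by blast
 have "harnack_constant TYPE('w) TYPE('n) ell K N" unfolding harnack_constant_def
 proof (intro allI impI ballI, elim conjE)
  fix a :: "real^'n => real^'n^'n" and b and X :: "real => 'w => real^'n" and F P and R :: ereal and u and x y :: "real^'n"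
  assume a: "a \<in> borel_measurable borel" "range a <= ellipticity_class ell" and b: "b \<in> borel_measurable borel" "Ld_norm_le b K"
   and Q: "quasi_diffusion X F P a b" and R: "0 < R" and u: "harmonic_on X P (centered_ball (2 * R)) u"
   and u0: "ALL x:centered_ball (2 * R). 0 <= u x" and x: "x \<in> centered_ball R" and y: "y \<in> centered_ball R"
  interpret quasi_diffusion X F P a b by (rule Q)
  have bi: "integrable lborel (%x. norm (b x) ^ ?d)" and bK: "root ?d (LINT x|lborel. norm (b x) ^ ?d) <= K"
   using b(2) by (simp_all add: Ld_norm_le_def)
  interpret Ld_quasi_diffusion X F P a b ell by unfold_locales (use ell a b bi in auto)
  have I0: "0 <= (LINT x|lborel. norm (b x) ^ ?d)" by (intro integral_nonneg_AE AE_I2) simp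
  have "(root ?d (LINT x|lborel. norm (b x) ^ ?d)) ^ ?d <= K ^ ?d" using bK I0 by (intro power_mono) auto
  hence I: "(LINT x|lborel. norm (b x) ^ ?d) <= K ^ ?d" using I0 by (simp add: real_root_pow_pos2)
  obtain R' :: real where R': "0 < R'" "x \<in> ball 0 R'" "y \<in> ball 0 R'" "ball 0 (2 * R') <= (centered_ball (2 * R) :: (real^'n) set)"
   and Dm: "(centered_ball (2 * R) :: (real^'n) set) \<in> sets borel"
  proof (cases R)
   case (real r)
   have "(2 :: ereal) * ereal r = ereal (2 * r)" by (metis numeral_eq_ereal times_ereal.simps(1))
   thus ?thesis using that[of r] x y R real by (simp add: centered_ball_ereal)
  next
   case PInf
   thus ?thesis using that[of "max (norm x) (norm y) + 1"] by (simp add: centered_ball_ereal add_nonneg_pos le_max_iff_disj)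
  qed (use R in simp)
  have "Ld_quasi_diffusion X F P a b ell" by unfold_locales
  thus "u x <= N * u y" using N[rule_format, of X F P a b R' "centered_ball (2 * R)" u x y] I u u0 R' Dm by blast
 qed
 thus ?thesis by blast
qed

section \<open>Transfer to path space\<close>

text \<open>Continuity is required at times \<open>>= 0\<close> only and values at negative times
  are arbitrary, so that shifted paths stay in the space.\<close>

definition path_space :: "(real => 'e::topological_space) set" where
 "path_space = {w. continuous_on {0..} w}"

definition coord :: "real => (real => 'e) => 'e" where [simp]: "coord t w = w t"

text \<open>The final sigma-algebra makes every set with a measurable preimage measurable, so that null sets and
conditional expectations are inherited in the passage to path space.\<close>

definition final_algebra :: "'w set => ('w => real => 'e::topological_space) => 'w measure => (real => 'e) measure" where
 "final_algebra S H M = sigma path_space {A. A <= path_space & H -` A Int S \<in> sets M}"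

lemma space_final_algebra [simp]: "space (final_algebra S H M) = path_space"
 by (simp add: final_algebra_def space_measure_of_conv)

lemma sets_final_algebra:
 assumes M: "space M = S" and H: "H \<in> S \<rightarrow> path_space"
 shows "sets (final_algebra S H M) = {A. A <= path_space & H -` A Int S \<in> sets M}"
proof -
 let ?\<A> = "{A. A <= path_space & H -` A Int S \<in> sets M}"
 have "sigma_algebra path_space ?\<A>" unfolding sigma_algebra_iff2
 proof (intro conjI ballI allI impI)
  fix A assume "A \<in> ?\<A>"
  hence "S - (H -` A Int S) \<in> sets M" using sets.compl_sets[of "H -` A Int S" M] M by auto
  also have "S - (H -` A Int S) = H -` (path_space - A) Int S" using H by auto
  finally show "path_space - A \<in> ?\<A>" by simp
 next
  fix A :: "nat => _" assume A: "range A <= ?\<A>"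
  hence "(\<Union>n. H -` A n Int S) \<in> sets M" by (intro sets.countable_UN) auto
  also have "(\<Union>n. H -` A n Int S) = H -` (\<Union>n. A n) Int S" by auto
  finally show "(\<Union>n. A n) \<in> ?\<A>" using A by auto
 qed auto
 thus ?thesis unfolding final_algebra_def by (subst sets_measure_of) (auto simp: sigma_algebra.sigma_sets_eq)
qed

context elliptic_quasi_diffusion
begin

text \<open>Freezing the path at negative times makes it depend only on the coordinates that
  matter.\<close>

definition path_of :: "'w => real => real^'n" where
 "path_of w t = X (max 0 t) w"

definition path_F :: "real => (real => real^'n) measure" where
 "path_F t = final_algebra Om path_of (F t)"

definition path_P :: "real^'n => (real => real^'n) measure" where
 "path_P x = distr (P x) (final_algebra Om path_of (P 0)) path_of"

lemma path_of_in: "path_of \<in> Om \<rightarrow> path_space" unfolding path_space_def path_of_def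
 by (auto intro!: continuous_on_compose2[OF continuous_path] continuous_intros)

lemma sets_path_P: "sets (path_P x) = {A. A <= path_space & path_of -` A Int Om \<in> sets (P x)}"
 unfolding path_P_def using sets_final_algebra[OF _ path_of_in, of "P 0"] sets_P[of x 0] by simp

lemma space_path_P [simp]: "space (path_P x) = path_space" by (simp add: path_P_def)

lemma space_path_F [simp]: "space (path_F t) = path_space" by (simp add: path_F_def)

lemma sets_path_F: "0 <= t ==> sets (path_F t) = {A. A <= path_space & path_of -` A Int Om \<in> sets (F t)}"
 unfolding path_F_def by (rule sets_final_algebra[OF space_F path_of_in])

lemma path_of_measurable: "path_of \<in> P x \<rightarrow>\<^sub>M final_algebra Om path_of (P 0)"
 using path_of_in sets_final_algebra[OF _ path_of_in, of "P 0"] sets_P[of x 0] by (intro measurableI) auto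

text \<open>Immediate from the final sigma-algebra; it reduces measurability on path space to
  measurability on the original sample space.\<close>

lemma final_measurable:
 fixes f :: "_ => 'b::topological_space"
 assumes "(%w. f (path_of w)) \<in> borel_measurable (P x)"
 shows "f \<in> borel_measurable (final_algebra Om path_of (P 0))"
proof (rule measurableI)
 fix A :: "'b set" assume "A \<in> sets borel"
 hence "path_of -` (f -` A Int path_space) Int Om \<in> sets (P 0)"
 proof -
  have "path_of -` (f -` A Int path_space) Int Om = (%w. f (path_of w)) -` A Int space (P x)" using path_of_in by auto
  thus ?thesis using measurable_sets[OF assms \<open>A \<in> sets borel\<close>] sets_P[of x 0] by simp
 qed
 thus "f -` A Int space (final_algebra Om path_of (P 0)) \<in> sets (final_algebra Om path_of (P 0))"
  using sets_final_algebra[OF _ path_of_in, of "P 0"] by simp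
qed auto

lemma integral_path_P:
 fixes f :: "_ => real"
 assumes "(%v. f (path_of v)) \<in> borel_measurable (P x)"
 shows "(LINT w|path_P x. f w) = (LINT v|P x. f (path_of v))"
 unfolding path_P_def by (rule integral_distr[OF path_of_measurable final_measurable[OF assms]])

lemma nn_integral_path_P:
 assumes "(%v. f (path_of v)) \<in> borel_measurable (P x)"
 shows "(\<integral>\<^sup>+w. f w \<partial>path_P x) = (\<integral>\<^sup>+v. f (path_of v) \<partial>P x)"
 unfolding path_P_def using final_measurable[OF assms] by (intro nn_integral_distr[OF path_of_measurable]) simp

lemma measure_path_P:
 assumes "path_of -` A Int Om \<in> sets (P x)" "A <= path_space"
 shows "measure (path_P x) A = measure (P x) (path_of -` A Int Om)"
proof -
 have "A \<in> sets (final_algebra Om path_of (P 0))" using assms sets_path_P[of x] by (simp add: path_P_def)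
 from measure_distr[OF path_of_measurable this, of x] show ?thesis by (simp add: path_P_def)
qed

lemma marginal_path_P:
 assumes "0 <= t" "G \<in> sets borel"
 shows "measure (path_P x) {w \<in> path_space. w t \<in> G} = measure (P x) {v \<in> Om. X t v \<in> G}"
proof -
 have eq: "path_of -` {w \<in> path_space. w t \<in> G} Int Om = X t -` G Int space (P x)"
  using path_of_in assms by (auto simp: path_of_def)
 have "path_of -` {w \<in> path_space. w t \<in> G} Int Om \<in> sets (P x)"
  unfolding eq by (rule measurable_sets[OF X_measurable[OF assms(1)] assms(2)])
 from measure_path_P[OF this] have "measure (path_P x) {w \<in> path_space. w t \<in> G} = measure (P x) (X t -` G Int space (P x))"
  unfolding eq by auto
 also have "X t -` G Int space (P x) = {v \<in> Om. X t v \<in> G}" by auto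
 finally show ?thesis .
qed

lemma path_time_integrand:
 assumes f: "f \<in> borel_measurable borel"
 shows "(%p. f (pos p)) \<in> borel_measurable (P x \<Otimes>\<^sub>M lborel)"
 using measurable_compose[OF space_time_X f] by (simp add: space_time_def)

lemma subalgebra_path: "0 <= t ==> subalgebra (path_P x) (path_F t)"
 unfolding subalgebra_def using sets_F[of t x] by (auto simp: sets_path_P sets_path_F)

text \<open>Everything is pulled back along \<open>path_of\<close>. For the Markov property the
  candidate \<open>q (w t)\<close> is tested on the events of \<open>path_F t\<close>, whose
  preimages lie in \<open>F t\<close>. The shift condition holds because path space contains all
  shifts of its elements.\<close>

lemma path_continuous_markov: "continuous_markov_process coord path_F path_P"
proof (rule continuous_markov_process.intro)
 show pr: "prob_space (path_P x)" for x
  unfolding path_P_def by (rule prob_space.prob_space_distr[OF prob_space_P path_of_measurable])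
 show "sets (path_P x) = sets (path_P y)" for x y by (simp add: path_P_def)
 show "subalgebra (path_P x) (path_F t)" if "0 <= t" for x t by (rule subalgebra_path[OF that])
 show "sets (path_F s) <= sets (path_F t)" if "0 <= s" "s <= t" for s t
  using F_mono[OF that] that by (auto simp: sets_path_F)
 show ad: "coord t \<in> path_F t \<rightarrow>\<^sub>M borel" if t: "0 <= t" for t
 proof (rule measurableI)
  fix G :: "(real^'n) set" assume G: "G \<in> sets borel"
  have "path_of -` (coord t -` G Int path_space) Int Om = X t -` G Int space (F t)"
   using path_of_in t by (auto simp: path_of_def space_F)
  thus "coord t -` G Int space (path_F t) \<in> sets (path_F t)"
   using measurable_sets[OF adapted[OF t] G] t by (simp add: sets_path_F)
 qed simp
 show "(%x. measure (path_P x) {w \<in> space (path_P x). coord t w \<in> G}) \<in> borel_measurable borel" if "0 <= t" "G \<in> sets borel" for t G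
  using transition_measurable[OF that] by (simp add: marginal_path_P that)
 show "measure (path_P x) {w \<in> space (path_P x). coord 0 w = x} = 1" for x
  using start[of x] marginal_path_P[of 0 "{x}" x] by simp
 show "AE w in path_P x. real_cond_exp (path_P x) (path_F t) (indicator {w' \<in> space (path_P x). coord (t + s) w' \<in> G}) w
   = measure (path_P (coord t w)) {w' \<in> space (path_P (coord t w)). coord s w' \<in> G}"
  if s: "0 <= s" and t: "0 <= t" and G: "G \<in> sets borel" for s t G x
 proof -
  interpret PP: prob_space "path_P x" by (rule pr)
  interpret fin: finite_measure_subalgebra "path_P x" "path_F t" by unfold_locales (rule subalgebra_path[OF t])
  interpret fin': finite_measure_subalgebra "P x" "F t" by unfold_locales (rule subalgebra_F[OF t])
  define q where "q y = measure (P y) {v \<in> Om. X s v \<in> G}" for y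
  have qm: "q \<in> borel_measurable borel" unfolding q_def using transition_measurable[OF s G] by simp
  have q01: "0 <= q y" "q y <= 1" for y
  proof -
   show "0 <= q y" "q y <= 1" by (simp_all add: q_def)
  qed
  let ?B = "{w' \<in> path_space. w' (t + s) \<in> G}" and ?B' = "{v \<in> Om. X (t + s) v \<in> G}"
  have B'm: "?B' \<in> sets (P x)" using measurable_sets[OF X_measurable G, of "t + s" x] s t by (auto simp: vimage_def Int_def conj_commute)
  have Bind: "(indicator ?B (path_of v) :: real) = indicator ?B' v" if "v \<in> Om" for v
   using that path_of_in s t by (auto simp: indicator_def path_of_def)
  have wm: "coord t \<in> path_F t \<rightarrow>\<^sub>M borel" by (rule ad[OF t])
  have wm': "coord t \<in> path_P x \<rightarrow>\<^sub>M borel" by (rule measurable_from_subalg[OF subalgebra_path[OF t] wm])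
  have Bm: "?B \<in> sets (path_P x)"
  proof -
   have "coord (t + s) \<in> path_P x \<rightarrow>\<^sub>M borel" using s t by (intro measurable_from_subalg[OF subalgebra_path ad]) auto
   from measurable_sets[OF this G] show ?thesis by (simp add: vimage_def Int_def conj_commute)
  qed
  have "AE w in path_P x. real_cond_exp (path_P x) (path_F t) (indicator ?B) w = q (w t)"
  proof (rule fin.real_cond_exp_charact)
   show "integrable (path_P x) (indicator ?B :: _ => real)" using Bm by (intro PP.integrable_const_bound[where B=1]) auto
   show "integrable (path_P x) (%w. q (w t))"
    using q01 measurable_compose[OF wm' qm] by (intro PP.integrable_const_bound[where B=1]) auto
   show "(%w. q (w t)) \<in> borel_measurable (path_F t)" using measurable_compose[OF wm qm] by simp
   fix A assume A: "A \<in> sets (path_F t)"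
   define A' where "A' = path_of -` A Int Om"
   have A': "A' \<in> sets (F t)" "A' \<in> sets (P x)" using A sets_path_F[OF t] sets_F[OF t] by (auto simp: A'_def)
   have Aind: "(indicator A (path_of v) :: real) = indicator A' v" if "v \<in> Om" for v
    using that by (auto simp: A'_def indicator_def)
   have "(%v. indicator A (path_of v) *\<^sub>R indicator ?B (path_of v) :: real) \<in> borel_measurable (P x)"
    by (subst measurable_cong[where g="%v. indicator A' v * indicator ?B' v"]) (use A' B'm in \<open>auto simp: Aind Bind\<close>)
   from integral_path_P[OF this] have "(LINT w:A|path_P x. (indicator ?B w :: real)) = (LINT v|P x. indicator A (path_of v) *\<^sub>R indicator ?B (path_of v))"
    by (simp add: set_lebesgue_integral_def)
   also have "... = (LINT v:A'|P x. indicator ?B' v)"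
    unfolding set_lebesgue_integral_def by (intro Bochner_Integration.integral_cong) (auto simp: Aind Bind)
   also have "... = (LINT v:A'|P x. real_cond_exp (P x) (F t) (indicator ?B') v)"
    using B'm by (intro fin'.real_cond_exp_intA A' Px.integrable_const_bound[where B=1]) auto
   also have "... = (LINT v:A'|P x. q (X t v))" unfolding set_lebesgue_integral_def
   proof (rule integral_cong_AE)
    show "AE v in P x. indicator A' v *\<^sub>R real_cond_exp (P x) (F t) (indicator ?B') v = indicator A' v *\<^sub>R q (X t v)"
     using markov[OF s t G, of x] by eventually_elim (simp add: q_def)
    show "(%v. indicator A' v *\<^sub>R q (X t v)) \<in> borel_measurable (P x)"
     using measurable_compose[OF X_measurable[OF t] qm] A' by (intro borel_measurable_scaleR borel_measurable_indicator) auto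
   qed (use A' in measurable)
   also have "... = (LINT v|P x. indicator A (path_of v) *\<^sub>R q (path_of v t))"
    unfolding set_lebesgue_integral_def using t by (intro Bochner_Integration.integral_cong) (auto simp: Aind path_of_def)
   also have "... = (LINT w:A|path_P x. q (w t))"
   proof -
    have "(%v. indicator A (path_of v) *\<^sub>R q (path_of v t)) \<in> borel_measurable (P x)"
     by (subst measurable_cong[where g="%v. indicator A' v * q (X t v)"])
      (use A' t measurable_compose[OF X_measurable[OF t] qm] in \<open>auto simp: Aind path_of_def intro!: borel_measurable_times\<close>)
    from integral_path_P[OF this] show ?thesis by (simp add: set_lebesgue_integral_def)
   qed
   finally show "(LINT w:A|path_P x. indicator ?B w) = (LINT w:A|path_P x. q (w t))" .
  qed
  thus ?thesis by (simp add: q_def marginal_path_P[OF s G])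
 qed
 show "EX w':space (path_P x). ALL s>=0. coord s w' = coord (t + s) w" if "0 <= t" "w \<in> space (path_P x)" for t w x
 proof (rule bexI[of _ "%s. w (t + s)"])
  show "(%s. w (t + s)) \<in> space (path_P x)" using that
   by (auto simp: path_space_def intro!: continuous_on_compose2[of "{0..}" w] continuous_intros)
 qed simp
 show "continuous_on {0..} (%t. coord t w)" if "w \<in> space (path_P x)" for w x using that by (simp add: path_space_def)
qed

lemma path_quasi_diffusion: "quasi_diffusion coord path_F path_P a b"
proof (intro quasi_diffusion.intro path_continuous_markov quasi_diffusion_axioms.intro)
  fix t :: real and x assume t: "0 <= t"
  interpret pair_sigma_finite "P x" "lborel :: real measure" by (rule pair_sigma_finite_P)
  have "(%y. ennreal (norm (b y))) \<in> borel_measurable borel" by measurable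
  from path_time_integrand[OF this]
  have m: "(%p. ennreal (norm (b (pos p))) * indicator {0..t} (snd p)) \<in> borel_measurable (P x \<Otimes>\<^sub>M lborel)"
   by (intro borel_measurable_times_ennreal measurable_compose[OF measurable_snd borel_measurable_indicator]) auto
  have eq: "(\<integral>\<^sup>+s\<in>{0..t}. ennreal (norm (b (path_of v s))) \<partial>lborel) = (\<integral>\<^sup>+s. ennreal (norm (b (X (max 0 (snd (v, s))) (fst (v, s))))) * indicator {0..t} (snd (v, s)) \<partial>lborel)" for v
   by (simp add: path_of_def)
  have "(%v. \<integral>\<^sup>+s\<in>{0..t}. ennreal (norm (b (path_of v s))) \<partial>lborel) \<in> borel_measurable (P x)"
   unfolding eq by (rule lborel.borel_measurable_nn_integral_fst[OF m])
  from nn_integral_path_P[OF this]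
  have "(\<integral>\<^sup>+w. (\<integral>\<^sup>+s\<in>{0..t}. ennreal (norm (b (w s))) \<partial>lborel) \<partial>path_P x) = (\<integral>\<^sup>+v. (\<integral>\<^sup>+s\<in>{0..t}. ennreal (norm (b (path_of v s))) \<partial>lborel) \<partial>P x)" .
  also have "... = (\<integral>\<^sup>+v. (\<integral>\<^sup>+s\<in>{0..t}. ennreal (norm (b (X s v))) \<partial>lborel) \<partial>P x)"
   by (intro nn_integral_cong) (auto simp: path_of_def indicator_def max_absorb2)
  also have "... < \<infinity>" by (rule drift_integrable[OF t])
  finally show "(\<integral>\<^sup>+w. (\<integral>\<^sup>+s\<in>{0..t}. ennreal (norm (b (coord s w))) \<partial>lborel) \<partial>path_P x) < \<infinity>" by simp
 next
  fix u :: "real^'n => real" and t :: real and x assume u: "C2_compact_support u" and t: "0 <= t"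
  interpret pair_sigma_finite "P x" "lborel :: real measure" by (rule pair_sigma_finite_P)
  have um: "u \<in> borel_measurable borel" by (rule borel_measurable_continuous_onI[OF C2_compact_support_bounds(1)[OF u]])
  have "(%v. u (path_of v t)) \<in> borel_measurable (P x)"
   using measurable_compose[OF X_measurable[OF t] um] t by (simp add: path_of_def)
  from integral_path_P[OF this] have 1: "(LINT w|path_P x. u (w t)) = (LINT v|P x. u (X t v))" using t by (simp add: path_of_def)
  have m: "(%p. indicator {0..t} (snd p) * L u (pos p)) \<in> borel_measurable (P x \<Otimes>\<^sub>M lborel)"
   by (intro borel_measurable_times path_time_integrand[OF L_measurable[OF u]]) measurable
  have eq: "(LINT s:{0..t}|lborel. L u (path_of v s)) = (LINT s|lborel. indicator {0..t} (snd (v, s)) * L u (X (max 0 (snd (v, s))) (fst (v, s))))" for v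
   by (simp add: path_of_def set_lebesgue_integral_def)
  have "(%v. LINT s:{0..t}|lborel. L u (path_of v s)) \<in> borel_measurable (P x)"
   unfolding eq using lborel.borel_measurable_lebesgue_integral[of "%v s. indicator {0..t} s * L u (X (max 0 s) v)" "P x"] m by (simp add: case_prod_beta')
  from integral_path_P[OF this] have "(LINT w|path_P x. (LINT s:{0..t}|lborel. L u (w s))) = (LINT v|P x. (LINT s:{0..t}|lborel. L u (path_of v s)))" .
  also have "... = (LINT v|P x. (LINT s:{0..t}|lborel. L u (X s v)))"
   unfolding set_lebesgue_integral_def by (intro Bochner_Integration.integral_cong) (auto simp: path_of_def indicator_def max_absorb2)
  finally show "u x = (LINT w|path_P x. u (coord t w)) - (LINT w|path_P x. (LINT s:{0..t}|lborel. L u (coord s w)))"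
   using generator[OF u t, of x] 1 by simp
qed

text \<open>Exit time and exit point depend on the trajectory at nonnegative times alone, so
  \<open>path_of\<close> preserves them.\<close>

lemma path_harmonic:
 assumes u: "harmonic_on X P D u" and D: "D \<in> sets borel"
 shows "harmonic_on coord path_P D u" unfolding harmonic_on_def
proof (intro conjI allI impI, use u in \<open>simp add: harmonic_on_def\<close>, use u in \<open>simp add: harmonic_on_def\<close>, elim conjE)
 fix y r x assume r: "0 < r" and cb: "cball y r <= D" and x: "x \<in> ball y r"
 have et: "exit_time coord y r (path_of v) = exit_time X y r v" for v
 proof -
  have "{ereal t |t. 0 <= t & path_of v t ~: ball y r} = {ereal t |t. 0 <= t & X t v ~: ball y r}" by (auto simp: path_of_def max_absorb2)
  thus ?thesis unfolding exit_time_def by simp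
 qed
 have ep: "exit_point coord y r (path_of v) = exit_point X y r v" for v
  unfolding exit_point_def et using exit_time_nonneg[of y r v] by (simp add: path_of_def real_of_ereal_pos)
 let ?I = "%w. indicator {w \<in> path_space. exit_time coord y r w < \<infinity> & exit_point coord y r w \<in> D} w *\<^sub>R u (exit_point coord y r w)"
 have I: "?I (path_of v) = indicator (exits y r) v * (indicator D (exit_point X y r v) * u (exit_point X y r v))" if "v \<in> Om" for v
  using that path_of_in by (auto simp: indicator_def et ep exits_iff Pi_iff)
 have "(%v. ?I (path_of v)) \<in> borel_measurable (P x)"
  by (subst measurable_cong[OF I]) (auto intro!: borel_measurable_times borel_measurable_indicator exits_P
   measurable_compose[OF measurable_path_algebra[OF exit_point_measurable] harmonic_extension(1)[OF u D]])
 from integral_path_P[OF this] have "(LINT w|path_P x. ?I w) = (LINT v|P x. ?I (path_of v))" .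
 also have "... = (LINT v:{v \<in> space (P x). exit_time X y r v < \<infinity> & exit_point X y r v \<in> D}|P x. u (exit_point X y r v))"
  unfolding set_lebesgue_integral_def
  by (intro Bochner_Integration.integral_cong refl) (simp only: space_P I, auto simp: exits_iff indicator_def)
 also have "... = u x" using u r cb x by (auto simp: harmonic_on_def)
 finally show "u x = (LINT w:{w \<in> space (path_P x). exit_time coord y r w < \<infinity> & exit_point coord y r w \<in> D}|path_P x. u (exit_point coord y r w))"
  by (simp add: set_lebesgue_integral_def)
qed

end

theorem harnack_constant_transfer:
 assumes ell: "0 < ell" and N: "harnack_constant TYPE(real => real^'n) TYPE('n::finite) ell K N"
 shows "harnack_constant TYPE('w) TYPE('n) ell K N" unfolding harnack_constant_def
proof (intro allI impI, elim conjE)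
 fix a :: "real^'n => real^'n^'n" and b and X :: "real => 'w => real^'n" and F P and R :: ereal and u
 assume a: "a \<in> borel_measurable borel" "range a <= ellipticity_class ell" and b: "b \<in> borel_measurable borel" "Ld_norm_le b K"
  and Q: "quasi_diffusion X F P a b" and R: "0 < R" and u: "harmonic_on X P (centered_ball (2 * R)) u"
  and u0: "ALL x:centered_ball (2 * R). 0 <= u x"
 interpret quasi_diffusion X F P a b by (rule Q)
 interpret elliptic_quasi_diffusion X F P a b ell by unfold_locales (use ell a b in auto)
 have "open (centered_ball r :: (real^'n) set)" for r
  unfolding centered_ball_def by (intro open_Collect_less continuous_intros)
 hence D: "(centered_ball (2 * R) :: (real^'n) set) \<in> sets borel" by simp
 show "ALL x:centered_ball R. ALL y:centered_ball R. u x <= N * u y"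
  using N[unfolded harnack_constant_def, rule_format, of a b coord path_F path_P R u]
   a b path_quasi_diffusion path_harmonic[OF u D] R u0 by blast
qed

theorem corollary6p2:
  fixes \<delta> K :: real
  assumes "0 < \<delta>" "\<delta> < 1" "0 < K"
  shows "(\<exists>N. harnack_constant TYPE(real \<Rightarrow> real^'n) TYPE('n) \<delta> K N) \<and>
    (\<forall>N. harnack_constant TYPE(real \<Rightarrow> real^'n) TYPE('n) \<delta> K N \<longrightarrow>
         harnack_constant TYPE('w) TYPE('n) \<delta> K N)"
  using harnack_constant_exists[OF assms(1,3)] harnack_constant_transfer[OF assms(1)] by blast

end
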